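(* Assume that $D\subset\mathbb{R}^d$ is a compact set. Then: (1) the infimum in the definition of $\overline\delta(\eta,\gamma)$ is achieved (for $\eta,\gamma\in\Gamma(D)$); (2) the function $(\eta,\gamma)\mapsto\overline\delta(\eta,\gamma)$ is narrowly lower semicontinuous, i.e. lower semicontinuous on $\Gamma(D)\times\Gamma(D)$ with respect to narrow convergence; (3) $\overline\delta(\gamma_{\mathrm{id}},\gamma_h)\le\delta(\mathrm{id},h)$ for all $h\in\mathrm{SDiff}(D)$. Furthermore, $\sup_{\eta,\gamma\in\Gamma(D)}\overline\delta(\eta,\gamma)\le\sqrt d$ when either $D=[0,1]^d$ or $D=\mathbb{T}^d$ (the flat torus $\mathbb{R}^d/\mathbb{Z}^d$) and, more generally, $$\sup_{\gamma\in\Gamma(D)}\overline\delta_D(\gamma_{\mathrm{id}},\gamma)\le \mathrm{Lip}(f)\,\sup_{\gamma'\in\Gamma(D')}\overline\delta_{D'}(\gamma_{\mathrm{id}},\gamma')$$ whenever a Lipschitz measure-preserving map $f:D'\to D$ exists (i.e. $f$ is Lipschitz, not necessarily injective, with $f_\#\mu_{D'}=\mu_D$). Here the subscripts $D$, $D'$ denote the space in which the distance is computed.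
   Context: $\mu_D$ is the volume measure of $D$, normalized to be a probability measure (and similarly $\mu_{D'}$ for $D'$; all the objects below are defined in the same way for $D'$). $f_\#\mu$ denotes push-forward. Narrow convergence of probability measures is convergence in duality with bounded continuous functions. $\Gamma(D)$ is the set of Borel probability measures on $D\times D$ with both marginals equal to $\mu_D$. Each $\eta\in\Gamma(D)$ is disintegrated as $\eta=\eta_a\otimes\mu_D$, meaning $\int f\,d\eta=\int_D\int_D f(a,x)\,d\eta_a(x)\,d\mu_D(a)$ with $\eta_a$ Borel probability measures on $D$. For a measure-preserving map $h:D\to D$ (i.e. $h_\#\mu_D=\mu_D$), $\gamma_h:=(\mathrm{id}\times h)_\#\mu_D$; in particular $\gamma_{\mathrm{id}}=\delta_a\otimes\mu_D$, where $\delta_a$ is the Dirac mass at $a$. Fix $T>0$. $\Omega(D)=C([0,T];D)$, $e_t(\omega)=\omega(t)$, $\tilde\Omega(D)=\Omega(D)\times D$ with elements $(\omega,a)$. A generalized incompressible flow is a Borel probability measure $\boldsymbol\eta=\boldsymbol\eta_a\otimes\mu_D$ on $\tilde\Omega(D)$ with marginal $\mu_D$ on the second factor ($\boldsymbol\eta_a$ being probability measures on $\Omega(D)$) such that $\int_D(e_t)_\#\boldsymbol\eta_a\,d\mu_D(a)=\mu_D$ for all $t\in[0,T]$. It connects $\eta=\eta_a\otimes\mu_D$ to $\gamma=\gamma_a\otimes\mu_D$ if $(e_0)_\#\boldsymbol\eta_a=\eta_a$ and $(e_T)_\#\boldsymbol\eta_a=\gamma_a$ for $\mu_D$-a.e.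 $a$. Its action is $\mathscr A_T(\boldsymbol\eta)=\int_{\tilde\Omega(D)}\mathscr A_T(\omega)\,d\boldsymbol\eta(\omega,a)$, where $\mathscr A_T(\omega)=T\int_0^T\frac12|\dot\omega(t)|^2dt$ if $\omega$ is absolutely continuous in $[0,T]$ and $+\infty$ otherwise. $\overline\delta^2(\eta,\gamma)$ is defined by minimizing $\mathscr A_T(\boldsymbol\eta)$ among all generalized incompressible flows $\boldsymbol\eta$ connecting $\eta$ to $\gamma$, i.e. it is the infimum of the action over such flows (it is independent of $T$). $\mathrm{SDiff}(D)$ is the set of measure-preserving diffeomorphisms of $D$. For $f,h\in\mathrm{SDiff}(D)$, $\delta^2(f,h)$ (the squared Arnold distance) is the infimum of $T\int_0^T\int_D\frac12|\dot g(t,x)|^2\,d\mu_D(x)\,dt$ over all smooth curves $t\in[0,T]\mapsto g(t,\cdot)\in\mathrm{SDiff}(D)$ with $g(0,\cdot)=f$, $g(T,\cdot)=h$ (again independent of $T$).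
   Formalization: In (1) the infimum is shown to be achieved whenever some generalized incompressible flow connects η to γ; for disconnected D there may be none (e.g. swapping two disjoint balls). D and D′ are assumed to have positive volume so that their normalized volume measures exist. *)

theory Defs
  imports "HOL-Probability.Probability"
begin

section \<open>The two families of ambient spaces\<close>

text \<open>
  The objects below are needed both for compact subsets of Euclidean space and for the flat torus.
  Besides the metric they only use the volume measure and the speed $|\dot\omega(t)|$ of a curve
  (one-sided at the end points of a time interval \<open>S\<close>), so these two are collected in a class.
\<close>

class flat_space = metric_space +
  fixes volume :: "'a measure"
    and speed :: "(real \<Rightarrow> 'a) \<Rightarrow> real \<Rightarrow> real set \<Rightarrow> real"

instantiation vec :: (euclidean_space, finite) flat_space
begin

definition volume_vec :: "('a, 'b) vec measure"
  where "volume_vec = lborel"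

definition speed_vec :: "(real \<Rightarrow> ('a, 'b) vec) \<Rightarrow> real \<Rightarrow> real set \<Rightarrow> real"
  where "speed_vec \<omega> t S = norm (vector_derivative \<omega> (at t within S))"

instance ..

end

definition lattice_equiv :: "real^'n \<Rightarrow> real^'n \<Rightarrow> bool"
  where "lattice_equiv x y \<longleftrightarrow> (\<forall>i. x $ i - y $ i \<in> \<int>)"

quotient_type 'n torus = "real^'n" / lattice_equiv
  morphisms rep_torus to_torus
proof (rule equivpI)
  show "reflp (lattice_equiv :: real^'n \<Rightarrow> _)"
    by (auto simp: reflp_def lattice_equiv_def)
  show "symp (lattice_equiv :: real^'n \<Rightarrow> _)"
    by (auto simp: symp_def lattice_equiv_def) (metis Ints_minus minus_diff_eq)
  show "transp (lattice_equiv :: real^'n \<Rightarrow> _)"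
    unfolding transp_def lattice_equiv_def
    by (metis Ints_add diff_add_cancel add_diff_eq)
qed

lemma to_torus_eq_iff: "to_torus x = to_torus y \<longleftrightarrow> (\<forall>i. x $ i - y $ i \<in> \<int>)"
  using torus.abs_eq_iff lattice_equiv_def by metis

lemma to_torus_surj: "\<exists>x. to_torus x = p"
  by (metis Quotient3_abs_rep Quotient3_torus)

lemma to_torus_translate:
  assumes "to_torus x = to_torus x'"
  shows "to_torus (y + (x' - x)) = to_torus y"
  using assms unfolding to_torus_eq_iff
  by (simp add: algebra_simps) (metis Ints_minus minus_diff_eq)

lemma closed_to_torus_fibre: "closed {x. to_torus x = p}"
proof -
  obtain y where y: "to_torus y = p" using to_torus_surj by blast
  have "{x. to_torus x = p} = (\<Inter>i. {x. x $ i - y $ i \<in> \<int>})"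
    by (auto simp: y [symmetric] to_torus_eq_iff)
  moreover have "closed {x::real^'a. x $ i - y $ i \<in> \<int>}" for i
  proof -
    have "{x::real^'a. x $ i - y $ i \<in> \<int>} = (\<lambda>x. x $ i - y $ i) -` \<int>" by auto
    moreover have "closed ((\<lambda>x::real^'a. x $ i - y $ i) -` \<int>)"
      by (rule closed_vimage) (auto intro!: continuous_intros)
    ultimately show ?thesis by simp
  qed
  ultimately show ?thesis by auto
qed

instantiation torus :: (finite) metric_space
begin

text \<open>The quotient metric: the distance between the fibres over \<open>p\<close> and \<open>q\<close>.\<close>

definition dist_torus :: "'a torus \<Rightarrow> 'a torus \<Rightarrow> real"
  where "dist_torus p q = setdist {x. to_torus x = p} {y. to_torus y = q}"

definition uniformity_torus :: "('a torus \<times> 'a torus) filter"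
  where "uniformity_torus = (INF e\<in>{0<..}. principal {(x, y). dist x y < e})"

definition open_torus :: "'a torus set \<Rightarrow> bool"
  where "open_torus U \<longleftrightarrow> (\<forall>x\<in>U. eventually (\<lambda>(x', y). x' = x \<longrightarrow> y \<in> U) uniformity)"

instance
proof
  have fibre: "{x. to_torus x = p} \<noteq> {}" for p :: "'a torus"
    using to_torus_surj by blast
  have inf: "dist p q = infdist x {y. to_torus y = q}" if "to_torus x = p" for p q :: "'a torus" and x
  proof (rule antisym)
    show "dist p q \<le> infdist x {y. to_torus y = q}"
      unfolding dist_torus_def infdist_eq_setdist using that
      by (intro setdist_subset_left) auto
    show "infdist x {y. to_torus y = q} \<le> dist p q"
      unfolding dist_torus_def
    proof (rule le_setdistI)
      fix u v assume u: "u \<in> {x. to_torus x = p}" and v: "v \<in> {y. to_torus y = q}"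
      have "to_torus (v + (x - u)) = to_torus v"
        using u that by (intro to_torus_translate) auto
      then have "infdist x {y. to_torus y = q} \<le> dist x (v + (x - u))"
        using v by (intro infdist_le) auto
      also have "\<dots> = dist u v" by (simp add: dist_norm)
      finally show "infdist x {y. to_torus y = q} \<le> dist u v" .
    qed (use fibre in auto)
  qed
  show "dist p q = 0 \<longleftrightarrow> p = q" for p q :: "'a torus"
  proof -
    obtain x where x: "to_torus x = p" using to_torus_surj by blast
    have "dist p q = 0 \<longleftrightarrow> x \<in> {y. to_torus y = q}"
      unfolding inf [OF x]
      using in_closed_iff_infdist_zero [OF closed_to_torus_fibre fibre] by metis
    then show ?thesis using x by auto
  qed
  show "dist p q \<le> dist p r + dist q r" for p q r :: "'a torus"
  proof -
    obtain z where z: "to_torus z = r" using to_torus_surj by blast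
    have sym: "dist a b = dist b a" for a b :: "'a torus"
      unfolding dist_torus_def by (rule setdist_sym)
    have "dist p q \<le> infdist z {y. to_torus y = p} + infdist z {y. to_torus y = q}"
    proof (rule field_le_epsilon)
      fix e :: real assume e: "e > 0"
      have near: "\<exists>y. to_torus y = a \<and> dist z y < infdist z {y. to_torus y = a} + e/2" for a :: "'a torus"
      proof (rule ccontr)
        assume "\<not> ?thesis"
        then have "infdist z {y. to_torus y = a} + e/2 \<le> infdist z {y. to_torus y = a}"
          using fibre [of a] unfolding infdist_notempty [OF fibre]
          by (intro cINF_greatest) (auto simp: not_less)
        with e show False by simp
      qed
      obtain u v where u: "to_torus u = p" "dist z u < infdist z {y. to_torus y = p} + e/2"
        and v: "to_torus v = q" "dist z v < infdist z {y. to_torus y = q} + e/2"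
        using near by meson
      have "dist p q \<le> dist u v"
        unfolding dist_torus_def using u v by (intro setdist_le_dist) auto
      also have "\<dots> \<le> dist z u + dist z v" by (rule dist_triangle3)
      finally show "dist p q \<le> infdist z {y. to_torus y = p} + infdist z {y. to_torus y = q} + e"
        using u v by linarith
    qed
    then show ?thesis using inf [OF z] sym by metis
  qed
qed (simp_all add: uniformity_torus_def open_torus_def)

end

lemma dist_to_torus_le: "dist (to_torus x) (to_torus y) \<le> dist x y"
  unfolding dist_torus_def by (rule setdist_le_dist) auto

lemma continuous_to_torus: "continuous_on S to_torus"
  unfolding continuous_on_iff by (meson dist_to_torus_le order_le_less_trans)

lemma measurable_to_torus [measurable]: "to_torus \<in> borel_measurable borel"
  by (rule borel_measurable_continuous_onI) (rule continuous_to_torus)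

lemma compact_torus: "compact (UNIV :: 'n::finite torus set)"
proof -
  have "p \<in> to_torus ` cbox 0 1" for p :: "'n torus"
  proof -
    obtain x where x: "to_torus x = p" using to_torus_surj by blast
    have "to_torus (\<chi> i. frac (x $ i)) = p"
      unfolding x [symmetric] to_torus_eq_iff by (simp add: frac_def)
    moreover have "(\<chi> i. frac (x $ i)) \<in> cbox 0 1"
      by (simp add: mem_box_cart less_imp_le [OF frac_lt_1])
    ultimately show ?thesis by blast
  qed
  then have "(UNIV :: 'n torus set) = to_torus ` cbox 0 1" by auto
  then show ?thesis
    using compact_continuous_image [OF continuous_to_torus compact_cbox] by metis
qed

text \<open>
  \<open>v\<close> is the velocity of \<open>\<omega>\<close> at time \<open>t\<close> if it is the derivative of a local lift of \<open>\<omega>\<close>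
  along the covering \<^const>\<open>to_torus\<close>.
\<close>

definition torus_has_velocity :: "(real \<Rightarrow> 'n::finite torus) \<Rightarrow> real^'n \<Rightarrow> real \<Rightarrow> real set \<Rightarrow> bool"
  where "torus_has_velocity \<omega> v t S \<longleftrightarrow>
    (\<exists>w. to_torus (w t) = \<omega> t \<and> (\<forall>\<^sub>F s in at t within S. to_torus (w s) = \<omega> s) \<and>
         (w has_vector_derivative v) (at t within S))"

instantiation torus :: (finite) flat_space
begin

definition volume_torus :: "'a torus measure"
  where "volume_torus =
    distr (restrict_space lborel {x::real^'a. \<forall>i. 0 \<le> x $ i \<and> x $ i < 1}) borel to_torus"

definition speed_torus :: "(real \<Rightarrow> 'a torus) \<Rightarrow> real \<Rightarrow> real set \<Rightarrow> real"
  where "speed_torus \<omega> t S = norm (SOME v. torus_has_velocity \<omega> v t S)"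

instance ..

end

definition unit_cube :: "(real^'n) set"
  where "unit_cube = {x. \<forall>i. 0 \<le> x $ i \<and> x $ i \<le> 1}"


section \<open>Plans with uniform marginals\<close>

definition mu :: "'a::flat_space set \<Rightarrow> 'a measure"
  where "mu D = restrict_space (uniform_measure volume D) D"

lemma space_mu: "D \<in> sets volume \<Longrightarrow> space (mu (D::(real^'n) set)) = D"
  by (auto simp: mu_def space_restrict_space volume_vec_def)

lemma prob_space_mu:
  fixes D :: "(real^'n) set"
  assumes "compact D" "emeasure volume D > 0"
  shows "prob_space (mu D)"
proof (rule prob_spaceI)
  have D: "D \<in> sets lborel" using borel_compact [OF assms(1)] by simp
  have "emeasure lborel D < \<infinity>"
    using emeasure_bounded_finite [OF compact_imp_bounded [OF assms(1)]] .
  then have "emeasure (uniform_measure lborel D) D = 1"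
    using assms D by (simp add: emeasure_uniform_measure volume_vec_def ennreal_divide_self)
  then show "emeasure (mu D) (space (mu D)) = 1"
    using D by (simp add: mu_def volume_vec_def space_restrict_space emeasure_restrict_space)
qed

lemma emeasure_volume_torus: "emeasure (volume :: 'n::finite torus measure) UNIV = 1"
proof -
  let ?Q = "{x::real^'n. \<forall>i. 0 \<le> x $ i \<and> x $ i < 1}"
  have Q: "?Q \<in> sets borel" by measurable
  have "box 0 1 \<subseteq> ?Q" "?Q \<subseteq> cbox 0 (1::real^'n)"
    by (auto simp: mem_box_cart less_imp_le)
  then have le: "emeasure lborel (box 0 1 :: (real^'n) set) \<le> emeasure lborel ?Q"
    "emeasure lborel ?Q \<le> emeasure lborel (cbox 0 1 :: (real^'n) set)"
    using Q by (auto intro!: emeasure_mono)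
  have one: "(1::real^'n) \<bullet> b = 1" if "b \<in> Basis" for b
    using that by (auto simp: Basis_vec_def inner_axis)
  have "emeasure lborel (box 0 1 :: (real^'n) set) = 1"
    "emeasure lborel (cbox 0 1 :: (real^'n) set) = 1"
    by (simp_all add: emeasure_lborel_box_eq emeasure_lborel_cbox_eq one)
  with le have "emeasure lborel ?Q = 1" by simp
  moreover have "to_torus \<in> restrict_space lborel ?Q \<rightarrow>\<^sub>M borel"
    using measurable_to_torus by (auto intro: measurable_restrict_space1)
  ultimately show ?thesis
    using Q unfolding volume_torus_def
    by (simp add: emeasure_distr emeasure_restrict_space space_restrict_space)
qed

lemma prob_space_mu_torus: "prob_space (mu (UNIV :: 'n::finite torus set))"
proof (rule prob_spaceI)
  have "UNIV \<in> sets (volume :: 'n torus measure)" by (simp add: volume_torus_def)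
  moreover have "space (volume :: 'n torus measure) = UNIV" by (simp add: volume_torus_def)
  ultimately show "emeasure (mu (UNIV :: 'n torus set)) (space (mu UNIV)) = 1"
    by (simp add: mu_def space_restrict_space emeasure_restrict_space emeasure_uniform_measure
        emeasure_volume_torus)
qed

text \<open>
  Since the metric spaces involved are separable, \<open>mu D \<Otimes>\<^sub>M mu D\<close> carries the Borel
  $\sigma$-algebra of $D\times D$.
\<close>

definition uniform_plans :: "'a::flat_space set \<Rightarrow> ('a \<times> 'a) measure set"
  where "uniform_plans D = {\<eta> \<in> space (prob_algebra (mu D \<Otimes>\<^sub>M mu D)).
    distr \<eta> (mu D) fst = mu D \<and> distr \<eta> (mu D) snd = mu D}"

text \<open>\<open>disintegration M N k \<eta>\<close> says that $\eta = k_a\otimes M$.\<close>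

definition disintegration ::
    "'a measure \<Rightarrow> 'b measure \<Rightarrow> ('a \<Rightarrow> 'b measure) \<Rightarrow> ('a \<times> 'b) measure \<Rightarrow> bool"
  where "disintegration M N k \<eta> \<longleftrightarrow>
    k \<in> M \<rightarrow>\<^sub>M prob_algebra N \<and> sets \<eta> = sets (M \<Otimes>\<^sub>M N) \<and>
    (\<forall>f\<in>borel_measurable (M \<Otimes>\<^sub>M N).
      (\<integral>\<^sup>+z. f z \<partial>\<eta>) = (\<integral>\<^sup>+a. \<integral>\<^sup>+x. f (a, x) \<partial>k a \<partial>M))"

definition map_plan :: "'a::flat_space set \<Rightarrow> ('a \<Rightarrow> 'a) \<Rightarrow> ('a \<times> 'a) measure"
  where "map_plan D h = distr (mu D) (mu D \<Otimes>\<^sub>M mu D) (\<lambda>a. (a, h a))"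

text \<open>
  The coarsest topology on \<open>uniform_plans D\<close> that makes \<open>\<eta> \<mapsto> \<integral>f d\<eta>\<close> continuous for every bounded
  continuous \<open>f\<close>; see \<open>limitin_narrow_topology\<close> for its convergence.
\<close>

definition narrow_topology :: "'a::flat_space set \<Rightarrow> ('a \<times> 'a) measure topology"
  where "narrow_topology D = topology_generated_by
    {{\<eta> \<in> uniform_plans D. integral\<^sup>L \<eta> f \<in> U} | (f :: 'a \<times> 'a \<Rightarrow> real) U.
      continuous_on (D \<times> D) f \<and> bounded (f ` (D \<times> D)) \<and> open U}"

lemma topspace_narrow_topology: "topspace (narrow_topology D) = uniform_plans D"
proof -
  have "uniform_plans D \<in> {{\<eta> \<in> uniform_plans D. integral\<^sup>L \<eta> f \<in> U} | (f :: 'a \<times> 'a \<Rightarrow> real) U.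
      continuous_on (D \<times> D) f \<and> bounded (f ` (D \<times> D)) \<and> open U}"
    by (rule CollectI, rule exI [of _ "\<lambda>_. 0"], rule exI [of _ UNIV])
       (auto simp: bounded_def image_def)
  then show ?thesis
    unfolding narrow_topology_def topology_generated_by_topspace by blast
qed

lemma limitin_narrow_topology:
  "limitin (narrow_topology D) \<eta>s \<eta> F \<longleftrightarrow>
    \<eta> \<in> uniform_plans D \<and> (\<forall>\<^sub>F i in F. \<eta>s i \<in> uniform_plans D) \<and>
    (\<forall>f :: 'a::flat_space \<times> 'a \<Rightarrow> real. continuous_on (D \<times> D) f \<and> bounded (f ` (D \<times> D)) \<longrightarrow>
      ((\<lambda>i. integral\<^sup>L (\<eta>s i) f) \<longlongrightarrow> integral\<^sup>L \<eta> f) F)"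
  (is "?L \<longleftrightarrow> ?R")
proof
  assume L: ?L
  have \<eta>: "\<eta> \<in> uniform_plans D" using L limitin_topspace topspace_narrow_topology by metis
  have ev: "\<forall>\<^sub>F i in F. \<eta>s i \<in> uniform_plans D"
    using L openin_topspace [of "narrow_topology D"] \<eta>
    unfolding limitin_def topspace_narrow_topology by blast
  have "((\<lambda>i. integral\<^sup>L (\<eta>s i) f) \<longlongrightarrow> integral\<^sup>L \<eta> f) F"
    if f: "continuous_on (D \<times> D) f \<and> bounded (f ` (D \<times> D))" for f :: "'a \<times> 'a \<Rightarrow> real"
  proof (rule topological_tendstoI)
    fix U assume U: "open U" "integral\<^sup>L \<eta> f \<in> U"
    have "openin (narrow_topology D) {\<eta> \<in> uniform_plans D. integral\<^sup>L \<eta> f \<in> U}"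
      unfolding narrow_topology_def using f U by (intro topology_generated_by_Basis) blast
    then have "\<forall>\<^sub>F i in F. \<eta>s i \<in> {\<eta> \<in> uniform_plans D. integral\<^sup>L \<eta> f \<in> U}"
      using L U \<eta> unfolding limitin_def by blast
    then show "\<forall>\<^sub>F i in F. integral\<^sup>L (\<eta>s i) f \<in> U"
      by eventually_elim auto
  qed
  with \<eta> ev show ?R by blast
next
  assume R: ?R
  let ?B = "{{\<eta> \<in> uniform_plans D. integral\<^sup>L \<eta> f \<in> U} | (f :: 'a \<times> 'a \<Rightarrow> real) U.
      continuous_on (D \<times> D) f \<and> bounded (f ` (D \<times> D)) \<and> open U}"
  have "\<forall>\<^sub>F i in F. \<eta>s i \<in> V" if V: "generate_topology_on ?B V" and "\<eta> \<in> V" for V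
    using that
  proof induction
    case (Int a b)
    then show ?case by (auto intro: eventually_conj)
  next
    case (UN K)
    then obtain k where k: "k \<in> K" "\<eta> \<in> k" by blast
    then have "\<forall>\<^sub>F i in F. \<eta>s i \<in> k" using UN by blast
    then show ?case by eventually_elim (use k in blast)
  next
    case (Basis s)
    then obtain f :: "'a \<times> 'a \<Rightarrow> real" and U where s: "s = {\<eta> \<in> uniform_plans D. integral\<^sup>L \<eta> f \<in> U}" "open U"
      "continuous_on (D \<times> D) f \<and> bounded (f ` (D \<times> D))" by blast
    then have "\<forall>\<^sub>F i in F. integral\<^sup>L (\<eta>s i) f \<in> U"
      using R Basis by (intro topological_tendstoD) auto
    moreover have "\<forall>\<^sub>F i in F. \<eta>s i \<in> uniform_plans D" using R by blast
    ultimately show ?case by eventually_elim (simp add: s)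
  qed simp
  then show ?L
    using R unfolding limitin_def topspace_narrow_topology
    by (simp add: narrow_topology_def openin_topology_generated_by_iff)
qed

definition lower_semicontinuous_map :: "'a topology \<Rightarrow> ('a \<Rightarrow> 'b::linorder) \<Rightarrow> bool"
  where "lower_semicontinuous_map X f \<longleftrightarrow> (\<forall>c. openin X {x \<in> topspace X. c < f x})"


section \<open>Generalized incompressible flows\<close>

definition path_metric :: "real \<Rightarrow> 'a::flat_space set \<Rightarrow> (real \<Rightarrow> 'a) metric"
  where "path_metric T D = cfunspace (top_of_set {0..T}) (submetric euclidean_metric D)"

text \<open>
  $\Omega(D) = C([0,T];D)$ with its Borel $\sigma$-algebra; paths are extensional functions, i.e.
  \<^const>\<open>undefined\<close> outside \<open>{0..T}\<close>. Only the space and the $\sigma$-algebra are meaningful here.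
\<close>

definition Path :: "real \<Rightarrow> 'a::flat_space set \<Rightarrow> (real \<Rightarrow> 'a) measure"
  where "Path T D = sigma (mspace (path_metric T D)) {U. openin (mtopology_of (path_metric T D)) U}"

text \<open>
  \<open>path_disintegration T D k F\<close> says that $F = k_a\otimes\mu_D$, where \<open>F\<close> is a measure on
  $\tilde\Omega(D) = \Omega(D)\times D$. The pair is swapped, since the label is its second component.
\<close>

definition path_disintegration ::
    "real \<Rightarrow> 'a::flat_space set \<Rightarrow> ('a \<Rightarrow> (real \<Rightarrow> 'a) measure) \<Rightarrow> ((real \<Rightarrow> 'a) \<times> 'a) measure \<Rightarrow> bool"
  where "path_disintegration T D k F \<longleftrightarrow>
    disintegration (mu D) (Path T D) k (distr F (mu D \<Otimes>\<^sub>M Path T D) (\<lambda>(\<omega>, a). (a, \<omega>)))"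

definition incompressible_flow ::
    "real \<Rightarrow> 'a::flat_space set \<Rightarrow> ((real \<Rightarrow> 'a) \<times> 'a) measure \<Rightarrow> bool"
  where "incompressible_flow T D F \<longleftrightarrow>
    F \<in> space (prob_algebra (Path T D \<Otimes>\<^sub>M mu D)) \<and>
    distr F (mu D) snd = mu D \<and>
    (\<exists>k. path_disintegration T D k F \<and>
      (\<forall>t\<in>{0..T}. mu D \<bind> (\<lambda>a. distr (k a) (mu D) (\<lambda>\<omega>. \<omega> t)) = mu D))"

text \<open>
  Disintegrations are unique up to \<open>mu D\<close>-null sets, so the existential quantifier selects nothing.
\<close>

definition connects ::
    "real \<Rightarrow> 'a::flat_space set \<Rightarrow> ((real \<Rightarrow> 'a) \<times> 'a) measure \<Rightarrow>
     ('a \<times> 'a) measure \<Rightarrow> ('a \<times> 'a) measure \<Rightarrow> bool"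
  where "connects T D F \<eta> \<gamma> \<longleftrightarrow>
    (\<exists>k k\<^sub>0 k\<^sub>1. path_disintegration T D k F \<and>
      disintegration (mu D) (mu D) k\<^sub>0 \<eta> \<and> disintegration (mu D) (mu D) k\<^sub>1 \<gamma> \<and>
      (AE a in mu D. distr (k a) (mu D) (\<lambda>\<omega>. \<omega> 0) = k\<^sub>0 a \<and>
                     distr (k a) (mu D) (\<lambda>\<omega>. \<omega> T) = k\<^sub>1 a))"

definition connecting_flows ::
    "real \<Rightarrow> 'a::flat_space set \<Rightarrow> ('a \<times> 'a) measure \<Rightarrow> ('a \<times> 'a) measure \<Rightarrow>
     ((real \<Rightarrow> 'a) \<times> 'a) measure set"
  where "connecting_flows T D \<eta> \<gamma> = {F. incompressible_flow T D F \<and> connects T D F \<eta> \<gamma>}"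

definition absolutely_continuous_path :: "real \<Rightarrow> (real \<Rightarrow> 'a::metric_space) \<Rightarrow> bool"
  where "absolutely_continuous_path T \<omega> \<longleftrightarrow>
    (\<forall>\<epsilon>>0. \<exists>\<delta>>0. \<forall>(n::nat) a b.
      (\<forall>i<n. 0 \<le> a i \<and> a i \<le> b i \<and> b i \<le> T) \<and>
      (\<forall>i<n. \<forall>j<n. i \<noteq> j \<longrightarrow> {a i<..<b i} \<inter> {a j<..<b j} = {}) \<and>
      (\<Sum>i<n. b i - a i) < \<delta> \<longrightarrow> (\<Sum>i<n. dist (\<omega> (a i)) (\<omega> (b i))) < \<epsilon>)"

definition path_action :: "real \<Rightarrow> (real \<Rightarrow> 'a::flat_space) \<Rightarrow> ennreal"
  where "path_action T \<omega> =
    (if absolutely_continuous_path T \<omega>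
     then ennreal T * (\<integral>\<^sup>+t\<in>{0..T}. ennreal (1/2 * (speed \<omega> t {0..T})\<^sup>2) \<partial>lebesgue)
     else \<infinity>)"

definition flow_action :: "real \<Rightarrow> ((real \<Rightarrow> 'a::flat_space) \<times> 'a) measure \<Rightarrow> ennreal"
  where "flow_action T F = (\<integral>\<^sup>+(\<omega>, a). path_action T \<omega> \<partial>F)"

definition ennreal_sqrt :: "ennreal \<Rightarrow> ennreal"
  where "ennreal_sqrt x = (if x = \<infinity> then \<infinity> else ennreal (sqrt (enn2real x)))"

text \<open>The infimum over the empty set is \<open>\<infinity>\<close>: \<open>\<eta>\<close> and \<open>\<gamma>\<close> need not be connected by any flow.\<close>

definition delta_bar_sq ::
    "real \<Rightarrow> 'a::flat_space set \<Rightarrow> ('a \<times> 'a) measure \<Rightarrow> ('a \<times> 'a) measure \<Rightarrow> ennreal"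
  where "delta_bar_sq T D \<eta> \<gamma> = (INF F\<in>connecting_flows T D \<eta> \<gamma>. flow_action T F)"

definition delta_bar ::
    "real \<Rightarrow> 'a::flat_space set \<Rightarrow> ('a \<times> 'a) measure \<Rightarrow> ('a \<times> 'a) measure \<Rightarrow> ennreal"
  where "delta_bar T D \<eta> \<gamma> = ennreal_sqrt (delta_bar_sq T D \<eta> \<gamma>)"


section \<open>Measure-preserving diffeomorphisms and the Arnold distance\<close>

text \<open>\<open>Ck_on k U f\<close>: \<open>f\<close> is of class $C^k$ on the open set \<open>U\<close>.\<close>

fun Ck_on :: "nat \<Rightarrow> 'a::real_normed_vector set \<Rightarrow> ('a \<Rightarrow> 'b::real_normed_vector) \<Rightarrow> bool"
  where
    "Ck_on 0 U f \<longleftrightarrow> continuous_on U f"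
  | "Ck_on (Suc k) U f \<longleftrightarrow> (\<forall>x\<in>U. f differentiable (at x)) \<and>
       (\<forall>v. Ck_on k U (\<lambda>x. frechet_derivative f (at x) v))"

text \<open>Smoothness on an arbitrary set means smooth extendability to an open neighbourhood.\<close>

definition smooth_on :: "'a::real_normed_vector set \<Rightarrow> ('a \<Rightarrow> 'b::real_normed_vector) \<Rightarrow> bool"
  where "smooth_on S f \<longleftrightarrow>
    (\<exists>U g. open U \<and> S \<subseteq> U \<and> (\<forall>k. Ck_on k U g) \<and> (\<forall>x\<in>S. g x = f x))"

definition SDiff :: "(real^'n) set \<Rightarrow> (real^'n \<Rightarrow> real^'n) set"
  where "SDiff D = {h. bij_betw h D D \<and> smooth_on D h \<and> smooth_on D (the_inv_into D h) \<and>
    distr (mu D) (mu D) h = mu D}"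

definition smooth_curves ::
    "real \<Rightarrow> (real^'n) set \<Rightarrow> (real^'n \<Rightarrow> real^'n) \<Rightarrow> (real^'n \<Rightarrow> real^'n) \<Rightarrow>
     (real \<Rightarrow> real^'n \<Rightarrow> real^'n) set"
  where "smooth_curves T D f h = {g.
    smooth_on ({0..T} \<times> D) (\<lambda>(t, x). g t x) \<and> (\<forall>t\<in>{0..T}. g t \<in> SDiff D) \<and>
    (\<forall>x\<in>D. g 0 x = f x \<and> g T x = h x)}"

definition curve_action :: "real \<Rightarrow> (real^'n) set \<Rightarrow> (real \<Rightarrow> real^'n \<Rightarrow> real^'n) \<Rightarrow> ennreal"
  where "curve_action T D g = ennreal T *
    (\<integral>\<^sup>+t\<in>{0..T}. (\<integral>\<^sup>+x. ennreal (1/2 *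
        (norm (vector_derivative (\<lambda>s. g s x) (at t within {0..T})))\<^sup>2) \<partial>mu D) \<partial>lborel)"

definition arnold_dist_sq ::
    "real \<Rightarrow> (real^'n) set \<Rightarrow> (real^'n \<Rightarrow> real^'n) \<Rightarrow> (real^'n \<Rightarrow> real^'n) \<Rightarrow> ennreal"
  where "arnold_dist_sq T D f h = (INF g\<in>smooth_curves T D f h. curve_action T D g)"

definition arnold_dist ::
    "real \<Rightarrow> (real^'n) set \<Rightarrow> (real^'n \<Rightarrow> real^'n) \<Rightarrow> (real^'n \<Rightarrow> real^'n) \<Rightarrow> ennreal"
  where "arnold_dist T D f h = ennreal_sqrt (arnold_dist_sq T D f h)"


section \<open>Lipschitz measure-preserving maps\<close>

definition Lip :: "'a::metric_space set \<Rightarrow> ('a \<Rightarrow> 'b::metric_space) \<Rightarrow> real"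
  where "Lip S f = Inf {L. L-lipschitz_on S f}"

definition lipschitz_measure_preserving ::
    "'a::flat_space set \<Rightarrow> 'b::flat_space set \<Rightarrow> ('a \<Rightarrow> 'b) \<Rightarrow> bool"
  where "lipschitz_measure_preserving D' D f \<longleftrightarrow>
    f ` D' \<subseteq> D \<and> (\<exists>L. L-lipschitz_on D' f) \<and> distr (mu D') (mu D) f = mu D"

end

theory Submission
  imports Defs 
begin

text \<open>
  Everything rests on two ways of describing a generalized flow that avoid differentiating paths
  and constructing conditional laws.
  
  The first is metric. For a continuous path \<open>\<omega>\<close> the numbers \<open>dyadic_energy T \<omega> n\<close>, the actions of
  the geodesic polygons through \<open>2 ^ n + 1\<close> equidistant points of the path, increase with \<open>n\<close>, and
  their supremum is the action, be it finite or not (\<open>path_action_eq_SUP_dyadic_energy\<close>). This needs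
  the differentiability almost everywhere of absolutely continuous functions, which is proved by two
  Vitali coverings, one inside the other (\<open>steep_both_negligible\<close>), together with a fundamental
  theorem of calculus for curves in a metric space (\<open>dist_le_integral_metric_speed\<close>). The formula
  shows at once that the action is measurable and lower semicontinuous, and that composition with an
  \<open>L\<close>-Lipschitz map increases it by at most the factor \<open>L\<^sup>2\<close>. It also treats compact subsets of
  Euclidean space and the torus on the same footing; the locale \<open>label_space\<close> collects what they
  have in common.
  
  The second is probabilistic. A flow is a joint law of a label and a path, and every joint law of
  \<open>a\<close> and some \<open>Y\<close> is the law of \<open>(a, Q (a, u))\<close> with \<open>u\<close> uniform in the unit interval and
  independent of \<open>a\<close> (\<open>noise_representation_real\<close>). So a random path that is a measurable function of
  the label and of independent noise is a flow as soon as each of its positions is uniform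
  (\<open>flow_of_noise\<close>), and the plans that it connects are the joint laws of the label and its end
  points.
  
  Existence and lower semicontinuity both follow from a compactness statement (\<open>limit_flow\<close>). The
  label and the positions at rational times of a flow are coded by a single real number. Along a
  subsequence these numbers converge in law, and after a change of the probability space they converge
  almost surely. By Fatou's lemma the limiting positions have a bounded energy at every dyadic level,
  so they belong to a path whose action is controlled, and the laws at the end points pass to the limit.
  
  A Lipschitz map that preserves the measure sends flows to flows (\<open>push_flow\<close>), and every plan on the
  target is the image of a plan on the source (\<open>plan_image_surj\<close>); this gives the inequality between
  the suprema. On the torus any two plans are connected by moving each particle along a shortest line
  to an independent uniform point and from there to its target (\<open>delta_bar_torus_le\<close>). The mean square
  length of such a line is at most \<open>n / 8\<close>, whence \<open>\<surd>n / 2\<close> as a bound for the distance. The cube is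
  the image of the torus under a folding map that is \<open>2\<close>-Lipschitz, which costs a factor \<open>2\<close>
  (\<open>delta_bar_cube_le\<close>). Finally, a smooth curve of diffeomorphisms is a deterministic flow
  (\<open>delta_bar_le_arnold_dist\<close>).
\<close>

section \<open>Absolutely continuous functions are differentiable almost everywhere\<close>

text \<open>
  The Vitali covering theorem and the tagged divisions below produce families of intervals that are
  indexed by finite sets, not by initial segments of the natural numbers.
\<close>

lemma absolutely_continuous_path_family:
  assumes "absolutely_continuous_path T \<omega>" "\<epsilon> > 0"
  obtains \<delta> where "\<delta> > 0"
    "\<forall>(I::'i set) a b. finite I \<longrightarrow> (\<forall>i. i \<in> I \<longrightarrow> 0 \<le> a i \<and> a i \<le> b i \<and> b i \<le> T) \<longrightarrow>
      (\<forall>i j. i \<in> I \<longrightarrow> j \<in> I \<longrightarrow> i \<noteq> j \<longrightarrow> {a i<..<b i} \<inter> {a j<..<b j} = {}) \<longrightarrow>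
      (\<Sum>i\<in>I. b i - a i) < \<delta> \<longrightarrow> (\<Sum>i\<in>I. dist (\<omega> (a i)) (\<omega> (b i))) < \<epsilon>"
proof -
  obtain \<delta> where \<delta>: "\<delta> > 0" and ac: "\<forall>(n::nat) a b. (\<forall>i<n. 0 \<le> a i \<and> a i \<le> b i \<and> b i \<le> T) \<and>
      (\<forall>i<n. \<forall>j<n. i \<noteq> j \<longrightarrow> {a i<..<b i} \<inter> {a j<..<b j} = {}) \<and>
      (\<Sum>i<n. b i - a i) < \<delta> \<longrightarrow> (\<Sum>i<n. dist (\<omega> (a i)) (\<omega> (b i))) < \<epsilon>"
    using assms(1) [unfolded absolutely_continuous_path_def, THEN spec, THEN mp, OF assms(2)] by (elim exE conjE)
  show ?thesis
  proof (rule that [OF \<delta>], intro allI impI)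
    fix I :: "'i set" and a b
    assume fin: "finite I" and ab: "\<forall>i. i \<in> I \<longrightarrow> 0 \<le> a i \<and> a i \<le> b i \<and> b i \<le> T"
      and dj: "\<forall>i j. i \<in> I \<longrightarrow> j \<in> I \<longrightarrow> i \<noteq> j \<longrightarrow> {a i<..<b i} \<inter> {a j<..<b j} = {}"
      and small: "(\<Sum>i\<in>I. b i - a i) < \<delta>"
    obtain h where h: "bij_betw h {..<card I} I"
      using ex_bij_betw_nat_finite [OF fin] by (auto simp: lessThan_atLeast0)
    have hI: "h i \<in> I" if "i < card I" for i using bij_betwE [OF h] that by auto
    have inj: "h i \<noteq> h j" if "i < card I" "j < card I" "i \<noteq> j" for i j
      using bij_betw_imp_inj_on [OF h] that by (auto simp: inj_on_def)
    have sums: "(\<Sum>i<card I. g (h i)) = sum g I" for g :: "'i \<Rightarrow> real"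
      by (rule sum.reindex_bij_betw [OF h])
    have "(\<Sum>i<card I. dist (\<omega> (a (h i))) (\<omega> (b (h i)))) < \<epsilon>"
    proof (rule ac [THEN spec [of _ "card I"], THEN spec [of _ "\<lambda>i. a (h i)"], THEN spec [of _ "\<lambda>i. b (h i)"], THEN mp], intro conjI allI impI)
      show "(\<Sum>i<card I. b (h i) - a (h i)) < \<delta>" using small sums [of "\<lambda>i. b i - a i"] by simp
    qed (use ab hI dj inj in auto)
    then show "(\<Sum>i\<in>I. dist (\<omega> (a i)) (\<omega> (b i))) < \<epsilon>"
      using sums [of "\<lambda>i. dist (\<omega> (a i)) (\<omega> (b i))"] by simp
  qed
qed

lemma absolutely_continuous_path_dominated:
  fixes \<omega> :: "real \<Rightarrow> 'a::metric_space" and \<omega>' :: "real \<Rightarrow> 'b::metric_space"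
  assumes ac: "absolutely_continuous_path T \<omega>"
    and dom: "\<And>s t. 0 \<le> s \<Longrightarrow> s \<le> t \<Longrightarrow> t \<le> T \<Longrightarrow> dist (\<omega>' s) (\<omega>' t) \<le> L * (dist (\<omega> s) (\<omega> t) + (t - s))"
    and L: "L > 0"
  shows "absolutely_continuous_path T \<omega>'"
  unfolding absolutely_continuous_path_def
proof (intro allI impI)
  fix \<epsilon> :: real assume \<epsilon>: "\<epsilon> > 0"
  obtain \<delta> where \<delta>1: "\<delta> > 0" and \<delta>2:
    "\<forall>(I::nat set) a b. finite I \<longrightarrow> (\<forall>i. i \<in> I \<longrightarrow> 0 \<le> a i \<and> a i \<le> b i \<and> b i \<le> T) \<longrightarrow>
      (\<forall>i j. i \<in> I \<longrightarrow> j \<in> I \<longrightarrow> i \<noteq> j \<longrightarrow> {a i<..<b i} \<inter> {a j<..<b j} = {}) \<longrightarrow>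
      (\<Sum>i\<in>I. b i - a i) < \<delta> \<longrightarrow> (\<Sum>i\<in>I. dist (\<omega> (a i)) (\<omega> (b i))) < \<epsilon> / (2 * L)"
    by (rule absolutely_continuous_path_family [OF ac divide_pos_pos [OF \<epsilon> mult_pos_pos [OF zero_less_numeral L]]])
  note \<delta> = \<delta>1 \<delta>2 [rule_format]
  show "\<exists>\<delta>>0. \<forall>(n::nat) a b.
      (\<forall>i<n. 0 \<le> a i \<and> a i \<le> b i \<and> b i \<le> T) \<and>
      (\<forall>i<n. \<forall>j<n. i \<noteq> j \<longrightarrow> {a i<..<b i} \<inter> {a j<..<b j} = {}) \<and>
      (\<Sum>i<n. b i - a i) < \<delta> \<longrightarrow> (\<Sum>i<n. dist (\<omega>' (a i)) (\<omega>' (b i))) < \<epsilon>"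
  proof (intro exI [of _ "min \<delta> (\<epsilon> / (2 * L))"] conjI allI impI; (elim conjE)?)
    fix n :: nat and a b
    assume ab: "\<forall>i<n. 0 \<le> a i \<and> a i \<le> b i \<and> b i \<le> T"
      and dj: "\<forall>i<n. \<forall>j<n. i \<noteq> j \<longrightarrow> {a i<..<b i} \<inter> {a j<..<b j} = {}"
      and small: "(\<Sum>i<n. b i - a i) < min \<delta> (\<epsilon> / (2 * L))"
    have "(\<Sum>i<n. dist (\<omega> (a i)) (\<omega> (b i))) < \<epsilon> / (2 * L)"
      by (rule \<delta>(2)) (use ab dj small in auto)
    then have "(\<Sum>i<n. dist (\<omega> (a i)) (\<omega> (b i))) + (\<Sum>i<n. b i - a i) < \<epsilon> / L"
      using small by (simp add: field_simps)
    then have *: "L * ((\<Sum>i<n. dist (\<omega> (a i)) (\<omega> (b i))) + (\<Sum>i<n. b i - a i)) < \<epsilon>"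
      using L by (simp add: field_simps)
    have "(\<Sum>i<n. dist (\<omega>' (a i)) (\<omega>' (b i))) \<le> (\<Sum>i<n. L * (dist (\<omega> (a i)) (\<omega> (b i)) + (b i - a i)))"
      by (rule sum_mono) (use ab dom in auto)
    also have "\<dots> = L * ((\<Sum>i<n. dist (\<omega> (a i)) (\<omega> (b i))) + (\<Sum>i<n. b i - a i))"
      by (simp only: sum.distrib [symmetric] sum_distrib_left)
    finally show "(\<Sum>i<n. dist (\<omega>' (a i)) (\<omega>' (b i))) < \<epsilon>" using * by linarith
  qed (use \<delta> \<epsilon> L in auto)
qed

lemma absolutely_continuous_path_imp_continuous_on:
  assumes "absolutely_continuous_path T \<omega>"
  shows "continuous_on {0..T} \<omega>"
  unfolding continuous_on_iff
proof (intro ballI allI impI)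
  fix x e :: real assume x: "x \<in> {0..T}" and e: "e > 0"
  obtain \<delta> where \<delta>1: "\<delta> > 0" and \<delta>2:
    "\<forall>(I::nat set) a b. finite I \<longrightarrow> (\<forall>i. i \<in> I \<longrightarrow> 0 \<le> a i \<and> a i \<le> b i \<and> b i \<le> T) \<longrightarrow>
      (\<forall>i j. i \<in> I \<longrightarrow> j \<in> I \<longrightarrow> i \<noteq> j \<longrightarrow> {a i<..<b i} \<inter> {a j<..<b j} = {}) \<longrightarrow>
      (\<Sum>i\<in>I. b i - a i) < \<delta> \<longrightarrow> (\<Sum>i\<in>I. dist (\<omega> (a i)) (\<omega> (b i))) < e"
    by (rule absolutely_continuous_path_family [OF assms e])
  note \<delta> = \<delta>1 \<delta>2 [rule_format]
  have ordered: "dist (\<omega> s) (\<omega> t) < e" if "0 \<le> s" "s \<le> t" "t \<le> T" "t - s < \<delta>" for s t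
    using \<delta>(2) [of "{0}" "\<lambda>_. s" "\<lambda>_. t"] that by simp
  have "dist (\<omega> y) (\<omega> x) < e" if y: "y \<in> {0..T}" "dist y x < \<delta>" for y
    using ordered [of x y] ordered [of y x] x y
    by (cases "x \<le> y") (auto simp: dist_real_def dist_commute)
  then show "\<exists>d>0. \<forall>x'\<in>{0..T}. dist x' x < d \<longrightarrow> dist (\<omega> x') (\<omega> x) < e"
    using \<delta>(1) by blast
qed

lemma finite_subfamily_emeasure:
  assumes "countable V" and S: "\<And>v. v \<in> V \<Longrightarrow> S v \<in> sets M" and r: "r < emeasure M (\<Union>v\<in>V. S v)"
  obtains V' where "finite V'" "V' \<subseteq> V" "r < emeasure M (\<Union>v\<in>V'. S v)"
proof (cases "V = {}")
  case True
  then show ?thesis using that [of "{}"] r by simp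
next
  case False
  let ?A = "\<lambda>n. \<Union>v\<in>from_nat_into V ` {..<n}. S v"
  have sub: "from_nat_into V ` {..<n} \<subseteq> V" for n
    using from_nat_into [OF False] by auto
  have un: "(\<Union>n. ?A n) = (\<Union>v\<in>V. S v)"
  proof
    show "(\<Union>n. ?A n) \<subseteq> (\<Union>v\<in>V. S v)" using sub by blast
    show "(\<Union>v\<in>V. S v) \<subseteq> (\<Union>n. ?A n)"
    proof
      fix x assume "x \<in> (\<Union>v\<in>V. S v)"
      then obtain v where v: "v \<in> V" "x \<in> S v" by blast
      then obtain m where "from_nat_into V m = v" using assms(1) from_nat_into_surj by metis
      then have "x \<in> ?A (Suc m)" using v by auto
      then show "x \<in> (\<Union>n. ?A n)" by blast
    qed
  qed
  have "(SUP n. emeasure M (?A n)) = emeasure M (\<Union>n. ?A n)"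
  proof (rule SUP_emeasure_incseq)
    show "range ?A \<subseteq> sets M" using S sub by (intro image_subsetI sets.finite_UN) auto
    show "incseq ?A" by (intro incseq_SucI UN_mono image_mono) auto
  qed
  then have "r < (SUP n. emeasure M (?A n))" using r un by simp
  then obtain n where "r < emeasure M (?A n)" unfolding less_SUP_iff by blast
  then show ?thesis using that [of "from_nat_into V ` {..<n}"] sub by simp
qed

text \<open>
  The intervals straddle \<open>x\<close>, rather than having it as an end point, because then the set of
  steep points is a countable intersection of open sets.
\<close>

definition steep :: "(real \<Rightarrow> real) \<Rightarrow> real \<Rightarrow> real \<Rightarrow> bool"
  where "steep f c x \<longleftrightarrow> (\<forall>d>0. \<exists>y z. y < x \<and> x < z \<and> z - y < d \<and> c * (z - y) < f z - f y)"

lemma steep_borel: "{x. steep f c x} \<in> sets borel"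
proof -
  have "{x. steep f c x} = (\<Inter>n::nat. \<Union>(y, z)\<in>{(y, z). z - y < inverse (Suc n) \<and> c * (z - y) < f z - f y}. {y<..<z})"
    (is "_ = (\<Inter>n. ?U n)")
  proof (intro set_eqI iffI)
    fix x assume "x \<in> {x. steep f c x}"
    then have st: "steep f c x" by simp
    show "x \<in> (\<Inter>n. ?U n)"
    proof
      fix n :: nat
      have "inverse (real (Suc n)) > 0" by simp
      then obtain y z where "y < x" "x < z" "z - y < inverse (Suc n)" "c * (z - y) < f z - f y"
        using st unfolding steep_def by blast
      then show "x \<in> ?U n" by force
    qed
  next
    fix x assume x: "x \<in> (\<Inter>n. ?U n)"
    show "x \<in> {x. steep f c x}"
      unfolding steep_def
    proof (intro CollectI allI impI)
      fix d :: real assume "d > 0"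
      then obtain n where n: "inverse (Suc n) < d" using reals_Archimedean by blast
      have "x \<in> ?U n" using x by blast
      then show "\<exists>y z. y < x \<and> x < z \<and> z - y < d \<and> c * (z - y) < f z - f y"
        using n by (force intro: less_trans)
    qed
  qed
  moreover have "open (?U n)" for n by (intro open_UN) auto
  ultimately show ?thesis by (auto intro: borel_open)
qed

lemma vitali_intervals:
  fixes E G :: "real set"
  assumes "open G" "E \<subseteq> G"
    and P: "\<And>x d. x \<in> E \<Longrightarrow> d > 0 \<Longrightarrow> \<exists>y z. y < x \<and> x < z \<and> z - y < d \<and> P y z"
  obtains C where "countable C" "\<And>y z. (y, z) \<in> C \<Longrightarrow> y < z \<and> {y..z} \<subseteq> G \<and> P y z"
    "\<And>p q. p \<in> C \<Longrightarrow> q \<in> C \<Longrightarrow> p \<noteq> q \<Longrightarrow> {fst p<..<snd p} \<inter> {fst q<..<snd q} = {}"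
    "negligible (E - (\<Union>p\<in>C. {fst p<..<snd p}))"
proof -
  let ?K = "{(y, z). y < z \<and> {y..z} \<subseteq> G \<and> P y z}"
  let ?a = "\<lambda>p::real\<times>real. (fst p + snd p) / 2" and ?r = "\<lambda>p::real\<times>real. (snd p - fst p) / 2"
  have ball: "ball (?a p) (?r p) = {fst p<..<snd p}" for p
    by (auto simp: ball_def dist_real_def abs_if field_simps split: if_splits)
  obtain C where C: "countable C" "C \<subseteq> ?K"
    "pairwise (\<lambda>i j. disjnt (ball (?a i) (?r i)) (ball (?a j) (?r j))) C"
    "negligible (E - (\<Union>i\<in>C. ball (?a i) (?r i)))"
  proof (rule Vitali_covering_theorem_balls [of E ?K ?a ?r])
    fix x d :: real assume x: "x \<in> E" and d: "0 < d"
    then obtain e where e: "e > 0" "ball x e \<subseteq> G" using assms by (meson open_contains_ball subsetD)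
    then obtain y z where yz: "y < x" "x < z" "z - y < min d e" "P y z"
      using P [OF x, of "min d e"] d by auto
    have "{y..z} \<subseteq> ball x e" using yz by (auto simp: dist_real_def)
    then have "(y, z) \<in> ?K" using yz e by auto
    moreover have "x \<in> ball (?a (y, z)) (?r (y, z))" using yz unfolding ball by simp
    ultimately show "\<exists>i. i \<in> ?K \<and> x \<in> ball (?a i) (?r i) \<and> ?r i < d"
      using yz by (intro exI [of _ "(y, z)"]) auto
  qed
  show ?thesis
    by (rule that [of C]) (use C in \<open>auto simp: ball pairwise_def disjnt_def\<close>)
qed

lemma emeasure_disjoint_intervals:
  assumes "finite C" "\<And>p. p \<in> C \<Longrightarrow> fst p \<le> snd p"
    "\<And>p q. p \<in> C \<Longrightarrow> q \<in> C \<Longrightarrow> p \<noteq> q \<Longrightarrow> {fst p<..<snd p} \<inter> {fst q<..<snd q} = {}"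
  shows "emeasure lborel (\<Union>p\<in>C. {fst p<..<snd p}) = ennreal (\<Sum>p\<in>C. snd p - fst p)"
proof -
  have "emeasure lborel (\<Union>p\<in>C. {fst p<..<snd p}) = (\<Sum>p\<in>C. emeasure lborel {fst p<..<snd p})"
    by (rule sum_emeasure [symmetric]) (use assms in \<open>auto simp: disjoint_family_on_def\<close>)
  also have "\<dots> = (\<Sum>p\<in>C. ennreal (snd p - fst p))"
    using assms by (intro sum.cong) auto
  also have "\<dots> = ennreal (\<Sum>p\<in>C. snd p - fst p)"
    using assms by (intro sum_ennreal) auto
  finally show ?thesis .
qed

lemma sum_division_increments:
  fixes g :: "real \<Rightarrow> real"
  assumes q: "q division_of {y..z}" and "y \<le> z"
  shows "(\<Sum>k\<in>q. g (Sup k) - g (Inf k)) = g z - g y"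
proof -
  note qD = division_ofD [OF q]
  have k: "\<exists>u w. u \<le> w \<and> k = {u..w}" if kq: "k \<in> q" for k
  proof -
    obtain u w where "k = {u..w}" using qD(4) [OF kq] by auto
    with qD(3) [OF kq] show ?thesis by auto
  qed
  let ?p = "(\<lambda>k. (Inf k, k)) ` q"
  have inj: "inj_on (\<lambda>k. (Inf k, k)) q" by (auto simp: inj_on_def)
  have "?p tagged_division_of {y..z}"
    unfolding tagged_division_of
  proof (intro conjI allI impI)
    show "finite ?p" using qD(1) by simp
    have "{K. \<exists>x. (x, K) \<in> ?p} = q" by auto
    then show "\<Union> {K. \<exists>x. (x, K) \<in> ?p} = {y..z}" using qD(6) by simp
  next
    fix x k assume "(x, k) \<in> ?p"
    then have "k \<in> q" "x = Inf k" by auto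
    with k [of k] qD(2) [of k] show "x \<in> k" "k \<subseteq> {y..z}" "\<exists>a b. k = cbox a b" by auto
  next
    fix x1 k1 x2 k2 assume "(x1, k1) \<in> ?p \<and> (x2, k2) \<in> ?p \<and> (x1, k1) \<noteq> (x2, k2)"
    then show "interior k1 \<inter> interior k2 = {}" using qD(5) by auto
  qed
  from additive_tagged_division_1 [OF \<open>y \<le> z\<close> this, of g]
  show ?thesis using inj by (simp add: sum.reindex)
qed

text \<open>
  The identity for all \<open>g\<close> at once serves two purposes: with \<open>g\<close> the identity it measures the
  gaps, and with \<open>g = f\<close> it turns an increment over an interval into increments over the gaps.
\<close>

lemma complementary_gaps:
  fixes y z :: real
  assumes "finite V" "y \<le> z" and V: "\<And>p. p \<in> V \<Longrightarrow> y \<le> fst p \<and> fst p < snd p \<and> snd p \<le> z"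
    and dj: "\<And>p q. p \<in> V \<Longrightarrow> q \<in> V \<Longrightarrow> p \<noteq> q \<Longrightarrow> {fst p<..<snd p} \<inter> {fst q<..<snd q} = {}"
  obtains W where "finite W" "\<And>p. p \<in> W \<Longrightarrow> y \<le> fst p \<and> fst p \<le> snd p \<and> snd p \<le> z"
    "\<And>p q. p \<in> W \<Longrightarrow> q \<in> W \<Longrightarrow> p \<noteq> q \<Longrightarrow> {fst p<..<snd p} \<inter> {fst q<..<snd q} = {}"
    "\<And>g :: real \<Rightarrow> real. g z - g y = (\<Sum>p\<in>V. g (snd p) - g (fst p)) + (\<Sum>p\<in>W. g (snd p) - g (fst p))"
proof -
  let ?I = "\<lambda>p::real\<times>real. {fst p..snd p}"
  let ?J = "\<lambda>k::real set. (Inf k, Sup k)"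
  have inj: "inj_on ?I V"
  proof (rule inj_onI)
    fix p1 p2 assume "p1 \<in> V" "p2 \<in> V" "?I p1 = ?I p2"
    then show "p1 = p2" using V [of p1] V [of p2] by (simp add: prod_eq_iff Icc_eq_Icc)
  qed
  have "?I ` V division_of \<Union>(?I ` V)"
  proof (rule division_ofI)
    fix k1 k2 assume "k1 \<in> ?I ` V" "k2 \<in> ?I ` V" "k1 \<noteq> k2"
    then obtain p1 p2 where "p1 \<in> V" "p2 \<in> V" "k1 = ?I p1" "k2 = ?I p2" "p1 \<noteq> p2" by blast
    then show "interior k1 \<inter> interior k2 = {}" using dj [of p1 p2] by simp
  next
    fix k assume "k \<in> ?I ` V"
    then obtain p where p: "p \<in> V" "k = ?I p" by blast
    show "k \<noteq> {}" using p V [of p] by auto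
    show "\<exists>a b. k = cbox a b" using p by auto
    show "k \<subseteq> \<Union>(?I ` V)" using p by blast
  qed (use assms(1) in auto)
  moreover have "\<Union>(?I ` V) \<subseteq> cbox y z"
  proof (rule UN_least)
    fix p assume "p \<in> V"
    then show "?I p \<subseteq> cbox y z" using V [of p] by simp
  qed
  ultimately obtain q where q: "?I ` V \<subseteq> q" "q division_of cbox y z"
    using partial_division_extend_interval by metis
  then have q2: "q division_of {y..z}" by simp
  note qD = division_ofD [OF q2]
  have k: "\<exists>u w. u \<le> w \<and> k = {u..w}" if kq: "k \<in> q" for k
  proof -
    obtain u w where "k = {u..w}" using qD(4) [OF kq] by auto
    with qD(3) [OF kq] show ?thesis by auto
  qed
  have kJ: "k = {Inf k..Sup k}" if "k \<in> q" for k
    using k [OF that] by auto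
  have injJ: "inj_on ?J q"
    by (rule inj_onI) (metis kJ prod.inject)
  let ?W = "?J ` (q - ?I ` V)"
  show ?thesis
  proof (rule that [of ?W])
    show "finite ?W" using qD(1) by simp
    show "y \<le> fst p \<and> fst p \<le> snd p \<and> snd p \<le> z" if pW: "p \<in> ?W" for p
    proof -
      obtain l where l: "l \<in> q" "p = ?J l" using pW by blast
      then obtain u w where "u \<le> w" "l = {u..w}" using k by blast
      then show ?thesis using qD(2) [OF l(1)] l by simp
    qed
    show "{fst p<..<snd p} \<inter> {fst p'<..<snd p'} = {}" if p: "p \<in> ?W" "p' \<in> ?W" "p \<noteq> p'" for p p'
    proof -
      obtain k1 k2 where k12: "k1 \<in> q" "k2 \<in> q" "p = ?J k1" "p' = ?J k2" "k1 \<noteq> k2" using p by auto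
      obtain u1 w1 u2 w2 where "k1 = {u1..w1}" "u1 \<le> w1" "k2 = {u2..w2}" "u2 \<le> w2"
        using k k12 by meson
      then show ?thesis using qD(5) [of k1 k2] k12 by simp
    qed
    fix g :: "real \<Rightarrow> real"
    have "g z - g y = (\<Sum>k\<in>q. g (Sup k) - g (Inf k))"
      using sum_division_increments [OF q2 \<open>y \<le> z\<close>] by simp
    also have "\<dots> = (\<Sum>k\<in>?I ` V. g (Sup k) - g (Inf k)) + (\<Sum>k\<in>q - ?I ` V. g (Sup k) - g (Inf k))"
      by (simp add: sum.subset_diff [OF q(1) qD(1)] add.commute)
    also have "(\<Sum>k\<in>?I ` V. g (Sup k) - g (Inf k)) = (\<Sum>p\<in>V. g (snd p) - g (fst p))"
      using V by (subst sum.reindex [OF inj]) (auto intro!: sum.cong simp: less_imp_le)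
    also have "(\<Sum>k\<in>q - ?I ` V. g (Sup k) - g (Inf k)) = (\<Sum>p\<in>?W. g (snd p) - g (fst p))"
      by (simp add: sum.reindex [OF inj_on_diff [OF injJ]])
    finally show "g z - g y = (\<Sum>p\<in>V. g (snd p) - g (fst p)) + (\<Sum>p\<in>?W. g (snd p) - g (fst p))" .
  qed
qed

lemma steep_antimono: "steep f c x \<Longrightarrow> c' \<le> c \<Longrightarrow> steep f c' x"
  unfolding steep_def
proof (intro allI impI)
  fix d :: real
  assume "\<forall>d>0. \<exists>y z. y < x \<and> x < z \<and> z - y < d \<and> c * (z - y) < f z - f y" "c' \<le> c" "d > 0"
  then obtain y z where yz: "y < x" "x < z" "z - y < d" "c * (z - y) < f z - f y" by blast
  have "c' * (z - y) \<le> c * (z - y)" using yz \<open>c' \<le> c\<close> by (intro mult_right_mono) auto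
  then have "c' * (z - y) < f z - f y" using yz(4) by (rule order_le_less_trans)
  with yz show "\<exists>y z. y < x \<and> x < z \<and> z - y < d \<and> c' * (z - y) < f z - f y"
    by blast
qed

lemma negligible_if_finite_subfamilies_small:
  fixes E :: "real set"
  assumes C: "countable C" "\<And>p. p \<in> C \<Longrightarrow> fst p < snd p"
    "\<And>p q. p \<in> C \<Longrightarrow> q \<in> C \<Longrightarrow> p \<noteq> q \<Longrightarrow> {fst p<..<snd p} \<inter> {fst q<..<snd q} = {}"
    and cover: "negligible (E - (\<Union>p\<in>C. {fst p<..<snd p}))"
    and small: "\<And>C'. finite C' \<Longrightarrow> C' \<subseteq> C \<Longrightarrow> (\<Sum>p\<in>C'. snd p - fst p) \<le> e" and e: "e > 0"
  shows "\<exists>S. E \<subseteq> S \<and> S \<in> lmeasurable \<and> measure lebesgue S \<le> e"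
proof -
  let ?U = "\<Union>p\<in>C. {fst p<..<snd p}"
  have le: "emeasure lborel ?U \<le> ennreal e"
  proof (rule ccontr)
    assume "\<not> ?thesis"
    then have "ennreal e < emeasure lborel ?U" by simp
    then obtain C' where C': "finite C'" "C' \<subseteq> C" "ennreal e < emeasure lborel (\<Union>p\<in>C'. {fst p<..<snd p})"
      using finite_subfamily_emeasure [OF C(1), of "\<lambda>p. {fst p<..<snd p}" lborel "ennreal e"] by auto
    have "emeasure lborel (\<Union>p\<in>C'. {fst p<..<snd p}) = ennreal (\<Sum>p\<in>C'. snd p - fst p)"
      by (rule emeasure_disjoint_intervals [OF C'(1)]; use C(2,3) C'(2) in \<open>blast intro: less_imp_le\<close>)
    with C' small [OF C'(1,2)] show False by (simp add: ennreal_leI leD)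
  qed
  have open_U: "open ?U" by auto
  then have eU: "emeasure lebesgue ?U \<le> ennreal e" using le by simp
  have null: "E - ?U \<in> null_sets lebesgue" using cover by (simp add: negligible_iff_null_sets)
  have U: "?U \<in> sets lebesgue" using open_U by auto
  have eUE: "emeasure lebesgue (?U \<union> (E - ?U)) \<le> ennreal e"
    using emeasure_Un_null_set [OF U null] eU by simp
  then have less_top: "emeasure lebesgue (?U \<union> (E - ?U)) < \<infinity>" by (rule order_le_less_trans) simp
  have "?U \<union> (E - ?U) \<in> lmeasurable"
    by (rule fmeasurableI [OF sets.Un [OF U] less_top]) (use null in auto)
  then show ?thesis
    using e eUE by (intro exI [of _ "?U \<union> (E - ?U)"]) (simp add: emeasure_eq_measure2 Un_upper2)
qed

text \<open>
  If \<open>f\<close> both rises and falls with slope \<open>c\<close> on arbitrarily short intervals around each point of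
  \<open>E\<close>, cover \<open>E\<close> by falling intervals inside an open set that is only slightly larger than \<open>E\<close>,
  and then cover it again by rising intervals inside the falling ones. On a falling interval the
  loss must then be made up on the gaps between the rising ones. The gaps have small total length,
  so by absolute continuity the falling intervals have small total length, too.
\<close>

lemma steep_both_negligible:
  fixes f :: "real \<Rightarrow> real"
  assumes ac: "absolutely_continuous_path T f" and c: "c > 0"
  shows "negligible {x\<in>{0<..<T}. steep f c x \<and> steep (\<lambda>t. - f t) c x}" (is "negligible ?E")
  unfolding negligible_outer_le
proof (intro allI impI)
  fix e :: real assume e: "e > 0"
  have Eb: "?E \<in> sets borel"
  proof -
    have "?E = {0<..<T} \<inter> {x. steep f c x} \<inter> {x. steep (\<lambda>t. - f t) c x}" by auto
    then show ?thesis using steep_borel by auto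
  qed
  obtain \<delta> where \<delta>1: "\<delta> > 0" and \<delta>2:
    "\<forall>(I::((real\<times>real)\<times>(real\<times>real)) set) a b. finite I \<longrightarrow> (\<forall>i. i \<in> I \<longrightarrow> 0 \<le> a i \<and> a i \<le> b i \<and> b i \<le> T) \<longrightarrow>
      (\<forall>i j. i \<in> I \<longrightarrow> j \<in> I \<longrightarrow> i \<noteq> j \<longrightarrow> {a i<..<b i} \<inter> {a j<..<b j} = {}) \<longrightarrow>
      (\<Sum>i\<in>I. b i - a i) < \<delta> \<longrightarrow> (\<Sum>i\<in>I. dist (f (a i)) (f (b i))) < c * e"
    by (rule absolutely_continuous_path_family [OF ac mult_pos_pos [OF c e]])
  note \<delta> = \<delta>1 \<delta>2 [rule_format]
  have El: "?E \<in> sets lebesgue" by (rule sets_completionI_sets) (use Eb in simp)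
  obtain G0 where G0: "open G0" "?E \<subseteq> G0" "emeasure lebesgue (G0 - ?E) < ennreal \<delta>"
    by (rule sets_lebesgue_outer_open [OF El \<delta>(1)]) (rule that)
  define G where "G = G0 \<inter> {0<..<T}"
  have G: "open G" "?E \<subseteq> G" "G \<subseteq> {0<..<T}" using G0 by (auto simp: G_def)
  have GE: "emeasure lebesgue (G - ?E) < ennreal \<delta>"
    by (rule order_le_less_trans [OF emeasure_mono G0(3)]) (use G0 Eb in \<open>auto simp: G_def\<close>)
  have fall: "\<exists>y z. y < x \<and> x < z \<and> z - y < d \<and> f z - f y < - c * (z - y)" if x: "x \<in> ?E" "d > 0" for x d
  proof -
    have "steep (\<lambda>t. - f t) c x" using x by blast
    then obtain y z where "y < x" "x < z" "z - y < d" "c * (z - y) < - f z - - f y"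
      using x(2) unfolding steep_def by blast
    then show ?thesis by (intro exI [of _ y] exI [of _ z]) auto
  qed
  obtain C where C: "countable C" "\<And>y z. (y, z) \<in> C \<Longrightarrow> y < z \<and> {y..z} \<subseteq> G \<and> f z - f y < - c * (z - y)"
    "\<And>p q. p \<in> C \<Longrightarrow> q \<in> C \<Longrightarrow> p \<noteq> q \<Longrightarrow> {fst p<..<snd p} \<inter> {fst q<..<snd q} = {}"
    "negligible (?E - (\<Union>p\<in>C. {fst p<..<snd p}))"
    by (rule vitali_intervals [OF G(1,2), of "\<lambda>y z. f z - f y < - c * (z - y)"]) (use fall in auto)
  have C2: "fst p < snd p" "0 < fst p" "snd p < T" "f (snd p) - f (fst p) < - c * (snd p - fst p)" "{fst p..snd p} \<subseteq> G"
    if "p \<in> C" for p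
  proof -
    have *: "fst p < snd p \<and> {fst p..snd p} \<subseteq> G \<and> f (snd p) - f (fst p) < - c * (snd p - fst p)"
      using C(2) [of "fst p" "snd p"] that by simp
    then show "fst p < snd p" "f (snd p) - f (fst p) < - c * (snd p - fst p)" "{fst p..snd p} \<subseteq> G" by auto
    have "fst p \<in> G" "snd p \<in> G" using * by auto
    then show "0 < fst p" "snd p < T" using G(3) by auto
  qed
  show "\<exists>S. ?E \<subseteq> S \<and> S \<in> lmeasurable \<and> measure lebesgue S \<le> e"
  proof (rule negligible_if_finite_subfamilies_small [OF C(1) C2(1) C(3) C(4) _ e])
    fix C' assume C': "finite C'" "C' \<subseteq> C"
    let ?U = "\<Union>p\<in>C'. {fst p<..<snd p}"
    let ?E' = "?E \<inter> ?U"
    let ?P = "\<lambda>u w. c * (w - u) < f w - f u \<and> (\<exists>p\<in>C'. fst p \<le> u \<and> w \<le> snd p)"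
    have "open ?U" by auto
    have rise: "\<exists>u w. u < x \<and> x < w \<and> w - u < d \<and> ?P u w" if x: "x \<in> ?E'" and d: "d > 0" for x d
    proof -
      obtain p where p: "p \<in> C'" "fst p < x" "x < snd p" using x by auto
      have "0 < min d (min (x - fst p) (snd p - x))" using d p by simp
      then obtain u w where "u < x" "x < w" "w - u < min d (min (x - fst p) (snd p - x))" "c * (w - u) < f w - f u"
        using x unfolding steep_def by blast
      then show ?thesis using p by (intro exI [of _ u] exI [of _ w]) (auto intro!: bexI [of _ p])
    qed
    obtain V where V: "countable V" "\<And>u w. (u, w) \<in> V \<Longrightarrow> u < w \<and> {u..w} \<subseteq> ?U \<and> ?P u w"
      "\<And>p q. p \<in> V \<Longrightarrow> q \<in> V \<Longrightarrow> p \<noteq> q \<Longrightarrow> {fst p<..<snd p} \<inter> {fst q<..<snd q} = {}"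
      "negligible (?E' - (\<Union>p\<in>V. {fst p<..<snd p}))"
      by (rule vitali_intervals [OF \<open>open ?U\<close>, of ?E' ?P]) (use rise in auto)
    have V2: "fst v < snd v" "?P (fst v) (snd v)" if "v \<in> V" for v
      using V(2) [of "fst v" "snd v"] that by auto
    define S where "S = (\<Sum>p\<in>C'. snd p - fst p)"
    have S: "emeasure lebesgue ?U = ennreal S"
    proof -
      have "emeasure lborel ?U = ennreal S"
        unfolding S_def by (rule emeasure_disjoint_intervals [OF C'(1)]; use C2(1) C(3) C'(2) in \<open>blast intro: less_imp_le\<close>)
      then show ?thesis using \<open>open ?U\<close> by simp
    qed
    let ?V = "\<Union>p\<in>V. {fst p<..<snd p}"
    have UV: "emeasure lebesgue (?U - ?V) < ennreal \<delta>"
    proof -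
      have null: "?E' - ?V \<in> null_sets lebesgue" using V(4) by (simp add: negligible_iff_null_sets)
      have "?U \<subseteq> G"
      proof (rule UN_least)
        fix p assume "p \<in> C'"
        then have "{fst p..snd p} \<subseteq> G" using C2(5) C' by blast
        moreover have "{fst p<..<snd p} \<subseteq> {fst p..snd p}" by auto
        ultimately show "{fst p<..<snd p} \<subseteq> G" by (rule order_trans [rotated])
      qed
      then have "?U - ?V \<subseteq> (G - ?E) \<union> (?E' - ?V)" by blast
      then have "emeasure lebesgue (?U - ?V) \<le> emeasure lebesgue ((G - ?E) \<union> (?E' - ?V))"
        by (rule emeasure_mono) (use G(1) Eb null in auto)
      also have "\<dots> = emeasure lebesgue (G - ?E)"
        by (rule emeasure_Un_null_set) (use G(1) Eb null in auto)
      finally show ?thesis using GE by (rule order_le_less_trans)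
    qed
    obtain V' where V': "finite V'" "V' \<subseteq> V" "S - \<delta> < (\<Sum>p\<in>V'. snd p - fst p)"
    proof (cases "S < \<delta>")
      case True
      then show ?thesis using that [of "{}"] by simp
    next
      case False
      have "open ?V" by auto
      then have sets: "?U \<in> sets lebesgue" "?V \<in> sets lebesgue" using \<open>open ?U\<close> by auto
      have "emeasure lebesgue ?U \<le> emeasure lebesgue ((?U - ?V) \<union> ?V)"
        by (rule emeasure_mono) (blast, intro sets.Un sets.Diff sets)
      also have "\<dots> \<le> emeasure lebesgue (?U - ?V) + emeasure lebesgue ?V"
        by (rule emeasure_subadditive) (intro sets.Diff sets)+
      finally have "ennreal S \<le> emeasure lebesgue (?U - ?V) + emeasure lebesgue ?V" using S by simp
      moreover obtain m where m: "emeasure lebesgue (?U - ?V) = ennreal m" "0 \<le> m" "m < \<delta>"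
        using UV \<delta>(1) by (cases "emeasure lebesgue (?U - ?V)") (auto simp: ennreal_less_iff)
      ultimately have "ennreal (S - \<delta>) < emeasure lebesgue ?V"
        using False by (cases "emeasure lebesgue ?V") (auto simp: ennreal_plus [symmetric] ennreal_less_iff simp del: ennreal_plus)
      then have "ennreal (S - \<delta>) < emeasure lborel ?V" using \<open>open ?V\<close> by simp
      then obtain V' where V': "finite V'" "V' \<subseteq> V" "ennreal (S - \<delta>) < emeasure lborel (\<Union>p\<in>V'. {fst p<..<snd p})"
        using finite_subfamily_emeasure [OF V(1), of "\<lambda>p. {fst p<..<snd p}" lborel "ennreal (S - \<delta>)"] by auto
      have "emeasure lborel (\<Union>p\<in>V'. {fst p<..<snd p}) = ennreal (\<Sum>p\<in>V'. snd p - fst p)"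
        by (rule emeasure_disjoint_intervals [OF V'(1)]; use V2(1) V(3) V'(2) in \<open>blast intro: less_imp_le\<close>)
      then show ?thesis using that [OF V'(1,2)] V'(3) False by (simp add: ennreal_less_iff)
    qed
    define Vp where "Vp p = {v \<in> V'. fst p \<le> fst v \<and> snd v \<le> snd p}" for p
    have ex: "\<exists>W. finite W \<and> (\<forall>w\<in>W. fst p \<le> fst w \<and> fst w \<le> snd w \<and> snd w \<le> snd p) \<and>
       (\<forall>w\<in>W. \<forall>w'\<in>W. w \<noteq> w' \<longrightarrow> {fst w<..<snd w} \<inter> {fst w'<..<snd w'} = {}) \<and>
       (\<forall>g::real \<Rightarrow> real. g (snd p) - g (fst p) = (\<Sum>v\<in>Vp p. g (snd v) - g (fst v)) + (\<Sum>w\<in>W. g (snd w) - g (fst w)))"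
      if p: "p \<in> C'" for p
    proof (rule complementary_gaps [of "Vp p" "fst p" "snd p"])
      show "finite (Vp p)" using V'(1) by (simp add: Vp_def)
      show "fst p \<le> snd p" using C2(1) [of p] p C' by auto
      show "fst p \<le> fst v \<and> fst v < snd v \<and> snd v \<le> snd p" if "v \<in> Vp p" for v
        using that V2(1) [of v] V' by (auto simp: Vp_def)
      show "{fst v<..<snd v} \<inter> {fst w<..<snd w} = {}" if "v \<in> Vp p" "w \<in> Vp p" "v \<noteq> w" for v w
        using that V(3) [of v w] V' by (auto simp: Vp_def)
    next
      fix W
      assume W: "finite W" "\<And>w. w \<in> W \<Longrightarrow> fst p \<le> fst w \<and> fst w \<le> snd w \<and> snd w \<le> snd p"
        "\<And>w w'. w \<in> W \<Longrightarrow> w' \<in> W \<Longrightarrow> w \<noteq> w' \<Longrightarrow> {fst w<..<snd w} \<inter> {fst w'<..<snd w'} = {}"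
        "\<And>g::real \<Rightarrow> real. g (snd p) - g (fst p) = (\<Sum>v\<in>Vp p. g (snd v) - g (fst v)) + (\<Sum>w\<in>W. g (snd w) - g (fst w))"
      show ?thesis
        by (intro exI [of _ W] conjI, rule W(1), (rule ballI, rule W(2), assumption),
            (intro ballI impI, rule W(3), assumption+), (rule allI, rule W(4)))
    qed
    have "\<exists>W. \<forall>p\<in>C'. finite (W p) \<and> (\<forall>w\<in>W p. fst p \<le> fst w \<and> fst w \<le> snd w \<and> snd w \<le> snd p) \<and>
       (\<forall>w\<in>W p. \<forall>w'\<in>W p. w \<noteq> w' \<longrightarrow> {fst w<..<snd w} \<inter> {fst w'<..<snd w'} = {}) \<and>
       (\<forall>g::real \<Rightarrow> real. g (snd p) - g (fst p) = (\<Sum>v\<in>Vp p. g (snd v) - g (fst v)) + (\<Sum>w\<in>W p. g (snd w) - g (fst w)))"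
      by (rule bchoice) (rule ballI, rule ex)
    then obtain W where W0: "\<forall>p\<in>C'. finite (W p) \<and> (\<forall>w\<in>W p. fst p \<le> fst w \<and> fst w \<le> snd w \<and> snd w \<le> snd p) \<and>
       (\<forall>w\<in>W p. \<forall>w'\<in>W p. w \<noteq> w' \<longrightarrow> {fst w<..<snd w} \<inter> {fst w'<..<snd w'} = {}) \<and>
       (\<forall>g::real \<Rightarrow> real. g (snd p) - g (fst p) = (\<Sum>v\<in>Vp p. g (snd v) - g (fst v)) + (\<Sum>w\<in>W p. g (snd w) - g (fst w)))" ..
    have W: "finite (W p)" "\<And>w. w \<in> W p \<Longrightarrow> fst p \<le> fst w \<and> fst w \<le> snd w \<and> snd w \<le> snd p"
      "\<And>w w'. w \<in> W p \<Longrightarrow> w' \<in> W p \<Longrightarrow> w \<noteq> w' \<Longrightarrow> {fst w<..<snd w} \<inter> {fst w'<..<snd w'} = {}"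
      "\<And>g::real \<Rightarrow> real. g (snd p) - g (fst p) = (\<Sum>v\<in>Vp p. g (snd v) - g (fst v)) + (\<Sum>w\<in>W p. g (snd w) - g (fst w))"
      if "p \<in> C'" for p
      using bspec [OF W0 that] by blast+
    have part: "(\<Sum>p\<in>C'. \<Sum>v\<in>Vp p. h v) = (\<Sum>v\<in>V'. h v)" for h :: "real \<times> real \<Rightarrow> real"
    proof -
      have "V' = (\<Union>p\<in>C'. Vp p)" using V2(2) V' by (auto simp: Vp_def)
      moreover have "(\<Sum>v\<in>(\<Union>p\<in>C'. Vp p). h v) = (\<Sum>p\<in>C'. \<Sum>v\<in>Vp p. h v)"
      proof (rule sum.UNION_disjoint)
        show "\<forall>p\<in>C'. finite (Vp p)" using V'(1) by (simp add: Vp_def)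
        show "\<forall>p\<in>C'. \<forall>q\<in>C'. p \<noteq> q \<longrightarrow> Vp p \<inter> Vp q = {}"
        proof (intro ballI impI equals0I)
          fix p q v assume pq: "p \<in> C'" "q \<in> C'" "p \<noteq> q" and "v \<in> Vp p \<inter> Vp q"
          then have v: "v \<in> V" "fst p \<le> fst v" "snd v \<le> snd p" "fst q \<le> fst v" "snd v \<le> snd q"
            using V' by (auto simp: Vp_def)
          then have "(fst v + snd v) / 2 \<in> {fst p<..<snd p} \<inter> {fst q<..<snd q}"
            using V2(1) [of v] by simp
          then show False using C(3) [of p q] pq C' by blast
        qed
      qed (rule C')
      ultimately show ?thesis by simp
    qed
    have "(\<Sum>i\<in>Sigma C' W. snd (snd i) - fst (snd i)) < \<delta>"
    proof -
      have "(\<Sum>i\<in>Sigma C' W. snd (snd i) - fst (snd i)) = (\<Sum>p\<in>C'. \<Sum>w\<in>W p. snd w - fst w)"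
        using C' W(1) by (subst sum.Sigma) (auto simp: case_prod_unfold)
      also have "\<dots> = (\<Sum>p\<in>C'. (snd p - fst p) - (\<Sum>v\<in>Vp p. snd v - fst v))"
      proof (rule sum.cong [OF refl])
        fix p assume "p \<in> C'"
        from W(4) [OF this, of "\<lambda>x. x"] show "(\<Sum>w\<in>W p. snd w - fst w) = (snd p - fst p) - (\<Sum>v\<in>Vp p. snd v - fst v)"
          by linarith
      qed
      also have "\<dots> = S - (\<Sum>v\<in>V'. snd v - fst v)"
        by (simp add: sum_subtractf part S_def)
      finally show ?thesis using V'(3) by linarith
    qed
    moreover have "finite (Sigma C' W)" using C' W(1) by auto
    ultimately have gaps: "(\<Sum>i\<in>Sigma C' W. dist (f (fst (snd i))) (f (snd (snd i)))) < c * e"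
    proof (intro \<delta>(2))
      fix i assume "i \<in> Sigma C' W"
      then obtain p w where i: "i = (p, w)" "p \<in> C'" "w \<in> W p" by auto
      then show "0 \<le> fst (snd i) \<and> fst (snd i) \<le> snd (snd i) \<and> snd (snd i) \<le> T"
        using W(2) [OF i(2,3)] C2(2,3) [of p] C' by auto
    next
      fix i j assume ij: "i \<in> Sigma C' W" "j \<in> Sigma C' W" "i \<noteq> j"
      obtain p w where i: "i = (p, w)" "p \<in> C'" "w \<in> W p" using ij(1) by blast
      obtain q v where j: "j = (q, v)" "q \<in> C'" "v \<in> W q" using ij(2) by blast
      show "{fst (snd i)<..<snd (snd i)} \<inter> {fst (snd j)<..<snd (snd j)} = {}"
      proof (cases "p = q")
        case True
        then show ?thesis using W(3) [of p w v] i j ij by auto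
      next
        case False
        then have "{fst p<..<snd p} \<inter> {fst q<..<snd q} = {}" using C(3) i j C' by blast
        moreover have "{fst w<..<snd w} \<subseteq> {fst p<..<snd p}" "{fst v<..<snd v} \<subseteq> {fst q<..<snd q}"
          using W(2) [OF i(2,3)] W(2) [OF j(2,3)] by auto
        ultimately show ?thesis unfolding i(1) j(1) fst_conv snd_conv by blast
      qed
    qed
    have "c * (snd p - fst p) \<le> (\<Sum>w\<in>W p. dist (f (fst w)) (f (snd w)))" if p: "p \<in> C'" for p
    proof -
      have "0 \<le> (\<Sum>v\<in>Vp p. f (snd v) - f (fst v))"
      proof (rule sum_nonneg)
        fix v assume "v \<in> Vp p"
        then have "v \<in> V" using V' by (auto simp: Vp_def)
        then have "fst v < snd v" "c * (snd v - fst v) < f (snd v) - f (fst v)" using V2 by auto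
        moreover from this c have "0 < c * (snd v - fst v)" by simp
        ultimately show "0 \<le> f (snd v) - f (fst v)" by linarith
      qed
      moreover have "f (snd p) - f (fst p) < - c * (snd p - fst p)" using C2(4) p C' by blast
      moreover have "- (\<Sum>w\<in>W p. f (snd w) - f (fst w)) \<le> (\<Sum>w\<in>W p. dist (f (fst w)) (f (snd w)))"
        unfolding sum_negf [symmetric] by (rule sum_mono) (auto simp: dist_real_def)
      ultimately show ?thesis using W(4) [OF p, of f] by simp
    qed
    then have "(\<Sum>p\<in>C'. c * (snd p - fst p)) \<le> (\<Sum>p\<in>C'. \<Sum>w\<in>W p. dist (f (fst w)) (f (snd w)))"
      by (rule sum_mono)
    also have "\<dots> = (\<Sum>i\<in>Sigma C' W. dist (f (fst (snd i))) (f (snd (snd i))))"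
      using C' W(1) by (subst sum.Sigma) (auto simp: case_prod_unfold)
    finally have "c * S < c * e" using gaps by (simp add: S_def sum_distrib_left)
    then show "(\<Sum>p\<in>C'. snd p - fst p) \<le> e" using c by (simp add: S_def)
  qed
qed

text \<open>
  Around such points there are disjoint intervals with arbitrarily large slopes. If their total
  length is below the \<open>\<delta>\<close> that belongs to increments of size \<open>1\<close>, the total increment is less than
  \<open>1\<close>, and so the total length is less than the inverse of the slope. The argument is local, to make
  the total length small beforehand.
\<close>

lemma steep_unbounded_negligible:
  fixes f :: "real \<Rightarrow> real"
  assumes ac: "absolutely_continuous_path T f"
  shows "negligible {x\<in>{0<..<T}. \<forall>n::nat. steep f n x}" (is "negligible ?E")
proof -
  obtain \<delta> where \<delta>1: "\<delta> > 0" and \<delta>2: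
    "\<forall>(I::(real\<times>real) set) a b. finite I \<longrightarrow> (\<forall>i. i \<in> I \<longrightarrow> 0 \<le> a i \<and> a i \<le> b i \<and> b i \<le> T) \<longrightarrow>
      (\<forall>i j. i \<in> I \<longrightarrow> j \<in> I \<longrightarrow> i \<noteq> j \<longrightarrow> {a i<..<b i} \<inter> {a j<..<b j} = {}) \<longrightarrow>
      (\<Sum>i\<in>I. b i - a i) < \<delta> \<longrightarrow> (\<Sum>i\<in>I. dist (f (a i)) (f (b i))) < 1"
    by (rule absolutely_continuous_path_family [OF ac zero_less_one])
  note \<delta> = \<delta>1 \<delta>2 [rule_format]
  have "negligible (?E \<inter> {x - \<delta>/3<..<x + \<delta>/3})" for x
    unfolding negligible_outer_le
  proof (intro allI impI)
    fix e :: real assume e: "e > 0"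
    obtain n where n: "inverse (real (Suc n)) < e" using reals_Archimedean e by blast
    let ?G = "{0<..<T} \<inter> {x - \<delta>/3<..<x + \<delta>/3}"
    let ?P = "\<lambda>(y::real) (z::real). Suc n * (z - y) < f z - f y"
    have Gopen: "open ?G" by auto
    have sub: "?E \<inter> {x - \<delta>/3<..<x + \<delta>/3} \<subseteq> ?G" by auto
    have rise: "\<exists>y z::real. y < x' \<and> x' < z \<and> z - y < d \<and> ?P y z" if "x' \<in> ?E \<inter> {x - \<delta>/3<..<x + \<delta>/3}" "d > 0" for x' d
    proof -
      have "steep f (Suc n) x'" using that by blast
      then show ?thesis using that(2) unfolding steep_def by blast
    qed
    obtain C where C: "countable C" "\<And>y z. (y, z) \<in> C \<Longrightarrow> y < z \<and> {y..z} \<subseteq> ?G \<and> ?P y z"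
      "\<And>p q. p \<in> C \<Longrightarrow> q \<in> C \<Longrightarrow> p \<noteq> q \<Longrightarrow> {fst p<..<snd p} \<inter> {fst q<..<snd q} = {}"
      "negligible (?E \<inter> {x - \<delta>/3<..<x + \<delta>/3} - (\<Union>p\<in>C. {fst p<..<snd p}))"
      by (rule vitali_intervals [OF Gopen sub, of ?P]) (use rise in auto)
    have C2: "fst p < snd p" "{fst p..snd p} \<subseteq> ?G" "?P (fst p) (snd p)" if "p \<in> C" for p
      using C(2) [of "fst p" "snd p", unfolded prod.collapse, OF that] by blast+
    show "\<exists>S. ?E \<inter> {x - \<delta>/3<..<x + \<delta>/3} \<subseteq> S \<and> S \<in> lmeasurable \<and> measure lebesgue S \<le> e"
    proof (rule negligible_if_finite_subfamilies_small [OF C(1) C2(1) C(3) C(4) _ e])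
      fix C' assume C': "finite C'" "C' \<subseteq> C"
      define S where "S = (\<Sum>p\<in>C'. snd p - fst p)"
      have "(\<Union>p\<in>C'. {fst p<..<snd p}) \<subseteq> {x - \<delta>/3<..<x + \<delta>/3}"
      proof (rule UN_least)
        fix p assume "p \<in> C'"
        then have "{fst p..snd p} \<subseteq> {x - \<delta>/3<..<x + \<delta>/3}" using C2(2) C' by blast
        moreover have "{fst p<..<snd p} \<subseteq> {fst p..snd p}" by auto
        ultimately show "{fst p<..<snd p} \<subseteq> {x - \<delta>/3<..<x + \<delta>/3}" by (rule order_trans [rotated])
      qed
      then have "emeasure lborel (\<Union>p\<in>C'. {fst p<..<snd p}) \<le> emeasure lborel {x - \<delta>/3<..<x + \<delta>/3}"
        by (rule emeasure_mono) auto
      also have "\<dots> = ennreal (2 * \<delta> / 3)" using \<delta>(1) by simp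
      finally have "ennreal S \<le> ennreal (2 * \<delta> / 3)"
        unfolding S_def
        by (subst emeasure_disjoint_intervals [OF C'(1), symmetric]; use C2(1) C(3) C'(2) in \<open>blast intro: less_imp_le\<close>)
      then have "S < \<delta>" using \<delta>(1) by (simp add: ennreal_le_iff)
      have "(\<Sum>p\<in>C'. dist (f (fst p)) (f (snd p))) < 1"
      proof (rule \<delta>(2) [OF C'(1)])
        fix p assume p: "p \<in> C'"
        then have "p \<in> C" using C' by blast
        then have *: "fst p < snd p" "{fst p..snd p} \<subseteq> ?G" using C2 by blast+
        moreover have "fst p \<in> {fst p..snd p}" "snd p \<in> {fst p..snd p}" using *(1) by auto
        ultimately have "fst p \<in> ?G" "snd p \<in> ?G" "fst p < snd p" by blast+
        then show "0 \<le> fst p \<and> fst p \<le> snd p \<and> snd p \<le> T" by simp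
      next
        show "(\<Sum>p\<in>C'. snd p - fst p) < \<delta>" using \<open>S < \<delta>\<close> by (simp add: S_def)
      qed (use C C' in blast)
      moreover have "Suc n * S \<le> (\<Sum>p\<in>C'. dist (f (fst p)) (f (snd p)))"
        unfolding S_def sum_distrib_left
      proof (rule sum_mono)
        fix p assume "p \<in> C'"
        then have "?P (fst p) (snd p)" using C2(3) C' by blast
        then show "Suc n * (snd p - fst p) \<le> dist (f (fst p)) (f (snd p))" by (simp add: dist_real_def)
      qed
      ultimately have "Suc n * S < 1" by simp
      then have "S < inverse (real (Suc n))" by (simp add: field_simps)
      then show "(\<Sum>p\<in>C'. snd p - fst p) \<le> e" using n by (simp add: S_def)
    qed
  qed
  then show ?thesis
    unfolding locally_negligible_alt [of ?E]
    using \<delta>(1) by (intro ballI) (rule_tac x = "?E \<inter> {x - \<delta>/3<..<x + \<delta>/3}" in exI, auto simp: openin_open)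
qed

text \<open>
  Outside the null sets of the two preceding lemmas (for rational slopes, and for \<open>f\<close> tilted so that
  the two slopes become opposite) the set of all \<open>c\<close> with \<open>steep f c x\<close> is nonempty and bounded above,
  and the function is not steep from the other side beyond its supremum. The supremum controls the
  slopes of straddling intervals; by continuity it also controls those that end at \<open>x\<close>.
\<close>

lemma absolutely_continuous_derivative_AE:
  fixes f :: "real \<Rightarrow> real"
  assumes ac: "absolutely_continuous_path T f"
  shows "\<exists>N. negligible N \<and> (\<forall>x\<in>{0<..<T} - N. \<exists>D. (f has_real_derivative D) (at x))"
proof -
  have acm: "absolutely_continuous_path T (\<lambda>t. a * f t - m * t)" if "\<bar>a\<bar> = 1" for a m :: real
  proof (rule absolutely_continuous_path_dominated [OF ac, where L = "1 + \<bar>m\<bar>"])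
    fix s t :: real assume "s \<le> t"
    have "dist (a * f s - m * s) (a * f t - m * t) \<le> \<bar>a * (f s - f t)\<bar> + \<bar>m * (t - s)\<bar>"
      unfolding dist_real_def by (simp add: algebra_simps)
    also have "\<dots> = dist (f s) (f t) + \<bar>m\<bar> * (t - s)"
      using that \<open>s \<le> t\<close> by (simp add: abs_mult dist_real_def)
    also have "\<dots> \<le> (1 + \<bar>m\<bar>) * (dist (f s) (f t) + (t - s))"
      using \<open>s \<le> t\<close> by (simp add: distrib_left distrib_right)
    finally show "dist (a * f s - m * s) (a * f t - m * t) \<le> (1 + \<bar>m\<bar>) * (dist (f s) (f t) + (t - s))" .
  qed simp
  have acneg: "absolutely_continuous_path T (\<lambda>t. - f t)" using acm [of "-1" 0] by simp
  define B where "B p q = {x\<in>{0<..<T}. steep f q x \<and> steep (\<lambda>t. - f t) (- p) x}" for p q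
  have B: "negligible (B p q)" if "p < q" for p q
  proof -
    let ?g = "\<lambda>t. f t - (p + q) / 2 * t"
    have "(q - p) / 2 * (z - y) < ?g z - ?g y \<longleftrightarrow> q * (z - y) < f z - f y" for y z
    proof -
      have "?g z - ?g y - (q - p) / 2 * (z - y) = f z - f y - q * (z - y)" by (simp add: field_simps)
      then show ?thesis by linarith
    qed
    moreover have "(q - p) / 2 * (z - y) < - ?g z - - ?g y \<longleftrightarrow> - p * (z - y) < - f z - - f y" for y z
    proof -
      have "- ?g z - - ?g y - (q - p) / 2 * (z - y) = - f z - - f y - - p * (z - y)" by (simp add: field_simps)
      then show ?thesis by linarith
    qed
    ultimately have "steep ?g ((q - p) / 2) x \<longleftrightarrow> steep f q x" "steep (\<lambda>t. - ?g t) ((q - p) / 2) x \<longleftrightarrow> steep (\<lambda>t. - f t) (- p) x" for x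
      unfolding steep_def by simp_all
    then show ?thesis
      using steep_both_negligible [of T ?g "(q - p) / 2"] acm [of 1 "(p + q) / 2"] that by (simp add: B_def)
  qed
  define N where "N = (\<Union>(p, q)\<in>{(p, q). p < q}. B (real_of_rat p) (real_of_rat q)) \<union>
    {x\<in>{0<..<T}. \<forall>n::nat. steep f n x} \<union> {x\<in>{0<..<T}. \<forall>n::nat. steep (\<lambda>t. - f t) n x}"
  have "negligible (\<Union>((\<lambda>(p, q). B (real_of_rat p) (real_of_rat q)) ` {(p, q). p < q}))"
    by (rule negligible_countable_Union) (auto intro!: B simp: of_rat_less)
  then have "negligible N"
    unfolding N_def using steep_unbounded_negligible [OF ac] steep_unbounded_negligible [OF acneg]
    by (intro negligible_Un) auto
  moreover have "\<exists>D. (f has_real_derivative D) (at x)" if x: "x \<in> {0<..<T} - N" for x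
  proof -
    have no: "\<not> (steep f q x \<and> steep (\<lambda>t. - f t) (- p) x)" if pq: "p < q" for p q
    proof
      assume st: "steep f q x \<and> steep (\<lambda>t. - f t) (- p) x"
      obtain p' where p': "p < real_of_rat p'" "real_of_rat p' < q" using of_rat_dense [OF pq] by blast
      obtain q' where q': "real_of_rat p' < real_of_rat q'" "real_of_rat q' < q" using of_rat_dense [OF p'(2)] by blast
      have "x \<in> B (real_of_rat p') (real_of_rat q')"
        using st x p' q' by (auto simp: B_def elim: steep_antimono)
      then show False using x q'(1) by (auto simp: N_def of_rat_less)
    qed
    obtain n where n: "\<not> steep f (real n) x" using x by (auto simp: N_def)
    obtain m where m: "\<not> steep (\<lambda>t. - f t) (real m) x" using x by (auto simp: N_def)
    define S where "S = {c. steep f c x}"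
    have bdd: "bdd_above S"
      by (rule bdd_aboveI [of _ "real n"]) (metis (no_types, lifting) S_def linorder_linear mem_Collect_eq n steep_antimono)
    have ne: "S \<noteq> {}"
    proof -
      obtain d where d: "d > 0" "\<And>y z. y < x \<Longrightarrow> x < z \<Longrightarrow> z - y < d \<Longrightarrow> - f z - - f y \<le> real m * (z - y)"
        using m unfolding steep_def by (metis not_less)
      have "steep f (- real m - 1) x"
        unfolding steep_def
      proof (intro allI impI)
        fix d' :: real assume "d' > 0"
        let ?y = "x - min d d' / 3" and ?z = "x + min d d' / 3"
        have "- f ?z - - f ?y \<le> real m * (?z - ?y)" using d \<open>d' > 0\<close> by (intro d(2)) (auto simp: min_def)
        moreover have "(- real m - 1) * (?z - ?y) < - (real m * (?z - ?y))"
          using d \<open>d' > 0\<close> by (simp add: algebra_simps)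
        ultimately have "(- real m - 1) * (?z - ?y) < f ?z - f ?y" by linarith
        moreover have "?y < x" "x < ?z" "?z - ?y < d'" using d \<open>d' > 0\<close> by (auto simp: min_def)
        ultimately show "\<exists>y z. y < x \<and> x < z \<and> z - y < d' \<and> (- real m - 1) * (z - y) < f z - f y"
          by blast
      qed
      then show ?thesis by (auto simp: S_def)
    qed
    define s where "s = Sup S"
    have cont: "isCont f x"
      using absolutely_continuous_path_imp_continuous_on [OF ac] x
      by (intro continuous_on_interior [of "{0..T}"]) auto
    have "(f has_derivative (\<lambda>h. s * h)) (at x)"
      unfolding has_derivative_at_alt
    proof (intro conjI allI impI)
      show "bounded_linear (\<lambda>h. s * h)" by (rule bounded_linear_mult_right)
      fix e :: real assume e: "e > 0"
      have "\<not> steep f (s + e) x"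
      proof
        assume "steep f (s + e) x"
        then have "s + e \<le> Sup S" using bdd by (intro cSup_upper) (auto simp: S_def)
        then show False using e by (simp add: s_def)
      qed
      then obtain d1 where d1: "d1 > 0" "\<And>y z. y < x \<Longrightarrow> x < z \<Longrightarrow> z - y < d1 \<Longrightarrow> f z - f y \<le> (s + e) * (z - y)"
        unfolding steep_def by (metis not_less)
      have "\<not> steep (\<lambda>t. - f t) (- (s - e)) x"
      proof
        assume st: "steep (\<lambda>t. - f t) (- (s - e)) x"
        have "s - e / 2 < Sup S" using e by (simp add: s_def)
        then obtain c where "c \<in> S" "s - e / 2 < c" using less_cSup_iff [OF ne bdd] by blast
        then have "steep f (s - e / 2) x" by (auto simp: S_def elim: steep_antimono)
        then show False using no [of "s - e" "s - e / 2"] st e by simp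
      qed
      then obtain d2 where d2: "d2 > 0" "\<And>y z. y < x \<Longrightarrow> x < z \<Longrightarrow> z - y < d2 \<Longrightarrow> - f z - - f y \<le> - (s - e) * (z - y)"
        unfolding steep_def by (metis not_less)
      have both: "\<bar>f z - f y - s * (z - y)\<bar> \<le> e * (z - y)" if "y < x" "x < z" "z - y < min d1 d2" for y z
        using d1(2) [of y z] d2(2) [of y z] that by (auto simp: abs_le_iff algebra_simps)
      have right: "\<bar>f z - f x - s * (z - x)\<bar> \<le> e * (z - x)" if z: "x < z" "z - x < min d1 d2" for z
      proof (rule tendsto_le [of "at_left x"])
        show "((\<lambda>y. e * (z - y)) \<longlongrightarrow> e * (z - x)) (at_left x)" by (intro tendsto_intros)
        have "(f \<longlongrightarrow> f x) (at_left x)" using cont by (simp add: isCont_def filterlim_at_split)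
        then show "((\<lambda>y. \<bar>f z - f y - s * (z - y)\<bar>) \<longlongrightarrow> \<bar>f z - f x - s * (z - x)\<bar>) (at_left x)"
          by (intro tendsto_intros)
        have "eventually (\<lambda>y. y \<in> {z - min d1 d2<..<x}) (at_left x)"
          using z by (intro eventually_at_left_real) linarith
        then show "eventually (\<lambda>y. \<bar>f z - f y - s * (z - y)\<bar> \<le> e * (z - y)) (at_left x)"
        proof eventually_elim
          case (elim y)
          then have "z - min d1 d2 < y" "y < x" by simp_all
          then show ?case by (intro both) (use z in linarith)+
        qed
      qed simp
      have left: "\<bar>f x - f y - s * (x - y)\<bar> \<le> e * (x - y)" if y: "y < x" "x - y < min d1 d2" for y
      proof (rule tendsto_le [of "at_right x"])
        show "((\<lambda>z. e * (z - y)) \<longlongrightarrow> e * (x - y)) (at_right x)" by (intro tendsto_intros)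
        have "(f \<longlongrightarrow> f x) (at_right x)" using cont by (simp add: isCont_def filterlim_at_split)
        then show "((\<lambda>z. \<bar>f z - f y - s * (z - y)\<bar>) \<longlongrightarrow> \<bar>f x - f y - s * (x - y)\<bar>) (at_right x)"
          by (intro tendsto_intros)
        have "eventually (\<lambda>z. z \<in> {x<..<y + min d1 d2}) (at_right x)"
          using y by (intro eventually_at_right_real) linarith
        then show "eventually (\<lambda>z. \<bar>f z - f y - s * (z - y)\<bar> \<le> e * (z - y)) (at_right x)"
        proof eventually_elim
          case (elim z)
          then have "z < y + min d1 d2" "x < z" by simp_all
          then show ?case by (intro both) (use y in linarith)+
        qed
      qed simp
      show "\<exists>d>0. \<forall>y. norm (y - x) < d \<longrightarrow> norm (f y - f x - s * (y - x)) \<le> e * norm (y - x)"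
      proof (intro exI [of _ "min d1 d2"] conjI allI impI)
        fix y assume y: "norm (y - x) < min d1 d2"
        consider "y = x" | "x < y" | "y < x" by linarith
        then show "norm (f y - f x - s * (y - x)) \<le> e * norm (y - x)"
        proof cases
          case 3
          have "\<bar>f y - f x - s * (y - x)\<bar> = \<bar>f x - f y - s * (x - y)\<bar>"
            by (simp add: abs_if algebra_simps)
          then show ?thesis using left [of y] y 3 by (simp add: abs_if)
        qed (use right [of y] y in \<open>auto simp: abs_if\<close>)
      qed (use d1 d2 in simp)
    qed
    then show ?thesis unfolding has_field_derivative_def by blast
  qed
  ultimately show ?thesis by blast
qed

section \<open>The metric speed of absolutely continuous curves\<close>

text \<open>
  The condition is stated for intervals that contain \<open>t\<close>, because these are the cells with tag
  \<open>t\<close> in a tagged division.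
\<close>

definition has_metric_speed :: "(real \<Rightarrow> 'a::metric_space) \<Rightarrow> real \<Rightarrow> real \<Rightarrow> bool"
  where "has_metric_speed \<omega> m t \<longleftrightarrow> (\<forall>e>0. \<exists>d>0. \<forall>y z. y \<le> t \<and> t \<le> z \<and> t - y < d \<and> z - t < d \<longrightarrow>
    \<bar>dist (\<omega> y) (\<omega> z) - m * (z - y)\<bar> \<le> e * (z - y))"

lemma has_vector_derivative_imp_metric_speed:
  assumes "(\<omega> has_vector_derivative v) (at t)"
  shows "has_metric_speed \<omega> (norm v) t"
  unfolding has_metric_speed_def
proof (intro allI impI)
  fix e :: real assume "e > 0"
  then obtain d where d: "d > 0" "\<And>y. norm (y - t) < d \<Longrightarrow> norm (\<omega> y - \<omega> t - (y - t) *\<^sub>R v) \<le> e * norm (y - t)"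
    using assms unfolding has_vector_derivative_def has_derivative_at_alt by blast
  have "\<bar>dist (\<omega> y) (\<omega> z) - norm v * (z - y)\<bar> \<le> e * (z - y)"
    if yz: "y \<le> t" "t \<le> z" "t - y < d" "z - t < d" for y z
  proof -
    have "norm (\<omega> z - \<omega> y - (z - y) *\<^sub>R v) = norm ((\<omega> z - \<omega> t - (z - t) *\<^sub>R v) - (\<omega> y - \<omega> t - (y - t) *\<^sub>R v))"
      by (simp add: algebra_simps)
    also have "\<dots> \<le> e * norm (z - t) + e * norm (y - t)"
      by (rule order_trans [OF norm_triangle_ineq4]) (use d(2) [of y] d(2) [of z] yz in \<open>intro add_mono; simp\<close>)
    also have "\<dots> = e * (z - y)" using yz by (simp add: algebra_simps)
    finally have *: "norm (\<omega> z - \<omega> y - (z - y) *\<^sub>R v) \<le> e * (z - y)" .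
    have "norm ((z - y) *\<^sub>R v) = norm v * (z - y)" using yz by simp
    then have "\<bar>dist (\<omega> y) (\<omega> z) - norm v * (z - y)\<bar> = \<bar>norm (\<omega> z - \<omega> y) - norm ((z - y) *\<^sub>R v)\<bar>"
      unfolding dist_norm norm_minus_commute [of "\<omega> y"] by (simp only:)
    also have "\<dots> \<le> e * (z - y)" using norm_triangle_ineq3 * by (rule order_trans)
    finally show ?thesis .
  qed
  then show "\<exists>d>0. \<forall>y z. y \<le> t \<and> t \<le> z \<and> t - y < d \<and> z - t < d \<longrightarrow>
      \<bar>dist (\<omega> y) (\<omega> z) - norm v * (z - y)\<bar> \<le> e * (z - y)"
    using d(1) by blast
qed

lemma absolutely_continuous_vector_derivative_AE:
  fixes \<omega> :: "real \<Rightarrow> 'a::euclidean_space"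
  assumes ac: "absolutely_continuous_path T \<omega>"
  shows "AE t in lebesgue. 0 < t \<and> t < T \<longrightarrow> (\<exists>v. (\<omega> has_vector_derivative v) (at t))"
proof -
  have "absolutely_continuous_path T (\<lambda>t. \<omega> t \<bullet> i)" if "i \<in> Basis" for i
    by (rule absolutely_continuous_path_dominated [OF ac, where L = 1])
      (use that in \<open>auto simp: dist_real_def dist_norm inner_diff_left [symmetric] intro: order_trans [OF Basis_le_norm]\<close>)
  then have "\<forall>i\<in>Basis. \<exists>N. negligible N \<and> (\<forall>x\<in>{0<..<T} - N. \<exists>D. ((\<lambda>t. \<omega> t \<bullet> i) has_real_derivative D) (at x))"
    using absolutely_continuous_derivative_AE by blast
  then obtain N where N: "\<And>i. i \<in> Basis \<Longrightarrow> negligible (N i)"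
    "\<And>i x. i \<in> Basis \<Longrightarrow> x \<in> {0<..<T} - N i \<Longrightarrow> \<exists>D. ((\<lambda>t. \<omega> t \<bullet> i) has_real_derivative D) (at x)"
    by metis
  have "negligible (\<Union>i\<in>Basis. N i)" using N(1) by (intro negligible_Union) auto
  then have null: "(\<Union>i\<in>Basis. N i) \<in> null_sets lebesgue" by (simp add: negligible_iff_null_sets)
  have "\<exists>v. (\<omega> has_vector_derivative v) (at t)" if t: "0 < t" "t < T" "t \<notin> (\<Union>i\<in>Basis. N i)" for t
  proof -
    have "\<forall>i\<in>Basis. \<exists>D. ((\<lambda>t. \<omega> t \<bullet> i) has_real_derivative D) (at t)" using N(2) t by auto
    then obtain D where D: "\<And>i. i \<in> Basis \<Longrightarrow> ((\<lambda>t. \<omega> t \<bullet> i) has_real_derivative D i) (at t)" by metis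
    define v where "v = (\<Sum>i\<in>Basis. D i *\<^sub>R i)"
    have "v \<bullet> i = D i" if "i \<in> Basis" for i
      using that by (simp add: v_def)
    then have "(\<omega> has_vector_derivative v) (at t)"
      unfolding has_vector_derivative_def
      by (subst has_derivative_componentwise_within) (use D in \<open>auto simp: has_field_derivative_def mult.commute [of _ "D _"]\<close>)
    then show ?thesis ..
  qed
  then show ?thesis by (intro AE_I' [OF null]) blast
qed

lemma metric_speed_AE_vec:
  fixes \<omega> :: "real \<Rightarrow> ('a::euclidean_space, 'n::finite) vec"
  assumes "absolutely_continuous_path T \<omega>"
  shows "AE t in lebesgue. 0 < t \<and> t < T \<longrightarrow> has_metric_speed \<omega> (speed \<omega> t {0..T}) t"
proof -
  from absolutely_continuous_vector_derivative_AE [OF assms]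
  show "AE t in lebesgue. 0 < t \<and> t < T \<longrightarrow> has_metric_speed \<omega> (speed \<omega> t {0..T}) t"
  proof eventually_elim
    case (elim t)
    show ?case
    proof
      assume t: "0 < t \<and> t < T"
      then obtain v where v: "(\<omega> has_vector_derivative v) (at t)" using elim by blast
      then have "vector_derivative \<omega> (at t within {0..T}) = v"
        using t by (intro vector_derivative_at_within_ivl) auto
      then show "has_metric_speed \<omega> (speed \<omega> t {0..T}) t"
        using has_vector_derivative_imp_metric_speed [OF v] by (simp add: speed_vec_def)
    qed
  qed
qed

text \<open>
  Other representatives differ by a nonzero integer in some coordinate, which moves that
  coordinate of the difference to an absolute value of at least \<open>1/2\<close>.
\<close>

lemma dist_to_torus_eq:
  assumes "norm (x - y) \<le> 1/2"
  shows "dist (to_torus x) (to_torus y) = dist x y"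
proof (rule antisym [OF dist_to_torus_le])
  show "dist x y \<le> dist (to_torus x) (to_torus y)"
    unfolding dist_torus_def
  proof (rule le_setdistI)
    fix u v assume "u \<in> {x'. to_torus x' = to_torus x}" "v \<in> {y'. to_torus y' = to_torus y}"
    then have int: "u $ i - x $ i \<in> \<int>" "v $ i - y $ i \<in> \<int>" for i by (auto simp: to_torus_eq_iff)
    show "dist x y \<le> dist u v"
    proof (cases "u - v = x - y")
      case True
      then show ?thesis by (simp add: dist_norm)
    next
      case False
      then obtain i where i: "u $ i - v $ i \<noteq> x $ i - y $ i" by (metis vec_eq_iff vector_minus_component)
      let ?k = "(u $ i - v $ i) - (x $ i - y $ i)"
      have "?k \<in> \<int>" using Ints_diff [OF int(1) [of i] int(2) [of i]] by (simp add: algebra_simps)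
      then have "1 \<le> \<bar>?k\<bar>" using i by (intro Ints_nonzero_abs_ge1) simp_all
      moreover have "\<bar>x $ i - y $ i\<bar> \<le> 1/2" using component_le_norm_cart [of "x - y" i] assms by simp
      moreover have "\<bar>u $ i - v $ i\<bar> \<le> norm (u - v)" using component_le_norm_cart [of "u - v" i] by simp
      ultimately have "norm (x - y) \<le> norm (u - v)" using assms by linarith
      then show ?thesis by (simp add: dist_norm)
    qed
  qed auto
qed

lemma to_torus_near_lift:
  assumes "dist (to_torus x) p < r"
  obtains y where "to_torus y = p" "dist x y < r"
proof -
  obtain q where q: "to_torus q = p" using to_torus_surj by blast
  have "\<exists>u v. to_torus u = to_torus x \<and> to_torus v = p \<and> dist u v < r"
  proof (rule ccontr)
    assume "\<not> ?thesis"
    then have "r \<le> setdist {u. to_torus u = to_torus x} {v. to_torus v = p}"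
      using q by (intro le_setdistI) (auto simp: not_less)
    then show False using assms by (simp add: dist_torus_def)
  qed
  then obtain u v where uv: "to_torus u = to_torus x" "to_torus v = p" "dist u v < r" by blast
  have "to_torus (v + (x - u)) = p" using to_torus_translate [OF uv(1)] uv(2) by simp
  moreover have "dist x (v + (x - u)) < r" using uv(3) by (simp add: dist_norm)
  ultimately show ?thesis using that by blast
qed

lemma torus_velocity_unique:
  fixes \<omega> :: "real \<Rightarrow> 'n::finite torus"
  assumes "torus_has_velocity \<omega> v t {0..T}" "torus_has_velocity \<omega> v' t {0..T}" "0 < t" "t < T"
  shows "v = v'"
proof -
  have at: "at t within {0..T} = at t" using assms by (simp add: at_within_Icc_at)
  obtain w where w: "to_torus (w t) = \<omega> t" "\<forall>\<^sub>F s in at t. to_torus (w s) = \<omega> s" "(w has_vector_derivative v) (at t)"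
    using assms(1) unfolding torus_has_velocity_def at by blast
  obtain w' where w': "to_torus (w' t) = \<omega> t" "\<forall>\<^sub>F s in at t. to_torus (w' s) = \<omega> s" "(w' has_vector_derivative v') (at t)"
    using assms(2) unfolding torus_has_velocity_def at by blast
  let ?u = "\<lambda>s. w s - w' s"
  have u: "(?u has_vector_derivative v - v') (at t)"
    using w(3) w'(3) by (rule has_vector_derivative_diff)
  then have "isCont ?u t" by (rule has_vector_derivative_continuous)
  then have "\<forall>\<^sub>F s in at t. dist (?u s) (?u t) < 1"
    by (simp add: isCont_def tendsto_iff)
  with w(2) w'(2) have "\<forall>\<^sub>F s in at t. ?u s = ?u t"
  proof eventually_elim
    case (elim s)
    show ?case
    proof (rule ccontr)
      assume "?u s \<noteq> ?u t"
      then obtain i where i: "?u s $ i \<noteq> ?u t $ i" by (metis vec_eq_iff)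
      have "?u s $ i \<in> \<int>" "?u t $ i \<in> \<int>"
        using elim w(1) w'(1) by (metis to_torus_eq_iff vector_minus_component)+
      then have "1 \<le> \<bar>?u s $ i - ?u t $ i\<bar>" using i Ints_nonzero_abs_ge1 [of "?u s $ i - ?u t $ i"] by auto
      also have "\<dots> \<le> dist (?u s) (?u t)"
        using component_le_norm_cart [of "?u s - ?u t" i] by (simp only: dist_norm vector_minus_component)
      finally show False using elim by simp
    qed
  qed
  then have "\<forall>\<^sub>F s in at t. ?u t = ?u s" by eventually_elim simp
  then have "(?u has_vector_derivative 0) (at t)"
    unfolding has_vector_derivative_def scaleR_zero_right
    by (rule has_derivative_transform_eventually [OF has_derivative_const]) auto
  then have "v - v' = 0" using u by (rule vector_derivative_unique_at [rotated])
  then show ?thesis by simp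
qed

lemma absolutely_continuous_path_clamp:
  assumes ac: "absolutely_continuous_path T \<omega>" and ab: "0 \<le> a" "a \<le> b" "b \<le> T"
  shows "absolutely_continuous_path T (\<lambda>t. \<omega> (max a (min b t)))"
  unfolding absolutely_continuous_path_def
proof (intro allI impI)
  fix \<epsilon> :: real assume "\<epsilon> > 0"
  from ac [unfolded absolutely_continuous_path_def, THEN spec, THEN mp, OF this]
  obtain \<delta> where \<delta>: "\<delta> > 0" and H: "\<forall>(n::nat) a b. (\<forall>i<n. 0 \<le> a i \<and> a i \<le> b i \<and> b i \<le> T) \<and>
      (\<forall>i<n. \<forall>j<n. i \<noteq> j \<longrightarrow> {a i<..<b i} \<inter> {a j<..<b j} = {}) \<and>
      (\<Sum>i<n. b i - a i) < \<delta> \<longrightarrow> (\<Sum>i<n. dist (\<omega> (a i)) (\<omega> (b i))) < \<epsilon>"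
    by (elim exE conjE)
  let ?c = "\<lambda>t. max a (min b t)"
  show "\<exists>\<delta>>0. \<forall>(n::nat) x y. (\<forall>i<n. 0 \<le> x i \<and> x i \<le> y i \<and> y i \<le> T) \<and>
      (\<forall>i<n. \<forall>j<n. i \<noteq> j \<longrightarrow> {x i<..<y i} \<inter> {x j<..<y j} = {}) \<and>
      (\<Sum>i<n. y i - x i) < \<delta> \<longrightarrow> (\<Sum>i<n. dist (\<omega> (?c (x i))) (\<omega> (?c (y i)))) < \<epsilon>"
  proof (intro exI [of _ \<delta>] conjI \<delta> allI impI; (elim conjE)?)
    fix n :: nat and x y :: "nat \<Rightarrow> real"
    assume xy: "\<forall>i<n. 0 \<le> x i \<and> x i \<le> y i \<and> y i \<le> T"
      and dj: "\<forall>i<n. \<forall>j<n. i \<noteq> j \<longrightarrow> {x i<..<y i} \<inter> {x j<..<y j} = {}"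
      and small: "(\<Sum>i<n. y i - x i) < \<delta>"
    have sub: "{?c s<..<?c t} \<subseteq> {s<..<t}" for s t by (auto simp: max_def min_def split: if_splits)
    show "(\<Sum>i<n. dist (\<omega> (?c (x i))) (\<omega> (?c (y i)))) < \<epsilon>"
    proof (rule H [THEN spec [of _ n], THEN spec [of _ "\<lambda>i. ?c (x i)"], THEN spec [of _ "\<lambda>i. ?c (y i)"], THEN mp], intro conjI allI impI)
      fix i j assume "i < n" "j < n" "i \<noteq> j"
      then have "{x i<..<y i} \<inter> {x j<..<y j} = {}" using dj by blast
      then show "{?c (x i)<..<?c (y i)} \<inter> {?c (x j)<..<?c (y j)} = {}" using sub by blast
    next
      have "(\<Sum>i<n. ?c (y i) - ?c (x i)) \<le> (\<Sum>i<n. y i - x i)"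
        by (rule sum_mono) (use xy in \<open>auto simp: max_def min_def\<close>)
      then show "(\<Sum>i<n. ?c (y i) - ?c (x i)) < \<delta>" using small by simp
    next
      fix i assume "i < n"
      then have "x i \<le> y i" using xy by blast
      then show "0 \<le> ?c (x i)" "?c (x i) \<le> ?c (y i)" "?c (y i) \<le> T" using ab by auto
    qed
  qed
qed

text \<open>
  Near any time the curve stays in a ball that the covering maps isometrically, so it has a local lift
  that is as absolutely continuous as the curve itself.
\<close>

lemma torus_local_metric_speed:
  fixes \<omega> :: "real \<Rightarrow> 'n::finite torus"
  assumes ac: "absolutely_continuous_path T \<omega>" and ab: "0 \<le> a" "a \<le> b" "b \<le> T"
    and close: "\<And>t. a \<le> t \<Longrightarrow> t \<le> b \<Longrightarrow> dist (\<omega> a) (\<omega> t) < 1/4"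
  shows "AE t in lebesgue. a < t \<and> t < b \<longrightarrow> has_metric_speed \<omega> (speed \<omega> t {0..T}) t"
proof -
  let ?c = "\<lambda>t. max a (min b t)"
  obtain x where x: "to_torus x = \<omega> a" using to_torus_surj by blast
  have "\<exists>y. to_torus y = \<omega> (?c t) \<and> dist x y < 1/4" for t
    using to_torus_near_lift [of x "\<omega> (?c t)" "1/4"] close [of "?c t"] x ab by auto
  then obtain w where w: "\<And>t. to_torus (w t) = \<omega> (?c t)" "\<And>t. dist x (w t) < 1/4" by metis
  have iso: "dist (w s) (w t) = dist (\<omega> (?c s)) (\<omega> (?c t))" for s t
  proof -
    have "dist (w s) (w t) \<le> dist x (w s) + dist x (w t)" by (rule dist_triangle3)
    then have "norm (w s - w t) \<le> 1/2" using w(2) [of s] w(2) [of t] by (simp add: dist_norm)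
    then show ?thesis using dist_to_torus_eq w(1) by metis
  qed
  have "absolutely_continuous_path T w"
    by (rule absolutely_continuous_path_dominated [OF absolutely_continuous_path_clamp [OF ac ab], where L = 1])
      (simp_all add: iso)
  from absolutely_continuous_vector_derivative_AE [OF this] show ?thesis
  proof eventually_elim
    case (elim t)
    show ?case
    proof
      assume t: "a < t \<and> t < b"
      then obtain v where v: "(w has_vector_derivative v) (at t)" using elim ab by auto
      have at: "at t within {0..T} = at t" using t ab by (simp add: at_within_Icc_at)
      have c: "?c s = s" if "a \<le> s" "s \<le> b" for s using that by simp
      have "\<forall>\<^sub>F s in at t. s \<in> {a<..<b}" using t by (intro eventually_at_in_open') auto
      then have "\<forall>\<^sub>F s in at t. to_torus (w s) = \<omega> s"
        by eventually_elim (simp add: w(1))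
      then have vel: "torus_has_velocity \<omega> v t {0..T}"
        unfolding torus_has_velocity_def at using v t w(1) [of t] by (intro exI [of _ w]) simp
      have "(SOME v. torus_has_velocity \<omega> v t {0..T}) = v"
        by (rule some_equality [where P = "\<lambda>v. torus_has_velocity \<omega> v t {0..T}", OF vel])
          (use torus_velocity_unique [OF _ vel] t ab in auto)
      then have sp: "speed \<omega> t {0..T} = norm v" by (simp add: speed_torus_def)
      show "has_metric_speed \<omega> (speed \<omega> t {0..T}) t"
        unfolding has_metric_speed_def sp
      proof (intro allI impI)
        fix e :: real assume "e > 0"
        then obtain d where d: "d > 0" "\<forall>y z. y \<le> t \<and> t \<le> z \<and> t - y < d \<and> z - t < d \<longrightarrow>
            \<bar>dist (w y) (w z) - norm v * (z - y)\<bar> \<le> e * (z - y)"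
          using has_vector_derivative_imp_metric_speed [OF v] unfolding has_metric_speed_def by blast
        let ?d = "min d (min (t - a) (b - t))"
        have "\<bar>dist (\<omega> y) (\<omega> z) - norm v * (z - y)\<bar> \<le> e * (z - y)"
          if yz: "y \<le> t" "t \<le> z" "t - y < ?d" "z - t < ?d" for y z
        proof -
          have "?c y = y" "?c z = z" using yz by auto
          then have "dist (\<omega> y) (\<omega> z) = dist (w y) (w z)" by (simp only: iso)
          then show ?thesis using d(2) yz by simp
        qed
        then show "\<exists>d>0. \<forall>y z. y \<le> t \<and> t \<le> z \<and> t - y < d \<and> z - t < d \<longrightarrow>
            \<bar>dist (\<omega> y) (\<omega> z) - norm v * (z - y)\<bar> \<le> e * (z - y)"
          using d(1) t by (intro exI [of _ ?d]) auto
      qed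
    qed
  qed
qed

lemma compact_UNIV_second_countable:
  assumes "compact (UNIV :: 'a::metric_space set)"
  shows "\<exists>B::'a set set. countable B \<and> open = generate_topology B"
proof -
  have "\<exists>K. finite K \<and> (UNIV :: 'a set) \<subseteq> (\<Union>x\<in>K. ball x (inverse (Suc n)))" for n
    using assms unfolding compact_eq_totally_bounded by simp
  then obtain K where K: "\<And>n. finite (K n)" "\<And>n. (UNIV :: 'a set) \<subseteq> (\<Union>x\<in>K n. ball x (inverse (Suc n)))"
    by metis
  define B where "B = (\<Union>n. (\<lambda>x. ball x (inverse (real (Suc n)))) ` K n)"
  have "countable B" unfolding B_def by (intro countable_UN countable_image countable_finite [OF K(1)]) simp
  moreover have "open = generate_topology B"
  proof
    fix U :: "'a set"
    show "open U = generate_topology B U"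
    proof
      assume U: "open U"
      have "\<exists>b\<in>B. x \<in> b \<and> b \<subseteq> U" if x: "x \<in> U" for x
      proof -
        obtain e where e: "e > 0" "ball x e \<subseteq> U" using U x by (meson openE)
        obtain n where n: "inverse (real (Suc n)) < e / 2" using reals_Archimedean [of "e / 2"] e by auto
        have "x \<in> (\<Union>x\<in>K n. ball x (inverse (Suc n)))" using K(2) [of n] by blast
        then obtain k where k: "k \<in> K n" "dist k x < inverse (Suc n)" by auto
        have "ball k (inverse (Suc n)) \<subseteq> ball x e"
        proof
          fix y assume "y \<in> ball k (inverse (Suc n))"
          then show "y \<in> ball x e" using dist_triangle [of x y k] k(2) n by (simp add: dist_commute)
        qed
        then show ?thesis using k e by (intro bexI [of _ "ball k (inverse (real (Suc n)))"]) (auto simp: B_def)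
      qed
      then have "U = \<Union>{b\<in>B. b \<subseteq> U}" by blast
      moreover have "generate_topology B (\<Union>{b\<in>B. b \<subseteq> U})"
        by (rule generate_topology.UN) (auto intro: generate_topology.Basis)
      ultimately show "generate_topology B U" by simp
    next
      assume "generate_topology B U"
      then show "open U" by induction (auto simp: B_def)
    qed
  qed
  ultimately show ?thesis by blast
qed

instance torus :: (finite) second_countable_topology
  by standard (rule compact_UNIV_second_countable [OF compact_torus])

lemma metric_speed_AE_torus:
  fixes \<omega> :: "real \<Rightarrow> 'n::finite torus"
  assumes ac: "absolutely_continuous_path T \<omega>"
  shows "AE t in lebesgue. 0 < t \<and> t < T \<longrightarrow> has_metric_speed \<omega> (speed \<omega> t {0..T}) t"
proof -
  have "uniformly_continuous_on {0..T} \<omega>"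
    using absolutely_continuous_path_imp_continuous_on [OF ac] by (rule compact_uniformly_continuous) simp
  then obtain h where h: "h > 0" "\<And>s t. s \<in> {0..T} \<Longrightarrow> t \<in> {0..T} \<Longrightarrow> dist s t < h \<Longrightarrow> dist (\<omega> s) (\<omega> t) < 1/4"
    unfolding uniformly_continuous_on_def by (metis zero_less_divide_1_iff zero_less_numeral dist_commute)
  define g where "g k = real k * (h / 2)" for k :: nat
  have "AE t in lebesgue. \<forall>k. g k < t \<and> t < min T (g (Suc k)) \<longrightarrow> has_metric_speed \<omega> (speed \<omega> t {0..T}) t"
  proof (rule AE_all_countable [THEN iffD2], rule allI)
    fix k
    show "AE t in lebesgue. g k < t \<and> t < min T (g (Suc k)) \<longrightarrow> has_metric_speed \<omega> (speed \<omega> t {0..T}) t"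
    proof (cases "g k \<le> T")
      case True
      have g: "0 \<le> g k" "g (Suc k) = g k + h / 2" using h(1) by (auto simp: g_def field_simps)
      show ?thesis
      proof (rule torus_local_metric_speed [OF ac])
        show "0 \<le> g k" "g k \<le> min T (g (Suc k))" "min T (g (Suc k)) \<le> T" using True g h(1) by auto
        fix t assume "g k \<le> t" "t \<le> min T (g (Suc k))"
        then show "dist (\<omega> (g k)) (\<omega> t) < 1/4" using True g h(1) by (intro h(2)) (auto simp: dist_real_def)
      qed
    qed auto
  qed
  moreover have "AE t in lebesgue. t \<notin> range g"
    by (rule AE_I' [of "range g", OF null_sets_completionI [OF countable_imp_null_set_lborel]]) auto
  ultimately show "AE t in lebesgue. 0 < t \<and> t < T \<longrightarrow> has_metric_speed \<omega> (speed \<omega> t {0..T}) t"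
  proof eventually_elim
    case (elim t)
    show ?case
    proof
      assume t: "0 < t \<and> t < T"
      define k where "k = nat \<lfloor>t / (h / 2)\<rfloor>"
      have "real k = of_int \<lfloor>t / (h / 2)\<rfloor>" using t h(1) by (simp add: k_def)
      then have "real k \<le> t / (h / 2)" "t / (h / 2) < real k + 1" by linarith+
      then have "g k \<le> t" "t < g (Suc k)" using h(1) by (auto simp: g_def field_simps)
      moreover have "g k \<noteq> t" using elim(2) by blast
      ultimately show "has_metric_speed \<omega> (speed \<omega> t {0..T}) t" using elim(1) t by fastforce
    qed
  qed
qed

section \<open>The action as a supremum of dyadic energies\<close>

text \<open>
  In a fine tagged division of the interval, the cells whose tags admit a metric speed contribute a
  Riemann sum. The other tags form a null set; their cells lie in an open set of small measure, so
  that absolute continuity bounds the sum of the increments over them.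
\<close>

lemma dist_le_integral_metric_speed:
  fixes \<omega> :: "real \<Rightarrow> 'a::metric_space"
  assumes ac: "absolutely_continuous_path T \<omega>"
    and sp: "AE t in lebesgue. 0 < t \<and> t < T \<longrightarrow> has_metric_speed \<omega> (m t) t"
    and st: "0 \<le> s" "s \<le> t" "t \<le> T" and int: "m integrable_on {s..t}"
  shows "dist (\<omega> s) (\<omega> t) \<le> integral {s..t} m"
proof (rule field_le_epsilon)
  fix e0 :: real assume e0: "e0 > 0"
  define e where "e = e0 / (2 + (t - s))"
  have e: "e > 0" "e * (2 + (t - s)) = e0" using e0 st by (auto simp: e_def)
  obtain N0 where N0: "{x. \<not> (0 < x \<and> x < T \<longrightarrow> has_metric_speed \<omega> (m x) x)} \<subseteq> N0" "N0 \<in> null_sets lebesgue"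
    using sp by (auto simp: eventually_ae_filter)
  define N where "N = N0 \<union> {s, t}"
  have N_null: "N \<in> null_sets lebesgue"
    unfolding N_def using N0(2) by (intro null_sets.Un) (auto simp: negligible_iff_null_sets [symmetric])
  define m0 where "m0 x = (if x \<in> N then 0 else m x)" for x
  have "(m0 has_integral integral {s..t} m) {s..t}"
    using N_null by (intro has_integral_spike [OF _ _ integrable_integral [OF int]])
      (auto simp: m0_def negligible_iff_null_sets)
  then obtain \<gamma>1 where g1: "gauge \<gamma>1" "\<And>p. p tagged_division_of {s..t} \<Longrightarrow> \<gamma>1 fine p \<Longrightarrow>
      norm ((\<Sum>(x, k)\<in>p. measure lborel k *\<^sub>R m0 x) - integral {s..t} m) < e"
    using e(1) unfolding has_integral_real by metis
  obtain \<delta> where \<delta>1: "\<delta> > 0" and \<delta>2: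
    "\<forall>(I::(real \<times> real set) set) a b. finite I \<longrightarrow> (\<forall>i. i \<in> I \<longrightarrow> 0 \<le> a i \<and> a i \<le> b i \<and> b i \<le> T) \<longrightarrow>
      (\<forall>i j. i \<in> I \<longrightarrow> j \<in> I \<longrightarrow> i \<noteq> j \<longrightarrow> {a i<..<b i} \<inter> {a j<..<b j} = {}) \<longrightarrow>
      (\<Sum>i\<in>I. b i - a i) < \<delta> \<longrightarrow> (\<Sum>i\<in>I. dist (\<omega> (a i)) (\<omega> (b i))) < e"
    by (rule absolutely_continuous_path_family [OF ac e(1)])
  have NL: "N \<in> sets lebesgue" using N_null by auto
  obtain G where G: "open G" "N \<subseteq> G" "emeasure lebesgue (G - N) < ennreal \<delta>"
    by (rule sets_lebesgue_outer_open [OF NL \<delta>1]) (rule that)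
  have GL: "G - N \<in> sets lebesgue" using G(1) NL by auto
  have "emeasure lebesgue ((G - N) \<union> N) = emeasure lebesgue (G - N)"
    by (rule emeasure_Un_null_set [OF GL N_null])
  moreover have "(G - N) \<union> N = G" using G(2) by blast
  ultimately have G\<delta>: "emeasure lborel G < ennreal \<delta>" using G(1,3) by simp
  have "\<exists>d>0. \<forall>y z. y \<le> x \<and> x \<le> z \<and> x - y < d \<and> z - x < d \<longrightarrow> \<bar>dist (\<omega> y) (\<omega> z) - m x * (z - y)\<bar> \<le> e * (z - y)"
    if "x \<in> {s..t} - N" for x
  proof -
    have "0 < x \<and> x < T" "x \<notin> N0" using that st by (auto simp: N_def less_le)
    then have "has_metric_speed \<omega> (m x) x" using N0(1) by blast
    then show ?thesis using e(1) unfolding has_metric_speed_def by blast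
  qed
  then obtain d where d: "\<And>x. x \<in> {s..t} - N \<Longrightarrow> d x > 0"
    "\<And>x y z. x \<in> {s..t} - N \<Longrightarrow> y \<le> x \<and> x \<le> z \<and> x - y < d x \<and> z - x < d x \<Longrightarrow> \<bar>dist (\<omega> y) (\<omega> z) - m x * (z - y)\<bar> \<le> e * (z - y)"
    by metis
  define \<gamma>2 where "\<gamma>2 x = (if x \<in> N then G else if x \<in> {s..t} then ball x (d x) else UNIV)" for x
  have "gauge \<gamma>2" unfolding gauge_def \<gamma>2_def using G d(1) by auto
  then have "gauge (\<lambda>x. \<gamma>1 x \<inter> \<gamma>2 x)" using g1(1) by (simp add: gauge_Int)
  then obtain p where p: "p tagged_division_of {s..t}" "(\<lambda>x. \<gamma>1 x \<inter> \<gamma>2 x) fine p"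
    by (rule fine_division_exists_real)
  then have fine: "\<gamma>1 fine p" "\<gamma>2 fine p" by (auto simp: fine_Int)
  note pD = tagged_division_ofD [OF p(1)]
  have cell: "\<exists>u w. k = {u..w} \<and> u \<le> w \<and> s \<le> u \<and> u \<le> x \<and> x \<le> w \<and> w \<le> t" if xk: "(x, k) \<in> p" for x k
  proof -
    obtain u w where k: "k = cbox u w" using pD(4) [OF xk] by blast
    with pD(2,3) [OF xk] show ?thesis by (intro exI [of _ u] exI [of _ w]) auto
  qed
  let ?\<Delta> = "\<lambda>i::real \<times> real set. dist (\<omega> (Inf (snd i))) (\<omega> (Sup (snd i)))"
  let ?pN = "{i\<in>p. fst i \<in> N}"
  have pN: "(\<Sum>i\<in>?pN. ?\<Delta> i) < e"
  proof (rule \<delta>2 [rule_format])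
    show "finite ?pN" using pD(1) by simp
    show "0 \<le> Inf (snd i) \<and> Inf (snd i) \<le> Sup (snd i) \<and> Sup (snd i) \<le> T" if "i \<in> ?pN" for i
      using cell [of "fst i" "snd i"] that st by auto
    show disj: "{Inf (snd i)<..<Sup (snd i)} \<inter> {Inf (snd j)<..<Sup (snd j)} = {}" if ij: "i \<in> ?pN" "j \<in> ?pN" "i \<noteq> j" for i j
    proof -
      obtain u w u' w' where "snd i = {u..w}" "u \<le> w" "snd j = {u'..w'}" "u' \<le> w'"
        using cell [of "fst i" "snd i"] cell [of "fst j" "snd j"] ij by auto
      moreover have "interior (snd i) \<inter> interior (snd j) = {}"
        using pD(5) [of "fst i" "snd i" "fst j" "snd j"] ij by auto
      ultimately show ?thesis by simp
    qed
    have "(\<Sum>i\<in>?pN. ennreal (Sup (snd i) - Inf (snd i))) = (\<Sum>i\<in>?pN. emeasure lborel {Inf (snd i)<..<Sup (snd i)})"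
    proof (rule sum.cong [OF refl])
      fix i assume "i \<in> ?pN"
      then have "Inf (snd i) \<le> Sup (snd i)" using cell [of "fst i" "snd i"] by auto
      then show "ennreal (Sup (snd i) - Inf (snd i)) = emeasure lborel {Inf (snd i)<..<Sup (snd i)}" by simp
    qed
    also have "\<dots> = emeasure lborel (\<Union>i\<in>?pN. {Inf (snd i)<..<Sup (snd i)})"
      by (rule sum_emeasure) (use pD(1) disj in \<open>auto simp: disjoint_family_on_def simp del: greaterThanLessThan_iff\<close>)
    also have "\<dots> \<le> emeasure lborel G"
    proof (rule emeasure_mono)
      show "(\<Union>i\<in>?pN. {Inf (snd i)<..<Sup (snd i)}) \<subseteq> G"
      proof (rule UN_least)
        fix i assume i: "i \<in> ?pN"
        then have "snd i \<subseteq> \<gamma>2 (fst i)" using fineD [OF fine(2), of "fst i" "snd i"] by simp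
        then have "snd i \<subseteq> G" using i by (simp add: \<gamma>2_def)
        moreover have "(fst i, snd i) \<in> p" using i by simp
        from cell [OF this] obtain u w where "snd i = {u..w}" "u \<le> w" by blast
        then have "{Inf (snd i)<..<Sup (snd i)} \<subseteq> snd i"
          by (simp only: cInf_atLeastAtMost cSup_atLeastAtMost greaterThanLessThan_subseteq_atLeastAtMost_iff) simp
        ultimately show "{Inf (snd i)<..<Sup (snd i)} \<subseteq> G" by blast
      qed
      show "G \<in> sets lborel" using G(1) by simp
    qed
    finally have "(\<Sum>i\<in>?pN. ennreal (Sup (snd i) - Inf (snd i))) < ennreal \<delta>" using G\<delta> by (rule order_le_less_trans)
    moreover have "(\<Sum>i\<in>?pN. ennreal (Sup (snd i) - Inf (snd i))) = ennreal (\<Sum>i\<in>?pN. Sup (snd i) - Inf (snd i))"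
    proof (rule sum_ennreal)
      fix i assume "i \<in> ?pN"
      then show "0 \<le> Sup (snd i) - Inf (snd i)" using cell [of "fst i" "snd i"] by auto
    qed
    ultimately have "ennreal (\<Sum>i\<in>?pN. Sup (snd i) - Inf (snd i)) < ennreal \<delta>" by simp
    then show "(\<Sum>i\<in>?pN. Sup (snd i) - Inf (snd i)) < \<delta>" by (meson ennreal_leI leD not_le_imp_less)
  qed
  have rest: "?\<Delta> i \<le> measure lborel (snd i) *\<^sub>R m0 (fst i) + e * measure lborel (snd i)" if i: "i \<in> p - ?pN" for i
  proof -
    obtain x k where xk: "i = (x, k)" by (cases i)
    have "(x, k) \<in> p" "x \<notin> N" using i xk by auto
    then obtain u w where k: "k = {u..w}" "u \<le> w" "s \<le> u" "u \<le> x" "x \<le> w" "w \<le> t"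
      using cell [OF \<open>(x, k) \<in> p\<close>] by blast
    have x: "x \<in> {s..t} - N" using k \<open>x \<notin> N\<close> by auto
    have "k \<subseteq> \<gamma>2 x" using fineD [OF fine(2) \<open>(x, k) \<in> p\<close>] .
    then have "k \<subseteq> ball x (d x)" using x by (simp add: \<gamma>2_def)
    moreover have "u \<in> k" "w \<in> k" using k by auto
    ultimately have "u \<in> ball x (d x)" "w \<in> ball x (d x)" by blast+
    then have "x - u < d x" "w - x < d x" by (auto simp: dist_real_def)
    then have "\<bar>dist (\<omega> u) (\<omega> w) - m x * (w - u)\<bar> \<le> e * (w - u)" using d(2) [OF x] k by blast
    then show ?thesis using k x by (simp add: xk m0_def mult.commute)
  qed
  have "dist (\<omega> s) (\<omega> t) = (\<Sum>(x, k)\<in>p. dist (\<omega> s) (\<omega> (Sup k)) - dist (\<omega> s) (\<omega> (Inf k)))"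
    using additive_tagged_division_1 [OF st(2) p(1), of "\<lambda>y. dist (\<omega> s) (\<omega> y)"] by simp
  also have "\<dots> \<le> (\<Sum>i\<in>p. ?\<Delta> i)"
  proof (rule sum_mono)
    fix i assume "i \<in> p"
    show "(case i of (x, k) \<Rightarrow> dist (\<omega> s) (\<omega> (Sup k)) - dist (\<omega> s) (\<omega> (Inf k))) \<le> ?\<Delta> i"
      using dist_triangle [of "\<omega> s" "\<omega> (Sup (snd i))" "\<omega> (Inf (snd i))"] by (simp add: case_prod_unfold)
  qed
  also have "\<dots> = (\<Sum>i\<in>p - ?pN. ?\<Delta> i) + (\<Sum>i\<in>?pN. ?\<Delta> i)"
    by (rule sum.subset_diff [OF _ pD(1)]) auto
  also have "\<dots> \<le> (\<Sum>i\<in>p - ?pN. measure lborel (snd i) *\<^sub>R m0 (fst i) + e * measure lborel (snd i)) + e"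
    using pN by (intro add_mono sum_mono rest) auto
  also have "\<dots> \<le> (\<Sum>i\<in>p. measure lborel (snd i) *\<^sub>R m0 (fst i) + e * measure lborel (snd i)) + e"
    using e(1) by (intro add_right_mono sum_mono2 pD(1)) (auto simp: m0_def)
  also have "\<dots> = (\<Sum>(x, k)\<in>p. measure lborel k *\<^sub>R m0 x) + e * (\<Sum>(x, k)\<in>p. measure lborel k) + e"
    by (simp add: sum.distrib sum_distrib_left case_prod_unfold)
  also have "(\<Sum>(x, k)\<in>p. measure lborel k) = t - s"
    using additive_content_tagged_division [of p s t] p(1) st by simp
  also have "(\<Sum>(x, k)\<in>p. measure lborel k *\<^sub>R m0 x) + e * (t - s) + e \<le> (integral {s..t} m + e) + e * (t - s) + e"
    using g1(2) [OF p(1) fine(1)] by simp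
  also have "\<dots> = integral {s..t} m + e0" using e(2) by (simp add: algebra_simps)
  finally show "dist (\<omega> s) (\<omega> t) \<le> integral {s..t} m + e0" .
qed

text \<open>
  This is the action of the polygon through the grid points: each of the \<open>2 ^ n\<close> pieces takes the
  time \<open>T / 2 ^ n\<close>, and all powers of \<open>T\<close> cancel.
\<close>

definition dyadic_energy :: "real \<Rightarrow> (real \<Rightarrow> 'a::metric_space) \<Rightarrow> nat \<Rightarrow> real"
  where "dyadic_energy T \<omega> n =
    2 ^ n / 2 * (\<Sum>i<2 ^ n. (dist (\<omega> (T * real i / 2 ^ n)) (\<omega> (T * real (Suc i) / 2 ^ n)))\<^sup>2)"

lemma dyadic_energy_nonneg: "0 \<le> dyadic_energy T \<omega> n"
  by (simp add: dyadic_energy_def sum_nonneg)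

lemma dyadic_energy_mono_step: "dyadic_energy T \<omega> n \<le> dyadic_energy T \<omega> (Suc n)"
proof -
  have split: "(\<Sum>i<2 * N. g i) = (\<Sum>i<N. g (2 * i) + g (Suc (2 * i)))" for N and g :: "nat \<Rightarrow> real"
    by (induction N) auto
  let ?D = "\<lambda>n i. (dist (\<omega> (T * real i / 2 ^ n)) (\<omega> (T * real (Suc i) / 2 ^ n)))\<^sup>2"
  have half: "?D n i \<le> 2 * (?D (Suc n) (2 * i) + ?D (Suc n) (Suc (2 * i)))" for i
  proof -
    have eq: "T * real i / 2 ^ n = T * real (2 * i) / 2 ^ Suc n" "T * real (Suc i) / 2 ^ n = T * real (Suc (Suc (2 * i))) / 2 ^ Suc n"
      by (simp_all add: field_simps)
    let ?x = "\<omega> (T * real (2 * i) / 2 ^ Suc n)" and ?y = "\<omega> (T * real (Suc (2 * i)) / 2 ^ Suc n)"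
      and ?z = "\<omega> (T * real (Suc (Suc (2 * i))) / 2 ^ Suc n)"
    have "(dist ?x ?z)\<^sup>2 \<le> (dist ?x ?y + dist ?y ?z)\<^sup>2"
      by (intro power_mono dist_triangle) simp
    also have "\<dots> \<le> 2 * ((dist ?x ?y)\<^sup>2 + (dist ?y ?z)\<^sup>2)"
      using sum_squares_bound [of "dist ?x ?y" "dist ?y ?z"] by (simp add: power2_sum)
    finally show ?thesis unfolding eq .
  qed
  have "dyadic_energy T \<omega> n \<le> 2 ^ n / 2 * (\<Sum>i<2 ^ n. 2 * (?D (Suc n) (2 * i) + ?D (Suc n) (Suc (2 * i))))"
    unfolding dyadic_energy_def by (intro mult_left_mono sum_mono half) simp
  also have "\<dots> = 2 ^ Suc n / 2 * (\<Sum>i<2 * 2 ^ n. ?D (Suc n) i)"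
    unfolding split sum_distrib_left [symmetric] by simp
  also have "\<dots> = dyadic_energy T \<omega> (Suc n)" by (simp add: dyadic_energy_def)
  finally show ?thesis .
qed

lemma dyadic_energy_mono: "n \<le> n' \<Longrightarrow> dyadic_energy T \<omega> n \<le> dyadic_energy T \<omega> n'"
  by (rule lift_Suc_mono_le [of "dyadic_energy T \<omega>"]) (rule dyadic_energy_mono_step)

lemma dist_le_sum_steps:
  assumes "p \<le> q"
  shows "dist (f p) (f q) \<le> (\<Sum>i\<in>{p..<q}. dist (f i) (f (Suc i)))"
  using assms
proof (induction q rule: dec_induct)
  case (step q)
  have "dist (f p) (f (Suc q)) \<le> dist (f p) (f q) + dist (f q) (f (Suc q))" by (rule dist_triangle)
  with step show ?case by simp
qed simp

definition grid_index :: "real \<Rightarrow> nat \<Rightarrow> real \<Rightarrow> nat"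
  where "grid_index T n t = nat \<lfloor>2 ^ n * t / T\<rfloor>"

lemma grid_index_bounds:
  assumes "T > 0" "0 \<le> t"
  shows "T * real (grid_index T n t) / 2 ^ n \<le> t" "t < T * real (Suc (grid_index T n t)) / 2 ^ n"
proof -
  have "real (grid_index T n t) = of_int \<lfloor>2 ^ n * t / T\<rfloor>" using assms by (simp add: grid_index_def)
  then have "real (grid_index T n t) \<le> 2 ^ n * t / T" "2 ^ n * t / T < real (Suc (grid_index T n t))" by linarith+
  then show "T * real (grid_index T n t) / 2 ^ n \<le> t" "t < T * real (Suc (grid_index T n t)) / 2 ^ n"
    using assms by (auto simp: field_simps)
qed

lemma grid_index_mono: "T > 0 \<Longrightarrow> s \<le> t \<Longrightarrow> grid_index T n s \<le> grid_index T n t"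
  unfolding grid_index_def by (intro nat_mono floor_mono divide_right_mono mult_left_mono) auto

lemma grid_index_le: "T > 0 \<Longrightarrow> t \<le> T \<Longrightarrow> grid_index T n t \<le> 2 ^ n"
proof -
  assume "T > 0" "t \<le> T"
  then have "grid_index T n t \<le> grid_index T n T" by (rule grid_index_mono)
  also have "grid_index T n T = 2 ^ n"
  proof -
    have "2 ^ n * T / T = real_of_int (2 ^ n)" using \<open>T > 0\<close> by simp
    then have "\<lfloor>2 ^ n * T / T\<rfloor> = 2 ^ n" by (simp only: floor_of_int)
    then show ?thesis by (simp add: grid_index_def nat_power_eq)
  qed
  finally show ?thesis .
qed

lemma grid_tendsto:
  assumes "T > 0" "0 \<le> t"
  shows "(\<lambda>n. T * real (grid_index T n t) / 2 ^ n) \<longlonglongrightarrow> t"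
proof (rule tendsto_sandwich)
  show "\<forall>\<^sub>F n in sequentially. t - T * (1/2) ^ n \<le> T * real (grid_index T n t) / 2 ^ n"
  proof (intro always_eventually allI)
    fix n
    have "T * real (Suc (grid_index T n t)) / 2 ^ n = T * real (grid_index T n t) / 2 ^ n + T * (1/2) ^ n"
      by (simp add: power_one_over add_divide_distrib distrib_left inverse_eq_divide)
    then show "t - T * (1/2) ^ n \<le> T * real (grid_index T n t) / 2 ^ n"
      using grid_index_bounds(2) [OF assms, of n] by linarith
  qed
  show "\<forall>\<^sub>F n in sequentially. T * real (grid_index T n t) / 2 ^ n \<le> t"
    using grid_index_bounds(1) [OF assms] by simp
  have "(\<lambda>n. t - T * (1/2) ^ n) \<longlonglongrightarrow> t - T * 0"
    by (intro tendsto_intros LIMSEQ_power_zero) simp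
  then show "(\<lambda>n. t - T * (1/2) ^ n) \<longlonglongrightarrow> t" by simp
qed simp

text \<open>
  Rounding the end points down to the grid turns a family of disjoint intervals into a family of
  disjoint blocks of grid cells, to which the Cauchy-Schwarz inequality (in its additive form, with a
  free weight \<open>l\<close>) applies.
\<close>

lemma absolutely_continuous_if_bounded_energy:
  fixes \<omega> :: "real \<Rightarrow> 'a::metric_space"
  assumes T: "T > 0" and cont: "continuous_on {0..T} \<omega>" and E: "\<And>n. dyadic_energy T \<omega> n \<le> E"
  shows "absolutely_continuous_path T \<omega>"
  unfolding absolutely_continuous_path_def
proof (intro allI impI)
  fix \<epsilon> :: real assume \<epsilon>: "\<epsilon> > 0"
  have E0: "E \<ge> 0" using E [of 0] dyadic_energy_nonneg [of T \<omega> 0] by linarith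
  define l where "l = \<epsilon> / (3 * (E + 1))"
  have l: "l > 0" "l * E < \<epsilon> / 2" using \<epsilon> E0 by (auto simp: l_def field_simps add_nonneg_pos)
  show "\<exists>\<delta>>0. \<forall>(n::nat) a b. (\<forall>i<n. 0 \<le> a i \<and> a i \<le> b i \<and> b i \<le> T) \<and>
      (\<forall>i<n. \<forall>j<n. i \<noteq> j \<longrightarrow> {a i<..<b i} \<inter> {a j<..<b j} = {}) \<and>
      (\<Sum>i<n. b i - a i) < \<delta> \<longrightarrow> (\<Sum>i<n. dist (\<omega> (a i)) (\<omega> (b i))) < \<epsilon>"
  proof (intro exI [of _ "l * T * \<epsilon>"] conjI allI impI; (elim conjE)?)
    show "0 < l * T * \<epsilon>" using l T \<epsilon> by simp
    fix N :: nat and a b :: "nat \<Rightarrow> real"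
    assume ab: "\<forall>i<N. 0 \<le> a i \<and> a i \<le> b i \<and> b i \<le> T"
      and dj: "\<forall>i<N. \<forall>j<N. i \<noteq> j \<longrightarrow> {a i<..<b i} \<inter> {a j<..<b j} = {}"
      and small: "(\<Sum>i<N. b i - a i) < l * T * \<epsilon>"
    let ?g = "\<lambda>n t. T * real (grid_index T n t) / 2 ^ n"
    have conv: "(\<lambda>n. \<omega> (?g n t)) \<longlonglongrightarrow> \<omega> t" if t: "0 \<le> t" "t \<le> T" for t
    proof (rule continuous_on_tendsto_compose [OF cont grid_tendsto [OF T t(1)]])
      show "\<forall>\<^sub>F n in sequentially. ?g n t \<in> {0..T}"
        using grid_index_bounds(1) [OF T t(1)] T t by (intro always_eventually allI) (auto intro: order_trans)
    qed (use t in auto)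
    have "(\<Sum>j<N. dist (\<omega> (?g n (a j))) (\<omega> (?g n (b j)))) \<le> l * E + (\<Sum>j<N. ?g n (b j) - ?g n (a j)) / (2 * l * T)" for n
    proof -
      let ?r = "grid_index T n"
      let ?D = "\<lambda>i. dist (\<omega> (T * real i / 2 ^ n)) (\<omega> (T * real (Suc i) / 2 ^ n))"
      have r: "?r (a j) \<le> ?r (b j)" "?r (b j) \<le> 2 ^ n" if "j < N" for j
        using that ab T by (auto intro: grid_index_mono grid_index_le)
      have disj: "{?r (a i)..<?r (b i)} \<inter> {?r (a j)..<?r (b j)} = {}" if ij: "i < N" "j < N" "i \<noteq> j" for i j
      proof -
        have "{a i<..<b i} \<inter> {a j<..<b j} = {}" using dj ij by blast
        then have "b i \<le> a j \<or> b j \<le> a i \<or> b i \<le> a i \<or> b j \<le> a j" by (auto simp: min_def max_def split: if_splits)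
        then show ?thesis
          using grid_index_mono [OF T, of "b i" "a j" n] grid_index_mono [OF T, of "b j" "a i" n]
            grid_index_mono [OF T, of "b i" "a i" n] grid_index_mono [OF T, of "b j" "a j" n] by auto
      qed
      have amgm: "?D i \<le> l * (2 ^ n / 2) * (?D i)\<^sup>2 + 1 / (2 * l * 2 ^ n)" for i
      proof -
        have "0 \<le> (l * 2 ^ n * ?D i - 1)\<^sup>2 / (2 * l * 2 ^ n)" using l by simp
        also have "\<dots> = l * (2 ^ n / 2) * (?D i)\<^sup>2 + 1 / (2 * l * 2 ^ n) - ?D i"
          using l by (simp add: power2_eq_square field_simps)
        finally show ?thesis by simp
      qed
      have "(\<Sum>j<N. dist (\<omega> (?g n (a j))) (\<omega> (?g n (b j)))) \<le> (\<Sum>j<N. \<Sum>i\<in>{?r (a j)..<?r (b j)}. ?D i)"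
        by (intro sum_mono dist_le_sum_steps [where f = "\<lambda>i. \<omega> (T * real i / 2 ^ n)"] r) auto
      also have "\<dots> \<le> (\<Sum>j<N. \<Sum>i\<in>{?r (a j)..<?r (b j)}. l * (2 ^ n / 2) * (?D i)\<^sup>2 + 1 / (2 * l * 2 ^ n))"
        by (intro sum_mono amgm)
      also have "\<dots> = l * (2 ^ n / 2) * (\<Sum>j<N. \<Sum>i\<in>{?r (a j)..<?r (b j)}. (?D i)\<^sup>2)
          + (\<Sum>j<N. real (?r (b j) - ?r (a j)) / (2 * l * 2 ^ n))"
        by (simp add: sum.distrib sum_distrib_left)
      also have "(\<Sum>j<N. \<Sum>i\<in>{?r (a j)..<?r (b j)}. (?D i)\<^sup>2) = (\<Sum>i\<in>(\<Union>j<N. {?r (a j)..<?r (b j)}). (?D i)\<^sup>2)"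
        by (rule sum.UNION_disjoint [symmetric]) (use disj in auto)
      also have "l * (2 ^ n / 2) * (\<Sum>i\<in>(\<Union>j<N. {?r (a j)..<?r (b j)}). (?D i)\<^sup>2) \<le> l * (2 ^ n / 2) * (\<Sum>i<2 ^ n. (?D i)\<^sup>2)"
        using l r by (intro mult_left_mono sum_mono2) (auto intro: less_le_trans)
      also have "\<dots> = l * dyadic_energy T \<omega> n" by (simp add: dyadic_energy_def)
      also have "\<dots> \<le> l * E" using l E by simp
      also have "(\<Sum>j<N. real (?r (b j) - ?r (a j)) / (2 * l * 2 ^ n)) = (\<Sum>j<N. ?g n (b j) - ?g n (a j)) / (2 * l * T)"
        unfolding sum_divide_distrib using r T l by (intro sum.cong refl) (simp add: of_nat_diff field_simps)
      finally show ?thesis by simp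
    qed
    moreover have "(\<lambda>n. \<Sum>j<N. dist (\<omega> (?g n (a j))) (\<omega> (?g n (b j)))) \<longlonglongrightarrow> (\<Sum>j<N. dist (\<omega> (a j)) (\<omega> (b j)))"
      using ab by (intro tendsto_sum tendsto_dist conv) (auto intro: order_trans)
    moreover have "(\<lambda>n. l * E + (\<Sum>j<N. ?g n (b j) - ?g n (a j)) / (2 * l * T)) \<longlonglongrightarrow> l * E + (\<Sum>j<N. b j - a j) / (2 * l * T)"
      using ab T l by (intro tendsto_intros grid_tendsto) (auto intro: order_trans)
    ultimately have "(\<Sum>j<N. dist (\<omega> (a j)) (\<omega> (b j))) \<le> l * E + (\<Sum>j<N. b j - a j) / (2 * l * T)"
      by (intro LIMSEQ_le) auto
    also have "\<dots> < \<epsilon> / 2 + \<epsilon> / 2"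
      using l T small by (intro add_strict_mono) (auto simp: field_simps)
    finally show "(\<Sum>i<N. dist (\<omega> (a i)) (\<omega> (b i))) < \<epsilon>" by simp
  qed
qed

text \<open>
  Cauchy-Schwarz in the form \<open>m\<^sup>2 \<ge> 2 * c * m - c\<^sup>2\<close> with \<open>c\<close> the mean slope.
\<close>

lemma square_quotient_le_integral:
  fixes \<omega> :: "real \<Rightarrow> 'a::metric_space"
  assumes ac: "absolutely_continuous_path T \<omega>"
    and sp: "AE t in lebesgue. 0 < t \<and> t < T \<longrightarrow> has_metric_speed \<omega> (m t) t"
    and st: "0 \<le> s" "s < t" "t \<le> T" and m [measurable]: "m \<in> borel_measurable borel"
    and fin: "(\<integral>\<^sup>+x. ennreal ((m x)\<^sup>2) * indicator {s..<t} x \<partial>lborel) < \<infinity>"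
  shows "ennreal ((dist (\<omega> s) (\<omega> t))\<^sup>2 / (t - s)) \<le> (\<integral>\<^sup>+x. ennreal ((m x)\<^sup>2) * indicator {s..<t} x \<partial>lborel)"
proof -
  have closed: "(\<integral>\<^sup>+x. ennreal ((m x)\<^sup>2) * indicator {s..<t} x \<partial>lborel) = (\<integral>\<^sup>+x. ennreal (indicator {s..t} x * (m x)\<^sup>2) \<partial>lborel)"
  proof (rule nn_integral_cong_AE)
    have "AE x in lborel. x \<noteq> t" by (rule AE_lborel_singleton)
    then show "AE x in lborel. ennreal ((m x)\<^sup>2) * indicator {s..<t} x = ennreal (indicator {s..t} x * (m x)\<^sup>2)"
      by eventually_elim (auto simp: indicator_def)
  qed
  have i2: "integrable lborel (\<lambda>x. indicator {s..t} x * (m x)\<^sup>2)"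
    using fin unfolding closed by (intro integrableI_bounded) (auto simp: abs_mult)
  have i0: "integrable lborel (\<lambda>x. indicator {s..t} x * (1::real))"
    using st by (simp add: integrable_indicator_iff)
  have i1: "integrable lborel (\<lambda>x. indicator {s..t} x * m x)"
  proof (rule Bochner_Integration.integrable_bound [OF Bochner_Integration.integrable_add [OF i0 i2]])
    have "\<bar>m x\<bar> \<le> 1 + (m x)\<^sup>2" for x
    proof -
      have "0 \<le> (\<bar>m x\<bar> - 1)\<^sup>2" by simp
      then have "2 * \<bar>m x\<bar> \<le> 1 + (m x)\<^sup>2" by (simp add: power2_diff)
      then show ?thesis by simp
    qed
    then show "AE x in lborel. norm (indicator {s..t} x * m x) \<le> norm (indicator {s..t} x * 1 + indicator {s..t} x * (m x)\<^sup>2)"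
      by (intro AE_I2) (auto simp: indicator_def)
  qed simp
  have si: "set_integrable lborel {s..t} m" using i1 by (simp add: set_integrable_def)
  have "m integrable_on {s..t}" "integral {s..t} m = (\<integral>x. indicator {s..t} x * m x \<partial>lborel)"
    using set_borel_integral_eq_integral [OF si] by (simp_all add: set_lebesgue_integral_def)
  then have d: "dist (\<omega> s) (\<omega> t) \<le> (\<integral>x. indicator {s..t} x * m x \<partial>lborel)"
    using dist_le_integral_metric_speed [OF ac sp st(1) _ st(3)] st(2) by simp
  define D where "D = dist (\<omega> s) (\<omega> t) / (t - s)"
  have "0 \<le> (\<integral>x. indicator {s..t} x * (m x - D)\<^sup>2 \<partial>lborel)"
    by (intro integral_nonneg_AE) auto
  also have "\<dots> = (\<integral>x. indicator {s..t} x * (m x)\<^sup>2 - 2 * D * (indicator {s..t} x * m x) + D\<^sup>2 * (indicator {s..t} x * 1) \<partial>lborel)"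
    by (intro Bochner_Integration.integral_cong refl) (simp add: power2_eq_square algebra_simps)
  also have "\<dots> = (\<integral>x. indicator {s..t} x * (m x)\<^sup>2 \<partial>lborel) - 2 * D * (\<integral>x. indicator {s..t} x * m x \<partial>lborel) + D\<^sup>2 * (t - s)"
    using i0 i1 i2 st by (simp add: Bochner_Integration.integral_add Bochner_Integration.integral_diff)
  finally have "0 \<le> (\<integral>x. indicator {s..t} x * (m x)\<^sup>2 \<partial>lborel) - 2 * D * (\<integral>x. indicator {s..t} x * m x \<partial>lborel) + D\<^sup>2 * (t - s)" .
  moreover have "2 * D * dist (\<omega> s) (\<omega> t) \<le> 2 * D * (\<integral>x. indicator {s..t} x * m x \<partial>lborel)"
    using d st by (intro mult_left_mono) (auto simp: D_def)
  ultimately have "2 * D * dist (\<omega> s) (\<omega> t) - D\<^sup>2 * (t - s) \<le> (\<integral>x. indicator {s..t} x * (m x)\<^sup>2 \<partial>lborel)" by simp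
  moreover have "2 * D * dist (\<omega> s) (\<omega> t) - D\<^sup>2 * (t - s) = (dist (\<omega> s) (\<omega> t))\<^sup>2 / (t - s)"
  proof -
    have "2 * (a / h) * a - (a / h)\<^sup>2 * h = a\<^sup>2 / h" if "h > 0" for a h :: real
      using that by (simp add: power2_eq_square field_simps)
    then show ?thesis using st unfolding D_def by simp
  qed
  ultimately show ?thesis
    unfolding closed by (subst nn_integral_eq_integral [OF i2]) (auto intro!: ennreal_leI)
qed

text \<open>
  The action is bounded above by the energies by Fatou's lemma, applied to the difference quotients
  over the grid cells. It is bounded below by them because of the Cauchy-Schwarz inequality on each
  cell. For a curve that is not absolutely continuous both sides are infinite.
\<close>

theorem path_action_eq_SUP_dyadic_energy:
  fixes \<omega> :: "real \<Rightarrow> 'a::flat_space"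
  assumes T: "T > 0" and cont: "continuous_on {0..T} \<omega>"
    and sp: "absolutely_continuous_path T \<omega> \<Longrightarrow>
      AE t in lebesgue. 0 < t \<and> t < T \<longrightarrow> has_metric_speed \<omega> (speed \<omega> t {0..T}) t"
  shows "path_action T \<omega> = (SUP n. ennreal (dyadic_energy T \<omega> n))"
proof (cases "absolutely_continuous_path T \<omega>")
  case False
  have "(SUP n. ennreal (dyadic_energy T \<omega> n)) = \<infinity>"
  proof (rule ccontr)
    assume "(SUP n. ennreal (dyadic_energy T \<omega> n)) \<noteq> \<infinity>"
    then obtain E where E: "0 \<le> E" "(SUP n. ennreal (dyadic_energy T \<omega> n)) = ennreal E"
      by (metis ennreal_cases infinity_ennreal_def)
    have "dyadic_energy T \<omega> n \<le> E" for n
      using SUP_upper [of n UNIV "\<lambda>n. ennreal (dyadic_energy T \<omega> n)"] E by (simp add: ennreal_le_iff)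
    then show False using absolutely_continuous_if_bounded_energy [OF T cont] False by blast
  qed
  then show ?thesis using False by (simp only: path_action_def if_False)
next
  case True
  note sp = sp [OF True]
  define q where "q n i = dist (\<omega> (T * real i / 2 ^ n)) (\<omega> (T * real (Suc i) / 2 ^ n)) / (T / 2 ^ n)" for n i
  define D where "D n t = q n (grid_index T n t)" for n t
  have [measurable]: "grid_index T n \<in> borel \<rightarrow>\<^sub>M count_space UNIV" for n
    unfolding grid_index_def by measurable
  have Dm [measurable]: "D n \<in> borel_measurable borel" for n
    unfolding D_def by measurable
  define m where "m t = lim (\<lambda>n. D n t)" for t
  have mm [measurable]: "m \<in> borel_measurable borel"
    unfolding m_def by (rule borel_measurable_lim_metric) (rule Dm)
  have conv: "(\<lambda>n. D n t) \<longlonglongrightarrow> c" if c: "has_metric_speed \<omega> c t" and t: "0 < t" for c t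
  proof (rule LIMSEQ_I)
    fix e :: real assume e: "e > 0"
    obtain d where d: "d > 0" "\<And>y z. y \<le> t \<and> t \<le> z \<and> t - y < d \<and> z - t < d \<Longrightarrow> \<bar>dist (\<omega> y) (\<omega> z) - c * (z - y)\<bar> \<le> e / 2 * (z - y)"
      using c e unfolding has_metric_speed_def by (metis half_gt_zero)
    have "(\<lambda>n. T * (1/2) ^ n) \<longlonglongrightarrow> T * 0" by (intro tendsto_intros LIMSEQ_power_zero) simp
    then obtain n0 where n0: "\<And>n. n \<ge> n0 \<Longrightarrow> T * (1/2) ^ n < d"
      using order_tendstoD(2) [of "\<lambda>n. T * (1/2) ^ n" 0 sequentially d] d(1) by (auto simp: eventually_sequentially)
    have "norm (D n t - c) < e" if "n \<ge> n0" for n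
    proof -
      let ?y = "T * real (grid_index T n t) / 2 ^ n" and ?z = "T * real (Suc (grid_index T n t)) / 2 ^ n"
      have zy: "?z - ?y = T / 2 ^ n" by (simp add: add_divide_distrib distrib_left)
      have "T / 2 ^ n < d" using n0 [OF that] by (simp add: power_one_over inverse_eq_divide)
      moreover have "?y \<le> t" "t < ?z" using grid_index_bounds [OF T, of t n] t by auto
      ultimately have "\<bar>dist (\<omega> ?y) (\<omega> ?z) - c * (?z - ?y)\<bar> \<le> e / 2 * (?z - ?y)"
        using zy by (intro d(2)) linarith
      then have "\<bar>dist (\<omega> ?y) (\<omega> ?z) - c * (T / 2 ^ n)\<bar> \<le> e / 2 * (T / 2 ^ n)" unfolding zy .
      moreover have "dist (\<omega> ?y) (\<omega> ?z) = D n t * (T / 2 ^ n)"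
        using T by (simp add: D_def q_def)
      then have "dist (\<omega> ?y) (\<omega> ?z) - c * (T / 2 ^ n) = (D n t - c) * (T / 2 ^ n)"
        by (simp only: left_diff_distrib)
      ultimately have "\<bar>D n t - c\<bar> * (T / 2 ^ n) \<le> e / 2 * (T / 2 ^ n)"
        using T by (simp add: abs_mult)
      moreover have "0 < T / 2 ^ n" using T by simp
      ultimately have "\<bar>D n t - c\<bar> \<le> e / 2" by (metis mult_le_cancel_right_pos)
      then show ?thesis using e by simp
    qed
    then show "\<exists>n0. \<forall>n\<ge>n0. norm (D n t - c) < e" by blast
  qed
  have m_eq: "m t = c" if "has_metric_speed \<omega> c t" "0 < t" for c t
    unfolding m_def by (rule limI [OF conv [OF that]])
  have spm: "AE t in lebesgue. 0 < t \<and> t < T \<longrightarrow> has_metric_speed \<omega> (m t) t"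
    using sp by eventually_elim (use m_eq in auto)
  let ?cell = "\<lambda>n i. {T * real i / 2 ^ n..<T * real (Suc i) / 2 ^ n}"
  have cell_iff: "t \<in> ?cell n i \<longleftrightarrow> i = grid_index T n t" if t: "0 \<le> t" for t n i
  proof
    assume i: "t \<in> ?cell n i"
    then have "real i \<le> 2 ^ n * t / T" "2 ^ n * t / T < real i + 1" using T by (auto simp: field_simps)
    then have "\<lfloor>2 ^ n * t / T\<rfloor> = int i" by (simp add: floor_unique)
    then show "i = grid_index T n t" by (simp add: grid_index_def)
  next
    assume "i = grid_index T n t"
    then show "t \<in> ?cell n i" using grid_index_bounds [OF T t] by simp
  qed
  have cell_out: "t \<notin> ?cell n i" if "t \<notin> {0..<T}" "i < 2 ^ n" for t n i
  proof
    assume t: "t \<in> ?cell n i"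
    have "real (Suc i) \<le> 2 ^ n" using that(2) by (metis Suc_leI of_nat_le_iff of_nat_numeral of_nat_power)
    then have "T * real (Suc i) \<le> T * 2 ^ n" using T by (intro mult_left_mono) auto
    then have "T * real (Suc i) / 2 ^ n \<le> T" by (subst pos_divide_le_eq) auto
    moreover have "0 \<le> T * real i / 2 ^ n" using T by simp
    ultimately show False using t that(1) by auto
  qed
  have grid_lt: "grid_index T n t < 2 ^ n" if "t \<in> {0..<T}" for n t
  proof -
    have "T * real (grid_index T n t) / 2 ^ n < T" using grid_index_bounds(1) [OF T, of t n] that by auto
    then have "real (grid_index T n t) < 2 ^ n" using T by (simp add: field_simps)
    then show ?thesis by (metis of_nat_less_iff of_nat_numeral of_nat_power)
  qed
  have cells: "(\<Sum>i<2 ^ n. f i * indicator (?cell n i) t) = f (grid_index T n t) * indicator {0..<T} t"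
    for f :: "nat \<Rightarrow> ennreal" and n t
  proof (cases "t \<in> {0..<T}")
    case True
    then have "(\<Sum>i<2 ^ n. f i * indicator (?cell n i) t) = (\<Sum>i<2 ^ n. if grid_index T n t = i then f i else 0)"
    proof (intro sum.cong refl)
      fix i
      have ci: "t \<in> ?cell n i \<longleftrightarrow> i = grid_index T n t" using True by (intro cell_iff) simp
      show "f i * indicator (?cell n i) t = (if grid_index T n t = i then f i else 0)"
        by (simp only: indicator_def ci) auto
    qed
    then show ?thesis using True grid_lt [OF True, of n] by simp
  next
    case False
    have "(\<Sum>i<2 ^ n. f i * indicator (?cell n i) t) = 0"
      using cell_out [OF False] by (intro sum.neutral) (auto simp: indicator_def simp del: atLeastLessThan_iff)
    then show ?thesis using False by simp
  qed
  have len: "T * real (Suc i) / 2 ^ n - T * real i / 2 ^ n = T / 2 ^ n" for n i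
    by (simp add: add_divide_distrib distrib_left)
  have energy: "ennreal (dyadic_energy T \<omega> n) = (\<Sum>i<2 ^ n. ennreal (T / 2 * (q n i)\<^sup>2 * (T / 2 ^ n)))" for n
  proof -
    have "dyadic_energy T \<omega> n = (\<Sum>i<2 ^ n. T / 2 * (q n i)\<^sup>2 * (T / 2 ^ n))"
      unfolding dyadic_energy_def sum_distrib_left q_def
      by (intro sum.cong refl) (use T in \<open>simp add: power2_eq_square field_simps\<close>)
    then show ?thesis using T by (simp add: sum_ennreal)
  qed
  have stepint: "(\<integral>\<^sup>+t. ennreal (T / 2 * (D n t)\<^sup>2) * indicator {0..<T} t \<partial>lborel) = ennreal (dyadic_energy T \<omega> n)" for n
  proof -
    have "(\<integral>\<^sup>+t. ennreal (T / 2 * (D n t)\<^sup>2) * indicator {0..<T} t \<partial>lborel)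
        = (\<integral>\<^sup>+t. (\<Sum>i<2 ^ n. ennreal (T / 2 * (q n i)\<^sup>2) * indicator (?cell n i) t) \<partial>lborel)"
      unfolding cells by (simp add: D_def)
    also have "\<dots> = (\<Sum>i<2 ^ n. \<integral>\<^sup>+t. ennreal (T / 2 * (q n i)\<^sup>2) * indicator (?cell n i) t \<partial>lborel)"
      by (rule nn_integral_sum) simp
    also have "\<dots> = (\<Sum>i<2 ^ n. ennreal (T / 2 * (q n i)\<^sup>2 * (T / 2 ^ n)))"
    proof (rule sum.cong [OF refl])
      fix i
      have "T * real i / 2 ^ n \<le> T * real (Suc i) / 2 ^ n" using T by (simp add: divide_right_mono)
      then have "emeasure lborel (?cell n i) = ennreal (T / 2 ^ n)" by (simp only: emeasure_lborel_Ico len)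
      moreover have "(\<integral>\<^sup>+t. ennreal (T / 2 * (q n i)\<^sup>2) * indicator (?cell n i) t \<partial>lborel)
          = ennreal (T / 2 * (q n i)\<^sup>2) * emeasure lborel (?cell n i)"
        by (rule nn_integral_cmult_indicator) simp
      moreover have "ennreal (T / 2 * (q n i)\<^sup>2) * ennreal (T / 2 ^ n) = ennreal (T / 2 * (q n i)\<^sup>2 * (T / 2 ^ n))"
        using T by (intro ennreal_mult [symmetric]) auto
      ultimately show "(\<integral>\<^sup>+t. ennreal (T / 2 * (q n i)\<^sup>2) * indicator (?cell n i) t \<partial>lborel) = ennreal (T / 2 * (q n i)\<^sup>2 * (T / 2 ^ n))"
        by simp
    qed
    finally show ?thesis using energy by simp
  qed
  let ?P = "\<integral>\<^sup>+t. ennreal (T / 2 * (m t)\<^sup>2) * indicator {0..<T} t \<partial>lborel"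
  have P: "path_action T \<omega> = ?P"
  proof -
    have "(\<integral>\<^sup>+t\<in>{0..T}. ennreal (1/2 * (speed \<omega> t {0..T})\<^sup>2) \<partial>lebesgue)
        = (\<integral>\<^sup>+t. ennreal (1/2 * (m t)\<^sup>2) * indicator {0..<T} t \<partial>lebesgue)"
    proof (rule nn_integral_cong_AE)
      have "AE t in lebesgue. t \<noteq> 0" "AE t in lebesgue. t \<noteq> T"
        using AE_lborel_singleton AE_completion by blast+
      with sp show "AE t in lebesgue. ennreal (1/2 * (speed \<omega> t {0..T})\<^sup>2) * indicator {0..T} t = ennreal (1/2 * (m t)\<^sup>2) * indicator {0..<T} t"
      proof eventually_elim
        case (elim t)
        show ?case
        proof (cases "0 < t \<and> t < T")
          case True
          then have "m t = speed \<omega> t {0..T}" using elim(1) by (intro m_eq) auto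
          then show ?thesis using True by (simp add: indicator_def)
        next
          case False
          then show ?thesis using elim by (auto simp: indicator_def)
        qed
      qed
    qed
    also have "\<dots> = (\<integral>\<^sup>+t. ennreal (1/2 * (m t)\<^sup>2) * indicator {0..<T} t \<partial>lborel)"
      by (rule nn_integral_completion)
    finally have "path_action T \<omega> = ennreal T * (\<integral>\<^sup>+t. ennreal (1/2 * (m t)\<^sup>2) * indicator {0..<T} t \<partial>lborel)"
      using True by (simp add: path_action_def)
    also have "\<dots> = (\<integral>\<^sup>+t. ennreal T * (ennreal (1/2 * (m t)\<^sup>2) * indicator {0..<T} t) \<partial>lborel)"
      by (rule nn_integral_cmult [symmetric]) simp
    also have "\<dots> = ?P"
      by (intro nn_integral_cong) (use T in \<open>simp add: mult.assoc [symmetric] ennreal_mult [symmetric]\<close>)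
    finally show ?thesis .
  qed
  show ?thesis unfolding P
  proof (rule antisym)
    have "AE t in lborel. ennreal (T / 2 * (m t)\<^sup>2) * indicator {0..<T} t = liminf (\<lambda>n. ennreal (T / 2 * (D n t)\<^sup>2) * indicator {0..<T} t)"
    proof -
      have "AE t in lborel. 0 < t \<and> t < T \<longrightarrow> has_metric_speed \<omega> (m t) t"
        using spm by (simp add: AE_completion_iff)
      moreover have "AE t in lborel. t \<noteq> (0::real)" by (rule AE_lborel_singleton)
      ultimately show ?thesis
      proof eventually_elim
        case (elim t)
        show ?case
        proof (cases "0 < t \<and> t < T")
          case True
          then have "(\<lambda>n. D n t) \<longlonglongrightarrow> m t" using elim(1) by (intro conv) auto
          then have "(\<lambda>n. ennreal (T / 2 * (D n t)\<^sup>2)) \<longlonglongrightarrow> ennreal (T / 2 * (m t)\<^sup>2)"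
            by (intro tendsto_intros) auto
          from lim_imp_Liminf [OF sequentially_bot this] show ?thesis using True by (simp add: indicator_def)
        next
          case False
          then show ?thesis using elim(2) by (auto simp: indicator_def Liminf_const)
        qed
      qed
    qed
    then have "?P = (\<integral>\<^sup>+t. liminf (\<lambda>n. ennreal (T / 2 * (D n t)\<^sup>2) * indicator {0..<T} t) \<partial>lborel)"
      by (rule nn_integral_cong_AE)
    also have "\<dots> \<le> liminf (\<lambda>n. \<integral>\<^sup>+t. ennreal (T / 2 * (D n t)\<^sup>2) * indicator {0..<T} t \<partial>lborel)"
      by (rule nn_integral_liminf) simp
    also have "\<dots> = liminf (\<lambda>n. ennreal (dyadic_energy T \<omega> n))" unfolding stepint ..
    also have "\<dots> = (SUP n. ennreal (dyadic_energy T \<omega> n))"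
      by (intro lim_imp_Liminf LIMSEQ_SUP) (auto simp: incseq_def intro!: ennreal_leI dyadic_energy_mono)
    finally show "?P \<le> (SUP n. ennreal (dyadic_energy T \<omega> n))" .
  next
    show "(SUP n. ennreal (dyadic_energy T \<omega> n)) \<le> ?P"
    proof (rule SUP_least)
      fix n
      show "ennreal (dyadic_energy T \<omega> n) \<le> ?P"
      proof (cases "?P = \<infinity>")
        case fin: False
        have each: "ennreal (T / 2 * (q n i)\<^sup>2 * (T / 2 ^ n)) \<le> (\<integral>\<^sup>+t. ennreal (T / 2 * (m t)\<^sup>2) * indicator (?cell n i) t \<partial>lborel)"
          if i: "i < 2 ^ n" for i
        proof -
          let ?s = "T * real i / 2 ^ n" and ?t = "T * real (Suc i) / 2 ^ n"
          have mult: "(\<integral>\<^sup>+t. ennreal (T / 2 * (m t)\<^sup>2) * indicator (?cell n i) t \<partial>lborel)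
              = ennreal (T / 2) * (\<integral>\<^sup>+t. ennreal ((m t)\<^sup>2) * indicator (?cell n i) t \<partial>lborel)"
          proof -
            have "ennreal (T / 2 * (m t)\<^sup>2) = ennreal (T / 2) * ennreal ((m t)\<^sup>2)" for t
              using T by (intro ennreal_mult) auto
            then show ?thesis by (simp only: mult.assoc) (rule nn_integral_cmult, simp)
          qed
          have "(\<integral>\<^sup>+t. ennreal (T / 2 * (m t)\<^sup>2) * indicator (?cell n i) t \<partial>lborel) \<le> ?P"
          proof (rule nn_integral_mono)
            fix t
            show "ennreal (T / 2 * (m t)\<^sup>2) * indicator (?cell n i) t \<le> ennreal (T / 2 * (m t)\<^sup>2) * indicator {0..<T} t"
              using cell_out [of t i n] i by (cases "t \<in> {0..<T}") (auto simp: indicator_def simp del: atLeastLessThan_iff)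
          qed
          then have "ennreal (T / 2) * (\<integral>\<^sup>+t. ennreal ((m t)\<^sup>2) * indicator (?cell n i) t \<partial>lborel) < \<infinity>"
            unfolding mult using fin by (auto simp: less_top[symmetric] top_unique)
          then have "(\<integral>\<^sup>+t. ennreal ((m t)\<^sup>2) * indicator (?cell n i) t \<partial>lborel) < \<infinity>"
            using T by (auto simp: ennreal_mult_less_top)
          moreover have "real (Suc i) \<le> 2 ^ n" using i by (metis Suc_leI of_nat_le_iff of_nat_numeral of_nat_power)
          then have "T * real (Suc i) \<le> T * 2 ^ n" using T by (intro mult_left_mono) auto
          then have "?t \<le> T" by (subst pos_divide_le_eq) auto
          moreover have "?s < ?t" using len [of i n] T by (smt (verit) divide_pos_pos zero_less_power)
          ultimately have "ennreal ((dist (\<omega> ?s) (\<omega> ?t))\<^sup>2 / (?t - ?s)) \<le> (\<integral>\<^sup>+t. ennreal ((m t)\<^sup>2) * indicator (?cell n i) t \<partial>lborel)"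
            using T by (intro square_quotient_le_integral [OF True spm]) auto
          then have "ennreal (T / 2) * ennreal ((dist (\<omega> ?s) (\<omega> ?t))\<^sup>2 / (?t - ?s)) \<le> (\<integral>\<^sup>+t. ennreal (T / 2 * (m t)\<^sup>2) * indicator (?cell n i) t \<partial>lborel)"
            unfolding mult by (rule mult_left_mono) simp
          moreover have "ennreal (T / 2) * ennreal ((dist (\<omega> ?s) (\<omega> ?t))\<^sup>2 / (?t - ?s)) = ennreal (T / 2 * (q n i)\<^sup>2 * (T / 2 ^ n))"
            unfolding len q_def using T by (simp add: ennreal_mult [symmetric] power2_eq_square field_simps)
          ultimately show ?thesis by simp
        qed
        have "ennreal (dyadic_energy T \<omega> n) \<le> (\<Sum>i<2 ^ n. \<integral>\<^sup>+t. ennreal (T / 2 * (m t)\<^sup>2) * indicator (?cell n i) t \<partial>lborel)"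
          unfolding energy by (intro sum_mono each) simp
        also have "\<dots> = (\<integral>\<^sup>+t. (\<Sum>i<2 ^ n. ennreal (T / 2 * (m t)\<^sup>2) * indicator (?cell n i) t) \<partial>lborel)"
          by (rule nn_integral_sum [symmetric]) simp
        also have "\<dots> = ?P" unfolding cells ..
        finally show ?thesis .
      qed simp
    qed
  qed
qed

section \<open>Path space\<close>

abbreviation mu2 :: "'a::flat_space set \<Rightarrow> ('a \<times> 'a) measure"
  where "mu2 D \<equiv> mu D \<Otimes>\<^sub>M mu D"

text \<open>
  Laws are compared by integrating, since most of the laws below are given by a disintegration
  or by Tonelli's theorem.
\<close>

lemma nn_integral_measure_eqI:
  fixes M N :: "'b measure"
  assumes "sets M = sets N"
    and "\<And>f :: 'b \<Rightarrow> ennreal. f \<in> borel_measurable M \<Longrightarrow> (\<integral>\<^sup>+x. f x \<partial>M) = (\<integral>\<^sup>+x. f x \<partial>N)"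
  shows "M = N"
proof (rule measure_eqI [OF assms(1)])
  fix A assume A: "A \<in> sets M"
  then have "(\<integral>\<^sup>+x. indicator A x \<partial>M) = (\<integral>\<^sup>+x. indicator A x \<partial>N)" by (intro assms(2)) simp
  then show "emeasure M A = emeasure N A" using A assms(1) by simp
qed

text \<open>
  The properties shared by compact sets of positive volume and the torus. Absence of atoms rules
  out constant measure-preserving maps; the codes reduce statements about random points to
  statements about random numbers.
\<close>

locale label_space =
  fixes D :: "'a::{flat_space, second_countable_topology} set"
  assumes compact_D: "compact D"
    and sets_mu: "sets (mu D) = sets (restrict_space borel D)"
    and prob_mu: "prob_space (mu D)"
    and atomless: "\<And>c. \<not> (AE x in mu D. x = c)"
    and metric_speed_AE: "\<And>T (\<omega> :: real \<Rightarrow> 'a). absolutely_continuous_path T \<omega> \<Longrightarrow>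
      AE t in lebesgue. 0 < t \<and> t < T \<longrightarrow> has_metric_speed \<omega> (speed \<omega> t {0..T}) t"
    and code_exists: "\<exists>\<phi> \<psi>. \<phi> \<in> borel_measurable (mu D) \<and> (\<forall>x\<in>D. 0 \<le> \<phi> x \<and> \<phi> x \<le> (1::real)) \<and>
      \<psi> \<in> borel \<rightarrow>\<^sub>M mu D \<and> (\<forall>x\<in>D. \<psi> (\<phi> x) = x)"
begin

lemma space_mu_D: "space (mu D) = D"
  using sets_eq_imp_space_eq [OF sets_mu] by (simp add: space_restrict_space)

lemma D_nonempty: "D \<noteq> {}"
  using prob_space.not_empty [OF prob_mu] by (simp add: space_mu_D)

lemma measurable_to_mu_iff: "f \<in> M \<rightarrow>\<^sub>M mu D \<longleftrightarrow> f \<in> M \<rightarrow>\<^sub>M borel \<and> f \<in> space M \<rightarrow> D"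
  by (simp add: measurable_cong_sets [OF refl sets_mu] measurable_restrict_space2_iff)

lemma measurable_id_mu [measurable]: "(\<lambda>x. x) \<in> mu D \<rightarrow>\<^sub>M borel"
  by (simp add: measurable_cong_sets [OF sets_mu refl] measurable_restrict_space1)

lemma continuous_measurable_mu: "continuous_on D f \<Longrightarrow> f \<in> borel_measurable (mu D)"
  by (simp add: measurable_cong_sets [OF sets_mu refl] borel_measurable_continuous_on_restrict)

lemma mspace_path: "mspace (path_metric T D) = {\<omega> \<in> extensional {0..T}. continuous_on {0..T} \<omega> \<and> \<omega> ` {0..T} \<subseteq> D}"
proof -
  have bounded: "Metric_space.mbounded D dist (\<omega> ` {0..T})" if "\<omega> ` {0..T} \<subseteq> D" for \<omega> :: "real \<Rightarrow> 'a"
  proof -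
    interpret Metric_space D "dist :: 'a \<Rightarrow> 'a \<Rightarrow> real"
      by unfold_locales (auto simp: dist_commute dist_triangle)
    obtain c where c: "c \<in> D" using D_nonempty by blast
    obtain B where "\<forall>x\<in>D. dist c x \<le> B"
      using compact_imp_bounded [OF compact_D] bounded_any_center [of D c] by blast
    then have "\<omega> ` {0..T} \<subseteq> mcball c B" using that c by (auto simp: image_subset_iff)
    then show ?thesis unfolding mbounded_def by blast
  qed
  show ?thesis
    unfolding path_metric_def mspace_cfunspace mtopology_of_submetric mtopology_of_euclidean
    using bounded by (auto simp: continuous_map_in_subtopology image_subset_iff Pi_iff)
qed

lemma path_openin_subset: "{U. openin (mtopology_of (path_metric T D)) U} \<subseteq> Pow (mspace (path_metric T D))"
  by (metis (no_types, lifting) CollectD PowI openin_subset subsetI topspace_mtopology_of)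

lemma space_Path_mspace: "space (Path T D) = mspace (path_metric T D)"
  unfolding Path_def by (rule space_measure_of [OF path_openin_subset])

lemma space_Path: "space (Path T D) = {\<omega> \<in> extensional {0..T}. continuous_on {0..T} \<omega> \<and> \<omega> ` {0..T} \<subseteq> D}"
  by (simp only: space_Path_mspace mspace_path)

lemma path_in_D: "\<omega> \<in> space (Path T D) \<Longrightarrow> t \<in> {0..T} \<Longrightarrow> \<omega> t \<in> D"
  by (auto simp: space_Path)

lemma path_continuous: "\<omega> \<in> space (Path T D) \<Longrightarrow> continuous_on {0..T} \<omega>"
  by (simp add: space_Path)

lemma openin_path: "openin (mtopology_of (path_metric T D)) U \<longleftrightarrow>
    U \<subseteq> mspace (path_metric T D) \<and>
    (\<forall>\<omega>\<in>U. \<exists>r>0. \<forall>\<omega>'\<in>mspace (path_metric T D). mdist (path_metric T D) \<omega> \<omega>' < r \<longrightarrow> \<omega>' \<in> U)"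
proof (cases "U \<subseteq> mspace (path_metric T D)")
  case True
  interpret Metric_space "mspace (path_metric T D)" "mdist (path_metric T D)" by simp
  have "mball \<omega> r \<subseteq> U \<longleftrightarrow> (\<forall>\<omega>'\<in>mspace (path_metric T D). mdist (path_metric T D) \<omega> \<omega>' < r \<longrightarrow> \<omega>' \<in> U)"
    if "\<omega> \<in> U" for \<omega> r
  proof -
    have "\<omega> \<in> mspace (path_metric T D)" using True that by blast
    then show ?thesis by (simp only: subset_iff in_mball) blast
  qed
  then show ?thesis
    unfolding mtopology_of_def openin_mtopology Ball_def using True by (simp cong: imp_cong conj_cong)
next
  case False
  then show ?thesis by (metis openin_subset topspace_mtopology_of)
qed

lemma mdist_path_le:
  assumes "T \<ge> 0" "\<omega> \<in> mspace (path_metric T D)" "\<omega>' \<in> mspace (path_metric T D)"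
  shows "mdist (path_metric T D) \<omega> \<omega>' \<le> r \<longleftrightarrow> (\<forall>t\<in>{0..T}. dist (\<omega> t) (\<omega>' t) \<le> r)"
  using assms cfunspace_mdist_le [of \<omega> "top_of_set {0..T}" "submetric euclidean_metric D" \<omega>' r]
  by (simp add: path_metric_def)

lemma measurable_eval_borel:
  assumes t: "t \<in> {0..T}"
  shows "(\<lambda>\<omega>. \<omega> t) \<in> Path T D \<rightarrow>\<^sub>M borel"
proof (rule borel_measurableI)
  fix S :: "'a set" assume S: "open S"
  let ?V = "(\<lambda>\<omega>. \<omega> t) -` S \<inter> space (Path T D)"
  note sp = space_Path_mspace [of T]
  have "openin (mtopology_of (path_metric T D)) ?V"
    unfolding openin_path
  proof (intro conjI ballI)
    fix \<omega> assume \<omega>: "\<omega> \<in> ?V"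
    then obtain r where r: "r > 0" "ball (\<omega> t) r \<subseteq> S" using S openE by blast
    show "\<exists>r>0. \<forall>\<omega>'\<in>mspace (path_metric T D). mdist (path_metric T D) \<omega> \<omega>' < r \<longrightarrow> \<omega>' \<in> ?V"
    proof (intro exI [of _ r] conjI ballI impI r(1))
      fix \<omega>' assume \<omega>': "\<omega>' \<in> mspace (path_metric T D)" "mdist (path_metric T D) \<omega> \<omega>' < r"
      have "dist (\<omega> t) (\<omega>' t) \<le> mdist (path_metric T D) \<omega> \<omega>'"
        using mdist_path_le [of T \<omega> \<omega>' "mdist (path_metric T D) \<omega> \<omega>'"] \<omega> \<omega>' t sp by auto
      then have "\<omega>' t \<in> ball (\<omega> t) r" using \<omega>'(2) by simp
      then show "\<omega>' \<in> ?V" using r(2) \<omega>'(1) sp by auto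
    qed
  qed (use sp in auto)
  then show "?V \<in> sets (Path T D)"
    unfolding Path_def sets_measure_of [OF path_openin_subset] by (intro sigma_sets.Basic) simp
qed

lemma measurable_eval:
  assumes t: "t \<in> {0..T}"
  shows "(\<lambda>\<omega>. \<omega> t) \<in> Path T D \<rightarrow>\<^sub>M mu D"
  unfolding measurable_to_mu_iff using measurable_eval_borel [OF t] path_in_D [OF _ t] by blast

text \<open>
  The Borel sets of the path space are generated by evaluations: up to an error of order \<open>1 / m\<close>,
  a path is determined by a grid level and a list of points from a finite net. There are only
  countably many such codes, and closeness to a code is a condition on countably many evaluations.
\<close>

lemma measurable_Path:
  assumes T: "T > 0" and f: "f \<in> space M \<rightarrow> space (Path T D)"
    and ev: "\<And>t. t \<in> {0..T} \<Longrightarrow> (\<lambda>x. f x t) \<in> M \<rightarrow>\<^sub>M borel"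
  shows "f \<in> M \<rightarrow>\<^sub>M Path T D"
proof -
  note sp = space_Path_mspace [of T]
  have "\<exists>K. finite K \<and> D \<subseteq> (\<Union>x\<in>K. ball x (inverse (2 * Suc m)))" for m
    using compact_D unfolding compact_eq_totally_bounded by simp
  then obtain K where K: "\<And>m. finite (K m)" "\<And>m. D \<subseteq> (\<Union>x\<in>K m. ball x (inverse (2 * Suc m)))"
    by metis
  define Q where "Q = {T * real i / 2 ^ n | i n. i \<le> 2 ^ n}"
  have Q: "countable Q" "Q \<subseteq> {0..T}"
  proof -
    have "Q \<subseteq> (\<lambda>(i, n). T * real i / 2 ^ n) ` UNIV" by (auto simp: Q_def)
    then show "countable Q" by (rule countable_subset) simp
    show "Q \<subseteq> {0..T}"
    proof
      fix t assume "t \<in> Q"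
      then obtain i n where t: "t = T * real i / 2 ^ n" "i \<le> 2 ^ n" by (auto simp: Q_def)
      have "real i \<le> 2 ^ n" using t(2) by (metis of_nat_le_iff of_nat_numeral of_nat_power)
      then have "T * real i \<le> T * 2 ^ n" using T by (intro mult_left_mono) auto
      then show "t \<in> {0..T}" using t(1) T by (auto simp: pos_divide_le_eq)
    qed
  qed
  define S where "S = (\<lambda>(m, n, L). {\<omega> \<in> space (Path T D). \<forall>t\<in>Q. dist (\<omega> t) (L ! grid_index T n t) \<le> inverse (Suc m)})"
  define C where "C = (UNIV :: nat set) \<times> (UNIV :: nat set) \<times> lists (\<Union>m. K m)"
  have "countable (\<Union>m. K m)" using K(1) by (intro countable_UN) (auto intro: countable_finite)
  then have C: "countable C" unfolding C_def by (intro countable_SIGMA) auto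
  have cover: "\<exists>n L. (m, n, L) \<in> C \<and> \<omega> \<in> S (m, n, L)" if \<omega>: "\<omega> \<in> space (Path T D)" for \<omega> and m :: nat
  proof -
    have "uniformly_continuous_on {0..T} \<omega>"
      using path_continuous [OF \<omega>] by (rule compact_uniformly_continuous) simp
    moreover have pos: "inverse (2 * real (Suc m)) > 0" by simp
    ultimately obtain h where h: "h > 0" "\<And>s t. s \<in> {0..T} \<Longrightarrow> t \<in> {0..T} \<Longrightarrow> dist t s < h \<Longrightarrow> dist (\<omega> t) (\<omega> s) < inverse (2 * real (Suc m))"
      unfolding uniformly_continuous_on_def by metis
    have "(\<lambda>n. T * (1/2) ^ n) \<longlonglongrightarrow> T * 0" by (intro tendsto_intros LIMSEQ_power_zero) simp
    then obtain n where n: "T * (1/2) ^ n < h"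
      using order_tendstoD(2) [of "\<lambda>n. T * (1/2) ^ n" 0 sequentially h] h(1) by (auto simp: eventually_sequentially)
    have "\<exists>x\<in>K m. dist x (\<omega> (T * real i / 2 ^ n)) < inverse (2 * Suc m)" if "i \<le> 2 ^ n" for i
    proof -
      have "T * real i / 2 ^ n \<in> Q" using that by (auto simp: Q_def)
      then have "\<omega> (T * real i / 2 ^ n) \<in> D" using Q(2) path_in_D [OF \<omega>] by blast
      then show ?thesis using K(2) [of m] by (auto simp: subset_iff)
    qed
    then obtain x where x: "\<And>i. i \<le> 2 ^ n \<Longrightarrow> x i \<in> K m" "\<And>i. i \<le> 2 ^ n \<Longrightarrow> dist (x i) (\<omega> (T * real i / 2 ^ n)) < inverse (2 * Suc m)"
      by metis
    define L where "L = map x [0..<Suc (2 ^ n)]"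
    have "set L \<subseteq> K m" using x(1) by (auto simp: L_def)
    then have "(m, n, L) \<in> C" by (auto simp: C_def)
    moreover have "\<omega> \<in> S (m, n, L)"
      unfolding S_def
    proof (clarsimp simp del: of_nat_Suc, intro conjI ballI \<omega>)
      fix t assume "t \<in> Q"
      then have t: "t \<in> {0..T}" using Q by blast
      let ?i = "grid_index T n t" and ?s = "T * real (grid_index T n t) / 2 ^ n"
      have i: "?i \<le> 2 ^ n" using t T by (intro grid_index_le) auto
      have "?s \<in> Q" using i by (auto simp: Q_def)
      then have s: "?s \<in> {0..T}" using Q by blast
      have "?s \<le> t" "t < T * real (Suc ?i) / 2 ^ n" using grid_index_bounds [OF T, of t n] t by auto
      moreover have "T * real (Suc ?i) / 2 ^ n = ?s + T * (1/2) ^ n"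
        by (simp add: power_one_over add_divide_distrib distrib_left inverse_eq_divide)
      ultimately have "dist t ?s < h" using n by (simp add: dist_real_def)
      then have "dist (\<omega> t) (\<omega> ?s) < inverse (2 * real (Suc m))" using h(2) s t by blast
      moreover have "dist (x ?i) (\<omega> ?s) < inverse (2 * Suc m)" using x(2) [OF i] .
      moreover have "L ! ?i = x ?i" using i unfolding L_def by (subst nth_map) (simp_all only: length_upt diff_zero less_Suc_eq_le nth_upt add_0)
      ultimately have "dist (\<omega> t) (L ! ?i) < inverse (2 * real (Suc m)) + inverse (2 * real (Suc m))"
        using dist_triangle2 [of "\<omega> t" "x ?i" "\<omega> ?s"] by simp
      also have "\<dots> = inverse (real (Suc m))" by (simp add: field_simps)
      finally show "dist (\<omega> t) (L ! ?i) \<le> inverse (real (Suc m))" by simp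
    qed
    ultimately show ?thesis by blast
  qed
  have diam: "mdist (path_metric T D) \<omega> \<omega>' \<le> 2 * inverse (Suc m)"
    if "\<omega> \<in> S (m, n, L)" "\<omega>' \<in> S (m, n, L)" for m n L \<omega> \<omega>'
  proof -
    have sp': "\<omega> \<in> space (Path T D)" "\<omega>' \<in> space (Path T D)" using that by (auto simp: S_def)
    have "dist (\<omega> t) (\<omega>' t) \<le> 2 * inverse (Suc m)" if t: "t \<in> {0..T}" for t
    proof (rule tendsto_le)
      let ?s = "\<lambda>k. T * real (grid_index T k t) / 2 ^ k"
      have sQ: "?s k \<in> Q" for k using t T grid_index_le [of T t k] by (auto simp: Q_def)
      have "(\<lambda>k. \<omega> (?s k)) \<longlonglongrightarrow> \<omega> t" "(\<lambda>k. \<omega>' (?s k)) \<longlonglongrightarrow> \<omega>' t"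
        using sQ Q(2) t T path_continuous [OF sp'(1)] path_continuous [OF sp'(2)]
        by (auto intro!: continuous_on_tendsto_compose [of "{0..T}" _ ?s] grid_tendsto always_eventually)
      then show "(\<lambda>k. dist (\<omega> (?s k)) (\<omega>' (?s k))) \<longlonglongrightarrow> dist (\<omega> t) (\<omega>' t)" by (rule tendsto_dist)
      have "dist (\<omega> (?s k)) (\<omega>' (?s k)) \<le> 2 * inverse (Suc m)" for k
      proof -
        have "dist (\<omega> (?s k)) (L ! grid_index T n (?s k)) \<le> inverse (Suc m)"
          "dist (\<omega>' (?s k)) (L ! grid_index T n (?s k)) \<le> inverse (Suc m)"
          using that sQ [of k] \<open>\<omega> \<in> S (m, n, L)\<close> \<open>\<omega>' \<in> S (m, n, L)\<close> by (auto simp: S_def)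
        then show ?thesis using dist_triangle2 [of "\<omega> (?s k)" "\<omega>' (?s k)" "L ! grid_index T n (?s k)"] by linarith
      qed
      then show "\<forall>\<^sub>F k in sequentially. dist (\<omega> (?s k)) (\<omega>' (?s k)) \<le> 2 * inverse (Suc m)" by simp
    qed auto
    then show ?thesis using mdist_path_le [of T \<omega> \<omega>'] T sp' sp by simp
  qed
  have Sm: "f -` S (m, n, L) \<inter> space M \<in> sets M" for m n L
  proof -
    have "f -` S (m, n, L) \<inter> space M = {x \<in> space M. \<forall>t\<in>Q. dist (f x t) (L ! grid_index T n t) \<le> inverse (Suc m)}"
      using f by (auto simp: S_def)
    also have "\<dots> \<in> sets M"
    proof (rule sets.sets_Collect_countable_All' [OF _ Q(1)])
      fix t assume "t \<in> Q"
      then have [measurable]: "(\<lambda>x. f x t) \<in> M \<rightarrow>\<^sub>M borel" using ev Q(2) by blast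
      show "{x \<in> space M. dist (f x t) (L ! grid_index T n t) \<le> inverse (Suc m)} \<in> sets M" by measurable
    qed
    finally show ?thesis .
  qed
  show ?thesis
    unfolding Path_def
  proof (rule measurable_measure_of [OF path_openin_subset])
    show "f \<in> space M \<rightarrow> mspace (path_metric T D)" using f sp by simp
    fix U assume "U \<in> {U. openin (mtopology_of (path_metric T D)) U}"
    then have U: "openin (mtopology_of (path_metric T D)) U" by simp
    have "U = (\<Union>\<kappa>\<in>{\<kappa>\<in>C. S \<kappa> \<subseteq> U}. S \<kappa>)"
    proof
      show "U \<subseteq> (\<Union>\<kappa>\<in>{\<kappa>\<in>C. S \<kappa> \<subseteq> U}. S \<kappa>)"
      proof
        fix \<omega> assume \<omega>: "\<omega> \<in> U"
        then obtain r where r: "r > 0" "\<And>\<omega>'. \<omega>' \<in> mspace (path_metric T D) \<Longrightarrow> mdist (path_metric T D) \<omega> \<omega>' < r \<Longrightarrow> \<omega>' \<in> U"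
          using U unfolding openin_path by blast
        have \<omega>sp: "\<omega> \<in> space (Path T D)" using U \<omega> sp unfolding openin_path by blast
        obtain m where m: "inverse (real (Suc m)) < r / 2" using reals_Archimedean [of "r / 2"] r(1) by auto
        obtain n L where nL: "(m, n, L) \<in> C" "\<omega> \<in> S (m, n, L)" using cover [OF \<omega>sp] by blast
        have "S (m, n, L) \<subseteq> U"
        proof
          fix \<omega>' assume \<omega>': "\<omega>' \<in> S (m, n, L)"
          then have "\<omega>' \<in> mspace (path_metric T D)" using sp by (auto simp: S_def)
          moreover have "mdist (path_metric T D) \<omega> \<omega>' < r" using diam [OF nL(2) \<omega>'] m by simp
          ultimately show "\<omega>' \<in> U" using r(2) by blast
        qed
        then show "\<omega> \<in> (\<Union>\<kappa>\<in>{\<kappa>\<in>C. S \<kappa> \<subseteq> U}. S \<kappa>)" using nL by blast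
      qed
    qed blast
    then have "f -` U \<inter> space M = (\<Union>\<kappa>\<in>{\<kappa>\<in>C. S \<kappa> \<subseteq> U}. f -` S \<kappa> \<inter> space M)" by blast
    also have "\<dots> \<in> sets M"
    proof (rule sets.countable_UN')
      show "countable {\<kappa>\<in>C. S \<kappa> \<subseteq> U}" using C by (rule countable_subset [rotated]) auto
      show "(\<lambda>\<kappa>. f -` S \<kappa> \<inter> space M) ` {\<kappa>\<in>C. S \<kappa> \<subseteq> U} \<subseteq> sets M" using Sm by auto
    qed
    finally show "f -` U \<inter> space M \<in> sets M" .
  qed
qed

lemma path_action_eq:
  assumes "T > 0" "\<omega> \<in> space (Path T D)"
  shows "path_action T \<omega> = (SUP n. ennreal (dyadic_energy T \<omega> n))"
  by (rule path_action_eq_SUP_dyadic_energy [OF assms(1) path_continuous [OF assms(2)] metric_speed_AE])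

lemma dyadic_point_in: "T > 0 \<Longrightarrow> i \<le> 2 ^ n \<Longrightarrow> T * real i / 2 ^ n \<in> {0..T}"
proof -
  assume T: "T > 0" and i: "i \<le> 2 ^ n"
  have "real i \<le> 2 ^ n" using i by (metis of_nat_le_iff of_nat_numeral of_nat_power)
  then have "T * real i \<le> T * 2 ^ n" using T by (intro mult_left_mono) auto
  then show ?thesis using T by (auto simp: pos_divide_le_eq)
qed

lemma measurable_dyadic_energy:
  assumes T: "T > 0"
  shows "(\<lambda>\<omega>. dyadic_energy T \<omega> n) \<in> borel_measurable (Path T D)"
proof -
  have "(\<lambda>\<omega>. dist (\<omega> (T * real i / 2 ^ n)) (\<omega> (T * real (Suc i) / 2 ^ n))) \<in> borel_measurable (Path T D)" if "i < 2 ^ n" for i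
    by (intro borel_measurable_dist measurable_eval_borel dyadic_point_in T) (use that in auto)
  then show ?thesis
    unfolding dyadic_energy_def by (intro borel_measurable_times borel_measurable_const borel_measurable_sum borel_measurable_power) auto
qed

lemma measurable_path_action:
  assumes T: "T > 0"
  shows "path_action T \<in> borel_measurable (Path T D)"
proof -
  have "(\<lambda>\<omega>. SUP n. ennreal (dyadic_energy T \<omega> n)) \<in> borel_measurable (Path T D)"
    using measurable_dyadic_energy [OF T] by measurable
  then show ?thesis by (subst measurable_cong [OF path_action_eq [OF T]])
qed

subsection \<open>Flows given by kernels\<close>

text \<open>
  The disintegrations in the definition of a flow are unique up to null sets, so that the conditions
  on them amount to conditions on joint laws. This lemma and the next one are the only passages
  between the two descriptions.
\<close>

lemma flow_of_kernel:
  assumes T: "T > 0" and k: "k \<in> mu D \<rightarrow>\<^sub>M prob_algebra (Path T D)"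
    and F: "prob_space F" "sets F = sets (Path T D \<Otimes>\<^sub>M mu D)"
    and dis: "\<And>f. f \<in> borel_measurable (mu D \<Otimes>\<^sub>M Path T D) \<Longrightarrow>
      (\<integral>\<^sup>+z. f (snd z, fst z) \<partial>F) = (\<integral>\<^sup>+a. \<integral>\<^sup>+\<omega>. f (a, \<omega>) \<partial>k a \<partial>mu D)"
    and inc: "\<And>t. t \<in> {0..T} \<Longrightarrow> distr F (mu D) (\<lambda>z. fst z t) = mu D"
    and \<eta>: "distr F (mu2 D) (\<lambda>z. (snd z, fst z 0)) = \<eta>"
    and \<gamma>: "distr F (mu2 D) (\<lambda>z. (snd z, fst z T)) = \<gamma>"
  shows "F \<in> connecting_flows T D \<eta> \<gamma>"
proof -
  note [measurable_cong] = F(2)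
  have km [measurable]: "k \<in> mu D \<rightarrow>\<^sub>M subprob_algebra (Path T D)" using k by (rule measurable_prob_algebraD)
  have kp: "prob_space (k a)" "sets (k a) = sets (Path T D)" if "a \<in> space (mu D)" for a
    using measurable_space [OF k that] by (auto simp: space_prob_algebra)
  have mu_in: "mu D \<in> space (prob_algebra (mu D))" using prob_mu by (simp add: space_prob_algebra)
  have swap [measurable]: "(\<lambda>(\<omega>, a). (a, \<omega>)) \<in> F \<rightarrow>\<^sub>M mu D \<Otimes>\<^sub>M Path T D" by measurable
  have ev: "(\<lambda>z. fst z t) \<in> F \<rightarrow>\<^sub>M mu D" if "t \<in> {0..T}" for t
    unfolding measurable_cong_sets [OF F(2) refl] by (rule measurable_compose [OF measurable_fst measurable_eval [OF that]])
  have pr: "(\<lambda>z. (snd z, fst z t)) \<in> F \<rightarrow>\<^sub>M mu2 D" if "t \<in> {0..T}" for t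
    by (intro measurable_Pair ev that) measurable
  have pd: "path_disintegration T D k F"
    unfolding path_disintegration_def disintegration_def
  proof (intro conjI ballI k)
    fix f :: "'a \<times> (real \<Rightarrow> 'a) \<Rightarrow> ennreal" assume [measurable]: "f \<in> borel_measurable (mu D \<Otimes>\<^sub>M Path T D)"
    show "(\<integral>\<^sup>+z. f z \<partial>distr F (mu D \<Otimes>\<^sub>M Path T D) (\<lambda>(\<omega>, a). (a, \<omega>))) = (\<integral>\<^sup>+a. \<integral>\<^sup>+x. f (a, x) \<partial>k a \<partial>mu D)"
      by (subst nn_integral_distr) (auto simp: dis [symmetric] case_prod_unfold)
  qed simp
  have kdistr: "(\<lambda>a. distr (k a) (mu D) (\<lambda>\<omega>. \<omega> t)) \<in> mu D \<rightarrow>\<^sub>M prob_algebra (mu D)" if "t \<in> {0..T}" for t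
    by (rule measurable_distr_prob_space2 [OF k]) (use measurable_eval [OF that] in measurable)
  have inner: "(\<integral>\<^sup>+x. f (a, x) \<partial>distr (k a) (mu D) (\<lambda>\<omega>. \<omega> t)) = (\<integral>\<^sup>+\<omega>. f (a, \<omega> t) \<partial>k a)"
    if "t \<in> {0..T}" "a \<in> space (mu D)" "f \<in> borel_measurable (mu2 D)" for f :: "'a \<times> 'a \<Rightarrow> ennreal" and a t
  proof (rule nn_integral_distr)
    show "(\<lambda>\<omega>. \<omega> t) \<in> k a \<rightarrow>\<^sub>M mu D"
      using measurable_eval [OF that(1)] by (simp add: measurable_cong_sets [OF kp(2) [OF that(2)] refl])
    show "(\<lambda>x. f (a, x)) \<in> borel_measurable (distr (k a) (mu D) (\<lambda>\<omega>. \<omega> t))"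
      using measurable_Pair2 [OF that(3) that(2)] by simp
  qed
  have joint: "disintegration (mu D) (mu D) (\<lambda>a. distr (k a) (mu D) (\<lambda>\<omega>. \<omega> t)) (distr F (mu2 D) (\<lambda>z. (snd z, fst z t)))"
    if t: "t \<in> {0..T}" for t
    unfolding disintegration_def
  proof (intro conjI ballI kdistr t)
    fix f :: "'a \<times> 'a \<Rightarrow> ennreal" assume f [measurable]: "f \<in> borel_measurable (mu2 D)"
    note [measurable] = measurable_eval [OF t]
    have "(\<integral>\<^sup>+z. f z \<partial>distr F (mu2 D) (\<lambda>z. (snd z, fst z t))) = (\<integral>\<^sup>+z. f (snd z, fst z t) \<partial>F)"
      by (rule nn_integral_distr [OF pr [OF t]]) simp
    also have "\<dots> = (\<integral>\<^sup>+a. \<integral>\<^sup>+\<omega>. f (a, \<omega> t) \<partial>k a \<partial>mu D)"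
      using dis [of "\<lambda>(a, \<omega>). f (a, \<omega> t)"] by simp
    also have "\<dots> = (\<integral>\<^sup>+a. \<integral>\<^sup>+x. f (a, x) \<partial>distr (k a) (mu D) (\<lambda>\<omega>. \<omega> t) \<partial>mu D)"
      by (intro nn_integral_cong inner [symmetric] t f)
    finally show "(\<integral>\<^sup>+z. f z \<partial>distr F (mu2 D) (\<lambda>z. (snd z, fst z t))) = (\<integral>\<^sup>+a. \<integral>\<^sup>+x. f (a, x) \<partial>distr (k a) (mu D) (\<lambda>\<omega>. \<omega> t) \<partial>mu D)" .
  qed simp
  have bind: "mu D \<bind> (\<lambda>a. distr (k a) (mu D) (\<lambda>\<omega>. \<omega> t)) = mu D" if t: "t \<in> {0..T}" for t
  proof (rule measure_eqI)
    show sets: "sets (mu D \<bind> (\<lambda>a. distr (k a) (mu D) (\<lambda>\<omega>. \<omega> t))) = sets (mu D)"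
      by (rule sets_bind' [OF mu_in kdistr [OF t]])
    fix A assume "A \<in> sets (mu D \<bind> (\<lambda>a. distr (k a) (mu D) (\<lambda>\<omega>. \<omega> t)))"
    then have A [measurable]: "A \<in> sets (mu D)" using sets by simp
    note [measurable] = measurable_eval [OF t]
    have "emeasure (mu D \<bind> (\<lambda>a. distr (k a) (mu D) (\<lambda>\<omega>. \<omega> t))) A = (\<integral>\<^sup>+a. emeasure (distr (k a) (mu D) (\<lambda>\<omega>. \<omega> t)) A \<partial>mu D)"
      by (rule emeasure_bind_prob_algebra [OF mu_in kdistr [OF t] A])
    also have "\<dots> = (\<integral>\<^sup>+a. \<integral>\<^sup>+x. indicator A (snd (a, x)) \<partial>distr (k a) (mu D) (\<lambda>\<omega>. \<omega> t) \<partial>mu D)"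
      by (intro nn_integral_cong) simp
    also have "\<dots> = (\<integral>\<^sup>+a. \<integral>\<^sup>+\<omega>. indicator A (\<omega> t) \<partial>k a \<partial>mu D)"
      by (intro nn_integral_cong) (simp add: inner [OF t, of _ "\<lambda>z. indicator A (snd z)", simplified])
    also have "\<dots> = (\<integral>\<^sup>+z. indicator A (fst z t) \<partial>F)"
      using dis [of "\<lambda>(a, \<omega>). indicator A (\<omega> t)"] by simp
    also have "\<dots> = (\<integral>\<^sup>+x. indicator A x \<partial>distr F (mu D) (\<lambda>z. fst z t))"
      by (rule nn_integral_distr [OF ev [OF t], symmetric]) (simp add: A)
    also have "\<dots> = emeasure (mu D) A" by (simp add: inc [OF t])
    finally show "emeasure (mu D \<bind> (\<lambda>a. distr (k a) (mu D) (\<lambda>\<omega>. \<omega> t))) A = emeasure (mu D) A" .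
  qed
  have snd: "distr F (mu D) snd = mu D"
  proof (rule nn_integral_measure_eqI)
    fix f :: "'a \<Rightarrow> ennreal" assume "f \<in> borel_measurable (distr F (mu D) snd)"
    then have [measurable]: "f \<in> borel_measurable (mu D)" by simp
    have "(\<integral>\<^sup>+x. f x \<partial>distr F (mu D) snd) = (\<integral>\<^sup>+z. f (snd z) \<partial>F)"
      by (rule nn_integral_distr) measurable
    also have "\<dots> = (\<integral>\<^sup>+a. \<integral>\<^sup>+\<omega>. f a \<partial>k a \<partial>mu D)"
      using dis [of "\<lambda>(a, \<omega>). f a"] by simp
    also have "\<dots> = (\<integral>\<^sup>+a. f a \<partial>mu D)"
      by (intro nn_integral_cong) (simp add: prob_space.emeasure_space_1 [OF kp(1)])
    finally show "(\<integral>\<^sup>+x. f x \<partial>distr F (mu D) snd) = (\<integral>\<^sup>+x. f x \<partial>mu D)" .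
  qed simp
  have "incompressible_flow T D F"
    unfolding incompressible_flow_def using F snd pd bind by (auto simp: space_prob_algebra)
  moreover have "connects T D F \<eta> \<gamma>"
    unfolding connects_def
  proof (intro exI conjI)
    show "path_disintegration T D k F" by (rule pd)
    show "disintegration (mu D) (mu D) (\<lambda>a. distr (k a) (mu D) (\<lambda>\<omega>. \<omega> 0)) \<eta>"
      using joint [of 0] T \<eta> by simp
    show "disintegration (mu D) (mu D) (\<lambda>a. distr (k a) (mu D) (\<lambda>\<omega>. \<omega> T)) \<gamma>"
      using joint [of T] T \<gamma> by simp
  qed simp
  ultimately show ?thesis by (simp add: connecting_flows_def)
qed

lemma connecting_flowD:
  assumes T: "T > 0" and F: "F \<in> connecting_flows T D \<eta> \<gamma>"
  shows "prob_space F" "sets F = sets (Path T D \<Otimes>\<^sub>M mu D)"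
    and "\<exists>k. k \<in> mu D \<rightarrow>\<^sub>M prob_algebra (Path T D) \<and> (\<forall>f\<in>borel_measurable (mu D \<Otimes>\<^sub>M Path T D).
      (\<integral>\<^sup>+z. f (snd z, fst z) \<partial>F) = (\<integral>\<^sup>+a. \<integral>\<^sup>+\<omega>. f (a, \<omega>) \<partial>k a \<partial>mu D))"
    and "\<And>t. t \<in> {0..T} \<Longrightarrow> distr F (mu D) (\<lambda>z. fst z t) = mu D"
    and "distr F (mu D) snd = mu D"
    and "distr F (mu2 D) (\<lambda>z. (snd z, fst z 0)) = \<eta>"
    and "distr F (mu2 D) (\<lambda>z. (snd z, fst z T)) = \<gamma>"
proof -
  show F1: "prob_space F" and F2 [measurable_cong]: "sets F = sets (Path T D \<Otimes>\<^sub>M mu D)" and "distr F (mu D) snd = mu D"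
    using F by (auto simp: connecting_flows_def incompressible_flow_def space_prob_algebra)
  have mu_in: "mu D \<in> space (prob_algebra (mu D))" using prob_mu by (simp add: space_prob_algebra)
  have swap [measurable]: "(\<lambda>(\<omega>, a). (a, \<omega>)) \<in> F \<rightarrow>\<^sub>M mu D \<Otimes>\<^sub>M Path T D" by measurable
  have ev: "(\<lambda>z. fst z t) \<in> F \<rightarrow>\<^sub>M mu D" if "t \<in> {0..T}" for t
    unfolding measurable_cong_sets [OF F2 refl] by (rule measurable_compose [OF measurable_fst measurable_eval [OF that]])
  have pr: "(\<lambda>z. (snd z, fst z t)) \<in> F \<rightarrow>\<^sub>M mu2 D" if "t \<in> {0..T}" for t
    by (intro measurable_Pair ev that) measurable
  have dis: "(\<integral>\<^sup>+z. f (snd z, fst z) \<partial>F) = (\<integral>\<^sup>+a. \<integral>\<^sup>+\<omega>. f (a, \<omega>) \<partial>k a \<partial>mu D)"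
    if "path_disintegration T D k F" and f [measurable]: "f \<in> borel_measurable (mu D \<Otimes>\<^sub>M Path T D)" for k f
  proof -
    have "(\<integral>\<^sup>+z. f z \<partial>distr F (mu D \<Otimes>\<^sub>M Path T D) (\<lambda>(\<omega>, a). (a, \<omega>))) = (\<integral>\<^sup>+z. f (snd z, fst z) \<partial>F)"
      by (subst nn_integral_distr) (auto simp: case_prod_unfold)
    then show ?thesis using that unfolding path_disintegration_def disintegration_def by simp
  qed
  have km: "k \<in> mu D \<rightarrow>\<^sub>M prob_algebra (Path T D)" if "path_disintegration T D k F" for k
    using that by (simp add: path_disintegration_def disintegration_def)
  obtain k where k: "path_disintegration T D k F" "\<And>t. t \<in> {0..T} \<Longrightarrow> mu D \<bind> (\<lambda>a. distr (k a) (mu D) (\<lambda>\<omega>. \<omega> t)) = mu D"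
    using F by (auto simp: connecting_flows_def incompressible_flow_def)
  show "\<exists>k. k \<in> mu D \<rightarrow>\<^sub>M prob_algebra (Path T D) \<and> (\<forall>f\<in>borel_measurable (mu D \<Otimes>\<^sub>M Path T D).
      (\<integral>\<^sup>+z. f (snd z, fst z) \<partial>F) = (\<integral>\<^sup>+a. \<integral>\<^sup>+\<omega>. f (a, \<omega>) \<partial>k a \<partial>mu D))"
    using km [OF k(1)] dis [OF k(1)] by blast
  have inner: "(\<integral>\<^sup>+x. f (a, x) \<partial>distr (k a) (mu D) (\<lambda>\<omega>. \<omega> t)) = (\<integral>\<^sup>+\<omega>. f (a, \<omega> t) \<partial>k a)"
    if "path_disintegration T D k F" "t \<in> {0..T}" "a \<in> space (mu D)" "f \<in> borel_measurable (mu2 D)" for f :: "'a \<times> 'a \<Rightarrow> ennreal" and a t k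
  proof (rule nn_integral_distr)
    have ks: "sets (k a) = sets (Path T D)" using measurable_space [OF km [OF that(1)] that(3)] by (simp add: space_prob_algebra)
    show "(\<lambda>\<omega>. \<omega> t) \<in> k a \<rightarrow>\<^sub>M mu D"
      unfolding measurable_cong_sets [OF ks refl] by (rule measurable_eval [OF that(2)])
    show "(\<lambda>x. f (a, x)) \<in> borel_measurable (distr (k a) (mu D) (\<lambda>\<omega>. \<omega> t))"
      using measurable_Pair2 [OF that(4) that(3)] by simp
  qed
  show "distr F (mu D) (\<lambda>z. fst z t) = mu D" if t: "t \<in> {0..T}" for t
  proof (rule measure_eqI)
    fix A assume "A \<in> sets (distr F (mu D) (\<lambda>z. fst z t))"
    then have A [measurable]: "A \<in> sets (mu D)" by simp
    note [measurable] = measurable_eval [OF t]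
    have kdistr: "(\<lambda>a. distr (k a) (mu D) (\<lambda>\<omega>. \<omega> t)) \<in> mu D \<rightarrow>\<^sub>M prob_algebra (mu D)"
      by (rule measurable_distr_prob_space2 [OF km [OF k(1)]]) measurable
    have "emeasure (distr F (mu D) (\<lambda>z. fst z t)) A = (\<integral>\<^sup>+x. indicator A x \<partial>distr F (mu D) (\<lambda>z. fst z t))" by simp
    also have "\<dots> = (\<integral>\<^sup>+z. indicator A (fst z t) \<partial>F)"
      by (rule nn_integral_distr [OF ev [OF t]]) (simp add: A)
    also have "\<dots> = (\<integral>\<^sup>+a. \<integral>\<^sup>+\<omega>. indicator A (\<omega> t) \<partial>k a \<partial>mu D)"
      using dis [OF k(1), of "\<lambda>(a, \<omega>). indicator A (\<omega> t)"] by simp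
    also have "\<dots> = (\<integral>\<^sup>+a. \<integral>\<^sup>+x. indicator A (snd (a, x)) \<partial>distr (k a) (mu D) (\<lambda>\<omega>. \<omega> t) \<partial>mu D)"
      by (intro nn_integral_cong) (simp add: inner [OF k(1) t, of _ "\<lambda>z. indicator A (snd z)", simplified])
    also have "\<dots> = (\<integral>\<^sup>+a. emeasure (distr (k a) (mu D) (\<lambda>\<omega>. \<omega> t)) A \<partial>mu D)"
      by (intro nn_integral_cong) simp
    also have "\<dots> = emeasure (mu D \<bind> (\<lambda>a. distr (k a) (mu D) (\<lambda>\<omega>. \<omega> t))) A"
      by (rule emeasure_bind_prob_algebra [OF mu_in kdistr A, symmetric])
    finally show "emeasure (distr F (mu D) (\<lambda>z. fst z t)) A = emeasure (mu D) A" by (simp add: k(2) [OF t])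
  qed simp
  obtain k k0 k1 where c: "path_disintegration T D k F" "disintegration (mu D) (mu D) k0 \<eta>" "disintegration (mu D) (mu D) k1 \<gamma>"
    "AE a in mu D. distr (k a) (mu D) (\<lambda>\<omega>. \<omega> 0) = k0 a \<and> distr (k a) (mu D) (\<lambda>\<omega>. \<omega> T) = k1 a"
    using F by (auto simp: connecting_flows_def connects_def)
  have joint: "distr F (mu2 D) (\<lambda>z. (snd z, fst z t)) = \<theta>"
    if t: "t \<in> {0..T}" and j: "disintegration (mu D) (mu D) j \<theta>" and eq: "AE a in mu D. distr (k a) (mu D) (\<lambda>\<omega>. \<omega> t) = j a" for t j \<theta>
  proof (rule nn_integral_measure_eqI)
    note [measurable] = measurable_eval [OF t]
    fix f :: "'a \<times> 'a \<Rightarrow> ennreal" assume "f \<in> borel_measurable (distr F (mu2 D) (\<lambda>z. (snd z, fst z t)))"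
    then have f [measurable]: "f \<in> borel_measurable (mu2 D)" by simp
    have "(\<integral>\<^sup>+z. f z \<partial>distr F (mu2 D) (\<lambda>z. (snd z, fst z t))) = (\<integral>\<^sup>+z. f (snd z, fst z t) \<partial>F)"
      by (rule nn_integral_distr [OF pr [OF t]]) simp
    also have "\<dots> = (\<integral>\<^sup>+a. \<integral>\<^sup>+\<omega>. f (a, \<omega> t) \<partial>k a \<partial>mu D)"
      using dis [OF c(1), of "\<lambda>(a, \<omega>). f (a, \<omega> t)"] by simp
    also have "\<dots> = (\<integral>\<^sup>+a. \<integral>\<^sup>+x. f (a, x) \<partial>distr (k a) (mu D) (\<lambda>\<omega>. \<omega> t) \<partial>mu D)"
      by (intro nn_integral_cong inner [symmetric] c(1) t f)
    also have "\<dots> = (\<integral>\<^sup>+a. \<integral>\<^sup>+x. f (a, x) \<partial>j a \<partial>mu D)"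
      by (rule nn_integral_cong_AE) (use eq in \<open>eventually_elim, simp\<close>)
    also have "\<dots> = (\<integral>\<^sup>+z. f z \<partial>\<theta>)" using j f unfolding disintegration_def by simp
    finally show "(\<integral>\<^sup>+z. f z \<partial>distr F (mu2 D) (\<lambda>z. (snd z, fst z t))) = (\<integral>\<^sup>+z. f z \<partial>\<theta>)" .
  qed (use j in \<open>simp add: disintegration_def\<close>)
  show "distr F (mu2 D) (\<lambda>z. (snd z, fst z 0)) = \<eta>"
    by (rule joint [OF _ c(2)]) (use T c(4) in auto)
  show "distr F (mu2 D) (\<lambda>z. (snd z, fst z T)) = \<gamma>"
    by (rule joint [OF _ c(3)]) (use T c(4) in auto)
qed

end

section \<open>Randomisation\<close>

definition noise :: "real measure"
  where "noise = uniform_measure lborel {0..1}"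

lemma sets_noise [simp, measurable_cong]: "sets noise = sets borel"
  by (simp add: noise_def)

lemma space_noise [simp]: "space noise = UNIV"
  by (simp add: noise_def)

lemma prob_space_noise: "prob_space noise"
  unfolding noise_def by (rule prob_space_uniform_measure) simp_all

lemma emeasure_noise_lessThan: "emeasure noise {u. ennreal u < c} = min 1 c"
proof -
  have "{0..1} \<inter> {u. ennreal u < c} = (if c \<le> 1 then {0..<enn2real c} else {0..1})"
  proof (cases "c \<le> 1")
    case True
    then obtain r where r: "c = ennreal r" "0 \<le> r" "r \<le> 1"
      by (cases c) (auto simp: top_unique)
    then show ?thesis using True by (auto simp: ennreal_less_iff)
  next
    case False
    have "ennreal u < c" if "u \<le> 1" for u
    proof -
      have "ennreal u \<le> 1" using that by (simp add: ennreal_le_1)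
      then show ?thesis using False by (meson le_less_trans not_le_imp_less)
    qed
    then show ?thesis using False by auto
  qed
  moreover have "emeasure noise {u. ennreal u < c} = emeasure lborel ({0..1} \<inter> {u. ennreal u < c}) / emeasure lborel {0..1::real}"
    unfolding noise_def by (rule emeasure_uniform_measure) auto
  moreover have "emeasure lborel (if c \<le> 1 then {0..<enn2real c} else {0..1}) = min 1 c"
  proof (cases "c \<le> 1")
    case True
    then have "c < top" by (auto simp: less_top[symmetric] top_unique)
    then show ?thesis using True by (simp add: min_absorb2)
  qed (simp add: min_absorb1)
  ultimately show ?thesis by (simp add: divide_ennreal_def)
qed

lemma AE_eq_if_AE_le_nn_integral_ge:
  assumes [measurable]: "f \<in> borel_measurable M" "g \<in> borel_measurable M"
    and le: "AE x in M. f x \<le> g x" and ge: "(\<integral>\<^sup>+x. g x \<partial>M) \<le> (\<integral>\<^sup>+x. f x \<partial>M)" and fin: "(\<integral>\<^sup>+x. f x \<partial>M) < \<infinity>"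
  shows "AE x in M. f x = g x"
proof -
  have "(\<integral>\<^sup>+x. g x - f x \<partial>M) = (\<integral>\<^sup>+x. g x \<partial>M) - (\<integral>\<^sup>+x. f x \<partial>M)"
    using le fin by (intro nn_integral_diff) auto
  also have "\<dots> = 0" using ge order_le_less_trans [OF ge fin] by (simp add: diff_eq_0_ennreal)
  finally have "AE x in M. g x - f x = 0" by (subst (asm) nn_integral_0_iff_AE) auto
  moreover have "AE x in M. f x \<noteq> \<infinity>" using fin by (intro nn_integral_noteq_infinite) auto
  ultimately show ?thesis using le
  proof eventually_elim
    case (elim x)
    then show ?case by (metis antisym diff_gt_0_iff_gt_ennreal infinity_ennreal_def not_gr_zero not_less)
  qed
qed

text \<open>
  This makes the densities of the conditional probabilities monotone in the threshold.
\<close>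

lemma AE_le_densities:
  assumes fin: "finite_measure M" and [measurable]: "f \<in> borel_measurable M" "g \<in> borel_measurable M"
    and le: "\<And>B. B \<in> sets M \<Longrightarrow> (\<integral>\<^sup>+x\<in>B. f x \<partial>M) \<le> (\<integral>\<^sup>+x\<in>B. g x \<partial>M)" and g: "(\<integral>\<^sup>+x. g x \<partial>M) < \<infinity>"
  shows "AE x in M. f x \<le> g x"
proof -
  let ?E = "{x\<in>space M. g x < f x}"
  have E [measurable]: "?E \<in> sets M" by measurable
  have "(\<integral>\<^sup>+x. max (f x) (g x) \<partial>M) = (\<integral>\<^sup>+x. f x * indicator ?E x + g x * indicator (space M - ?E) x \<partial>M)"
    by (intro nn_integral_cong) (auto simp: indicator_def max_def not_less)
  also have "\<dots> = (\<integral>\<^sup>+x\<in>?E. f x \<partial>M) + (\<integral>\<^sup>+x\<in>space M - ?E. g x \<partial>M)"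
    by (rule nn_integral_add) auto
  also have "\<dots> \<le> (\<integral>\<^sup>+x\<in>?E. g x \<partial>M) + (\<integral>\<^sup>+x\<in>space M - ?E. g x \<partial>M)"
    by (intro add_right_mono le E)
  also have "\<dots> = (\<integral>\<^sup>+x. g x * indicator ?E x + g x * indicator (space M - ?E) x \<partial>M)"
    by (rule nn_integral_add [symmetric]) auto
  also have "\<dots> = (\<integral>\<^sup>+x. g x \<partial>M)"
    by (intro nn_integral_cong) (auto simp: indicator_def)
  finally have "(\<integral>\<^sup>+x. max (f x) (g x) \<partial>M) \<le> (\<integral>\<^sup>+x. g x \<partial>M)" .
  then have "AE x in M. g x = max (f x) (g x)"
    by (intro AE_eq_if_AE_le_nn_integral_ge g) auto
  then show ?thesis by eventually_elim (metis max.cobounded1)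
qed

text \<open>
  Every joint law of a label and a real variable is the law of the label together with a function of
  the label and independent noise: the function is the conditional upper quantile function. It is
  built from the conditional probabilities that the variable exceeds a rational number, which are
  Radon-Nikodym densities.
\<close>

lemma noise_representation_real:
  assumes N: "prob_space N" and A [measurable]: "A \<in> N \<rightarrow>\<^sub>M M" and Y [measurable]: "Y \<in> borel_measurable N"
    and Y01: "\<And>z. z \<in> space N \<Longrightarrow> 0 \<le> Y z \<and> Y z \<le> (1::real)"
  obtains Q where "Q \<in> borel_measurable (M \<Otimes>\<^sub>M noise)"
    "distr N (M \<Otimes>\<^sub>M borel) (\<lambda>z. (A z, Y z)) = distr (distr N M A \<Otimes>\<^sub>M noise) (M \<Otimes>\<^sub>M borel) (\<lambda>(a, u). (a, Q (a, u)))"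
proof -
  interpret N: prob_space N by fact
  define \<mu> where "\<mu> = distr N M A"
  have sets_\<mu> [simp, measurable_cong]: "sets \<mu> = sets M" by (simp add: \<mu>_def)
  have space_\<mu>: "space \<mu> = space M" by (simp add: \<mu>_def)
  interpret \<mu>: prob_space \<mu> unfolding \<mu>_def by (rule N.prob_space_distr) simp
  interpret U: prob_space noise by (rule prob_space_noise)
  interpret P: pair_prob_space \<mu> noise ..
  have SY [simp]: "{z\<in>space N. x < Y z} \<in> sets N" for x by measurable
  have SA [simp]: "{z\<in>space N. A z \<in> B} \<in> sets N" if "B \<in> sets M" for B
    using measurable_sets [OF A that] by (simp add: vimage_def Int_def conj_commute)
  have SAY [simp]: "{z\<in>space N. A z \<in> B \<and> x < Y z} \<in> sets N" if "B \<in> sets M" for B x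
    using sets.Int [OF SA [OF that] SY [of x]] by (simp add: Int_def conj_ac cong: conj_cong)
  define \<nu> where "\<nu> x = distr (density N (indicator {z\<in>space N. x < Y z})) M A" for x :: real
  have sets_\<nu> [simp]: "sets (\<nu> x) = sets M" for x by (simp add: \<nu>_def)
  have \<nu>: "emeasure (\<nu> x) B = emeasure N {z\<in>space N. A z \<in> B \<and> x < Y z}" if B: "B \<in> sets M" for x B
  proof -
    have "emeasure (\<nu> x) B = (\<integral>\<^sup>+z. indicator {z\<in>space N. x < Y z} z * indicator (A -` B \<inter> space N) z \<partial>N)"
      using B unfolding \<nu>_def by (subst emeasure_distr) (auto simp: emeasure_density)
    also have "\<dots> = (\<integral>\<^sup>+z. indicator {z\<in>space N. A z \<in> B \<and> x < Y z} z \<partial>N)"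
      by (intro nn_integral_cong) (auto simp: indicator_def)
    also have "\<dots> = emeasure N {z\<in>space N. A z \<in> B \<and> x < Y z}"
      using B by (intro nn_integral_indicator) simp
    finally show ?thesis .
  qed
  have \<mu>B: "emeasure \<mu> B = emeasure N {z\<in>space N. A z \<in> B}" if "B \<in> sets M" for B
    using that unfolding \<mu>_def by (subst emeasure_distr) (auto intro!: arg_cong [where f = "emeasure N"])
  define g where "g x = RN_deriv \<mu> (\<nu> x)" for x
  have g [measurable]: "g x \<in> borel_measurable M" for x
    unfolding g_def using borel_measurable_RN_deriv [of \<mu> "\<nu> x"] by (simp cong: measurable_cong_sets)
  have ac: "absolutely_continuous \<mu> (\<nu> x)" for x
    unfolding absolutely_continuous_def
  proof
    fix B assume B: "B \<in> null_sets \<mu>"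
    then have BM: "B \<in> sets M" by auto
    have "emeasure (\<nu> x) B \<le> emeasure \<mu> B"
      unfolding \<nu> [OF BM] \<mu>B [OF BM] using BM by (intro emeasure_mono) auto
    then show "B \<in> null_sets (\<nu> x)" using B BM by (auto simp: null_sets_def)
  qed
  have gB: "(\<integral>\<^sup>+a\<in>B. g x a \<partial>\<mu>) = emeasure N {z\<in>space N. A z \<in> B \<and> x < Y z}" if B: "B \<in> sets M" for x B
  proof -
    have "density \<mu> (g x) = \<nu> x" unfolding g_def by (rule \<mu>.density_RN_deriv [OF ac]) simp
    then have "emeasure (density \<mu> (g x)) B = emeasure N {z\<in>space N. A z \<in> B \<and> x < Y z}" by (simp add: \<nu> [OF B])
    then show ?thesis using B by (subst (asm) emeasure_density) auto
  qed
  have gint: "(\<integral>\<^sup>+a. g x a \<partial>\<mu>) = emeasure N {z\<in>space N. x < Y z}" for x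
  proof -
    have "(\<integral>\<^sup>+a. g x a \<partial>\<mu>) = (\<integral>\<^sup>+a\<in>space M. g x a \<partial>\<mu>)"
      by (intro nn_integral_cong) (simp add: space_\<mu>)
    also have "\<dots> = emeasure N {z\<in>space N. A z \<in> space M \<and> x < Y z}" by (rule gB) simp
    also have "{z\<in>space N. A z \<in> space M \<and> x < Y z} = {z\<in>space N. x < Y z}"
      using measurable_space [OF A] by auto
    finally show ?thesis .
  qed
  have gfin: "(\<integral>\<^sup>+a. g x a \<partial>\<mu>) < \<infinity>" for x
    unfolding gint using N.emeasure_finite by (simp add: less_top [symmetric])
  have ganti: "AE a in \<mu>. g y a \<le> g x a" if "x \<le> y" for x y
  proof (rule AE_le_densities)
    fix B assume "B \<in> sets \<mu>"
    then have B: "B \<in> sets M" by simp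
    show "(\<integral>\<^sup>+a\<in>B. g y a \<partial>\<mu>) \<le> (\<integral>\<^sup>+a\<in>B. g x a \<partial>\<mu>)"
      unfolding gB [OF B] using that B by (intro emeasure_mono) auto
  qed (use gfin \<mu>.finite_measure_axioms in auto)
  have g1: "AE a in \<mu>. g x a \<le> 1" for x
  proof (rule AE_le_densities)
    fix B assume "B \<in> sets \<mu>"
    then have B: "B \<in> sets M" by simp
    have "(\<integral>\<^sup>+a\<in>B. g x a \<partial>\<mu>) \<le> emeasure \<mu> B"
      unfolding gB [OF B] \<mu>B [OF B] using B by (intro emeasure_mono) auto
    then show "(\<integral>\<^sup>+a\<in>B. g x a \<partial>\<mu>) \<le> (\<integral>\<^sup>+a\<in>B. 1 \<partial>\<mu>)" using B by simp
  qed (use \<mu>.finite_measure_axioms \<mu>.emeasure_space_1 in auto)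
  define R where "R = {q::rat. 0 \<le> q \<and> q \<le> 1}"
  have R0: "0 \<in> R" by (simp add: R_def)
  define Q where "Q z = (SUP q\<in>R. if ennreal (snd z) < g (real_of_rat q) (fst z) then real_of_rat q else 0)" for z :: "'b \<times> real"
  have Rle: "0 \<le> real_of_rat q" "real_of_rat q \<le> 1" if "q \<in> R" for q using that by (auto simp: R_def)
  have bdd: "bdd_above ((\<lambda>q. if ennreal (snd z) < g (real_of_rat q) (fst z) then real_of_rat q else 0) ` R)" for z
    by (rule bdd_aboveI2 [of _ _ 1]) (use Rle in auto)
  have Q [measurable]: "Q \<in> borel_measurable (M \<Otimes>\<^sub>M noise)"
    unfolding Q_def by (rule borel_measurable_cSUP) (use bdd in auto)
  have Qgt: "x < Q (a, u) \<longleftrightarrow> (\<exists>q\<in>R. x < real_of_rat q \<and> ennreal u < g (real_of_rat q) a)" if "0 \<le> x" for x a u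
  proof -
    have "x < Q (a, u) \<longleftrightarrow> (\<exists>q\<in>R. x < (if ennreal u < g (real_of_rat q) a then real_of_rat q else 0))"
      unfolding Q_def using R0 bdd [of "(a, u)"] by (subst less_cSUP_iff) auto
    then show ?thesis using that by (auto split: if_splits)
  qed
  have Qgt0: "x < Q (a, u)" if "x < 0" for x a u
  proof -
    have "0 \<le> Q (a, u)"
    proof -
      have b: "bdd_above ((\<lambda>q. if ennreal u < g (real_of_rat q) a then real_of_rat q else 0) ` R)"
        by (rule bdd_aboveI2 [of _ _ 1]) (use Rle in auto)
      show ?thesis unfolding Q_def fst_conv snd_conv by (rule cSUP_upper2 [OF b R0]) simp
    qed
    then show ?thesis using that by simp
  qed
  define Rx where "Rx x = {q\<in>R. x < real_of_rat q}" for x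
  define s where "s x a = (SUP q\<in>Rx x. g (real_of_rat q) a)" for x a
  have s [measurable]: "s x \<in> borel_measurable M" for x
    unfolding s_def by (intro borel_measurable_SUP) (auto intro: countable_subset)
  have seq: "AE a in \<mu>. s x a = g x a" if x: "0 \<le> x" for x
  proof (rule AE_eq_if_AE_le_nn_integral_ge)
    have "AE a in \<mu>. \<forall>q\<in>Rx x. g (real_of_rat q) a \<le> g x a"
      by (rule AE_ball_countable') (auto simp: Rx_def intro!: ganti)
    then show le: "AE a in \<mu>. s x a \<le> g x a"
      by eventually_elim (auto simp: s_def intro: SUP_least)
    show "(\<integral>\<^sup>+a. s x a \<partial>\<mu>) < \<infinity>"
      using nn_integral_mono_AE [OF le] gfin by (rule order_le_less_trans)
    have lower: "emeasure N {z\<in>space N. real_of_rat q < Y z} \<le> (\<integral>\<^sup>+a. s x a \<partial>\<mu>)" if "q \<in> Rx x" for q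
      unfolding gint [symmetric] s_def using that by (intro nn_integral_mono SUP_upper)
    show "(\<integral>\<^sup>+a. g x a \<partial>\<mu>) \<le> (\<integral>\<^sup>+a. s x a \<partial>\<mu>)"
      unfolding gint
    proof (cases "x < 1")
      case True
      have "\<exists>q. x < real_of_rat q \<and> real_of_rat q < min 1 (x + inverse (Suc n))" for n
        using of_rat_dense [of x "min 1 (x + inverse (Suc n))"] True by (auto simp: min_def)
      then obtain q where q: "\<And>n. x < real_of_rat (q n)" "\<And>n. real_of_rat (q n) < min 1 (x + inverse (Suc n))" by metis
      have qR: "q n \<in> Rx x" for n
      proof -
        have "0 < real_of_rat (q n)" using q(1) [of n] x by (rule order_le_less_trans [rotated])
        moreover have "real_of_rat (q n) < 1" using q(2) [of n] by simp
        ultimately show ?thesis using q(1) [of n] by (simp add: Rx_def R_def)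
      qed
      have "{z\<in>space N. x < Y z} \<subseteq> (\<Union>n. {z\<in>space N. x + inverse (Suc n) < Y z})"
      proof
        fix z assume z: "z \<in> {z\<in>space N. x < Y z}"
        then obtain n where "inverse (real (Suc n)) < Y z - x" using reals_Archimedean [of "Y z - x"] by auto
        then show "z \<in> (\<Union>n. {z\<in>space N. x + inverse (Suc n) < Y z})" using z by (auto intro!: exI [of _ n])
      qed
      then have "emeasure N {z\<in>space N. x < Y z} \<le> emeasure N (\<Union>n. {z\<in>space N. x + inverse (Suc n) < Y z})"
        by (rule emeasure_mono) auto
      also have "\<dots> = (SUP n. emeasure N {z\<in>space N. x + inverse (Suc n) < Y z})"
      proof (rule SUP_emeasure_incseq [symmetric])
        show "incseq (\<lambda>n. {z\<in>space N. x + inverse (Suc n) < Y z})"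
        proof (rule incseq_SucI)
          fix n
          have le: "inverse (real (Suc (Suc n))) \<le> inverse (real (Suc n))" by (intro le_imp_inverse_le) auto
          show "{z\<in>space N. x + inverse (Suc n) < Y z} \<subseteq> {z\<in>space N. x + inverse (Suc (Suc n)) < Y z}"
          proof (rule Collect_mono, rule impI, elim conjE, rule conjI)
            fix z assume "x + inverse (Suc n) < Y z"
            with le show "x + inverse (Suc (Suc n)) < Y z" by linarith
          qed
        qed
      qed auto
      also have "\<dots> \<le> (\<integral>\<^sup>+a. s x a \<partial>\<mu>)"
      proof (rule SUP_least)
        fix n
        have "emeasure N {z\<in>space N. x + inverse (Suc n) < Y z} \<le> emeasure N {z\<in>space N. real_of_rat (q n) < Y z}"
          using q(2) [of n] by (intro emeasure_mono) auto
        also have "\<dots> \<le> (\<integral>\<^sup>+a. s x a \<partial>\<mu>)" by (rule lower [OF qR])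
        finally show "emeasure N {z\<in>space N. x + inverse (Suc n) < Y z} \<le> (\<integral>\<^sup>+a. s x a \<partial>\<mu>)" .
      qed
      finally show "emeasure N {z\<in>space N. x < Y z} \<le> (\<integral>\<^sup>+a. s x a \<partial>\<mu>)" .
    next
      case False
      then have "{z\<in>space N. x < Y z} = {}" using Y01 by force
      then show "emeasure N {z\<in>space N. x < Y z} \<le> (\<integral>\<^sup>+a. s x a \<partial>\<mu>)" by (simp only: emeasure_empty zero_le)
    qed
  qed auto
  let ?P1 = "distr N (M \<Otimes>\<^sub>M borel) (\<lambda>z. (A z, Y z))"
  let ?P2 = "distr (\<mu> \<Otimes>\<^sub>M noise) (M \<Otimes>\<^sub>M borel) (\<lambda>(a, u). (a, Q (a, u)))"
  have map2 [measurable]: "(\<lambda>(a, u). (a, Q (a, u))) \<in> \<mu> \<Otimes>\<^sub>M noise \<rightarrow>\<^sub>M M \<Otimes>\<^sub>M borel" by measurable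
  have P1: "emeasure ?P1 (B \<times> {x<..}) = emeasure N {z\<in>space N. A z \<in> B \<and> x < Y z}" if B: "B \<in> sets M" for B x
    using B by (subst emeasure_distr) (auto intro!: arg_cong [where f = "emeasure N"])
  have P2: "emeasure ?P2 (B \<times> {x<..}) = emeasure N {z\<in>space N. A z \<in> B \<and> x < Y z}" if B: "B \<in> sets M" for B x
  proof -
    let ?E = "{z\<in>space (\<mu> \<Otimes>\<^sub>M noise). fst z \<in> B \<and> x < Q z}"
    have E [measurable]: "?E \<in> sets (\<mu> \<Otimes>\<^sub>M noise)" using B by measurable
    have "emeasure ?P2 (B \<times> {x<..}) = emeasure (\<mu> \<Otimes>\<^sub>M noise) ?E"
      using B by (subst emeasure_distr) (auto intro!: arg_cong [where f = "emeasure (\<mu> \<Otimes>\<^sub>M noise)"])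
    also have "\<dots> = (\<integral>\<^sup>+a. emeasure noise (Pair a -` ?E) \<partial>\<mu>)"
      by (rule U.emeasure_pair_measure_alt [OF E])
    also have "\<dots> = (\<integral>\<^sup>+a\<in>B. emeasure noise {u. x < Q (a, u)} \<partial>\<mu>)"
      by (intro nn_integral_cong) (auto simp: indicator_def space_pair_measure vimage_def)
    also have "\<dots> = emeasure N {z\<in>space N. A z \<in> B \<and> x < Y z}"
    proof (cases "0 \<le> x")
      case True
      have "emeasure noise {u. x < Q (a, u)} = min 1 (s x a)" for a
      proof -
        have "{u. x < Q (a, u)} = {u. ennreal u < s x a}"
          unfolding Qgt [OF True] s_def less_SUP_iff by (auto simp: Rx_def)
        then show ?thesis by (simp add: emeasure_noise_lessThan)
      qed
      then have "(\<integral>\<^sup>+a\<in>B. emeasure noise {u. x < Q (a, u)} \<partial>\<mu>) = (\<integral>\<^sup>+a\<in>B. min 1 (s x a) \<partial>\<mu>)" by simp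
      also have "\<dots> = (\<integral>\<^sup>+a\<in>B. g x a \<partial>\<mu>)"
        by (rule nn_integral_cong_AE) (use seq [OF True] g1 [of x] in \<open>eventually_elim, simp add: min_absorb2\<close>)
      finally show ?thesis by (simp add: gB [OF B])
    next
      case False
      then have "{u. x < Q (a, u)} = UNIV" for a using Qgt0 by auto
      then have "(\<integral>\<^sup>+a\<in>B. emeasure noise {u. x < Q (a, u)} \<partial>\<mu>) = emeasure \<mu> B"
        using B U.emeasure_space_1 by simp
      also have "\<dots> = emeasure N {z\<in>space N. A z \<in> B \<and> x < Y z}"
        unfolding \<mu>B [OF B] using False Y01 by (intro arg_cong [where f = "emeasure N"]) force
      finally show ?thesis .
    qed
    finally show ?thesis .
  qed
  interpret P1: prob_space ?P1 by (rule N.prob_space_distr) simp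
  interpret P2: prob_space ?P2 by (rule P.prob_space_distr) (rule map2)
  have rect: "emeasure ?P1 (B \<times> C) = emeasure ?P2 (B \<times> C)" if B: "B \<in> sets M" and C: "C \<in> sets borel" for B and C :: "real set"
  proof -
    have BU: "B \<times> UNIV \<in> sets (M \<Otimes>\<^sub>M borel)" using B by (intro pair_measureI) auto
    let ?r = "\<lambda>P. distr (density P (indicator (B \<times> UNIV))) borel snd"
    have r: "emeasure (?r P) C = emeasure P (B \<times> C)" if P: "sets P = sets (M \<Otimes>\<^sub>M borel)" and C: "C \<in> sets borel" for P :: "('b \<times> real) measure" and C
    proof -
      note [measurable_cong] = P
      have BC: "B \<times> C \<in> sets P" using B C unfolding P by (intro pair_measureI)
      have "emeasure (?r P) C = emeasure (density P (indicator (B \<times> UNIV))) (snd -` C \<inter> space P)"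
        using C by (subst emeasure_distr) auto
      also have "\<dots> = (\<integral>\<^sup>+z. indicator (B \<times> UNIV) z * indicator (snd -` C \<inter> space P) z \<partial>P)"
      proof (rule emeasure_density)
        show "indicator (B \<times> UNIV) \<in> borel_measurable P"
          by (rule borel_measurable_indicator) (unfold P, rule BU)
        have "snd \<in> P \<rightarrow>\<^sub>M borel" by measurable
        then show "snd -` C \<inter> space P \<in> sets P" using C by (rule measurable_sets)
      qed
      also have "\<dots> = (\<integral>\<^sup>+z. indicator (B \<times> C) z \<partial>P)"
        by (intro nn_integral_cong) (auto simp: indicator_def)
      also have "\<dots> = emeasure P (B \<times> C)" by (rule nn_integral_indicator [OF BC])
      finally show ?thesis .
    qed
    have "?r ?P1 = ?r ?P2"
    proof (rule measure_eqI_lessThan)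
      fix x
      show "emeasure (?r ?P1) {x<..} < \<infinity>"
        by (subst r) (use P1.emeasure_finite in \<open>auto simp: less_top [symmetric]\<close>)
      show "emeasure (?r ?P1) {x<..} = emeasure (?r ?P2) {x<..}"
        by (simp add: r P1 [OF B] P2 [OF B])
    qed auto
    then show ?thesis using r [of ?P1 C] r [of ?P2 C] C by simp
  qed
  have "?P1 = ?P2"
  proof (rule measure_eqI_generator_eq [OF Int_stable_pair_measure_generator])
    show "{a \<times> b |a b. a \<in> sets M \<and> b \<in> sets (borel :: real measure)} \<subseteq> Pow (space M \<times> space borel)"
      by (auto dest: sets.sets_into_space)
    show "sets ?P1 = sigma_sets (space M \<times> space borel) {a \<times> b |a b. a \<in> sets M \<and> b \<in> sets borel}"
      "sets ?P2 = sigma_sets (space M \<times> space borel) {a \<times> b |a b. a \<in> sets M \<and> b \<in> sets borel}"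
      by (simp_all only: sets_distr sets_pair_measure)
    have "space M \<times> (UNIV :: real set) \<in> {a \<times> b |a b. a \<in> sets M \<and> b \<in> sets borel}"
      using sets.top [of M] sets.top [of "borel :: real measure"] by (simp only: space_borel) blast
    then show "range (\<lambda>_::nat. space M \<times> (UNIV :: real set)) \<subseteq> {a \<times> b |a b. a \<in> sets M \<and> b \<in> sets borel}" by blast
    show "emeasure ?P1 (space M \<times> UNIV) \<noteq> \<infinity>" using P1.emeasure_finite by simp
  qed (use rect in auto)
  then show ?thesis using that [OF Q] by (simp add: \<mu>_def)
qed

context label_space begin

lemma noise_representation:
  assumes N: "prob_space N" and A [measurable]: "A \<in> N \<rightarrow>\<^sub>M M" and Z [measurable]: "Z \<in> N \<rightarrow>\<^sub>M mu D"
  obtains q where "q \<in> M \<Otimes>\<^sub>M noise \<rightarrow>\<^sub>M mu D"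
    "distr N (M \<Otimes>\<^sub>M mu D) (\<lambda>z. (A z, Z z)) = distr (distr N M A \<Otimes>\<^sub>M noise) (M \<Otimes>\<^sub>M mu D) (\<lambda>(a, u). (a, q (a, u)))"
proof -
  obtain \<phi> \<psi> where \<phi> [measurable]: "\<phi> \<in> borel_measurable (mu D)" and \<phi>01: "\<And>x. x \<in> D \<Longrightarrow> 0 \<le> \<phi> x \<and> \<phi> x \<le> (1::real)"
    and \<psi> [measurable]: "\<psi> \<in> borel \<rightarrow>\<^sub>M mu D" and \<psi>\<phi>: "\<And>x. x \<in> D \<Longrightarrow> \<psi> (\<phi> x) = x"
    using code_exists by blast
  have ZD: "Z z \<in> D" if "z \<in> space N" for z using measurable_space [OF Z that] by (simp add: space_mu_D)
  obtain Q where Q [measurable]: "Q \<in> borel_measurable (M \<Otimes>\<^sub>M noise)"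
    and eq: "distr N (M \<Otimes>\<^sub>M borel) (\<lambda>z. (A z, \<phi> (Z z))) = distr (distr N M A \<Otimes>\<^sub>M noise) (M \<Otimes>\<^sub>M borel) (\<lambda>(a, u). (a, Q (a, u)))"
    by (rule noise_representation_real [OF N A, of "\<lambda>z. \<phi> (Z z)"]) (use ZD \<phi>01 in auto)
  have "distr (distr N (M \<Otimes>\<^sub>M borel) (\<lambda>z. (A z, \<phi> (Z z)))) (M \<Otimes>\<^sub>M mu D) (\<lambda>(a, y). (a, \<psi> y)) =
      distr (distr (distr N M A \<Otimes>\<^sub>M noise) (M \<Otimes>\<^sub>M borel) (\<lambda>(a, u). (a, Q (a, u)))) (M \<Otimes>\<^sub>M mu D) (\<lambda>(a, y). (a, \<psi> y))"
    unfolding eq ..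
  moreover have "distr (distr N (M \<Otimes>\<^sub>M borel) (\<lambda>z. (A z, \<phi> (Z z)))) (M \<Otimes>\<^sub>M mu D) (\<lambda>(a, y). (a, \<psi> y)) = distr N (M \<Otimes>\<^sub>M mu D) (\<lambda>z. (A z, Z z))"
    by (subst distr_distr) (auto intro!: distr_cong simp: \<psi>\<phi> ZD)
  moreover have "distr (distr (distr N M A \<Otimes>\<^sub>M noise) (M \<Otimes>\<^sub>M borel) (\<lambda>(a, u). (a, Q (a, u)))) (M \<Otimes>\<^sub>M mu D) (\<lambda>(a, y). (a, \<psi> y))
      = distr (distr N M A \<Otimes>\<^sub>M noise) (M \<Otimes>\<^sub>M mu D) (\<lambda>(a, u). (a, \<psi> (Q (a, u))))"
    by (subst distr_distr) (auto intro!: distr_cong)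
  ultimately show ?thesis
    by (intro that [of "\<lambda>z. \<psi> (Q z)"]) auto
qed

end

section \<open>Coding sequences of numbers by a single number\<close>

text \<open>
  The digits used to code are only \<open>0\<close> and \<open>1\<close>, in base \<open>4\<close>. So codes that are close to
  each other have the same leading digits: coding has a continuous inverse on the set of codes.
  The offset \<open>1/3\<close>, the largest value of a remainder, makes the digits of the limit of a sequence of
  codes agree with the digits of the codes.
\<close>

definition of_digits :: "(nat \<Rightarrow> int) \<Rightarrow> real"
  where "of_digits b = (\<Sum>k. of_int (b k) / 4 ^ Suc k)"

definition digit :: "real \<Rightarrow> nat \<Rightarrow> int"
  where "digit y k = \<lfloor>4 ^ Suc k * y + 1/3\<rfloor> mod 2"

lemma digit_01: "digit y k \<in> {0, 1}"
  by (auto simp: digit_def)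

lemma of_digits_bounds:
  assumes b: "\<And>k. b k \<in> {0, 1}"
  shows "summable (\<lambda>k. of_int (b k) / 4 ^ Suc k :: real)" "0 \<le> of_digits b" "of_digits b \<le> 1/3"
proof -
  have geo: "(\<lambda>k. (1/4) * (1/4) ^ k :: real) sums ((1/4) * (1 / (1 - 1/4)))"
    by (intro sums_mult geometric_sums) simp
  have le: "of_int (b k) / (4 ^ Suc k :: real) \<le> (1/4) * (1/4) ^ k" "0 \<le> of_int (b k) / (4 ^ Suc k :: real)" for k
    using b [of k] by (auto simp: power_one_over inverse_eq_divide)
  show sm: "summable (\<lambda>k. of_int (b k) / 4 ^ Suc k :: real)"
    by (rule summable_comparison_test' [OF sums_summable [OF geo], of 0]) (use le in \<open>simp only: real_norm_def abs_of_nonneg\<close>)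
  show "0 \<le> of_digits b" unfolding of_digits_def by (rule suminf_nonneg [OF sm]) (use le in blast)
  have "of_digits b \<le> (\<Sum>k. (1/4) * (1/4) ^ k)"
    unfolding of_digits_def by (rule suminf_le [OF _ sm sums_summable [OF geo]]) (use le in blast)
  then show "of_digits b \<le> 1/3" using sums_unique [OF geo] by simp
qed

lemma of_digits_shift:
  assumes b: "\<And>k. b k \<in> {0, 1}"
  obtains n :: int where "n mod 2 = b k" "n \<le> 4 ^ Suc k * of_digits b" "4 ^ Suc k * of_digits b \<le> n + 1/3"
proof -
  define n where "n = (\<Sum>i<Suc k. b i * 4 ^ (k - i))"
  define r where "r = of_digits (\<lambda>i. b (i + Suc k))"
  have "of_digits b = (\<Sum>i. of_int (b (i + Suc k)) / 4 ^ Suc (i + Suc k)) + (\<Sum>i<Suc k. of_int (b i) / 4 ^ Suc i)"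
    unfolding of_digits_def by (rule suminf_split_initial_segment [OF of_digits_bounds(1) [OF b]])
  also have "(\<Sum>i. of_int (b (i + Suc k)) / 4 ^ Suc (i + Suc k)) = (\<Sum>i. of_int (b (i + Suc k)) / 4 ^ Suc i * (1 / 4 ^ Suc k) :: real)"
  proof (rule suminf_cong)
    fix i
    have "(4 ^ Suc (i + Suc k) :: real) = 4 ^ Suc i * 4 ^ Suc k" by (simp add: power_add)
    then show "of_int (b (i + Suc k)) / 4 ^ Suc (i + Suc k) = (of_int (b (i + Suc k)) / 4 ^ Suc i * (1 / 4 ^ Suc k) :: real)"
      by (simp only: times_divide_times_eq mult_1_right)
  qed
  also have "\<dots> = r * (1 / 4 ^ Suc k)"
    unfolding r_def of_digits_def by (rule suminf_mult2 [symmetric]) (rule of_digits_bounds(1), rule b)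
  finally have "4 ^ Suc k * of_digits b = r + (\<Sum>i<Suc k. 4 ^ Suc k * (of_int (b i) / 4 ^ Suc i))"
    by (simp only: distrib_left sum_distrib_left) simp
  also have "(\<Sum>i<Suc k. 4 ^ Suc k * (of_int (b i) / 4 ^ Suc i)) = (of_int n :: real)"
    unfolding n_def of_int_sum
  proof (rule sum.cong [OF refl])
    fix i assume "i \<in> {..<Suc k}"
    then have "4 ^ Suc k = (4 ^ (k - i) * 4 ^ Suc i :: real)" by (simp add: power_add [symmetric])
    then show "4 ^ Suc k * (of_int (b i) / 4 ^ Suc i) = real_of_int (b i * 4 ^ (k - i))" by simp
  qed
  finally have eq: "4 ^ Suc k * of_digits b = r + of_int n" .
  have "n mod 2 = b k mod 2"
  proof -
    have "even (\<Sum>i<k. b i * 4 ^ (k - i))" by (rule dvd_sum) auto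
    then show ?thesis unfolding n_def by (simp add: mod_eq_dvd_iff)
  qed
  also have "\<dots> = b k" using b [of k] by auto
  finally have "n mod 2 = b k" .
  moreover have "0 \<le> r" "r \<le> 1/3" unfolding r_def by (rule of_digits_bounds, rule b)+
  ultimately show ?thesis using eq by (intro that [of n]) auto
qed

lemma digit_of_digits_near:
  assumes b: "\<And>k. b k \<in> {0, 1}" and near: "\<bar>y - of_digits b\<bar> < 1 / (3 * 4 ^ Suc k)"
  shows "digit y k = b k"
proof -
  obtain n :: int where n: "n mod 2 = b k" "n \<le> 4 ^ Suc k * of_digits b" "4 ^ Suc k * of_digits b \<le> n + 1/3"
    by (rule of_digits_shift [OF b])
  have "\<bar>4 ^ Suc k * y - 4 ^ Suc k * of_digits b\<bar> = 4 ^ Suc k * \<bar>y - of_digits b\<bar>"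
    by (simp add: right_diff_distrib [symmetric] abs_mult del: power_Suc)
  also have "\<dots> < 1/3" using near by (simp add: field_simps)
  finally have "of_int n < 4 ^ Suc k * y + 1/3" "4 ^ Suc k * y + 1/3 < of_int n + 1" using n by linarith+
  then have "\<lfloor>4 ^ Suc k * y + 1/3\<rfloor> = n" by (intro floor_unique) auto
  then show ?thesis using n(1) by (simp add: digit_def)
qed

lemma digit_of_digits: "(\<And>k. b k \<in> {0, 1}) \<Longrightarrow> digit (of_digits b) k = b k"
  by (rule digit_of_digits_near) auto

lemma digit_measurable [measurable]: "(\<lambda>y. digit y k) \<in> borel \<rightarrow>\<^sub>M count_space UNIV"
  unfolding digit_def by measurable

definition bit_real :: "real \<Rightarrow> nat \<Rightarrow> int"
  where "bit_real x j = \<lfloor>2 ^ Suc j * x\<rfloor> mod 2"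

lemma bit_real_01: "bit_real x j \<in> {0, 1}"
  by (auto simp: bit_real_def)

lemma bit_real_sums:
  assumes "0 \<le> x" "x < 1"
  shows "(\<lambda>j. of_int (bit_real x j) / 2 ^ Suc j) sums x"
proof -
  have partial: "(\<Sum>j<m. of_int (bit_real x j) / 2 ^ Suc j) = (of_int \<lfloor>2 ^ m * x\<rfloor> / 2 ^ m :: real)" for m
  proof (induction m)
    case 0
    have "\<lfloor>x\<rfloor> = 0" using assms by (simp add: floor_unique)
    then show ?case by simp
  next
    case (Suc m)
    let ?a = "\<lfloor>2 ^ m * x\<rfloor>" and ?b = "\<lfloor>2 ^ Suc m * x\<rfloor>"
    have "?b div 2 = ?a"
    proof -
      have "real_of_int ?a \<le> 2 ^ m * x" "2 ^ m * x < real_of_int ?a + 1" by linarith+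
      moreover have "2 ^ Suc m * x = 2 * (2 ^ m * x)" by simp
      ultimately have "2 * real_of_int ?a \<le> 2 ^ Suc m * x" "2 ^ Suc m * x < 2 * real_of_int ?a + 2" by linarith+
      then have "2 * ?a \<le> ?b" "?b < 2 * ?a + 2" by linarith+
      then show ?thesis by linarith
    qed
    then have "?b = 2 * ?a + bit_real x m" unfolding bit_real_def by (metis mult_div_mod_eq)
    then have "real_of_int ?b = 2 * real_of_int ?a + of_int (bit_real x m)" by linarith
    then show ?case using Suc by (simp add: field_simps)
  qed
  have "(\<lambda>m. of_int \<lfloor>2 ^ m * x\<rfloor> / 2 ^ m) \<longlonglongrightarrow> x"
  proof (rule tendsto_sandwich)
    show "\<forall>\<^sub>F m in sequentially. x - (1/2) ^ m \<le> of_int \<lfloor>2 ^ m * x\<rfloor> / 2 ^ m"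
    proof (intro always_eventually allI)
      fix m
      have "2 ^ m * x < of_int \<lfloor>2 ^ m * x\<rfloor> + 1" by linarith
      then have "x < (of_int \<lfloor>2 ^ m * x\<rfloor> + 1) / 2 ^ m" by (simp add: pos_less_divide_eq mult.commute)
      then show "x - (1/2) ^ m \<le> of_int \<lfloor>2 ^ m * x\<rfloor> / 2 ^ m" by (simp add: add_divide_distrib power_one_over inverse_eq_divide)
    qed
    show "\<forall>\<^sub>F m in sequentially. of_int \<lfloor>2 ^ m * x\<rfloor> / 2 ^ m \<le> x"
      by (intro always_eventually allI) (simp add: pos_divide_le_eq mult.commute)
    have "(\<lambda>m. x - (1/2) ^ m) \<longlonglongrightarrow> x - 0" by (intro tendsto_intros LIMSEQ_power_zero) simp
    then show "(\<lambda>m. x - (1/2) ^ m) \<longlonglongrightarrow> x" by simp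
  qed simp
  then show ?thesis unfolding sums_def partial .
qed

definition encode :: "('i \<Rightarrow> real) \<Rightarrow> real"
  where "encode X = of_digits (\<lambda>k. bit_real (X (from_nat_into UNIV (fst (prod_decode k)))) (snd (prod_decode k)))"

definition decode :: "real \<Rightarrow> 'i \<Rightarrow> real"
  where "decode y i = (\<Sum>j. of_int (digit y (prod_encode (to_nat_on UNIV i, j))) / 2 ^ Suc j)"

lemma decode_encode:
  fixes X :: "'i \<Rightarrow> real"
  assumes "countable (UNIV :: 'i set)" "0 \<le> X i" "X i < 1"
  shows "decode (encode X) i = X i"
proof -
  have "digit (encode X) (prod_encode (to_nat_on UNIV i, j)) = bit_real (X i) j" for j
    unfolding encode_def by (subst digit_of_digits) (simp_all only: bit_real_01 prod_encode_inverse fst_conv snd_conv from_nat_into_to_nat_on [OF assms(1) UNIV_I])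
  then show ?thesis unfolding decode_def using sums_unique [OF bit_real_sums [OF assms(2,3)]] by simp
qed

lemma encode_bounds: "0 \<le> encode X" "encode X \<le> 1/3"
  unfolding encode_def by (rule of_digits_bounds; rule bit_real_01)+

lemma encode_measurable:
  assumes "\<And>i. (\<lambda>z. X z i) \<in> borel_measurable M"
  shows "(\<lambda>z. encode (X z)) \<in> borel_measurable M"
proof -
  note [measurable] = assms
  show ?thesis unfolding encode_def of_digits_def bit_real_def by measurable
qed

lemma decode_measurable [measurable]: "(\<lambda>y. decode y i) \<in> borel_measurable borel"
  unfolding decode_def by measurable

definition codes :: "real set"
  where "codes = {y. of_digits (digit y) = y}"

lemma codes_measurable [measurable]: "codes \<in> sets borel"
proof -
  have "(\<lambda>y. of_digits (digit y)) \<in> borel_measurable borel" unfolding of_digits_def by measurable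
  then show ?thesis unfolding codes_def by measurable
qed

lemma encode_in_codes: "encode X \<in> codes"
proof -
  have "digit (encode X) = (\<lambda>k. bit_real (X (from_nat_into UNIV (fst (prod_decode k)))) (snd (prod_decode k)))"
    unfolding encode_def by (rule ext, rule digit_of_digits) (rule bit_real_01)
  then show ?thesis by (simp add: codes_def) (simp add: encode_def)
qed

lemma decode_tendsto:
  assumes y: "\<And>n. y n \<in> codes" and lim: "y \<longlonglongrightarrow> y'"
  shows "(\<lambda>n. decode (y n) i) \<longlonglongrightarrow> decode y' i"
proof -
  have dig: "\<forall>\<^sub>F n in sequentially. digit (y n) k = digit y' k" for k
  proof -
    have "\<forall>\<^sub>F n in sequentially. dist (y n) y' < 1 / (3 * 4 ^ Suc k)" using lim by (rule tendstoD) simp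
    then show ?thesis
    proof eventually_elim
      case (elim n)
      have "of_digits (digit (y n)) = y n" using y by (simp add: codes_def)
      then have "\<bar>y' - of_digits (digit (y n))\<bar> < 1 / (3 * 4 ^ Suc k)" using elim by (simp add: dist_real_def abs_minus_commute)
      then show ?case using digit_of_digits_near [OF digit_01, of y'] by simp
    qed
  qed
  have geo: "summable (\<lambda>k. (1/2) * (1/2) ^ k :: real)" by (intro summable_mult summable_geometric) simp
  show ?thesis
    unfolding decode_def
  proof (rule tannerys_theorem [THEN conjunct2, THEN conjunct2])
    fix j
    show "(\<lambda>n. of_int (digit (y n) (prod_encode (to_nat_on UNIV i, j))) / 2 ^ Suc j) \<longlonglongrightarrow>
        (of_int (digit y' (prod_encode (to_nat_on UNIV i, j))) / 2 ^ Suc j :: real)"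
      by (rule tendsto_eventually) (use dig in \<open>eventually_elim, simp\<close>)
  next
    have "norm (of_int (digit (y n) k) / 2 ^ Suc j :: real) \<le> (1/2) * (1/2) ^ j" for n j k
      using digit_01 [of "y n" k] by (auto simp: power_one_over inverse_eq_divide)
    then show "\<forall>\<^sub>F (j, n) in at_top \<times>\<^sub>F sequentially.
        norm (of_int (digit (y n) (prod_encode (to_nat_on UNIV i, j))) / 2 ^ Suc j :: real) \<le> (1/2) * (1/2) ^ j"
      by (intro always_eventually) auto
  qed (use geo in auto)
qed

text \<open>
  Laws of codes live in a bounded interval, so some subsequence converges weakly by Helly's theorem,
  and by Skorohod's theorem the convergence can be realised pointwise on one probability space.
\<close>

lemma coupled_subsequence:
  fixes X :: "nat \<Rightarrow> 'b \<Rightarrow> 'i \<Rightarrow> real" and M :: "nat \<Rightarrow> 'b measure"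
  assumes M: "\<And>n. prob_space (M n)" and X: "\<And>n i. (\<lambda>z. X n z i) \<in> borel_measurable (M n)"
  obtains r \<Omega> Y' Y where "strict_mono (r :: nat \<Rightarrow> nat)" "prob_space (\<Omega> :: real measure)"
    "\<And>n. Y' n \<in> borel_measurable \<Omega>" "Y \<in> borel_measurable \<Omega>"
    "\<And>n. distr \<Omega> borel (Y' n) = distr (M (r n)) borel (\<lambda>z. encode (X (r n) z))"
    "\<And>x. 0 \<le> Y x \<and> Y x \<le> (1 :: real)"
    "AE x in \<Omega>. \<forall>i :: 'i. (\<lambda>n. decode (Y' n x) i) \<longlonglongrightarrow> decode (Y x) i"
proof -
  define \<mu> where "\<mu> n = distr (M n) borel (\<lambda>z. encode (X n z))" for n
  have code [measurable]: "(\<lambda>z. encode (X n z)) \<in> borel_measurable (M n)" for n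
    by (rule encode_measurable [OF X])
  have dist: "real_distribution (\<mu> n)" for n
    unfolding \<mu>_def by (rule prob_space.real_distribution_distr [OF M code])
  have one: "measure (\<mu> n) {-1<..1} = 1" for n
  proof -
    interpret prob_space "M n" by (rule M)
    have "measure (\<mu> n) {-1<..1} = measure (M n) ((\<lambda>z. encode (X n z)) -` {-1<..1} \<inter> space (M n))"
      unfolding \<mu>_def by (rule measure_distr) auto
    also have "(\<lambda>z. encode (X n z)) -` {-1<..1} \<inter> space (M n) = space (M n)"
    proof -
      have "encode (X n z) \<in> {-1<..1}" for z using encode_bounds [of "X n z"] by auto
      then show ?thesis by blast
    qed
    finally show ?thesis by (simp add: prob_space)
  qed
  have "tight \<mu>"
    unfolding tight_def
  proof (intro conjI allI impI dist)
    fix \<epsilon> :: real assume "\<epsilon> > 0"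
    then show "\<exists>a b. a < b \<and> (\<forall>n. 1 - \<epsilon> < measure (\<mu> n) {a<..b})"
      by (intro exI [of _ "-1"] exI [of _ 1]) (simp add: one)
  qed
  then obtain r L where r: "strict_mono (r :: nat \<Rightarrow> nat)" and L: "real_distribution L" "weak_conv_m (\<mu> \<circ> id \<circ> r) L"
    using tight_imp_convergent_subsubsequence [of \<mu> id] by (auto simp: strict_mono_def)
  have "\<And>n. real_distribution ((\<mu> \<circ> id \<circ> r) n)" using dist by simp
  from Skorohod [OF this L] obtain \<Omega> :: "real measure" and Y' Y where
    \<Omega>: "prob_space \<Omega>" and Y' [measurable]: "\<And>n. Y' n \<in> borel_measurable \<Omega>" and
    law: "\<And>n. distr \<Omega> borel (Y' n) = (\<mu> \<circ> id \<circ> r) n" and Y [measurable]: "Y \<in> borel_measurable \<Omega>" and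
    lim: "\<And>x. x \<in> space \<Omega> \<Longrightarrow> (\<lambda>n. Y' n x) \<longlonglongrightarrow> Y x" by force
  have AEprop: "AE x in \<Omega>. Y' n x \<in> codes \<inter> {0..1}" for n
  proof -
    have "AE y in \<mu> (r n). y \<in> codes \<inter> {0..1}"
      unfolding \<mu>_def
    proof (subst AE_distr_iff)
      have "encode (X (r n) z) \<in> codes \<inter> {0..1}" for z
        using encode_bounds [of "X (r n) z"] by (simp add: encode_in_codes)
      then show "AE z in M (r n). encode (X (r n) z) \<in> codes \<inter> {0..1}" by simp
    qed auto
    moreover have "distr \<Omega> borel (Y' n) = \<mu> (r n)" using law [of n] by simp
    ultimately show ?thesis by (intro AE_distrD [OF Y', of "\<lambda>y. y \<in> codes \<inter> {0..1}"]) (simp only:)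
  qed
  have "AE x in \<Omega>. \<forall>n. Y' n x \<in> codes \<inter> {0..1}" unfolding AE_all_countable using AEprop by blast
  then have "AE x in \<Omega>. \<forall>i :: 'i. (\<lambda>n. decode (Y' n x) i) \<longlonglongrightarrow> decode (max 0 (min 1 (Y x))) i"
    using AE_space
  proof eventually_elim
    case (elim x)
    have conv: "(\<lambda>n. Y' n x) \<longlonglongrightarrow> Y x" by (rule lim [OF elim(2)])
    have mem: "Y' n x \<in> codes" "Y' n x \<in> {0..1}" for n using elim(1) by blast+
    have "Y x \<in> {0..1}" by (rule closed_sequentially [OF closed_atLeastAtMost mem(2) conv])
    then have "max 0 (min 1 (Y x)) = Y x" by auto
    then show ?case by (simp only:) (rule allI, rule decode_tendsto [OF mem(1) conv])
  qed
  then show ?thesis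
    using r \<Omega> Y' law by (intro that [of r \<Omega> Y' "\<lambda>x. max 0 (min 1 (Y x))"]) (auto simp: \<mu>_def)
qed

section \<open>Measures are determined by countably many continuous functions\<close>

text \<open>
  The indicator of an open set is an increasing limit of truncated multiples of the distance to its
  complement, and a countable base, closed under finite intersections, generates the Borel sets.
\<close>

lemma countable_determining_functions:
  obtains F :: "nat \<Rightarrow> 'a::{metric_space, second_countable_topology} \<Rightarrow> real"
  where "\<And>i. continuous_on UNIV (F i)" "\<And>i x. 0 \<le> F i x \<and> F i x \<le> 1"
    "\<And>M N. prob_space M \<Longrightarrow> prob_space N \<Longrightarrow> sets M = sets borel \<Longrightarrow> sets N = sets borel \<Longrightarrow>
      (\<And>i. (\<integral>x. F i x \<partial>M) = (\<integral>x. F i x \<partial>N)) \<Longrightarrow> M = N"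
proof -
  obtain B0 :: "'a set set" where B0: "countable B0" "topological_basis B0" using ex_countable_basis by blast
  define B where "B = Inter ` {S. finite S \<and> S \<subseteq> B0}"
  have B: "countable B" unfolding B_def using B0(1) by (intro countable_image countable_Collect_finite_subset)
  have openB: "open U" if "U \<in> B" for U
    using that topological_basis_open [OF B0(2)] by (auto simp: B_def intro!: open_Inter)
  have UNIV_B: "UNIV \<in> B" unfolding B_def by (rule image_eqI [of _ _ "{}"]) auto
  have B0B: "B0 \<subseteq> B" unfolding B_def by (auto intro!: image_eqI [of _ Inter "{x}" for x])
  have stable: "Int_stable B"
    unfolding Int_stable_def
  proof (intro ballI)
    fix U V assume "U \<in> B" "V \<in> B"
    then obtain S S' where "finite S" "S \<subseteq> B0" "U = \<Inter>S" "finite S'" "S' \<subseteq> B0" "V = \<Inter>S'" by (auto simp: B_def)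
    then show "U \<inter> V \<in> B" unfolding B_def by (intro image_eqI [of _ _ "S \<union> S'"]) auto
  qed
  have gen: "sets (borel :: 'a measure) = sigma_sets UNIV B"
  proof
    have "sets (borel :: 'a measure) = sigma_sets UNIV B0"
      by (subst borel_eq_countable_basis [OF B0]) (simp add: sets_measure_of)
    then show "sets (borel :: 'a measure) \<subseteq> sigma_sets UNIV B" using sigma_sets_mono' [OF B0B] by blast
    have "B \<subseteq> sets borel" using openB by auto
    then show "sigma_sets UNIV B \<subseteq> sets borel" using sets.sigma_sets_subset [of B borel] by simp
  qed
  define f where "f U k x = (if U = UNIV then 1 else min 1 (real k * infdist x (- U)))" for U :: "'a set" and k x
  have fcont: "continuous_on UNIV (f U k)" for U k
    unfolding f_def by (cases "U = UNIV") (auto intro!: continuous_intros)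
  have f01: "0 \<le> f U k x \<and> f U k x \<le> 1" for U k x
    unfolding f_def by (auto simp: infdist_nonneg)
  have flim: "(\<lambda>k. f U k x) \<longlonglongrightarrow> indicator U x" if "open U" for U x
  proof (cases "U = UNIV")
    case False
    then have ne: "- U \<noteq> {}" "closed (- U)" using that by auto
    show ?thesis
    proof (cases "x \<in> U")
      case True
      then have pos: "infdist x (- U) > 0" using ne by (intro infdist_pos_not_in_closed) auto
      obtain k0 where k0: "inverse (real (Suc k0)) < infdist x (- U)" using reals_Archimedean [OF pos] by blast
      have "f U k x = 1" if "k \<ge> Suc k0" for k
      proof -
        have "1 = real (Suc k0) * inverse (real (Suc k0))" by simp
        also have "\<dots> \<le> real k * infdist x (- U)" using that k0 by (intro mult_mono) auto
        finally show ?thesis using False by (simp add: f_def)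
      qed
      then have "\<forall>\<^sub>F k in sequentially. f U k x = 1" unfolding eventually_sequentially by blast
      then show ?thesis using True by (simp add: tendsto_eventually)
    next
      case xU: False
      then have "infdist x (- U) = 0" by (intro infdist_zero) simp
      then show ?thesis using False xU by (simp add: f_def)
    qed
  qed (simp add: f_def)
  define F where "F i = (\<lambda>(p, k). f (from_nat_into B p) k) (prod_decode i)" for i
  show ?thesis
  proof (rule that [of F])
    show "continuous_on UNIV (F i)" for i using fcont by (simp add: F_def case_prod_unfold)
    show "0 \<le> F i x \<and> F i x \<le> 1" for i x using f01 by (simp add: F_def case_prod_unfold)
    fix M N :: "'a measure"
    assume M: "prob_space M" "sets M = sets borel" and N: "prob_space N" "sets N = sets borel"
      and eq: "\<And>i. (\<integral>x. F i x \<partial>M) = (\<integral>x. F i x \<partial>N)"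
    interpret M: prob_space M by fact
    interpret N: prob_space N by fact
    have lim: "(\<lambda>k. \<integral>x. f U k x \<partial>L) \<longlonglongrightarrow> measure L U" if L: "prob_space L" "sets L = sets borel" and U: "open U" for L :: "'a measure" and U
    proof -
      interpret L: prob_space L by fact
      note [measurable_cong] = L(2)
      have [measurable]: "f U k \<in> borel_measurable borel" for k by (rule borel_measurable_continuous_onI [OF fcont])
      have [measurable]: "indicat_real U \<in> borel_measurable L"
        by (rule borel_measurable_indicator) (unfold L(2), use U in simp)
      have "(\<lambda>k. \<integral>x. f U k x \<partial>L) \<longlonglongrightarrow> (\<integral>x. indicator U x \<partial>L)"
        by (rule integral_dominated_convergence [where w = "\<lambda>_. 1"]) (use U f01 flim [OF U] L(2) in auto)
      also have "(\<integral>x. indicator U x \<partial>L) = measure L U" using U L(2) by (simp add: sets_eq_imp_space_eq [OF L(2)])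
      finally show ?thesis .
    qed
    have "emeasure M U = emeasure N U" if U: "U \<in> B" for U
    proof -
      obtain p where p: "from_nat_into B p = U" using from_nat_into_surj [OF B U] by blast
      have "(\<integral>x. f U k x \<partial>M) = (\<integral>x. f U k x \<partial>N)" for k
        using eq [of "prod_encode (p, k)"] by (simp add: F_def p)
      then have "measure M U = measure N U"
        using lim [OF M openB [OF U]] lim [OF N openB [OF U]] LIMSEQ_unique by simp
      then show ?thesis
        by (simp add: M.emeasure_eq_measure N.emeasure_eq_measure)
    qed
    then show "M = N"
      using UNIV_B M.emeasure_finite
      by (intro measure_eqI_generator_eq [OF stable, of UNIV M N "\<lambda>_. UNIV"]) (auto simp: M(2) N(2) gen)
  qed
qed

section \<open>Flows driven by noise\<close>

context label_space begin

text \<open>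
  The kernel is the law of the path for a fixed label, obtained by freezing the label and averaging
  over the noise.
\<close>

lemma flow_of_noise:
  assumes T: "T > 0" and N: "prob_space N" and \<Phi>: "\<Phi> \<in> mu D \<Otimes>\<^sub>M N \<rightarrow>\<^sub>M Path T D"
    and inc: "\<And>t. t \<in> {0..T} \<Longrightarrow> distr (mu D \<Otimes>\<^sub>M N) (mu D) (\<lambda>z. \<Phi> z t) = mu D"
  shows "distr (mu D \<Otimes>\<^sub>M N) (Path T D \<Otimes>\<^sub>M mu D) (\<lambda>z. (\<Phi> z, fst z)) \<in>
    connecting_flows T D (distr (mu D \<Otimes>\<^sub>M N) (mu2 D) (\<lambda>z. (fst z, \<Phi> z 0)))
      (distr (mu D \<Otimes>\<^sub>M N) (mu2 D) (\<lambda>z. (fst z, \<Phi> z T)))"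
    and "flow_action T (distr (mu D \<Otimes>\<^sub>M N) (Path T D \<Otimes>\<^sub>M mu D) (\<lambda>z. (\<Phi> z, fst z))) = (\<integral>\<^sup>+z. path_action T (\<Phi> z) \<partial>(mu D \<Otimes>\<^sub>M N))"
proof -
  interpret N: prob_space N by fact
  interpret m: prob_space "mu D" by (rule prob_mu)
  interpret P: pair_prob_space "mu D" N ..
  let ?F = "distr (mu D \<Otimes>\<^sub>M N) (Path T D \<Otimes>\<^sub>M mu D) (\<lambda>z. (\<Phi> z, fst z))"
  note \<Phi> [measurable]
  have map [measurable]: "(\<lambda>z. (\<Phi> z, fst z)) \<in> mu D \<Otimes>\<^sub>M N \<rightarrow>\<^sub>M Path T D \<Otimes>\<^sub>M mu D" by measurable
  have ev: "(\<lambda>z. fst z t) \<in> Path T D \<Otimes>\<^sub>M mu D \<rightarrow>\<^sub>M mu D" if "t \<in> {0..T}" for t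
    by (rule measurable_compose [OF measurable_fst measurable_eval [OF that]])
  show "?F \<in> connecting_flows T D (distr (mu D \<Otimes>\<^sub>M N) (mu2 D) (\<lambda>z. (fst z, \<Phi> z 0)))
      (distr (mu D \<Otimes>\<^sub>M N) (mu2 D) (\<lambda>z. (fst z, \<Phi> z T)))"
  proof (rule flow_of_kernel [OF T])
    show "(\<lambda>a. distr N (Path T D) (\<lambda>u. \<Phi> (a, u))) \<in> mu D \<rightarrow>\<^sub>M prob_algebra (Path T D)"
    proof (rule measurable_distr_prob_space2)
      show "(\<lambda>_. N) \<in> mu D \<rightarrow>\<^sub>M prob_algebra N" using N by (simp add: space_prob_algebra)
      show "(\<lambda>(x, y). \<Phi> (x, y)) \<in> mu D \<Otimes>\<^sub>M N \<rightarrow>\<^sub>M Path T D" by simp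
    qed
    show "prob_space ?F" by (rule P.prob_space_distr [OF map])
    fix f :: "'a \<times> (real \<Rightarrow> 'a) \<Rightarrow> ennreal" assume f [measurable]: "f \<in> borel_measurable (mu D \<Otimes>\<^sub>M Path T D)"
    have "(\<integral>\<^sup>+z. f (snd z, fst z) \<partial>?F) = (\<integral>\<^sup>+z. f (fst z, \<Phi> z) \<partial>(mu D \<Otimes>\<^sub>M N))"
      by (subst nn_integral_distr [OF map]) auto
    also have "\<dots> = (\<integral>\<^sup>+a. \<integral>\<^sup>+u. f (a, \<Phi> (a, u)) \<partial>N \<partial>mu D)"
      by (subst N.nn_integral_fst [symmetric]) auto
    also have "\<dots> = (\<integral>\<^sup>+a. \<integral>\<^sup>+\<omega>. f (a, \<omega>) \<partial>distr N (Path T D) (\<lambda>u. \<Phi> (a, u)) \<partial>mu D)"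
      by (intro nn_integral_cong) (subst nn_integral_distr, auto)
    finally show "(\<integral>\<^sup>+z. f (snd z, fst z) \<partial>?F) = (\<integral>\<^sup>+a. \<integral>\<^sup>+\<omega>. f (a, \<omega>) \<partial>distr N (Path T D) (\<lambda>u. \<Phi> (a, u)) \<partial>mu D)" .
  next
    fix t assume t: "t \<in> {0..T}"
    show "distr ?F (mu D) (\<lambda>z. fst z t) = mu D"
      by (subst distr_distr [OF ev [OF t] map]) (use inc [OF t] in \<open>simp add: comp_def\<close>)
  next
    have joint: "distr ?F (mu2 D) (\<lambda>z. (snd z, fst z t)) = distr (mu D \<Otimes>\<^sub>M N) (mu2 D) (\<lambda>z. (fst z, \<Phi> z t))"
      if t: "t \<in> {0..T}" for t
    proof (subst distr_distr [OF _ map])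
      show "(\<lambda>z. (snd z, fst z t)) \<in> Path T D \<Otimes>\<^sub>M mu D \<rightarrow>\<^sub>M mu2 D"
        by (intro measurable_Pair measurable_snd ev t)
    qed (simp add: comp_def)
    show "distr ?F (mu2 D) (\<lambda>z. (snd z, fst z 0)) = distr (mu D \<Otimes>\<^sub>M N) (mu2 D) (\<lambda>z. (fst z, \<Phi> z 0))"
      using T by (intro joint) simp
    show "distr ?F (mu2 D) (\<lambda>z. (snd z, fst z T)) = distr (mu D \<Otimes>\<^sub>M N) (mu2 D) (\<lambda>z. (fst z, \<Phi> z T))"
      using T by (intro joint) simp
  qed simp
  have "path_action T \<in> borel_measurable (Path T D)" by (rule measurable_path_action [OF T])
  then have "(\<lambda>(\<omega>, a). path_action T \<omega>) \<in> borel_measurable (Path T D \<Otimes>\<^sub>M mu D)" by measurable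
  then show "flow_action T ?F = (\<integral>\<^sup>+z. path_action T (\<Phi> z) \<partial>(mu D \<Otimes>\<^sub>M N))"
    unfolding flow_action_def by (subst nn_integral_distr [OF map]) simp_all
qed

end

section \<open>Paths from their values at dyadic times\<close>

text \<open>
  The discrete Cauchy-Schwarz inequality: bounded energy yields the Hoelder exponent \<open>1/2\<close>.
\<close>

lemma dyadic_dist_square_le:
  assumes T: "T > 0" and E: "dyadic_energy T \<omega> n \<le> E" and ab: "a \<le> b" "b \<le> 2 ^ n"
  shows "(dist (\<omega> (T * real a / 2 ^ n)) (\<omega> (T * real b / 2 ^ n)))\<^sup>2 \<le> 2 * E / T * (T * real b / 2 ^ n - T * real a / 2 ^ n)"
proof -
  let ?d = "\<lambda>i. dist (\<omega> (T * real i / 2 ^ n)) (\<omega> (T * real (Suc i) / 2 ^ n))"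
  have "dist (\<omega> (T * real a / 2 ^ n)) (\<omega> (T * real b / 2 ^ n)) \<le> (\<Sum>i\<in>{a..<b}. ?d i)"
    by (rule dist_le_sum_steps [where f = "\<lambda>i. \<omega> (T * real i / 2 ^ n)", OF ab(1)])
  then have "(dist (\<omega> (T * real a / 2 ^ n)) (\<omega> (T * real b / 2 ^ n)))\<^sup>2 \<le> (\<Sum>i\<in>{a..<b}. ?d i)\<^sup>2"
    by (intro power_mono) auto
  also have "\<dots> \<le> (\<Sum>i\<in>{a..<b}. (?d i)\<^sup>2) * card {a..<b}" by (rule sum_squared_le_sum_of_squares)
  also have "\<dots> \<le> (2 * E / 2 ^ n) * card {a..<b}"
  proof (rule mult_right_mono)
    have "(\<Sum>i\<in>{a..<b}. (?d i)\<^sup>2) \<le> (\<Sum>i<2 ^ n. (?d i)\<^sup>2)" by (rule sum_mono2) (use ab in auto)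
    also have "\<dots> = 2 * dyadic_energy T \<omega> n / 2 ^ n" by (simp add: dyadic_energy_def)
    also have "\<dots> \<le> 2 * E / 2 ^ n" using E by (simp add: divide_right_mono)
    finally show "(\<Sum>i\<in>{a..<b}. (?d i)\<^sup>2) \<le> 2 * E / 2 ^ n" .
  qed simp
  also have "\<dots> = 2 * E / T * (T * real b / 2 ^ n - T * real a / 2 ^ n)"
    using T ab by (simp add: of_nat_diff diff_divide_distrib right_diff_distrib)
  finally show ?thesis .
qed

lemma grid_index_refine:
  assumes T: "T > 0" and t: "0 \<le> t" and kl: "k \<le> l"
  shows "grid_index T k t * 2 ^ (l - k) \<le> grid_index T l t"
  unfolding grid_index_def [of T l]
proof (rule le_nat_floor)
  have "T * real (grid_index T k t) \<le> t * 2 ^ k"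
    using grid_index_bounds(1) [OF T t, of k] by (simp add: pos_divide_le_eq)
  then have "real (grid_index T k t) \<le> 2 ^ k * t / T" using T by (simp add: pos_le_divide_eq mult.commute)
  then have "real (grid_index T k t) * 2 ^ (l - k) \<le> 2 ^ k * t / T * 2 ^ (l - k)" by (rule mult_right_mono) simp
  also have "\<dots> = 2 ^ l * t / T" using kl by (simp add: power_add [symmetric] mult.commute mult.left_commute)
  finally show "real (grid_index T k t * 2 ^ (l - k)) \<le> 2 ^ l * t / T" by simp
qed

lemma grid_index_grid_point:
  assumes T: "T > 0" and kn: "n \<le> k"
  shows "grid_index T k (T * real i / 2 ^ n) = i * 2 ^ (k - n)"
proof -
  have "(2 :: real) ^ k = 2 ^ (k - n) * 2 ^ n" using kn by (simp add: power_add [symmetric])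
  then have "2 ^ k * (T * real i / 2 ^ n) / T = real (i * 2 ^ (k - n))" using T by simp
  then show ?thesis unfolding grid_index_def by (simp only: floor_of_nat nat_int)
qed

lemma refine_point: "n \<le> k \<Longrightarrow> T * real (i * 2 ^ (k - n)) / 2 ^ k = T * real i / 2 ^ n"
proof -
  assume "n \<le> k"
  then have "(2 :: real) ^ k = 2 ^ (k - n) * 2 ^ n" by (simp add: power_add [symmetric])
  then show ?thesis by simp
qed

text \<open>
  By the Hoelder estimate at grid points, the values at the grid points below \<open>t\<close> form a Cauchy
  sequence, and the limits depend continuously on \<open>t\<close>.
\<close>

lemma dyadic_extension:
  fixes \<omega> :: "real \<Rightarrow> 'a::complete_space"
  assumes T: "T > 0" and E: "\<And>n. dyadic_energy T \<omega> n \<le> E" and D: "closed D" "\<And>n i. i \<le> 2 ^ n \<Longrightarrow> \<omega> (T * real i / 2 ^ n) \<in> D"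
  defines "\<omega>' t \<equiv> lim (\<lambda>k. \<omega> (T * real (grid_index T k t) / 2 ^ k))"
  shows dyadic_extension_tendsto: "\<And>t. t \<in> {0..T} \<Longrightarrow> (\<lambda>k. \<omega> (T * real (grid_index T k t) / 2 ^ k)) \<longlonglongrightarrow> \<omega>' t"
    and dyadic_extension_in: "\<And>t. t \<in> {0..T} \<Longrightarrow> \<omega>' t \<in> D"
    and dyadic_extension_continuous: "continuous_on {0..T} \<omega>'"
    and dyadic_extension_grid: "\<And>n i. i \<le> 2 ^ n \<Longrightarrow> \<omega>' (T * real i / 2 ^ n) = \<omega> (T * real i / 2 ^ n)"
proof -
  let ?g = "\<lambda>k t. T * real (grid_index T k t) / 2 ^ k"
  have E0: "0 \<le> E" using E [of 0] dyadic_energy_nonneg [of T \<omega> 0] by linarith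
  have idx: "grid_index T k t \<le> 2 ^ k" if "t \<in> {0..T}" for k t using grid_index_le [OF T] that by auto
  show conv: "(\<lambda>k. \<omega> (?g k t)) \<longlonglongrightarrow> \<omega>' t" if t: "t \<in> {0..T}" for t
  proof -
    have "Cauchy (\<lambda>k. \<omega> (?g k t))"
    proof (rule metric_CauchyI)
      fix e :: real assume e: "e > 0"
      have "(\<lambda>k. 2 * E * (1/2) ^ k) \<longlonglongrightarrow> 2 * E * 0" by (intro tendsto_intros LIMSEQ_power_zero) simp
      then have "\<forall>\<^sub>F k in sequentially. 2 * E * (1/2) ^ k < e\<^sup>2" using e by (intro order_tendstoD) auto
      then obtain k0 where k0: "\<And>k. k \<ge> k0 \<Longrightarrow> 2 * E * (1/2) ^ k < e\<^sup>2" unfolding eventually_sequentially by blast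
      have ordered: "dist (\<omega> (?g k t)) (\<omega> (?g l t)) < e" if kl: "k0 \<le> k" "k \<le> l" for k l
      proof -
        have "(dist (\<omega> (?g k t)) (\<omega> (?g l t)))\<^sup>2 \<le> 2 * E / T * (?g l t - ?g k t)"
          using dyadic_dist_square_le [OF T E grid_index_refine [OF T _ kl(2)] idx [OF t]] t
          unfolding refine_point [OF kl(2)] by simp
        also have "\<dots> \<le> 2 * E / T * (T * (1/2) ^ k)"
        proof (rule mult_left_mono)
          have "?g l t \<le> t" "t < T * real (Suc (grid_index T k t)) / 2 ^ k" using grid_index_bounds [OF T] t by auto
          moreover have "T * real (Suc (grid_index T k t)) / 2 ^ k = ?g k t + T * (1/2) ^ k"
            by (simp add: power_one_over add_divide_distrib distrib_left inverse_eq_divide)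
          ultimately show "?g l t - ?g k t \<le> T * (1/2) ^ k" by linarith
        qed (use E0 T in simp)
        also have "\<dots> = 2 * E * (1/2) ^ k" using T by simp
        also have "\<dots> < e\<^sup>2" by (rule k0 [OF kl(1)])
        finally show ?thesis using e by (simp add: power_less_imp_less_base)
      qed
      show "\<exists>M. \<forall>m\<ge>M. \<forall>n\<ge>M. dist (\<omega> (?g m t)) (\<omega> (?g n t)) < e"
      proof (intro exI allI impI)
        fix m n assume "k0 \<le> m" "k0 \<le> n"
        then show "dist (\<omega> (?g m t)) (\<omega> (?g n t)) < e"
          using ordered [of m n] ordered [of n m] by (cases "m \<le> n") (auto simp: dist_commute)
      qed
    qed
    then show ?thesis unfolding \<omega>'_def by (simp add: Cauchy_convergent_iff convergent_LIMSEQ_iff)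
  qed
  show "\<omega>' t \<in> D" if t: "t \<in> {0..T}" for t
    by (rule closed_sequentially [OF D(1) D(2) conv [OF t]]) (rule idx [OF t])
  show grid: "\<omega>' (T * real i / 2 ^ n) = \<omega> (T * real i / 2 ^ n)" if "i \<le> 2 ^ n" for n i
    unfolding \<omega>'_def
  proof (rule limI, rule tendsto_eventually)
    show "\<forall>\<^sub>F k in sequentially. \<omega> (?g k (T * real i / 2 ^ n)) = \<omega> (T * real i / 2 ^ n)"
      unfolding eventually_sequentially
      by (intro exI [of _ n] allI impI) (simp only: grid_index_grid_point [OF T] refine_point)
  qed
  have holder: "(dist (\<omega>' s) (\<omega>' t))\<^sup>2 \<le> 2 * E / T * (t - s)" if st: "0 \<le> s" "s \<le> t" "t \<le> T" for s t
  proof (rule LIMSEQ_le)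
    show "(\<lambda>k. (dist (\<omega> (?g k s)) (\<omega> (?g k t)))\<^sup>2) \<longlonglongrightarrow> (dist (\<omega>' s) (\<omega>' t))\<^sup>2"
      using st by (intro tendsto_intros conv) auto
    show "(\<lambda>k. 2 * E / T * (?g k t - ?g k s)) \<longlonglongrightarrow> 2 * E / T * (t - s)"
      using st T by (intro tendsto_intros grid_tendsto) auto
    show "\<exists>N. \<forall>k\<ge>N. (dist (\<omega> (?g k s)) (\<omega> (?g k t)))\<^sup>2 \<le> 2 * E / T * (?g k t - ?g k s)"
      using st by (intro exI allI impI dyadic_dist_square_le [OF T E] grid_index_mono [OF T] idx) auto
  qed
  show "continuous_on {0..T} \<omega>'"
    unfolding continuous_on_iff
  proof (intro ballI allI impI)
    fix t e :: real assume t: "t \<in> {0..T}" and e: "e > 0"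
    let ?d = "e\<^sup>2 * T / (2 * E + 1)"
    have "?d > 0" using e T E0 by simp
    moreover have "dist (\<omega>' s) (\<omega>' t) < e" if s: "s \<in> {0..T}" "dist s t < ?d" for s
    proof -
      have "(dist (\<omega>' s) (\<omega>' t))\<^sup>2 \<le> 2 * E / T * \<bar>t - s\<bar>"
        using holder [of s t] holder [of t s] s t by (cases "s \<le> t") (auto simp: dist_commute)
      also have "\<dots> \<le> (2 * E + 1) / T * \<bar>t - s\<bar>" using T by (intro mult_right_mono divide_right_mono) auto
      also have "\<dots> < (2 * E + 1) / T * ?d"
        using s(2) T E0 by (intro mult_strict_left_mono) (auto simp: dist_real_def abs_minus_commute)
      also have "\<dots> = e\<^sup>2" using T E0 by (simp add: field_simps add_nonneg_eq_0_iff)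
      finally show ?thesis using e by (simp add: power_less_imp_less_base)
    qed
    ultimately show "\<exists>d>0. \<forall>s\<in>{0..T}. dist s t < d \<longrightarrow> dist (\<omega>' s) (\<omega>' t) < e" by blast
  qed
qed

section \<open>Compact sets of positive volume as label spaces\<close>

lemma measurable_vec_lambda:
  fixes f :: "'b \<Rightarrow> 'n::finite \<Rightarrow> real"
  assumes "\<And>i. (\<lambda>y. f y i) \<in> borel_measurable M"
  shows "(\<lambda>y. \<chi> i. f y i) \<in> borel_measurable M"
proof (subst borel_measurable_euclidean_space, rule ballI)
  fix b :: "real^'n" assume "b \<in> Basis"
  then obtain i where "b = axis i 1" by (auto simp: Basis_vec_def)
  then show "(\<lambda>y. (\<chi> i. f y i) \<bullet> b) \<in> borel_measurable M" using assms by (simp add: inner_axis)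
qed

lemma measurable_vec_nth' [measurable]: "(\<lambda>x :: real^'n. x $ i) \<in> borel_measurable borel"
  by (intro borel_measurable_continuous_onI continuous_intros)

text \<open>
  The digits recover only numbers that are at least \<open>0\<close> and less than \<open>1\<close>.
\<close>

definition to_unit :: "real \<Rightarrow> real \<Rightarrow> real" where "to_unit B v = (v + B) / (2 * B)"
definition from_unit :: "real \<Rightarrow> real \<Rightarrow> real" where "from_unit B s = 2 * B * s - B"

lemma to_unit_bounds: "\<bar>v\<bar> < B \<Longrightarrow> 0 \<le> to_unit B v \<and> to_unit B v < 1"
  by (auto simp: to_unit_def field_simps)

lemma from_to_unit: "B > 0 \<Longrightarrow> from_unit B (to_unit B v) = v"
  by (simp add: to_unit_def from_unit_def field_simps)

lemma unit_measurable [measurable]: "to_unit B \<in> borel_measurable borel" "from_unit B \<in> borel_measurable borel"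
  unfolding to_unit_def from_unit_def by measurable

lemma compact_norm_bound:
  assumes "compact (D :: (real^'n) set)"
  obtains B where "B > 0" "\<And>x i. x \<in> D \<Longrightarrow> \<bar>x $ i\<bar> < B"
proof -
  obtain B where B: "B > 0" "\<And>x. x \<in> D \<Longrightarrow> norm x \<le> B"
    using compact_imp_bounded [OF assms] by (meson bounded_pos)
  show ?thesis
  proof (rule that [of "B + 1"])
    show "\<bar>x $ i\<bar> < B + 1" if "x \<in> D" for x i
      using component_le_norm_cart [of x i] B(2) [OF that] by linarith
  qed (use B in simp)
qed

lemma label_space_compact:
  fixes D :: "(real^'n) set"
  assumes D: "compact D" "emeasure volume D > 0"
  shows "label_space D"
proof (rule label_space.intro)
  have Db: "D \<in> sets borel" using borel_compact [OF D(1)] .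
  have pos: "emeasure lborel D \<noteq> 0" using D(2) by (simp add: volume_vec_def)
  have fin: "emeasure lborel D < \<infinity>" using emeasure_bounded_finite [OF compact_imp_bounded [OF D(1)]] .
  have sets: "sets (mu D) = sets (restrict_space borel D)"
    unfolding mu_def volume_vec_def by (rule sets_restrict_space_cong) simp
  show "compact D" by (rule D(1))
  show "sets (mu D) = sets (restrict_space borel D)" by (rule sets)
  show "prob_space (mu D)" by (rule prob_space_mu [OF D])
  show "\<not> (AE x in mu D. x = c)" for c
  proof
    assume "AE x in mu D. x = c"
    then have "AE x in uniform_measure lborel D. x \<in> D \<longrightarrow> x = c"
      unfolding mu_def volume_vec_def using Db by (subst (asm) AE_restrict_space_iff) auto
    then have "AE x in lborel. x \<in> D \<longrightarrow> (x \<in> D \<longrightarrow> x = c)"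
      using pos fin Db by (subst (asm) AE_uniform_measure) auto
    then have "AE x in lborel. x \<notin> D"
      using AE_lborel_singleton [of c] by eventually_elim auto
    then have "emeasure lborel D = 0" using Db by (subst (asm) AE_iff_measurable [where N = D]) auto
    then show False using pos by simp
  qed
  show "AE t in lebesgue. 0 < t \<and> t < T \<longrightarrow> has_metric_speed \<omega> (speed \<omega> t {0..T}) t"
    if "absolutely_continuous_path T \<omega>" for T and \<omega> :: "real \<Rightarrow> real^'n"
    using that by (rule metric_speed_AE_vec)
  obtain B where B: "B > 0" "\<And>x i. x \<in> D \<Longrightarrow> \<bar>x $ i\<bar> < B" using compact_norm_bound [OF D(1)] by blast
  obtain d0 where d0: "d0 \<in> D" using D(2) by fastforce
  let ?\<phi> = "\<lambda>x :: real^'n. encode (\<lambda>i. to_unit B (x $ i))"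
  let ?v = "\<lambda>y :: real. (\<chi> i. from_unit B (decode y i)) :: real^'n"
  let ?\<psi> = "\<lambda>y. if ?v y \<in> D then ?v y else d0"
  have cn: "countable (UNIV :: 'n set)" by (simp add: countable_finite)
  have vm [measurable]: "?v \<in> borel_measurable borel" by (rule measurable_vec_lambda) measurable
  show "\<exists>\<phi> \<psi>. \<phi> \<in> borel_measurable (mu D) \<and> (\<forall>x\<in>D. 0 \<le> \<phi> x \<and> \<phi> x \<le> (1::real)) \<and>
      \<psi> \<in> borel \<rightarrow>\<^sub>M mu D \<and> (\<forall>x\<in>D. \<psi> (\<phi> x) = x)"
  proof (intro exI conjI ballI)
    have "?\<phi> \<in> borel_measurable borel" by (rule encode_measurable) measurable
    then show "?\<phi> \<in> borel_measurable (mu D)"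
      unfolding measurable_cong_sets [OF sets refl] by (rule measurable_restrict_space1)
    show "0 \<le> ?\<phi> x" "?\<phi> x \<le> 1" for x using encode_bounds [of "\<lambda>i. to_unit B (x $ i)"] by auto
    have "?\<psi> \<in> borel_measurable borel" using Db by measurable
    then show "?\<psi> \<in> borel \<rightarrow>\<^sub>M mu D"
      unfolding measurable_cong_sets [OF refl sets] using d0 by (intro measurable_restrict_space2) auto
    fix x assume x: "x \<in> D"
    have "decode (?\<phi> x) i = to_unit B (x $ i)" for i
      using to_unit_bounds [OF B(2) [OF x]] by (intro decode_encode cn) auto
    then have "?v (?\<phi> x) = x" by (simp add: from_to_unit B(1) vec_eq_iff)
    then show "?\<psi> (?\<phi> x) = x" using x by simp
  qed
qed

section \<open>Compactness of flows with bounded action\<close>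

text \<open>
  Countably many test functions allow shrinking the narrow neighbourhoods of a plan along a sequence.
\<close>

definition determining_family :: "(nat \<Rightarrow> 'a::topological_space \<Rightarrow> real) \<Rightarrow> bool"
  where "determining_family G \<longleftrightarrow> (\<forall>i. continuous_on UNIV (G i)) \<and> (\<forall>i x. 0 \<le> G i x \<and> G i x \<le> 1) \<and>
    (\<forall>M N. prob_space M \<longrightarrow> prob_space N \<longrightarrow> sets M = sets borel \<longrightarrow> sets N = sets borel \<longrightarrow>
      (\<forall>i. (\<integral>x. G i x \<partial>M) = (\<integral>x. G i x \<partial>N)) \<longrightarrow> M = N)"

lemma determining_familyD:
  assumes "determining_family G"
  shows "continuous_on UNIV (G i)" "0 \<le> G i x \<and> G i x \<le> 1"
    and "prob_space M \<Longrightarrow> prob_space N \<Longrightarrow> sets M = sets borel \<Longrightarrow> sets N = sets borel \<Longrightarrow>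
      (\<And>i. (\<integral>x. G i x \<partial>M) = (\<integral>x. G i x \<partial>N)) \<Longrightarrow> M = N"
  using assms unfolding determining_family_def by blast+

lemma ex_determining_family:
  "\<exists>G :: nat \<Rightarrow> 'a::{metric_space, second_countable_topology} \<Rightarrow> real. determining_family G"
proof (rule countable_determining_functions)
  fix G :: "nat \<Rightarrow> 'a \<Rightarrow> real"
  assume "\<And>i. continuous_on UNIV (G i)" "\<And>i x. 0 \<le> G i x \<and> G i x \<le> 1"
    and det: "\<And>M N. prob_space M \<Longrightarrow> prob_space N \<Longrightarrow> sets M = sets borel \<Longrightarrow> sets N = sets borel \<Longrightarrow>
      (\<And>i. (\<integral>x. G i x \<partial>M) = (\<integral>x. G i x \<partial>N)) \<Longrightarrow> M = N"
  then have "determining_family G" unfolding determining_family_def by (intro conjI allI impI det) auto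
  then show "\<exists>G :: nat \<Rightarrow> 'a \<Rightarrow> real. determining_family G" by blast
qed

text \<open>
  The determining functions identify laws on the whole Euclidean space, whereas flows live on \<open>D\<close>.
\<close>

lemma distr_eq_coarser:
  assumes f: "f \<in> N \<rightarrow>\<^sub>M M" "f \<in> N \<rightarrow>\<^sub>M B" and g: "g \<in> K \<rightarrow>\<^sub>M M" "g \<in> K \<rightarrow>\<^sub>M B"
    and sub: "sets M \<subseteq> sets B" and eq: "distr N B f = distr K B g"
  shows "distr N M f = distr K M g"
proof (rule measure_eqI)
  fix A assume "A \<in> sets (distr N M f)"
  then have A: "A \<in> sets M" "A \<in> sets B" using sub by auto
  have "emeasure (distr N M f) A = emeasure (distr N B f) A"
    by (simp add: emeasure_distr f A)
  also have "\<dots> = emeasure (distr K M g) A"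
    unfolding eq by (simp add: emeasure_distr g A)
  finally show "emeasure (distr N M f) A = emeasure (distr K M g) A" .
qed simp

context label_space begin

lemma D_borel: "D \<in> sets borel"
  using borel_compact [OF compact_D] .

lemma sets_mu_subset: "sets (mu D) \<subseteq> sets borel"
  unfolding sets_mu using D_borel by (auto simp: sets_restrict_space_iff)

lemma sets_mu_pair_subset: "sets (mu2 D) \<subseteq> sets (borel :: ('a \<times> 'a) measure)"
proof
  fix A assume A: "A \<in> sets (mu2 D)"
  let ?R = "restrict_space (borel :: ('a \<times> 'a) measure) (D \<times> D)"
  have DD: "D \<times> D \<in> sets (borel :: ('a \<times> 'a) measure)"
    by (rule borel_closed) (intro closed_Times compact_imp_closed compact_D)
  have "(\<lambda>z. (fst z, snd z)) \<in> ?R \<rightarrow>\<^sub>M mu2 D"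
  proof (rule measurable_Pair)
    have "fst \<in> (borel :: ('a \<times> 'a) measure) \<rightarrow>\<^sub>M borel" "snd \<in> (borel :: ('a \<times> 'a) measure) \<rightarrow>\<^sub>M borel"
      by (auto intro!: borel_measurable_continuous_onI continuous_on_fst continuous_on_snd continuous_on_id)
    then show "fst \<in> ?R \<rightarrow>\<^sub>M mu D" "snd \<in> ?R \<rightarrow>\<^sub>M mu D"
      by (auto simp: measurable_to_mu_iff space_restrict_space intro: measurable_restrict_space1)
  qed
  from measurable_sets [OF this A] have "A \<inter> (D \<times> D) \<in> sets ?R"
    by (simp add: space_restrict_space vimage_def Int_def)
  moreover have "A \<subseteq> D \<times> D" using sets.sets_into_space [OF A] by (simp add: space_pair_measure space_mu_D)
  ultimately have "A \<in> sets ?R" by (simp add: Int_absorb2)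
  then show "A \<in> sets borel" using DD by (auto simp: sets_restrict_space_iff)
qed

lemma mu_pair_borel: "f \<in> N \<rightarrow>\<^sub>M mu2 D \<Longrightarrow> f \<in> N \<rightarrow>\<^sub>M (borel :: ('a \<times> 'a) measure)"
proof -
  assume f: "f \<in> N \<rightarrow>\<^sub>M mu2 D"
  have "(\<lambda>z. fst (f z)) \<in> N \<rightarrow>\<^sub>M borel" "(\<lambda>z. snd (f z)) \<in> N \<rightarrow>\<^sub>M borel"
    using measurable_compose [OF f measurable_fst] measurable_compose [OF f measurable_snd] by (auto simp: measurable_to_mu_iff)
  then have "(\<lambda>z. (fst (f z), snd (f z))) \<in> borel_measurable N" by (rule borel_measurable_Pair)
  then show ?thesis by simp
qed

lemma mu_borel: "f \<in> N \<rightarrow>\<^sub>M mu D \<Longrightarrow> f \<in> borel_measurable N"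
  by (simp add: measurable_to_mu_iff)

end

text \<open>
  A flow is determined by the label and by the positions at rational multiples of the time horizon,
  that is, by a point of a compact product space. The coupled subsequence yields random limits of all
  these coordinates. The energies pass to the limit by Fatou's lemma, so that the limits are the
  values of a random path of finite action, and the marginals pass to the limit because they are
  tested with bounded continuous functions. Finally, the randomisation lemma turns the limit into a
  flow that is given by a kernel.
\<close>

lemma limit_flow:
  fixes D :: "(real^'n) set" and H :: "nat \<Rightarrow> (real^'n) \<times> (real^'n) \<Rightarrow> real"
  assumes T: "T > 0" and D: "compact D" "emeasure volume D > 0"
    and F: "\<And>n. F n \<in> connecting_flows T D (\<eta> n) (\<gamma> n)" and act: "\<And>n. flow_action T (F n) \<le> c n"
    and c: "c \<longlonglongrightarrow> c'" "c' < \<infinity>"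
    and plans: "\<eta>' \<in> uniform_plans D" "\<gamma>' \<in> uniform_plans D"
    and H: "determining_family H"
    and \<eta>: "\<And>i. (\<lambda>n. \<integral>x. H i x \<partial>\<eta> n) \<longlonglongrightarrow> (\<integral>x. H i x \<partial>\<eta>')"
    and \<gamma>: "\<And>i. (\<lambda>n. \<integral>x. H i x \<partial>\<gamma> n) \<longlonglongrightarrow> (\<integral>x. H i x \<partial>\<gamma>')"
  shows "\<exists>F\<in>connecting_flows T D \<eta>' \<gamma>'. flow_action T F \<le> c'"
proof -
  interpret label_space D by (rule label_space_compact [OF D])
  interpret mD: prob_space "mu D" by (rule prob_mu)
  note Hdet = determining_familyD(3) [OF H] and H = determining_familyD(1,2) [OF H]
  note flowD = connecting_flowD [OF T F]
  obtain B where B: "B > 0" "\<And>x i. x \<in> D \<Longrightarrow> \<bar>x $ i\<bar> < B" using compact_norm_bound [OF D(1)] by blast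
  obtain d0 where d0: "d0 \<in> D" using D_nonempty by blast
  define \<tau> where "\<tau> q = max 0 (min T (T * real_of_rat q))" for q
  have \<tau>: "\<tau> q \<in> {0..T}" for q using T by (simp add: \<tau>_def)
  define pos where "pos z p = (case p of None \<Rightarrow> snd z | Some q \<Rightarrow> fst z (\<tau> q))" for z :: "(real \<Rightarrow> real^'n) \<times> (real^'n)" and p
  have pos_mu: "(\<lambda>z. pos z p) \<in> F n \<rightarrow>\<^sub>M mu D" for n p
    unfolding measurable_cong_sets [OF flowD(2) refl]
  proof (cases p)
    case (Some q)
    then show "(\<lambda>z. pos z p) \<in> Path T D \<Otimes>\<^sub>M mu D \<rightarrow>\<^sub>M mu D"
      using measurable_compose [OF measurable_fst measurable_eval [OF \<tau>]] by (simp add: pos_def)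
  qed (simp add: pos_def)
  have pos_law: "distr (F n) (mu D) (\<lambda>z. pos z p) = mu D" for n p
    using flowD(4) [OF \<tau>] flowD(5) by (cases p) (simp_all add: pos_def)
  have posD: "pos z p \<in> D" if "z \<in> space (F n)" for z p n
    using measurable_space [OF pos_mu that] by (simp add: space_mu_D)
  define X where "X z = (\<lambda>(p, i). to_unit B (pos z p $ i))" for z
  have XM: "(\<lambda>z. X z (p :: rat option \<times> 'n)) \<in> borel_measurable (F n)" for n p
  proof (cases p)
    case (Pair q i)
    have [measurable]: "(\<lambda>z. pos z q) \<in> borel_measurable (F n)" by (rule mu_borel [OF pos_mu])
    show ?thesis unfolding X_def Pair by simp
  qed
  obtain r \<Omega> Y' Y where r: "strict_mono (r :: nat \<Rightarrow> nat)" and \<Omega>: "prob_space (\<Omega> :: real measure)"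
    and Y' [measurable]: "\<And>n. Y' n \<in> borel_measurable \<Omega>" and Y [measurable]: "Y \<in> borel_measurable \<Omega>"
    and law: "\<And>n. distr \<Omega> borel (Y' n) = distr (F (r n)) borel (\<lambda>z. encode (X z))"
    and Y01: "\<And>x. 0 \<le> Y x \<and> Y x \<le> (1 :: real)"
    and dlim: "AE x in \<Omega>. \<forall>p :: rat option \<times> 'n. (\<lambda>n. decode (Y' n x) p) \<longlonglongrightarrow> decode (Y x) p"
    by (rule coupled_subsequence [where M = F and X = "\<lambda>_. X", OF flowD(1) XM]) (rule that)
  interpret \<Omega>: prob_space \<Omega> by (rule \<Omega>)
  have encM [measurable]: "(\<lambda>z. encode (X z)) \<in> borel_measurable (F n)" for n by (rule encode_measurable [OF XM])
  define val where "val y p = ((\<chi> i. from_unit B (decode y (p, i))) :: real^'n)" for y :: real and p :: "rat option"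
  have val [measurable]: "(\<lambda>y. val y p :: real^'n) \<in> borel_measurable borel" for p
    unfolding val_def by (rule measurable_vec_lambda) measurable
  have cI: "countable (UNIV :: (rat option \<times> 'n) set)"
    unfolding UNIV_Times_UNIV [symmetric] by (intro countable_SIGMA) (auto simp: countable_finite)
  have val_enc: "val (encode (X z)) p = pos z p" if z: "z \<in> space (F n)" for z p n
  proof -
    have "decode (encode (X z)) (p, i) = to_unit B (pos z p $ i)" for i
      using decode_encode [OF cI, of "X z" "(p, i)"] to_unit_bounds [OF B(2) [OF posD [OF z]]] by (simp add: X_def)
    then show ?thesis by (simp add: val_def from_to_unit B(1) vec_eq_iff)
  qed
  have vlim: "AE x in \<Omega>. \<forall>p. (\<lambda>n. val (Y' n x) p :: real^'n) \<longlonglongrightarrow> val (Y x) p"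
    using dlim
  proof eventually_elim
    case (elim x)
    show ?case
    proof
      fix p :: "rat option"
      have "(\<lambda>n. from_unit B (decode (Y' n x) (p, i))) \<longlonglongrightarrow> from_unit B (decode (Y x) (p, i))" for i :: 'n
        unfolding from_unit_def by (intro tendsto_intros spec [OF elim])
      then show "(\<lambda>n. val (Y' n x) p :: real^'n) \<longlonglongrightarrow> val (Y x) p"
        unfolding val_def by (intro vec_tendstoI) simp
    qed
  qed
  have transfer: "(\<integral>x. g (Y' n x) \<partial>\<Omega>) = (\<integral>z. g (encode (X z)) \<partial>F (r n))" if g [measurable]: "g \<in> borel_measurable borel" for g :: "real \<Rightarrow> real" and n
  proof -
    have "(\<integral>x. g (Y' n x) \<partial>\<Omega>) = (\<integral>y. g y \<partial>distr \<Omega> borel (Y' n))" by (rule integral_distr [symmetric]) auto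
    also have "\<dots> = (\<integral>z. g (encode (X z)) \<partial>F (r n))" unfolding law by (rule integral_distr) auto
    finally show ?thesis .
  qed
  have nn_transfer: "(\<integral>\<^sup>+x. g (Y' n x) \<partial>\<Omega>) = (\<integral>\<^sup>+z. g (encode (X z)) \<partial>F (r n))" if g [measurable]: "g \<in> borel_measurable borel" for g :: "real \<Rightarrow> ennreal" and n
  proof -
    have "(\<integral>\<^sup>+x. g (Y' n x) \<partial>\<Omega>) = (\<integral>\<^sup>+y. g y \<partial>distr \<Omega> borel (Y' n))" by (rule nn_integral_distr [symmetric]) auto
    also have "\<dots> = (\<integral>\<^sup>+z. g (encode (X z)) \<partial>F (r n))" unfolding law by (rule nn_integral_distr) auto
    finally show ?thesis .
  qed
  \<comment> \<open>each position is uniform along the sequence, so its integrals against the test functions are constant\<close>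
  obtain G :: "nat \<Rightarrow> real^'n \<Rightarrow> real" where "determining_family G" using ex_determining_family by blast
  note G = determining_familyD(1,2) [OF this] and Gdet = determining_familyD(3) [OF this]
  have Gm [measurable]: "G i \<in> borel_measurable borel" for i by (rule borel_measurable_continuous_onI [OF G(1)])
  have Hm [measurable]: "H i \<in> borel_measurable borel" for i by (rule borel_measurable_continuous_onI [OF H(1)])
  have idm: "(\<lambda>x. x) \<in> mu D \<rightarrow>\<^sub>M mu D" "(\<lambda>x. x) \<in> mu D \<rightarrow>\<^sub>M borel" by (simp_all add: mu_borel)
  have valG: "(\<integral>x. G i (val (Y x) p) \<partial>\<Omega>) = (\<integral>x. G i x \<partial>mu D)" for i p
  proof (rule LIMSEQ_unique)
    show "(\<lambda>n. \<integral>x. G i (val (Y' n x) p) \<partial>\<Omega>) \<longlonglongrightarrow> (\<integral>x. G i (val (Y x) p) \<partial>\<Omega>)"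
    proof (rule integral_dominated_convergence [where w = "\<lambda>_. 1"])
      show "AE x in \<Omega>. (\<lambda>n. G i (val (Y' n x) p)) \<longlonglongrightarrow> G i (val (Y x) p)"
        using vlim by eventually_elim (rule continuous_on_tendsto_compose [OF G(1)], auto)
    qed (use G(2) in auto)
    have "(\<integral>x. G i (val (Y' n x) p) \<partial>\<Omega>) = (\<integral>x. G i x \<partial>mu D)" for n
    proof -
      have "(\<integral>x. G i (val (Y' n x) p) \<partial>\<Omega>) = (\<integral>z. G i (val (encode (X z)) p) \<partial>F (r n))" by (rule transfer) measurable
      also have "\<dots> = (\<integral>z. G i (pos z p) \<partial>F (r n))" by (intro Bochner_Integration.integral_cong refl) (simp add: val_enc)
      also have "\<dots> = (\<integral>x. G i x \<partial>distr (F (r n)) (mu D) (\<lambda>z. pos z p))"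
        by (rule integral_distr [symmetric, OF pos_mu]) (rule measurable_compose [OF idm(2) Gm])
      finally show ?thesis by (simp add: pos_law)
    qed
    then show "(\<lambda>n. \<integral>x. G i (val (Y' n x) p) \<partial>\<Omega>) \<longlonglongrightarrow> (\<integral>x. G i x \<partial>mu D)" by simp
  qed
  have muG: "(\<integral>x. G i x \<partial>distr (mu D) borel (\<lambda>x. x)) = (\<integral>x. G i x \<partial>mu D)" for i
    by (rule integral_distr [OF idm(2) Gm])
  have val_law: "distr \<Omega> borel (\<lambda>x. val (Y x) p) = distr (mu D) borel (\<lambda>x. x)" for p
  proof (rule Gdet)
    show "prob_space (distr \<Omega> borel (\<lambda>x. val (Y x) p))" by (rule \<Omega>.prob_space_distr) simp
    show "prob_space (distr (mu D) borel (\<lambda>x. x))" by (rule mD.prob_space_distr [OF idm(2)])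
    show "(\<integral>x. G i x \<partial>distr \<Omega> borel (\<lambda>x. val (Y x) p)) = (\<integral>x. G i x \<partial>distr (mu D) borel (\<lambda>x. x))" for i
      by (subst integral_distr) (simp_all add: muG valG)
  qed simp_all
  have valD: "AE x in \<Omega>. \<forall>p. val (Y x) p \<in> D"
    unfolding AE_all_countable
  proof
    fix p
    have "AE y in distr (mu D) borel (\<lambda>x. x). y \<in> D"
      by (subst AE_distr_iff [OF idm(2)]) (use D_borel AE_space [of "mu D"] in \<open>auto simp: space_mu_D\<close>)
    then have "AE y in distr \<Omega> borel (\<lambda>x. val (Y x) p). y \<in> D" by (simp only: val_law)
    then show "AE x in \<Omega>. val (Y x) p \<in> D" by (rule AE_distrD [rotated]) simp
  qed
  \<comment> \<open>for codes without a path of finite energy in \<open>D\<close>, a null set, the path rests at \<open>d0\<close>\<close>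
  define \<omega>0 where "\<omega>0 y t = (val y (Some (THE q. real_of_rat q = t / T)) :: real^'n)" for y t
  have \<omega>0_grid: "\<omega>0 y (T * real i / 2 ^ n) = val y (Some (of_nat i / 2 ^ n))" for y i n
  proof -
    have "real_of_rat q = T * real i / 2 ^ n / T \<longleftrightarrow> q = of_nat i / 2 ^ n" for q
    proof -
      have "T * real i / 2 ^ n / T = real_of_rat (of_nat i / 2 ^ n)" using T by (simp add: of_rat_divide of_rat_power)
      then show ?thesis by (simp only: of_rat_eq_iff)
    qed
    then show ?thesis by (simp add: \<omega>0_def)
  qed
  have \<tau>_grid: "\<tau> (of_nat i / 2 ^ n) = T * real i / 2 ^ n" if "i \<le> 2 ^ n" for i n
    using dyadic_point_in [OF T that] by (simp add: \<tau>_def of_rat_divide of_rat_power)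
  have \<omega>0m [measurable]: "(\<lambda>y. \<omega>0 y (T * real i / 2 ^ n)) \<in> borel_measurable borel" for i n
    unfolding \<omega>0_grid by measurable
  define e where "e n y = dyadic_energy T (\<omega>0 y) n" for n y
  have em [measurable]: "e n \<in> borel_measurable borel" for n
    unfolding e_def dyadic_energy_def using \<omega>0m [of "Suc _" n] by measurable
  define good where "good y \<longleftrightarrow> (SUP n. ennreal (e n y)) < \<infinity> \<and> (\<forall>n i. i \<le> 2 ^ n \<longrightarrow> \<omega>0 y (T * real i / 2 ^ n) \<in> D)" for y
  have goodm [measurable]: "Measurable.pred borel good"
    unfolding good_def using D_borel by measurable
  define \<omega>1 where "\<omega>1 y t = lim (\<lambda>k. \<omega>0 y (T * real (grid_index T k t) / 2 ^ k))" for y t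
  have ext: "(\<And>t. t \<in> {0..T} \<Longrightarrow> (\<lambda>k. \<omega>0 y (T * real (grid_index T k t) / 2 ^ k)) \<longlonglongrightarrow> \<omega>1 y t)"
    "(\<And>t. t \<in> {0..T} \<Longrightarrow> \<omega>1 y t \<in> D)" "continuous_on {0..T} (\<omega>1 y)"
    "(\<And>n i. i \<le> 2 ^ n \<Longrightarrow> \<omega>1 y (T * real i / 2 ^ n) = \<omega>0 y (T * real i / 2 ^ n))" if y: "good y" for y
  proof -
    obtain E where E: "0 \<le> E" "(SUP n. ennreal (e n y)) = ennreal E"
      using y unfolding good_def by (cases "SUP n. ennreal (e n y)") auto
    have "dyadic_energy T (\<omega>0 y) n \<le> E" for n
      using SUP_upper [of n UNIV "\<lambda>n. ennreal (e n y)"] E by (simp add: ennreal_le_iff e_def)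
    note dy = this
    have "\<omega>0 y (T * real i / 2 ^ n) \<in> D" if "i \<le> 2 ^ n" for n i using y that by (simp add: good_def)
    note dy = T dy compact_imp_closed [OF D(1)] this
    show "(\<lambda>k. \<omega>0 y (T * real (grid_index T k t) / 2 ^ k)) \<longlonglongrightarrow> \<omega>1 y t" if "t \<in> {0..T}" for t
      unfolding \<omega>1_def by (rule dyadic_extension_tendsto [OF dy that])
    show "\<omega>1 y t \<in> D" if "t \<in> {0..T}" for t
      unfolding \<omega>1_def by (rule dyadic_extension_in [OF dy that])
    have "continuous_on {0..T} (\<lambda>t. \<omega>1 y t)"
      unfolding \<omega>1_def by (rule dyadic_extension_continuous [OF dy])
    then show "continuous_on {0..T} (\<omega>1 y)" .
    show "\<omega>1 y (T * real i / 2 ^ n) = \<omega>0 y (T * real i / 2 ^ n)" if "i \<le> 2 ^ n" for n i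
      unfolding \<omega>1_def by (rule dyadic_extension_grid [OF dy that])
  qed
  define \<Psi> where "\<Psi> y = restrict (\<lambda>t. if good y then \<omega>1 y t else d0) {0..T}" for y
  have \<Psi>_space: "\<Psi> y \<in> space (Path T D)" for y
  proof -
    have "continuous_on {0..T} (\<lambda>t. if good y then \<omega>1 y t else d0)" using ext(3) by (cases "good y") auto
    then have "continuous_on {0..T} (\<Psi> y)" by (rule continuous_on_eq) (simp add: \<Psi>_def)
    then show ?thesis using ext(2) d0 by (auto simp: space_Path \<Psi>_def)
  qed
  have \<Psi>m [measurable]: "\<Psi> \<in> borel \<rightarrow>\<^sub>M Path T D"
  proof (rule measurable_Path [OF T])
    fix t assume t: "t \<in> {0..T}"
    have [measurable]: "(\<lambda>y. \<omega>1 y t) \<in> borel_measurable borel"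
      unfolding \<omega>1_def by (rule borel_measurable_lim_metric) (rule \<omega>0m)
    show "(\<lambda>y. \<Psi> y t) \<in> borel_measurable borel" using t by (simp add: \<Psi>_def)
  qed (use \<Psi>_space in auto)
  have action: "path_action T (\<Psi> y) = (SUP n. ennreal (e n y))" if y: "good y" for y
  proof -
    have "dyadic_energy T (\<Psi> y) n = e n y" for n
    proof -
      have "\<Psi> y (T * real i / 2 ^ n) = \<omega>0 y (T * real i / 2 ^ n)" if "i \<le> 2 ^ n" for i
        using dyadic_point_in [OF T that] ext(4) [OF y that] y by (simp add: \<Psi>_def)
      note pts = this
      show ?thesis unfolding e_def dyadic_energy_def
        by (intro arg_cong2 [where f = "(*)"] sum.cong refl arg_cong [where f = "\<lambda>x. x ^ 2"] arg_cong2 [where f = dist] pts) auto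
    qed
    then show ?thesis by (simp add: path_action_eq [OF T \<Psi>_space])
  qed
  \<comment> \<open>an energy is a continuous function of finitely many positions, so Fatou's lemma applies at each level\<close>
  have elim: "AE x in \<Omega>. \<forall>n. (\<lambda>m. e n (Y' m x)) \<longlonglongrightarrow> e n (Y x)"
    using vlim
  proof eventually_elim
    case (elim x)
    show ?case unfolding e_def dyadic_energy_def \<omega>0_grid using elim by (intro allI tendsto_intros) auto
  qed
  have e_le: "(\<integral>\<^sup>+x. ennreal (e n (Y' m x)) \<partial>\<Omega>) \<le> c (r m)" for n m
  proof -
    have "(\<integral>\<^sup>+x. ennreal (e n (Y' m x)) \<partial>\<Omega>) = (\<integral>\<^sup>+z. ennreal (e n (encode (X z))) \<partial>F (r m))"
      by (rule nn_transfer) measurable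
    also have "\<dots> \<le> (\<integral>\<^sup>+z. path_action T (fst z) \<partial>F (r m))"
    proof (rule nn_integral_mono)
      fix z assume z: "z \<in> space (F (r m))"
      have "\<omega>0 (encode (X z)) (T * real i / 2 ^ n) = fst z (T * real i / 2 ^ n)" if "i \<le> 2 ^ n" for i
        unfolding \<omega>0_grid val_enc [OF z] by (simp add: pos_def \<tau>_grid [OF that])
      note pts = this
      have "e n (encode (X z)) = dyadic_energy T (fst z) n" unfolding e_def dyadic_energy_def
        by (intro arg_cong2 [where f = "(*)"] sum.cong refl arg_cong [where f = "\<lambda>x. x ^ 2"] arg_cong2 [where f = dist] pts) auto
      moreover have "fst z \<in> space (Path T D)"
        using z sets_eq_imp_space_eq [OF flowD(2)] by (auto simp: space_pair_measure)
      ultimately show "ennreal (e n (encode (X z))) \<le> path_action T (fst z)"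
        using SUP_upper [of n UNIV "\<lambda>n. ennreal (dyadic_energy T (fst z) n)"] by (simp add: path_action_eq [OF T])
    qed
    also have "\<dots> = flow_action T (F (r m))" by (simp add: flow_action_def case_prod_unfold)
    also have "\<dots> \<le> c (r m)" by (rule act)
    finally show ?thesis .
  qed
  have eY_le: "(\<integral>\<^sup>+x. ennreal (e n (Y x)) \<partial>\<Omega>) \<le> c'" for n
  proof -
    have "(\<integral>\<^sup>+x. ennreal (e n (Y x)) \<partial>\<Omega>) = (\<integral>\<^sup>+x. liminf (\<lambda>m. ennreal (e n (Y' m x))) \<partial>\<Omega>)"
    proof (rule nn_integral_cong_AE)
      show "AE x in \<Omega>. ennreal (e n (Y x)) = liminf (\<lambda>m. ennreal (e n (Y' m x)))"
        using elim by eventually_elim (intro lim_imp_Liminf [symmetric] tendsto_ennrealI, auto)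
    qed
    also have "\<dots> \<le> liminf (\<lambda>m. \<integral>\<^sup>+x. ennreal (e n (Y' m x)) \<partial>\<Omega>)" by (rule nn_integral_liminf) measurable
    also have "\<dots> \<le> liminf (\<lambda>m. c (r m))" by (rule Liminf_mono) (simp add: e_le)
    also have "\<dots> = c'" using LIMSEQ_subseq_LIMSEQ [OF c(1) r] by (intro lim_imp_Liminf) (simp_all add: comp_def)
    finally show ?thesis .
  qed
  have SUP_le: "(\<integral>\<^sup>+x. (SUP n. ennreal (e n (Y x))) \<partial>\<Omega>) \<le> c'"
  proof -
    have "(\<integral>\<^sup>+x. (SUP n. ennreal (e n (Y x))) \<partial>\<Omega>) = (SUP n. \<integral>\<^sup>+x. ennreal (e n (Y x)) \<partial>\<Omega>)"
    proof (rule nn_integral_monotone_convergence_SUP)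
      show "incseq (\<lambda>n x. ennreal (e n (Y x)))"
        unfolding incseq_def le_fun_def e_def by (intro allI impI ennreal_leI dyadic_energy_mono)
    qed measurable
    also have "\<dots> \<le> c'" by (rule SUP_least) (rule eY_le)
    finally show ?thesis .
  qed
  have good: "AE x in \<Omega>. good (Y x)"
  proof -
    have "AE x in \<Omega>. (SUP n. ennreal (e n (Y x))) \<noteq> \<infinity>"
      using order_le_less_trans [OF SUP_le c(2)] by (intro nn_integral_noteq_infinite) auto
    then show ?thesis using valD
      by eventually_elim (auto simp: good_def \<omega>0_grid less_top [symmetric])
  qed
  \<comment> \<open>rational positions are uniform in the limit; the others are limits of these by continuity\<close>
  define L where "L x = (if val (Y x) None \<in> D then val (Y x) None else d0)" for x
  have Lm [measurable]: "L \<in> \<Omega> \<rightarrow>\<^sub>M mu D"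
  proof -
    have "L \<in> borel_measurable \<Omega>" unfolding L_def using D_borel by measurable
    then show ?thesis using d0 by (auto simp: measurable_to_mu_iff L_def)
  qed
  have L_AE: "AE x in \<Omega>. L x = val (Y x) None" using valD by eventually_elim (simp add: L_def)
  have L_law: "distr \<Omega> (mu D) L = mu D"
  proof -
    have "distr \<Omega> borel L = distr \<Omega> borel (\<lambda>x. val (Y x) None)"
      by (rule distr_cong_AE) (use L_AE mu_borel [OF Lm] in auto)
    then have "distr \<Omega> borel L = distr (mu D) borel (\<lambda>x. x)" by (simp add: val_law)
    then have "distr \<Omega> (mu D) L = distr (mu D) (mu D) (\<lambda>x. x)"
      by (rule distr_eq_coarser [OF Lm mu_borel [OF Lm] idm sets_mu_subset])
    then show ?thesis by simp
  qed
  have \<Psi>t: "(\<lambda>x. \<Psi> (Y x) t) \<in> \<Omega> \<rightarrow>\<^sub>M mu D" if "t \<in> {0..T}" for t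
    by (rule measurable_compose [OF _ measurable_eval [OF that]]) measurable
  have \<Psi>_law: "distr \<Omega> (mu D) (\<lambda>x. \<Psi> (Y x) t) = mu D" if t: "t \<in> {0..T}" for t
  proof -
    note [measurable] = mu_borel [OF \<Psi>t [OF t]]
    have "distr \<Omega> borel (\<lambda>x. \<Psi> (Y x) t) = distr (mu D) borel (\<lambda>x. x)"
    proof (rule Gdet)
      show "prob_space (distr \<Omega> borel (\<lambda>x. \<Psi> (Y x) t))" by (rule \<Omega>.prob_space_distr) simp
      show "prob_space (distr (mu D) borel (\<lambda>x. x))" by (rule mD.prob_space_distr [OF idm(2)])
      fix i
      have "(\<integral>x. G i (\<Psi> (Y x) t) \<partial>\<Omega>) = (\<integral>x. G i x \<partial>mu D)"
      proof (rule LIMSEQ_unique)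
        let ?v = "\<lambda>k x. \<omega>0 (Y x) (T * real (grid_index T k t) / 2 ^ k)"
        show "(\<lambda>k. \<integral>x. G i (?v k x) \<partial>\<Omega>) \<longlonglongrightarrow> (\<integral>x. G i (\<Psi> (Y x) t) \<partial>\<Omega>)"
        proof (rule integral_dominated_convergence [where w = "\<lambda>_. 1"])
          show "AE x in \<Omega>. (\<lambda>k. G i (?v k x)) \<longlonglongrightarrow> G i (\<Psi> (Y x) t)"
            using good
          proof eventually_elim
            case (elim x)
            have "(\<lambda>k. ?v k x) \<longlonglongrightarrow> \<Psi> (Y x) t" using ext(1) [OF elim t] elim t by (simp add: \<Psi>_def)
            then show ?case by (rule continuous_on_tendsto_compose [OF G(1)]) auto
          qed
        qed (use G(2) in auto)
        show "(\<lambda>k. \<integral>x. G i (?v k x) \<partial>\<Omega>) \<longlonglongrightarrow> (\<integral>x. G i x \<partial>mu D)"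
          unfolding \<omega>0_grid valG by simp
      qed
      then show "(\<integral>x. G i x \<partial>distr \<Omega> borel (\<lambda>x. \<Psi> (Y x) t)) = (\<integral>x. G i x \<partial>distr (mu D) borel (\<lambda>x. x))"
        by (subst integral_distr) (simp_all add: muG)
    qed simp_all
    then have "distr \<Omega> (mu D) (\<lambda>x. \<Psi> (Y x) t) = distr (mu D) (mu D) (\<lambda>x. x)"
      by (rule distr_eq_coarser [OF \<Psi>t [OF t] mu_borel [OF \<Psi>t [OF t]] idm sets_mu_subset])
    then show ?thesis by simp
  qed
  have joint: "distr \<Omega> (mu2 D) (\<lambda>x. (L x, \<Psi> (Y x) t)) = \<theta>'"
    if i: "i \<le> (1 :: nat)" and t: "t = T * real i / 2 ^ 0" and \<theta>': "\<theta>' \<in> uniform_plans D"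
      and \<theta>: "\<And>n. distr (F n) (mu2 D) (\<lambda>z. (snd z, fst z t)) = \<theta> n"
      and conv: "\<And>j. (\<lambda>n. \<integral>x. H j x \<partial>\<theta> n) \<longlonglongrightarrow> (\<integral>x. H j x \<partial>\<theta>')" for i t \<theta> \<theta>'
  proof -
    have tT: "t \<in> {0..T}" unfolding t by (rule dyadic_point_in [OF T]) (use i in simp)
    let ?q = "of_nat i / 2 ^ 0 :: rat"
    have P [measurable]: "(\<lambda>x. (L x, \<Psi> (Y x) t)) \<in> \<Omega> \<rightarrow>\<^sub>M mu2 D" using \<Psi>t [OF tT] by measurable
    note [measurable] = mu_pair_borel [OF P]
    have \<theta>'s: "sets \<theta>' = sets (mu2 D)" "prob_space \<theta>'"
      using \<theta>' by (auto simp: uniform_plans_def space_prob_algebra)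
    have id\<theta>: "(\<lambda>x. x) \<in> \<theta>' \<rightarrow>\<^sub>M mu2 D" unfolding measurable_cong_sets [OF \<theta>'s(1) refl] by simp
    have "distr \<Omega> borel (\<lambda>x. (L x, \<Psi> (Y x) t)) = distr \<theta>' borel (\<lambda>x. x)"
    proof (rule Hdet)
      show "prob_space (distr \<Omega> borel (\<lambda>x. (L x, \<Psi> (Y x) t)))" by (rule \<Omega>.prob_space_distr) simp
      show "prob_space (distr \<theta>' borel (\<lambda>x. x))" by (rule prob_space.prob_space_distr [OF \<theta>'s(2) mu_pair_borel [OF id\<theta>]])
      fix j
      have pairm [measurable]: "(\<lambda>y. H j (val y None, val y (Some ?q))) \<in> borel_measurable borel"
        by (rule measurable_compose [OF borel_measurable_Pair [OF val val] Hm])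
      have "(\<integral>x. H j (L x, \<Psi> (Y x) t) \<partial>\<Omega>) = (\<integral>x. H j (val (Y x) None, val (Y x) (Some ?q)) \<partial>\<Omega>)"
      proof (rule integral_cong_AE)
        show "AE x in \<Omega>. H j (L x, \<Psi> (Y x) t) = H j (val (Y x) None, val (Y x) (Some ?q))"
          using L_AE good
        proof eventually_elim
          case (elim x)
          have "\<Psi> (Y x) t = \<omega>0 (Y x) (T * real i / 2 ^ 0)"
            using elim(2) tT ext(4) [OF elim(2), of i 0] i by (simp add: \<Psi>_def t)
          then show ?case using elim(1) by (simp only: \<omega>0_grid)
        qed
      qed measurable
      also have "\<dots> = (\<integral>x. H j x \<partial>\<theta>')"
      proof (rule LIMSEQ_unique)
        show "(\<lambda>n. \<integral>x. H j (val (Y' n x) None, val (Y' n x) (Some ?q)) \<partial>\<Omega>) \<longlonglongrightarrow> (\<integral>x. H j (val (Y x) None, val (Y x) (Some ?q)) \<partial>\<Omega>)"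
        proof (rule integral_dominated_convergence [where w = "\<lambda>_. 1"])
          show "AE x in \<Omega>. (\<lambda>n. H j (val (Y' n x) None, val (Y' n x) (Some ?q))) \<longlonglongrightarrow> H j (val (Y x) None, val (Y x) (Some ?q))"
            using vlim by eventually_elim (rule continuous_on_tendsto_compose [OF H(1)], auto intro!: tendsto_intros)
        qed (use H(2) in auto)
        have "(\<integral>x. H j (val (Y' n x) None, val (Y' n x) (Some ?q)) \<partial>\<Omega>) = (\<integral>x. H j x \<partial>\<theta> (r n))" for n
        proof -
          have m: "(\<lambda>z. (snd z, fst z t)) \<in> F (r n) \<rightarrow>\<^sub>M mu2 D"
            using measurable_Pair [OF pos_mu [of None "r n"] pos_mu [of "Some ?q" "r n"]] \<tau>_grid [of i 0] i by (simp add: pos_def t)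
          have "(\<integral>x. H j (val (Y' n x) None, val (Y' n x) (Some ?q)) \<partial>\<Omega>) = (\<integral>z. H j (val (encode (X z)) None, val (encode (X z)) (Some ?q)) \<partial>F (r n))"
            by (rule transfer) measurable
          also have "\<dots> = (\<integral>z. H j (snd z, fst z t) \<partial>F (r n))"
            using \<tau>_grid [of i 0] i by (intro Bochner_Integration.integral_cong refl) (simp add: val_enc pos_def t)
          also have "\<dots> = (\<integral>x. H j x \<partial>distr (F (r n)) (mu2 D) (\<lambda>z. (snd z, fst z t)))"
            by (rule integral_distr [symmetric, OF m]) (rule measurable_compose [OF mu_pair_borel Hm], simp)
          finally show ?thesis by (simp add: \<theta>)
        qed
        then show "(\<lambda>n. \<integral>x. H j (val (Y' n x) None, val (Y' n x) (Some ?q)) \<partial>\<Omega>) \<longlonglongrightarrow> (\<integral>x. H j x \<partial>\<theta>')"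
          using LIMSEQ_subseq_LIMSEQ [OF conv r] by (simp add: comp_def)
      qed
      finally show "(\<integral>x. H j x \<partial>distr \<Omega> borel (\<lambda>x. (L x, \<Psi> (Y x) t))) = (\<integral>x. H j x \<partial>distr \<theta>' borel (\<lambda>x. x))"
        by (subst (1 2) integral_distr) (simp_all add: mu_pair_borel [OF id\<theta>])
    qed simp_all
    then have "distr \<Omega> (mu2 D) (\<lambda>x. (L x, \<Psi> (Y x) t)) = distr \<theta>' (mu2 D) (\<lambda>x. x)"
      by (rule distr_eq_coarser [OF P mu_pair_borel [OF P] id\<theta> mu_pair_borel [OF id\<theta>] sets_mu_pair_subset])
    then show ?thesis using distr_id2 [OF \<theta>'s(1) [symmetric]] by simp
  qed
  \<comment> \<open>label and path live on the auxiliary space \<open>\<Omega>\<close>; only their joint law matters, and it comes from noise\<close>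
  obtain Q where Q [measurable]: "Q \<in> borel_measurable (mu D \<Otimes>\<^sub>M noise)"
    and Qeq: "distr \<Omega> (mu D \<Otimes>\<^sub>M borel) (\<lambda>x. (L x, Y x)) = distr (distr \<Omega> (mu D) L \<Otimes>\<^sub>M noise) (mu D \<Otimes>\<^sub>M borel) (\<lambda>(a, u). (a, Q (a, u)))"
    by (rule noise_representation_real [OF \<Omega> Lm Y]) (use Y01 in auto)
  have map [measurable]: "(\<lambda>z. (fst z, Q z)) \<in> mu D \<Otimes>\<^sub>M noise \<rightarrow>\<^sub>M mu D \<Otimes>\<^sub>M borel" by measurable
  have Qeq': "distr \<Omega> (mu D \<Otimes>\<^sub>M borel) (\<lambda>x. (L x, Y x)) = distr (mu D \<Otimes>\<^sub>M noise) (mu D \<Otimes>\<^sub>M borel) (\<lambda>z. (fst z, Q z))"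
    using Qeq by (simp add: L_law case_prod_unfold)
  have LYm [measurable]: "(\<lambda>x. (L x, Y x)) \<in> \<Omega> \<rightarrow>\<^sub>M mu D \<Otimes>\<^sub>M borel" by measurable
  have hlaw: "distr (mu D \<Otimes>\<^sub>M noise) K (\<lambda>z. h (fst z, Q z)) = distr \<Omega> K (\<lambda>x. h (L x, Y x))"
    if h: "h \<in> mu D \<Otimes>\<^sub>M borel \<rightarrow>\<^sub>M K" for h K
  proof -
    have "distr (distr (mu D \<Otimes>\<^sub>M noise) (mu D \<Otimes>\<^sub>M borel) (\<lambda>z. (fst z, Q z))) K h = distr (distr \<Omega> (mu D \<Otimes>\<^sub>M borel) (\<lambda>x. (L x, Y x))) K h"
      by (simp only: Qeq')
    then show ?thesis by (simp add: distr_distr [OF h map] distr_distr [OF h LYm] comp_def)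
  qed
  have \<Phi>: "(\<lambda>z. \<Psi> (Q z)) \<in> mu D \<Otimes>\<^sub>M noise \<rightarrow>\<^sub>M Path T D" by measurable
  have ev: "(\<lambda>z. \<Psi> (snd z) t) \<in> mu D \<Otimes>\<^sub>M borel \<rightarrow>\<^sub>M mu D" if "t \<in> {0..T}" for t
    by (rule measurable_compose [OF _ measurable_eval [OF that]]) measurable
  have inc: "distr (mu D \<Otimes>\<^sub>M noise) (mu D) (\<lambda>z. \<Psi> (Q z) t) = mu D" if t: "t \<in> {0..T}" for t
    using hlaw [OF ev [OF t]] \<Psi>_law [OF t] by simp
  have ends: "distr (mu D \<Otimes>\<^sub>M noise) (mu2 D) (\<lambda>z. (fst z, \<Psi> (Q z) t)) = distr \<Omega> (mu2 D) (\<lambda>x. (L x, \<Psi> (Y x) t))"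
    if t: "t \<in> {0..T}" for t
    using hlaw [OF measurable_Pair [OF measurable_fst ev [OF t]]] by simp
  have start: "distr (mu D \<Otimes>\<^sub>M noise) (mu2 D) (\<lambda>z. (fst z, \<Psi> (Q z) 0)) = \<eta>'"
    using ends [of 0] joint [of 0 0 \<eta>' \<eta>] T plans flowD(6) \<eta> by simp
  have final: "distr (mu D \<Otimes>\<^sub>M noise) (mu2 D) (\<lambda>z. (fst z, \<Psi> (Q z) T)) = \<gamma>'"
    using ends [of T] joint [of 1 T \<gamma>' \<gamma>] T plans flowD(7) \<gamma> by simp
  let ?F = "distr (mu D \<Otimes>\<^sub>M noise) (Path T D \<Otimes>\<^sub>M mu D) (\<lambda>z. (\<Psi> (Q z), fst z))"
  have "?F \<in> connecting_flows T D \<eta>' \<gamma>'"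
    using flow_of_noise(1) [OF T prob_space_noise \<Phi> inc] by (simp only: start final)
  moreover have "flow_action T ?F \<le> c'"
  proof -
    have pm: "(\<lambda>z. path_action T (\<Psi> (snd z))) \<in> borel_measurable (mu D \<Otimes>\<^sub>M borel)"
      by (rule measurable_compose [OF _ measurable_path_action [OF T]]) measurable
    have "flow_action T ?F = (\<integral>\<^sup>+z. path_action T (\<Psi> (Q z)) \<partial>(mu D \<Otimes>\<^sub>M noise))"
      by (rule flow_of_noise(2) [OF T prob_space_noise \<Phi> inc])
    also have "\<dots> = (\<integral>\<^sup>+w. path_action T (\<Psi> (snd w)) \<partial>distr (mu D \<Otimes>\<^sub>M noise) (mu D \<Otimes>\<^sub>M borel) (\<lambda>z. (fst z, Q z)))"
      by (subst nn_integral_distr [OF map]) (use pm in simp_all)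
    also have "\<dots> = (\<integral>\<^sup>+x. path_action T (\<Psi> (Y x)) \<partial>\<Omega>)"
      unfolding Qeq' [symmetric] by (subst nn_integral_distr [OF LYm]) (use pm in simp_all)
    also have "\<dots> = (\<integral>\<^sup>+x. (SUP n. ennreal (e n (Y x))) \<partial>\<Omega>)"
      by (rule nn_integral_cong_AE) (use good in \<open>eventually_elim, simp add: action\<close>)
    finally show ?thesis using SUP_le by simp
  qed
  ultimately show ?thesis by blast
qed

section \<open>Existence of minimisers and lower semicontinuity\<close>

lemma ennreal_sqrt_le_iff: "ennreal_sqrt x \<le> c \<longleftrightarrow> x \<le> c * c"
proof (cases x)
  case (real r)
  show ?thesis
  proof (cases c)
    case c: (real s)
    have "sqrt r \<le> s \<longleftrightarrow> r \<le> s * s"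
      using real c real_sqrt_le_iff [of r "s * s"] by (simp add: power2_eq_square [symmetric])
    then show ?thesis using real c by (simp add: ennreal_sqrt_def ennreal_le_iff ennreal_mult [symmetric] real_sqrt_ge_zero)
  qed (simp add: ennreal_top_mult)
next
  case top
  have "c * c = top \<longleftrightarrow> c = top" by (auto simp: ennreal_mult_eq_top_iff)
  then show ?thesis by (simp add: top ennreal_sqrt_def top_unique)
qed

text \<open>
  A flow that nearly minimises for each of a sequence of nearby data has a limit
  that connects the limiting data; this is the common core of existence and semicontinuity.
\<close>

lemma nearly_minimising_limit:
  fixes D :: "(real^'n) set"
  assumes T: "T > 0" and D: "compact D" "emeasure volume D > 0"
    and plans: "\<eta>' \<in> uniform_plans D" "\<gamma>' \<in> uniform_plans D" and H: "determining_family H"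
    and sq: "\<And>n. delta_bar_sq T D (\<eta> n) (\<gamma> n) \<le> c" and c: "c < \<infinity>"
    and \<eta>: "\<And>i. (\<lambda>n. \<integral>x. H i x \<partial>\<eta> n) \<longlonglongrightarrow> (\<integral>x. H i x \<partial>\<eta>')"
    and \<gamma>: "\<And>i. (\<lambda>n. \<integral>x. H i x \<partial>\<gamma> n) \<longlonglongrightarrow> (\<integral>x. H i x \<partial>\<gamma>')"
  shows "\<exists>F\<in>connecting_flows T D \<eta>' \<gamma>'. flow_action T F \<le> c"
proof -
  have "\<exists>F\<in>connecting_flows T D (\<eta> n) (\<gamma> n). flow_action T F < c + ennreal (1 / Suc n)" for n
  proof -
    have "c < c + ennreal (1 / Suc n)" using c by (cases c) (auto simp: ennreal_plus [symmetric] ennreal_less_iff simp del: ennreal_plus)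
    then show ?thesis using sq [of n] unfolding delta_bar_sq_def by (meson INF_less_iff order_le_less_trans)
  qed
  then obtain F where F: "\<And>n. F n \<in> connecting_flows T D (\<eta> n) (\<gamma> n)"
    "\<And>n. flow_action T (F n) < c + ennreal (1 / Suc n)" by metis
  have "(\<lambda>n. c + ennreal (1 / Suc n)) \<longlonglongrightarrow> c + ennreal 0"
    by (intro tendsto_add tendsto_const tendsto_ennrealI LIMSEQ_Suc [OF lim_1_over_n])
  then have lim: "(\<lambda>n. c + ennreal (1 / Suc n)) \<longlonglongrightarrow> c" by simp
  show ?thesis
    by (rule limit_flow [OF T D F(1) less_imp_le [OF F(2)] lim c plans H \<eta> \<gamma>])
qed

lemma minimising_flow_exists:
  fixes D :: "(real^'n) set"
  assumes T: "T > 0" and D: "compact D" "emeasure volume D > 0"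
    and plans: "\<eta> \<in> uniform_plans D" "\<gamma> \<in> uniform_plans D" and ne: "connecting_flows T D \<eta> \<gamma> \<noteq> {}"
  shows "\<exists>F\<in>connecting_flows T D \<eta> \<gamma>. flow_action T F = delta_bar_sq T D \<eta> \<gamma>"
proof -
  have "\<exists>F\<in>connecting_flows T D \<eta> \<gamma>. flow_action T F \<le> delta_bar_sq T D \<eta> \<gamma>"
  proof (cases "delta_bar_sq T D \<eta> \<gamma> = \<infinity>")
    case True
    then show ?thesis using ne by auto
  next
    case False
    obtain H :: "nat \<Rightarrow> (real^'n) \<times> (real^'n) \<Rightarrow> real" where H: "determining_family H"
      using ex_determining_family by blast
    show ?thesis
      by (rule nearly_minimising_limit [OF T D plans H, of "\<lambda>_. \<eta>" "\<lambda>_. \<gamma>"])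
        (use False in \<open>simp_all add: less_top [symmetric]\<close>)
  qed
  then obtain F where F: "F \<in> connecting_flows T D \<eta> \<gamma>" "flow_action T F \<le> delta_bar_sq T D \<eta> \<gamma>" by blast
  have "delta_bar_sq T D \<eta> \<gamma> \<le> flow_action T F" unfolding delta_bar_sq_def by (rule INF_lower [OF F(1)])
  then show ?thesis using F by (intro bexI [of _ F]) auto
qed

lemma openin_narrow_near:
  fixes H :: "nat \<Rightarrow> 'a::flat_space \<times> 'a \<Rightarrow> real"
  assumes H: "\<And>i. continuous_on UNIV (H i)" "\<And>i x. 0 \<le> H i x \<and> H i x \<le> 1"
  shows "openin (narrow_topology D) {\<eta> \<in> uniform_plans D. \<forall>i<m. \<bar>(\<integral>x. H i x \<partial>\<eta>) - v i\<bar> < (e :: real)}"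
proof (induction m)
  case 0
  then show ?case using openin_topspace [of "narrow_topology D"] by (simp add: topspace_narrow_topology)
next
  case (Suc m)
  have "continuous_on (D \<times> D) (H m)" using H(1) by (rule continuous_on_subset) simp
  moreover have "bounded (H m ` (D \<times> D))" unfolding bounded_iff using H(2) by (intro exI [of _ 1]) auto
  moreover have "open (ball (v m) e)" by simp
  ultimately have "openin (narrow_topology D) {\<eta> \<in> uniform_plans D. integral\<^sup>L \<eta> (H m) \<in> ball (v m) e}"
    unfolding narrow_topology_def by (intro topology_generated_by_Basis) blast
  from openin_Int [OF Suc this] show ?case
    by (rule back_subst [of "openin (narrow_topology D)"])
      (auto simp: less_Suc_eq dist_real_def abs_minus_commute)
qed

text \<open>
  If the distance did not stay above \<open>c\<close> near a pair of plans, neighbourhoods given by more and more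
  test functions would contain pairs at distance at most \<open>c\<close> that converge to it, and a limit of
  nearly optimal flows would connect the given pair.
\<close>

lemma delta_bar_lower_semicontinuous:
  fixes D :: "(real^'n) set"
  assumes T: "T > 0" and D: "compact D" "emeasure volume D > 0"
  shows "lower_semicontinuous_map (prod_topology (narrow_topology D) (narrow_topology D)) (\<lambda>(\<eta>, \<gamma>). delta_bar T D \<eta> \<gamma>)"
  unfolding lower_semicontinuous_map_def
proof (intro allI)
  fix c :: ennreal
  let ?X = "prod_topology (narrow_topology D) (narrow_topology D)"
  let ?S = "{z \<in> topspace ?X. c < (case z of (\<eta>, \<gamma>) \<Rightarrow> delta_bar T D \<eta> \<gamma>)}"
  obtain H :: "nat \<Rightarrow> (real^'n) \<times> (real^'n) \<Rightarrow> real" where H: "determining_family H"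
    using ex_determining_family by blast
  define U where "U \<eta> m = {\<eta>' \<in> uniform_plans D. \<forall>i<m. \<bar>(\<integral>x. H i x \<partial>\<eta>') - (\<integral>x. H i x \<partial>\<eta>)\<bar> < 1 / Suc m}" for \<eta> m
  have U_open: "openin (narrow_topology D) (U \<eta> m)" for \<eta> m
    unfolding U_def by (rule openin_narrow_near [OF determining_familyD(1,2) [OF H]])
  have U_lim: "(\<lambda>n. \<integral>x. H i x \<partial>\<eta>s n) \<longlonglongrightarrow> (\<integral>x. H i x \<partial>\<eta>)" if "\<And>n. \<eta>s n \<in> U \<eta> n" for \<eta>s \<eta> i
  proof (rule LIM_zero_cancel, rule Lim_null_comparison)
    show "\<forall>\<^sub>F n in sequentially. norm ((\<integral>x. H i x \<partial>\<eta>s n) - (\<integral>x. H i x \<partial>\<eta>)) \<le> 1 / Suc n"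
      unfolding eventually_sequentially
    proof (intro exI [of _ "Suc i"] allI impI)
      fix n assume "Suc i \<le> n"
      then show "norm ((\<integral>x. H i x \<partial>\<eta>s n) - (\<integral>x. H i x \<partial>\<eta>)) \<le> 1 / Suc n"
        using that [of n] by (simp add: U_def less_imp_le)
    qed
    show "(\<lambda>n. 1 / real (Suc n)) \<longlonglongrightarrow> 0" by (rule LIMSEQ_Suc [OF lim_1_over_n])
  qed
  show "openin ?X ?S"
  proof (subst openin_subopen, rule ballI)
    fix z assume z: "z \<in> ?S"
    then obtain \<eta> \<gamma> where z_eq: "z = (\<eta>, \<gamma>)" and plans: "\<eta> \<in> uniform_plans D" "\<gamma> \<in> uniform_plans D"
      and less: "c < delta_bar T D \<eta> \<gamma>" by (auto simp: topspace_prod_topology topspace_narrow_topology)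
    have "\<exists>m. \<forall>\<eta>'\<in>U \<eta> m. \<forall>\<gamma>'\<in>U \<gamma> m. c < delta_bar T D \<eta>' \<gamma>'"
    proof (rule ccontr)
      assume "\<not> ?thesis"
      then have "\<forall>m. \<exists>\<eta>' \<gamma>'. \<eta>' \<in> U \<eta> m \<and> \<gamma>' \<in> U \<gamma> m \<and> delta_bar T D \<eta>' \<gamma>' \<le> c" by (meson not_less)
      then obtain \<eta>s \<gamma>s where s: "\<And>m. \<eta>s m \<in> U \<eta> m" "\<And>m. \<gamma>s m \<in> U \<gamma> m" "\<And>m. delta_bar T D (\<eta>s m) (\<gamma>s m) \<le> c" by metis
      have sq: "delta_bar_sq T D (\<eta>s m) (\<gamma>s m) \<le> c * c" for m
        using s(3) [of m] by (simp add: delta_bar_def ennreal_sqrt_le_iff)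
      have "c < \<infinity>" using order_less_le_trans [OF less top_greatest] by simp
      then have "c * c < \<infinity>" by (simp add: ennreal_mult_less_top)
      then obtain F where F: "F \<in> connecting_flows T D \<eta> \<gamma>" "flow_action T F \<le> c * c"
        using nearly_minimising_limit [OF T D plans H sq _ U_lim [of \<eta>s] U_lim [of \<gamma>s]] s by blast
      have "delta_bar_sq T D \<eta> \<gamma> \<le> c * c"
        unfolding delta_bar_sq_def by (rule INF_lower2) (rule F)+
      then have "delta_bar T D \<eta> \<gamma> \<le> c" by (simp add: delta_bar_def ennreal_sqrt_le_iff)
      with less show False by simp
    qed
    then obtain m where m: "\<And>\<eta>' \<gamma>'. \<eta>' \<in> U \<eta> m \<Longrightarrow> \<gamma>' \<in> U \<gamma> m \<Longrightarrow> c < delta_bar T D \<eta>' \<gamma>'" by blast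
    show "\<exists>W. openin ?X W \<and> z \<in> W \<and> W \<subseteq> ?S"
    proof (intro exI conjI)
      show "openin ?X (U \<eta> m \<times> U \<gamma> m)" by (simp add: openin_prod_Times_iff U_open)
      show "z \<in> U \<eta> m \<times> U \<gamma> m" using plans by (simp add: z_eq U_def)
      show "U \<eta> m \<times> U \<gamma> m \<subseteq> ?S"
        using m by (auto simp: topspace_prod_topology topspace_narrow_topology U_def)
    qed
  qed
qed

section \<open>Images of flows under Lipschitz measure-preserving maps\<close>

definition plan_image :: "'a::flat_space set \<Rightarrow> ('b \<Rightarrow> 'a) \<Rightarrow> ('b \<times> 'b) measure \<Rightarrow> ('a \<times> 'a) measure"
  where "plan_image D f \<eta> = distr \<eta> (mu2 D) (map_prod f f)"

context label_space begin

lemma dyadic_energy_lipschitz: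
  assumes T: "T > 0" and f: "L-lipschitz_on D f" and \<omega>: "\<And>t. t \<in> {0..T} \<Longrightarrow> \<omega> t \<in> D"
    and \<omega>': "\<And>t. t \<in> {0..T} \<Longrightarrow> \<omega>' t = f (\<omega> t)"
  shows "dyadic_energy T \<omega>' n \<le> L\<^sup>2 * dyadic_energy T \<omega> n"
proof -
  have "(\<Sum>i<2 ^ n. (dist (\<omega>' (T * real i / 2 ^ n)) (\<omega>' (T * real (Suc i) / 2 ^ n)))\<^sup>2)
      \<le> (\<Sum>i<2 ^ n. L\<^sup>2 * (dist (\<omega> (T * real i / 2 ^ n)) (\<omega> (T * real (Suc i) / 2 ^ n)))\<^sup>2)"
  proof (rule sum_mono)
    fix i :: nat assume "i \<in> {..<2 ^ n}"
    then have i: "i \<le> 2 ^ n" "Suc i \<le> 2 ^ n" by auto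
    note p = dyadic_point_in [OF T i(1)] dyadic_point_in [OF T i(2)]
    have "dist (\<omega>' (T * real i / 2 ^ n)) (\<omega>' (T * real (Suc i) / 2 ^ n)) \<le> L * dist (\<omega> (T * real i / 2 ^ n)) (\<omega> (T * real (Suc i) / 2 ^ n))"
      unfolding \<omega>' [OF p(1)] \<omega>' [OF p(2)] by (rule lipschitz_onD [OF f \<omega> [OF p(1)] \<omega> [OF p(2)]])
    then show "(dist (\<omega>' (T * real i / 2 ^ n)) (\<omega>' (T * real (Suc i) / 2 ^ n)))\<^sup>2 \<le> L\<^sup>2 * (dist (\<omega> (T * real i / 2 ^ n)) (\<omega> (T * real (Suc i) / 2 ^ n)))\<^sup>2"
      unfolding power_mult_distrib [symmetric] by (intro power_mono) auto
  qed
  then show ?thesis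
    unfolding dyadic_energy_def sum_distrib_left [symmetric] mult.left_commute [of "L\<^sup>2"]
    by (rule mult_left_mono) simp
qed

end

text \<open>
  The image flow carries the label \<open>f a'\<close> on the image of the path, where \<open>a'\<close> is the label
  upstairs. Since several \<open>a'\<close> may have the same image, its kernel averages over the fibre; the
  average is taken with the help of a measurable choice of \<open>a'\<close> from \<open>f a'\<close> and independent noise.
\<close>

lemma push_flow:
  fixes D' :: "'b::{flat_space, second_countable_topology} set" and D :: "'a::{flat_space, second_countable_topology} set"
  assumes T: "T > 0" and D': "label_space D'" and D: "label_space D"
    and f: "L-lipschitz_on D' f" "f ` D' \<subseteq> D" "distr (mu D') (mu D) f = mu D"
    and F': "F' \<in> connecting_flows T D' \<eta> \<gamma>"
  shows "\<exists>F\<in>connecting_flows T D (plan_image D f \<eta>) (plan_image D f \<gamma>). flow_action T F \<le> ennreal (L\<^sup>2) * flow_action T F'"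
proof -
  interpret D': label_space D' by fact
  interpret D: label_space D by fact
  note F'D = D'.connecting_flowD [OF T F']
  interpret F': prob_space F' by (rule F'D(1))
  interpret noise: prob_space noise by (rule prob_space_noise)
  note [measurable_cong] = F'D(2)
  have fm [measurable]: "f \<in> mu D' \<rightarrow>\<^sub>M mu D"
    unfolding D.measurable_to_mu_iff
    using D'.continuous_measurable_mu [OF lipschitz_on_continuous_on [OF f(1)]] f(2) by (auto simp: D'.space_mu_D)
  define \<Phi> where "\<Phi> \<omega> = restrict (\<lambda>t. f (\<omega> t)) {0..T}" for \<omega>
  have \<Phi>_space: "\<Phi> \<omega> \<in> space (Path T D)" if \<omega>: "\<omega> \<in> space (Path T D')" for \<omega>
  proof -
    have sub: "\<omega> ` {0..T} \<subseteq> D'" using D'.path_in_D [OF \<omega>] by blast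
    have "continuous_on {0..T} (\<lambda>t. f (\<omega> t))"
      using continuous_on_compose2 [OF lipschitz_on_continuous_on [OF f(1)] D'.path_continuous [OF \<omega>] sub] .
    then have "continuous_on {0..T} (\<Phi> \<omega>)" by (rule continuous_on_eq) (simp add: \<Phi>_def)
    then show ?thesis using sub f(2) by (auto simp: D.space_Path \<Phi>_def image_subset_iff)
  qed
  have \<Phi>m [measurable]: "\<Phi> \<in> Path T D' \<rightarrow>\<^sub>M Path T D"
  proof (rule D.measurable_Path [OF T])
    fix t assume t: "t \<in> {0..T}"
    show "(\<lambda>\<omega>. \<Phi> \<omega> t) \<in> borel_measurable (Path T D')"
      using D.mu_borel [OF measurable_compose [OF D'.measurable_eval [OF t] fm]] t by (simp add: \<Phi>_def)
  qed (use \<Phi>_space in auto)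
  define F where "F = distr F' (Path T D \<Otimes>\<^sub>M mu D) (\<lambda>z. (\<Phi> (fst z), f (snd z)))"
  have map [measurable]: "(\<lambda>z. (\<Phi> (fst z), f (snd z))) \<in> F' \<rightarrow>\<^sub>M Path T D \<Otimes>\<^sub>M mu D" by measurable
  obtain k' where k' [measurable]: "k' \<in> mu D' \<rightarrow>\<^sub>M prob_algebra (Path T D')"
    and dis': "\<And>g. g \<in> borel_measurable (mu D' \<Otimes>\<^sub>M Path T D') \<Longrightarrow>
      (\<integral>\<^sup>+z. g (snd z, fst z) \<partial>F') = (\<integral>\<^sup>+a. \<integral>\<^sup>+\<omega>. g (a, \<omega>) \<partial>k' a \<partial>mu D')"
    using F'D(3) by blast
  have idm: "(\<lambda>x. x) \<in> mu D' \<rightarrow>\<^sub>M mu D'" by simp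
  obtain q where q [measurable]: "q \<in> mu D \<Otimes>\<^sub>M noise \<rightarrow>\<^sub>M mu D'"
    and q_law: "distr (mu D') (mu D \<Otimes>\<^sub>M mu D') (\<lambda>a. (f a, a)) = distr (distr (mu D') (mu D) f \<Otimes>\<^sub>M noise) (mu D \<Otimes>\<^sub>M mu D') (\<lambda>(a, u). (a, q (a, u)))"
    by (rule D'.noise_representation [OF D'.prob_mu fm idm])
  define k where "k a = noise \<bind> (\<lambda>u. distr (k' (q (a, u))) (Path T D) \<Phi>)" for a
  have noise_pa: "noise \<in> space (prob_algebra noise)" using prob_space_noise by (simp add: space_prob_algebra)
  have k'D: "sets (k' a) = sets (Path T D')" if "a \<in> space (mu D')" for a
    using measurable_space [OF k' that] by (simp add: space_prob_algebra)
  have k0: "(\<lambda>z. distr (k' (q z)) (Path T D) \<Phi>) \<in> mu D \<Otimes>\<^sub>M noise \<rightarrow>\<^sub>M prob_algebra (Path T D)"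
    by (rule measurable_distr_prob_space2 [where M = "Path T D'"]) measurable
  have k: "k \<in> mu D \<rightarrow>\<^sub>M prob_algebra (Path T D)"
    unfolding k_def
    by (rule measurable_bind_prob_space2 [where N = noise]) (use noise_pa k0 in auto)
  have "F \<in> connecting_flows T D (plan_image D f \<eta>) (plan_image D f \<gamma>)"
  proof (rule D.flow_of_kernel [OF T k])
    show "prob_space F" unfolding F_def by (rule F'.prob_space_distr [OF map])
    show "sets F = sets (Path T D \<Otimes>\<^sub>M mu D)" by (simp add: F_def)
    fix g :: "'a \<times> (real \<Rightarrow> 'a) \<Rightarrow> ennreal" assume g [measurable]: "g \<in> borel_measurable (mu D \<Otimes>\<^sub>M Path T D)"
    define h where "h = (\<lambda>(a, a'). \<integral>\<^sup>+\<omega>. g (a, \<Phi> \<omega>) \<partial>k' a')"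
    have k's: "k' \<in> mu D' \<rightarrow>\<^sub>M subprob_algebra (Path T D')" using k' by (rule measurable_prob_algebraD)
    have h [measurable]: "h \<in> borel_measurable (mu D \<Otimes>\<^sub>M mu D')"
      unfolding h_def case_prod_unfold
      by (rule nn_integral_measurable_subprob_algebra2 [where N = "Path T D'"])
        (use measurable_compose [OF measurable_snd k's] in measurable)
    have "(\<integral>\<^sup>+z. g (snd z, fst z) \<partial>F) = (\<integral>\<^sup>+z. g (f (snd z), \<Phi> (fst z)) \<partial>F')"
      unfolding F_def by (subst nn_integral_distr [OF map]) auto
    also have "\<dots> = (\<integral>\<^sup>+a. \<integral>\<^sup>+\<omega>. g (f a, \<Phi> \<omega>) \<partial>k' a \<partial>mu D')"
      using dis' [of "\<lambda>z. g (f (fst z), \<Phi> (snd z))"] by simp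
    also have "\<dots> = (\<integral>\<^sup>+a. h (f a, a) \<partial>mu D')" by (simp add: h_def)
    also have "\<dots> = (\<integral>\<^sup>+z. h z \<partial>distr (mu D') (mu D \<Otimes>\<^sub>M mu D') (\<lambda>a. (f a, a)))"
      by (subst nn_integral_distr) auto
    also have "\<dots> = (\<integral>\<^sup>+z. h (fst z, q z) \<partial>(mu D \<Otimes>\<^sub>M noise))"
      unfolding q_law f(3) by (subst nn_integral_distr) (auto simp: case_prod_unfold)
    also have "\<dots> = (\<integral>\<^sup>+a. \<integral>\<^sup>+u. h (a, q (a, u)) \<partial>noise \<partial>mu D)"
      by (subst noise.nn_integral_fst [symmetric]) auto
    also have "\<dots> = (\<integral>\<^sup>+a. \<integral>\<^sup>+\<omega>. g (a, \<omega>) \<partial>k a \<partial>mu D)"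
    proof (rule nn_integral_cong)
      fix a assume a: "a \<in> space (mu D)"
      have k0a: "(\<lambda>u. distr (k' (q (a, u))) (Path T D) \<Phi>) \<in> noise \<rightarrow>\<^sub>M subprob_algebra (Path T D)"
        using measurable_prob_algebraD [OF measurable_compose [OF measurable_Pair1' [OF a] k0]] .
      have ga: "(\<lambda>\<omega>. g (a, \<omega>)) \<in> borel_measurable (Path T D)" by (rule measurable_compose [OF measurable_Pair1' [OF a] g])
      have "(\<integral>\<^sup>+\<omega>. g (a, \<omega>) \<partial>k a) = (\<integral>\<^sup>+u. \<integral>\<^sup>+\<omega>. g (a, \<omega>) \<partial>distr (k' (q (a, u))) (Path T D) \<Phi> \<partial>noise)"
        unfolding k_def by (rule nn_integral_bind [OF ga k0a])
      also have "\<dots> = (\<integral>\<^sup>+u. h (a, q (a, u)) \<partial>noise)"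
      proof (rule nn_integral_cong)
        fix u :: real
        have qs: "q (a, u) \<in> space (mu D')" using a by (intro measurable_space [OF q]) (simp add: space_pair_measure)
        have "\<Phi> \<in> k' (q (a, u)) \<rightarrow>\<^sub>M Path T D" unfolding measurable_cong_sets [OF k'D [OF qs] refl] by (rule \<Phi>m)
        from nn_integral_distr [OF this, of "\<lambda>\<omega>. g (a, \<omega>)"] ga
        show "(\<integral>\<^sup>+\<omega>. g (a, \<omega>) \<partial>distr (k' (q (a, u))) (Path T D) \<Phi>) = h (a, q (a, u))" by (simp add: h_def)
      qed
      finally show "(\<integral>\<^sup>+u. h (a, q (a, u)) \<partial>noise) = (\<integral>\<^sup>+\<omega>. g (a, \<omega>) \<partial>k a)" by simp
    qed
    finally show "(\<integral>\<^sup>+z. g (snd z, fst z) \<partial>F) = (\<integral>\<^sup>+a. \<integral>\<^sup>+\<omega>. g (a, \<omega>) \<partial>k a \<partial>mu D)" .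
  next
    fix t assume t: "t \<in> {0..T}"
    have ev: "(\<lambda>z. fst z t) \<in> Path T D \<Otimes>\<^sub>M mu D \<rightarrow>\<^sub>M mu D"
      by (rule measurable_compose [OF measurable_fst D.measurable_eval [OF t]])
    have ev': "(\<lambda>z. fst z t) \<in> F' \<rightarrow>\<^sub>M mu D'"
      unfolding measurable_cong_sets [OF F'D(2) refl] by (rule measurable_compose [OF measurable_fst D'.measurable_eval [OF t]])
    have "distr F (mu D) (\<lambda>z. fst z t) = distr F' (mu D) (\<lambda>z. f (fst z t))"
      unfolding F_def by (subst distr_distr [OF ev map]) (use t in \<open>simp add: comp_def \<Phi>_def\<close>)
    also have "\<dots> = distr (distr F' (mu D') (\<lambda>z. fst z t)) (mu D) f"
      by (subst distr_distr [OF fm ev']) (simp add: comp_def)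
    finally show "distr F (mu D) (\<lambda>z. fst z t) = mu D" by (simp add: F'D(4) [OF t] f(3))
  next
    have ends: "distr F (mu2 D) (\<lambda>z. (snd z, fst z t)) = plan_image D f (distr F' (mu D' \<Otimes>\<^sub>M mu D') (\<lambda>z. (snd z, fst z t)))"
      if t: "t \<in> {0..T}" for t
    proof -
      have ev: "(\<lambda>z. (snd z, fst z t)) \<in> Path T D \<Otimes>\<^sub>M mu D \<rightarrow>\<^sub>M mu2 D"
        by (intro measurable_Pair measurable_snd measurable_compose [OF measurable_fst D.measurable_eval [OF t]])
      have ev': "(\<lambda>z. (snd z, fst z t)) \<in> F' \<rightarrow>\<^sub>M mu D' \<Otimes>\<^sub>M mu D'"
        unfolding measurable_cong_sets [OF F'D(2) refl]
        by (intro measurable_Pair measurable_snd measurable_compose [OF measurable_fst D'.measurable_eval [OF t]])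
      have ff: "map_prod f f \<in> mu D' \<Otimes>\<^sub>M mu D' \<rightarrow>\<^sub>M mu2 D" unfolding map_prod_def case_prod_unfold by measurable
      show ?thesis unfolding F_def plan_image_def distr_distr [OF ev map] distr_distr [OF ff ev']
        by (rule distr_cong) (use t in \<open>simp_all add: \<Phi>_def\<close>)
    qed
    show "distr F (mu2 D) (\<lambda>z. (snd z, fst z 0)) = plan_image D f \<eta>" using ends [of 0] T F'D(6) by simp
    show "distr F (mu2 D) (\<lambda>z. (snd z, fst z T)) = plan_image D f \<gamma>" using ends [of T] T F'D(7) by simp
  qed
  moreover have "flow_action T F \<le> ennreal (L\<^sup>2) * flow_action T F'"
  proof -
    note [measurable] = D.measurable_path_action [OF T] D'.measurable_path_action [OF T]
    have "flow_action T F = (\<integral>\<^sup>+z. path_action T (\<Phi> (fst z)) \<partial>F')"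
      unfolding F_def flow_action_def case_prod_unfold by (subst nn_integral_distr [OF map]) auto
    also have "\<dots> \<le> (\<integral>\<^sup>+z. ennreal (L\<^sup>2) * path_action T (fst z) \<partial>F')"
    proof (rule nn_integral_mono)
      fix z assume "z \<in> space F'"
      then have \<omega>: "fst z \<in> space (Path T D')"
        using sets_eq_imp_space_eq [OF F'D(2)] by (auto simp: space_pair_measure)
      have "ennreal (dyadic_energy T (\<Phi> (fst z)) n) \<le> ennreal (L\<^sup>2) * path_action T (fst z)" for n
      proof -
        have "dyadic_energy T (\<Phi> (fst z)) n \<le> L\<^sup>2 * dyadic_energy T (fst z) n"
          by (rule D'.dyadic_energy_lipschitz [OF T f(1) D'.path_in_D [OF \<omega>]]) (simp_all add: \<Phi>_def)
        then have "ennreal (dyadic_energy T (\<Phi> (fst z)) n) \<le> ennreal (L\<^sup>2) * ennreal (dyadic_energy T (fst z) n)"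
          by (subst ennreal_mult [symmetric]) (auto intro: ennreal_leI dyadic_energy_nonneg)
        also have "\<dots> \<le> ennreal (L\<^sup>2) * path_action T (fst z)"
          unfolding D'.path_action_eq [OF T \<omega>] by (intro mult_left_mono SUP_upper) auto
        finally show ?thesis .
      qed
      then show "path_action T (\<Phi> (fst z)) \<le> ennreal (L\<^sup>2) * path_action T (fst z)"
        unfolding D.path_action_eq [OF T \<Phi>_space [OF \<omega>]] by (rule SUP_least)
    qed
    also have "\<dots> = ennreal (L\<^sup>2) * flow_action T F'"
      unfolding flow_action_def case_prod_unfold by (rule nn_integral_cmult) measurable
    finally show ?thesis .
  qed
  ultimately show ?thesis by blast
qed

lemma ennreal_sqrt_square: "ennreal_sqrt x * ennreal_sqrt x = x"
  by (cases x) (auto simp: ennreal_sqrt_def ennreal_mult [symmetric] ennreal_top_mult)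

lemma delta_bar_plan_image_le:
  fixes D' :: "'b::{flat_space, second_countable_topology} set" and D :: "'a::{flat_space, second_countable_topology} set"
  assumes T: "T > 0" and D': "label_space D'" and D: "label_space D"
    and L: "L > 0" and f: "L-lipschitz_on D' f" "f ` D' \<subseteq> D" "distr (mu D') (mu D) f = mu D"
  shows "delta_bar T D (plan_image D f \<eta>) (plan_image D f \<gamma>) \<le> ennreal L * delta_bar T D' \<eta> \<gamma>"
proof -
  let ?x = "delta_bar_sq T D (plan_image D f \<eta>) (plan_image D f \<gamma>)"
  have "?x / ennreal (L\<^sup>2) \<le> flow_action T F'" if F': "F' \<in> connecting_flows T D' \<eta> \<gamma>" for F'
  proof -
    obtain F where F: "F \<in> connecting_flows T D (plan_image D f \<eta>) (plan_image D f \<gamma>)" "flow_action T F \<le> ennreal (L\<^sup>2) * flow_action T F'"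
      using push_flow [OF T D' D f F'] by blast
    have "?x \<le> flow_action T F" unfolding delta_bar_sq_def by (rule INF_lower [OF F(1)])
    also note F(2)
    finally show ?thesis using L by (subst divide_le_posI_ennreal) (simp_all add: mult.commute)
  qed
  then have "?x / ennreal (L\<^sup>2) \<le> delta_bar_sq T D' \<eta> \<gamma>" unfolding delta_bar_sq_def [of T D'] by (rule INF_greatest)
  then have "ennreal (L\<^sup>2) * (?x / ennreal (L\<^sup>2)) \<le> ennreal (L\<^sup>2) * delta_bar_sq T D' \<eta> \<gamma>" by (rule mult_left_mono) simp
  moreover have "ennreal (L\<^sup>2) * (?x / ennreal (L\<^sup>2)) = ?x"
    by (subst ennreal_times_divide, subst mult.commute, rule mult_divide_eq_ennreal) (use L in auto)
  ultimately have "?x \<le> ennreal (L\<^sup>2) * delta_bar_sq T D' \<eta> \<gamma>" by simp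
  also have "\<dots> = (ennreal L * delta_bar T D' \<eta> \<gamma>) * (ennreal L * delta_bar T D' \<eta> \<gamma>)"
  proof -
    have "(ennreal L * y) * (ennreal L * y) = (ennreal L * ennreal L) * (y * y)" for y by (simp add: ac_simps)
    then show ?thesis using L by (simp add: delta_bar_def ennreal_sqrt_square ennreal_mult [symmetric] power2_eq_square)
  qed
  finally show ?thesis by (simp add: delta_bar_def [of T D] ennreal_sqrt_le_iff)
qed

lemma distr_pair_snd:
  assumes M: "prob_space M" and N: "prob_space N"
  shows "distr (M \<Otimes>\<^sub>M N) N snd = N"
proof (rule measure_eqI)
  interpret M: prob_space M by fact
  interpret N: prob_space N by fact
  fix A assume "A \<in> sets (distr (M \<Otimes>\<^sub>M N) N snd)"
  then have A: "A \<in> sets N" by simp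
  have "snd -` A \<inter> space (M \<Otimes>\<^sub>M N) = space M \<times> A"
    using sets.sets_into_space [OF A] by (auto simp: space_pair_measure)
  then show "emeasure (distr (M \<Otimes>\<^sub>M N) N snd) A = emeasure N A"
    using A by (simp add: emeasure_distr N.emeasure_pair_measure_Times M.emeasure_space_1)
qed simp

lemma uniform_plansD:
  assumes "\<gamma> \<in> uniform_plans D"
  shows "prob_space \<gamma>" "sets \<gamma> = sets (mu2 D)" "distr \<gamma> (mu D) fst = mu D" "distr \<gamma> (mu D) snd = mu D"
  using assms by (auto simp: uniform_plans_def space_prob_algebra)

text \<open>
  Both marginals of a plan are lifted separately, with independent noises: a lift of \<open>x\<close> is a
  random point of the fibre over \<open>x\<close> whose law is the conditional law of \<open>mu D'\<close> given \<open>f = x\<close>.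
\<close>

lemma plan_image_surj:
  fixes D' :: "'b::{flat_space, second_countable_topology} set" and D :: "'a::{flat_space, second_countable_topology} set"
  assumes D': "label_space D'" and D: "label_space D"
    and fm [measurable]: "f \<in> mu D' \<rightarrow>\<^sub>M mu D" and f: "distr (mu D') (mu D) f = mu D" and \<gamma>: "\<gamma> \<in> uniform_plans D"
  shows "\<exists>\<gamma>'\<in>uniform_plans D'. plan_image D f \<gamma>' = \<gamma>"
proof -
  interpret D': label_space D' by fact
  interpret D: label_space D by fact
  note \<gamma>D = uniform_plansD [OF \<gamma>]
  note [measurable_cong] = \<gamma>D(2)
  interpret noise: prob_space noise by (rule prob_space_noise)
  interpret NN: pair_prob_space noise noise ..
  interpret \<gamma>: prob_space \<gamma> by (rule \<gamma>D(1))
  interpret mD: prob_space "mu D" by (rule D.prob_mu)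
  interpret P: pair_prob_space \<gamma> "noise \<Otimes>\<^sub>M noise" ..
  have idm: "(\<lambda>x. x) \<in> mu D' \<rightarrow>\<^sub>M mu D'" by simp
  obtain q where q [measurable]: "q \<in> mu D \<Otimes>\<^sub>M noise \<rightarrow>\<^sub>M mu D'"
    and q_law: "distr (mu D') (mu D \<Otimes>\<^sub>M mu D') (\<lambda>a. (f a, a)) = distr (distr (mu D') (mu D) f \<Otimes>\<^sub>M noise) (mu D \<Otimes>\<^sub>M mu D') (\<lambda>(a, u). (a, q (a, u)))"
    by (rule D'.noise_representation [OF D'.prob_mu fm idm])
  note q_law = q_law [unfolded f case_prod_unfold, simplified]
  have q_snd: "distr (mu D \<Otimes>\<^sub>M noise) (mu D') q = mu D'"
  proof -
    have "distr (mu D \<Otimes>\<^sub>M noise) (mu D') q = distr (distr (mu D \<Otimes>\<^sub>M noise) (mu D \<Otimes>\<^sub>M mu D') (\<lambda>z. (fst z, q z))) (mu D') snd"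
      by (subst distr_distr) (auto simp: comp_def)
    also have "\<dots> = mu D'" unfolding q_law [symmetric] by (subst distr_distr) (auto simp: comp_def)
    finally show ?thesis .
  qed
  have q_fibre: "AE z in mu D \<Otimes>\<^sub>M noise. f (q z) = fst z"
  proof -
    have [measurable]: "(\<lambda>w. dist (f (snd w)) (fst w)) \<in> borel_measurable (mu D \<Otimes>\<^sub>M mu D')"
      by (intro borel_measurable_dist D.mu_borel) measurable
    have "AE w in distr (mu D') (mu D \<Otimes>\<^sub>M mu D') (\<lambda>a. (f a, a)). dist (f (snd w)) (fst w) = 0"
      by (subst AE_distr_iff) auto
    then have "AE z in mu D \<Otimes>\<^sub>M noise. dist (f (q z)) (fst z) = 0"
      unfolding q_law by (subst (asm) AE_distr_iff) auto
    then show ?thesis by simp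
  qed
  let ?R = "\<gamma> \<Otimes>\<^sub>M (noise \<Otimes>\<^sub>M noise)"
  have A1 [measurable]: "(\<lambda>w. (fst (fst w), fst (snd w))) \<in> ?R \<rightarrow>\<^sub>M mu D \<Otimes>\<^sub>M noise" by measurable
  have A2 [measurable]: "(\<lambda>w. (snd (fst w), snd (snd w))) \<in> ?R \<rightarrow>\<^sub>M mu D \<Otimes>\<^sub>M noise" by measurable
  have law1: "distr ?R (mu D \<Otimes>\<^sub>M noise) (\<lambda>w. (fst (fst w), fst (snd w))) = mu D \<Otimes>\<^sub>M noise"
  proof -
    have "distr \<gamma> (mu D) fst \<Otimes>\<^sub>M distr (noise \<Otimes>\<^sub>M noise) noise fst = distr ?R (mu D \<Otimes>\<^sub>M noise) (\<lambda>(x, y). (fst x, fst y))"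
      by (rule pair_measure_distr) (simp_all add: noise.distr_pair_fst noise.sigma_finite_measure_axioms)
    then show ?thesis by (simp add: \<gamma>D noise.distr_pair_fst case_prod_unfold)
  qed
  have law2: "distr ?R (mu D \<Otimes>\<^sub>M noise) (\<lambda>w. (snd (fst w), snd (snd w))) = mu D \<Otimes>\<^sub>M noise"
  proof -
    note s = distr_pair_snd [OF prob_space_noise prob_space_noise]
    have "distr \<gamma> (mu D) snd \<Otimes>\<^sub>M distr (noise \<Otimes>\<^sub>M noise) noise snd = distr ?R (mu D \<Otimes>\<^sub>M noise) (\<lambda>(x, y). (snd x, snd y))"
      by (rule pair_measure_distr) (simp_all add: s noise.sigma_finite_measure_axioms)
    then show ?thesis by (simp add: \<gamma>D s case_prod_unfold)
  qed
  let ?lift = "\<lambda>w. (q (fst (fst w), fst (snd w)), q (snd (fst w), snd (snd w)))"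
  have lift [measurable]: "?lift \<in> ?R \<rightarrow>\<^sub>M mu D' \<Otimes>\<^sub>M mu D'" by measurable
  define \<gamma>' where "\<gamma>' = distr ?R (mu D' \<Otimes>\<^sub>M mu D') ?lift"
  have "distr \<gamma>' (mu D') fst = distr (distr ?R (mu D \<Otimes>\<^sub>M noise) (\<lambda>w. (fst (fst w), fst (snd w)))) (mu D') q"
    unfolding \<gamma>'_def by (subst (1 2) distr_distr) (auto simp: comp_def)
  then have fst': "distr \<gamma>' (mu D') fst = mu D'" by (simp add: law1 q_snd)
  have "distr \<gamma>' (mu D') snd = distr (distr ?R (mu D \<Otimes>\<^sub>M noise) (\<lambda>w. (snd (fst w), snd (snd w)))) (mu D') q"
    unfolding \<gamma>'_def by (subst (1 2) distr_distr) (auto simp: comp_def)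
  then have snd': "distr \<gamma>' (mu D') snd = mu D'" by (simp add: law2 q_snd)
  have "prob_space \<gamma>'" unfolding \<gamma>'_def by (rule P.prob_space_distr [OF lift])
  then have plan: "\<gamma>' \<in> uniform_plans D'"
    using fst' snd' by (simp add: uniform_plans_def space_prob_algebra) (simp add: \<gamma>'_def)
  have "AE w in ?R. f (q (fst (fst w), fst (snd w))) = fst (fst w)"
    using AE_distrD [OF A1 back_subst [where P = "\<lambda>M. AE z in M. f (q z) = fst z", OF q_fibre law1 [symmetric]]] by simp
  moreover have "AE w in ?R. f (q (snd (fst w), snd (snd w))) = snd (fst w)"
    using AE_distrD [OF A2 back_subst [where P = "\<lambda>M. AE z in M. f (q z) = fst z", OF q_fibre law2 [symmetric]]] by simp
  ultimately have AE: "AE w in ?R. map_prod f f (?lift w) = fst w" by eventually_elim (simp add: prod_eq_iff)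
  have ff [measurable]: "map_prod f f \<in> mu D' \<Otimes>\<^sub>M mu D' \<rightarrow>\<^sub>M mu2 D" unfolding map_prod_def case_prod_unfold by measurable
  have "plan_image D f \<gamma>' = distr ?R (mu2 D) (\<lambda>w. map_prod f f (?lift w))"
    unfolding plan_image_def \<gamma>'_def by (subst distr_distr [OF ff lift]) (simp add: comp_def)
  also have "\<dots> = distr ?R (mu2 D) fst"
  proof (rule distr_cong_AE [OF refl refl AE])
    show "(\<lambda>w. map_prod f f (?lift w)) \<in> ?R \<rightarrow>\<^sub>M mu2 D" by (rule measurable_compose [OF lift ff])
    show "fst \<in> ?R \<rightarrow>\<^sub>M mu2 D" by measurable
  qed
  also have "\<dots> = distr ?R \<gamma> fst" by (rule distr_cong) (simp_all add: \<gamma>D(2))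
  also have "\<dots> = \<gamma>" by (rule NN.distr_pair_fst)
  finally show ?thesis using plan by blast
qed

lemma Lip_lipschitz_on:
  assumes "L-lipschitz_on S f"
  shows "(Lip S f)-lipschitz_on S f"
proof (rule lipschitz_onI)
  have ne: "{L. L-lipschitz_on S f} \<noteq> {}" using assms by blast
  show "0 \<le> Lip S f" unfolding Lip_def using lipschitz_on_nonneg by (intro cInf_greatest [OF ne]) auto
  fix x y assume xy: "x \<in> S" "y \<in> S"
  show "dist (f x) (f y) \<le> Lip S f * dist x y"
  proof (cases "x = y")
    case False
    then have pos: "dist x y > 0" by simp
    have "dist (f x) (f y) / dist x y \<le> Lip S f"
      unfolding Lip_def using pos xy by (intro cInf_greatest [OF ne]) (auto simp: pos_divide_le_eq dest: lipschitz_onD)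
    then show ?thesis using pos by (simp add: pos_divide_le_eq)
  qed simp
qed

text \<open>A constant map would push the volume measure to a point mass, so the Lipschitz constant is positive.\<close>

lemma lipschitz_measure_preserving_pos:
  fixes D' :: "'b::{flat_space, second_countable_topology} set" and D :: "'a::{flat_space, second_countable_topology} set"
  assumes D': "label_space D'" and D: "label_space D"
    and f: "L-lipschitz_on D' f" "f ` D' \<subseteq> D" "distr (mu D') (mu D) f = mu D"
  shows "L > 0"
proof (rule ccontr)
  interpret D': label_space D' by fact
  interpret D: label_space D by fact
  assume "\<not> L > 0"
  then have L: "L = 0" using lipschitz_on_nonneg [OF f(1)] by simp
  have fm: "f \<in> mu D' \<rightarrow>\<^sub>M mu D"
    unfolding D.measurable_to_mu_iff
    using D'.continuous_measurable_mu [OF lipschitz_on_continuous_on [OF f(1)]] f(2) by (auto simp: D'.space_mu_D)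
  obtain a where a: "a \<in> D'" using D'.D_nonempty by blast
  have const: "f x = f a" if "x \<in> D'" for x using lipschitz_onD [OF f(1) that a] L by simp
  have [measurable]: "(\<lambda>x. dist x (f a)) \<in> borel_measurable (mu D)"
    by (intro borel_measurable_dist borel_measurable_const D.mu_borel) measurable
  have "AE x in distr (mu D') (mu D) f. dist x (f a) = 0"
  proof (subst AE_distr_iff [OF fm])
    show "{x \<in> space (mu D). dist x (f a) = 0} \<in> sets (mu D)" by measurable
    show "AE x in mu D'. dist (f x) (f a) = 0" by (rule AE_I2) (simp add: const D'.space_mu_D)
  qed
  then have "AE x in mu D. x = f a" by (simp only: f(3) dist_eq_0_iff)
  then show False using D.atomless by blast
qed

lemma sup_delta_bar_lipschitz:
  fixes D' :: "'b::{flat_space, second_countable_topology} set" and D :: "'a::{flat_space, second_countable_topology} set"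
  assumes T: "T > 0" and D': "label_space D'" and D: "label_space D" and f: "lipschitz_measure_preserving D' D f"
  shows "(SUP \<gamma>\<in>uniform_plans D. delta_bar T D (map_plan D id) \<gamma>)
    \<le> ennreal (Lip D' f) * (SUP \<gamma>'\<in>uniform_plans D'. delta_bar T D' (map_plan D' id) \<gamma>')"
proof (rule SUP_least)
  interpret D': label_space D' by fact
  interpret D: label_space D by fact
  have f': "(Lip D' f)-lipschitz_on D' f" "f ` D' \<subseteq> D" "distr (mu D') (mu D) f = mu D"
    using f Lip_lipschitz_on by (auto simp: lipschitz_measure_preserving_def)
  have fm [measurable]: "f \<in> mu D' \<rightarrow>\<^sub>M mu D"
    unfolding D.measurable_to_mu_iff
    using D'.continuous_measurable_mu [OF lipschitz_on_continuous_on [OF f'(1)]] f'(2) by (auto simp: D'.space_mu_D)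
  fix \<gamma> assume "\<gamma> \<in> uniform_plans D"
  then obtain \<gamma>' where \<gamma>': "\<gamma>' \<in> uniform_plans D'" "plan_image D f \<gamma>' = \<gamma>"
    using plan_image_surj [OF D' D fm f'(3)] by blast
  have ff [measurable]: "map_prod f f \<in> mu D' \<Otimes>\<^sub>M mu D' \<rightarrow>\<^sub>M mu2 D" unfolding map_prod_def case_prod_unfold by measurable
  have id: "plan_image D f (map_plan D' id) = map_plan D id"
  proof -
    have "plan_image D f (map_plan D' id) = distr (mu D') (mu2 D) (\<lambda>a. (f a, f a))"
      unfolding plan_image_def map_plan_def by (subst distr_distr) (auto simp: comp_def)
    also have "\<dots> = distr (distr (mu D') (mu D) f) (mu2 D) (\<lambda>a. (a, id a))"
      by (subst distr_distr) (auto simp: comp_def)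
    finally show ?thesis by (simp add: f'(3) map_plan_def)
  qed
  have "delta_bar T D (map_plan D id) \<gamma> \<le> ennreal (Lip D' f) * delta_bar T D' (map_plan D' id) \<gamma>'"
    using delta_bar_plan_image_le [OF T D' D lipschitz_measure_preserving_pos [OF D' D f'] f', of "map_plan D' id" \<gamma>']
    by (simp only: id \<gamma>'(2))
  also have "\<dots> \<le> ennreal (Lip D' f) * (SUP \<gamma>'\<in>uniform_plans D'. delta_bar T D' (map_plan D' id) \<gamma>')"
    by (intro mult_left_mono SUP_upper \<gamma>'(1)) simp
  finally show "delta_bar T D (map_plan D id) \<gamma> \<le> \<dots>" .
qed

section \<open>Uniform coordinates on the cube and on the torus\<close>

lemma emeasure_noise: "A \<in> sets borel \<Longrightarrow> emeasure noise A = emeasure lborel ({0..1} \<inter> A)"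
  by (simp add: noise_def emeasure_uniform_measure divide_ennreal_def)

text \<open>
  A law on the unit interval is uniform if its distribution function is.
\<close>

lemma noise_preservedI:
  assumes \<phi> [measurable]: "\<phi> \<in> borel_measurable borel" and bounds: "\<And>r. 0 \<le> r \<Longrightarrow> r \<le> 1 \<Longrightarrow> 0 \<le> \<phi> r \<and> \<phi> r \<le> (1::real)"
    and tail: "\<And>x. 0 \<le> x \<Longrightarrow> x < 1 \<Longrightarrow> emeasure lborel {r\<in>{0..1}. x < \<phi> r} = ennreal (1 - x)"
  shows "distr noise noise \<phi> = noise"
proof (rule measure_eqI_lessThan)
  interpret noise: prob_space noise by (rule prob_space_noise)
  have \<phi>n: "\<phi> \<in> noise \<rightarrow>\<^sub>M noise" by measurable
  interpret d: prob_space "distr noise noise \<phi>" by (rule noise.prob_space_distr [OF \<phi>n])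
  show "emeasure (distr noise noise \<phi>) {x<..} < \<infinity>" for x using d.emeasure_finite by (simp add: less_top [symmetric])
  fix x :: real
  have vim: "{0..1} \<inter> (\<phi> -` {x<..} \<inter> UNIV) = {r\<in>{0..1}. x < \<phi> r}" by auto
  have l: "emeasure (distr noise noise \<phi>) {x<..} = emeasure lborel {r\<in>{0..1}. x < \<phi> r}"
  proof -
    have "\<phi> -` {x<..} \<inter> UNIV \<in> sets borel" using measurable_sets [OF \<phi>, of "{x<..}"] by simp
    then show ?thesis by (simp add: emeasure_distr [OF \<phi>n] emeasure_noise vim [simplified])
  qed
  have r: "emeasure noise {x<..} = emeasure lborel ({0..1} \<inter> {x<..})" by (simp add: emeasure_noise)
  consider "x < 0" | "0 \<le> x" "x < 1" | "1 \<le> x" by linarith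
  then show "emeasure (distr noise noise \<phi>) {x<..} = emeasure noise {x<..}"
  proof cases
    case 1
    have "x < \<phi> r" if "r \<in> {0..1}" for r using order_less_le_trans [OF 1] bounds [of r] that by simp
    then have "{r\<in>{0..1}. x < \<phi> r} = {0..1}" by blast
    moreover have "{0..1} \<inter> {x<..} = {0..1}" using 1 by auto
    ultimately show ?thesis using l r by simp
  next
    case 2
    then have "{0..1} \<inter> {x<..} = {x<..1}" by auto
    then show ?thesis using 2 l r tail by simp
  next
    case 3
    then have "{r\<in>{0..1}. x < \<phi> r} = {}" "{0..1} \<inter> {x<..} = {}"
      using bounds by (force simp: not_less)+
    then show ?thesis using l r by (simp only: emeasure_empty)
  qed
qed simp_all

lemma emeasure_two_intervals:
  fixes a b c d :: real
  assumes "a \<le> b" "b \<le> c" "c \<le> d" and S: "S - {a, b, c, d} = {a<..<b} \<union> {c<..<d}" "S \<in> sets borel"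
  shows "emeasure lborel S = ennreal ((b - a) + (d - c))"
proof -
  have fin: "{a, b, c, d} \<in> null_sets lborel" by (rule finite_imp_null_set_lborel) simp
  have "emeasure lborel S = emeasure lborel (S - {a, b, c, d})"
    using emeasure_Diff_null_set [OF fin, of S] S(2) by simp
  also have "\<dots> = emeasure lborel {a<..<b} + emeasure lborel {c<..<d}"
    unfolding S(1) by (rule plus_emeasure [symmetric]) (use assms in auto)
  finally show ?thesis using assms by (simp add: ennreal_plus [symmetric] del: ennreal_plus)
qed

lemma frac_measurable [measurable]: "(frac :: real \<Rightarrow> real) \<in> borel_measurable borel"
  unfolding frac_def by measurable

text \<open>
  A rotation of the circle: the preimage of \<open>{x<..}\<close> is an interval or, if it is cut at the
  origin, the union of two.
\<close>

lemma noise_frac_add: "distr noise noise (\<lambda>r. frac (r + v)) = noise"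
proof -
  define w where "w = frac v"
  have w: "0 \<le> w" "w < 1" by (simp_all add: w_def frac_lt_1)
  have shift: "frac (r + v) = frac (r + w)" for r
  proof -
    have "r + v = (r + w) + of_int \<lfloor>v\<rfloor>" by (simp add: w_def frac_def)
    then show ?thesis by (simp only: frac_def floor_add_int [symmetric])
  qed
  have val: "frac (r + w) = (if r + w < 1 then r + w else r + w - 1)" if "0 \<le> r" "r < 1" for r
  proof (cases "r + w < 1")
    case True
    then have "frac (r + w) = r + w" using that w by (intro frac_eq [THEN iffD2]) linarith
    then show ?thesis using True by (simp only: if_True)
  next
    case False
    then have "frac (r + w - 1) = r + w - 1" using that w by (intro frac_eq [THEN iffD2]) linarith
    moreover have "frac (r + w - 1) = frac (r + w)" by (simp add: frac_def)
    ultimately show ?thesis using False by simp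
  qed
  show ?thesis
    unfolding shift
  proof (rule noise_preservedI)
    show "0 \<le> frac (r + w) \<and> frac (r + w) \<le> 1" for r by (simp add: less_imp_le [OF frac_lt_1])
    fix x :: real assume x: "0 \<le> x" "x < 1"
    let ?S = "{r\<in>{0..1}. x < frac (r + w)}"
    have Sm: "?S \<in> sets borel" by measurable
    have mem: "r \<in> ?S \<longleftrightarrow> 0 < r \<and> r < 1 \<and> x < (if r + w < 1 then r + w else r + w - 1)"
      if "r \<noteq> 0" "r \<noteq> 1" for r using that val [of r] by auto
    show "emeasure lborel ?S = ennreal (1 - x)"
    proof (cases "w \<le> x")
      case True
      have "emeasure lborel ?S = ennreal ((0 - 0) + ((1 - w) - (x - w))) "
      proof -
        have "emeasure lborel ?S = emeasure lborel (?S - {0, 1})"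
          using emeasure_Diff_null_set [OF finite_imp_null_set_lborel, of "{0, 1}" ?S] Sm by simp
        also have "?S - {0, 1} = {x - w<..<1 - w}"
        proof (rule set_eqI)
          fix r show "r \<in> ?S - {0, 1} \<longleftrightarrow> r \<in> {x - w<..<1 - w}"
            using mem [of r] True x w by (cases "r = 0 \<or> r = 1") (auto split: if_splits)
        qed
        finally show ?thesis using x by simp
      qed
      then show ?thesis by simp
    next
      case False
      have "emeasure lborel ?S = ennreal (((1 - w) - 0) + (1 - (x + 1 - w)))"
      proof (rule emeasure_two_intervals)
        show "?S - {0, 1 - w, x + 1 - w, 1} = {0<..<1 - w} \<union> {x + 1 - w<..<1}"
        proof (rule set_eqI)
          fix r show "r \<in> ?S - {0, 1 - w, x + 1 - w, 1} \<longleftrightarrow> r \<in> {0<..<1 - w} \<union> {x + 1 - w<..<1}"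
            using mem [of r] False x w by (cases "r = 0 \<or> r = 1") (auto split: if_splits)
        qed
      qed (use False x w Sm in auto)
      then show ?thesis by simp
    qed
  qed measurable
qed

text \<open>
  The distance of a real number to the nearest integer.
\<close>

definition int_dist :: "real \<Rightarrow> real"
  where "int_dist r = \<bar>frac (r + 1/2) - 1/2\<bar>"

lemma int_dist_le: "int_dist r \<le> \<bar>r - of_int k\<bar>"
proof -
  let ?j = "\<lfloor>r + 1/2\<rfloor>"
  have eq: "int_dist r = \<bar>r - of_int ?j\<bar>" by (simp add: int_dist_def frac_def)
  have b: "of_int ?j \<le> r + 1/2" "r + 1/2 < of_int ?j + 1" by linarith+
  consider "k = ?j" | "k \<ge> ?j + 1" | "k \<le> ?j - 1" by linarith
  then show ?thesis
  proof cases
    case 2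
    then have "real_of_int k \<ge> of_int ?j + 1" by linarith
    then show ?thesis unfolding eq using b by linarith
  next
    case 3
    then have "real_of_int k \<le> of_int ?j - 1" by linarith
    then show ?thesis unfolding eq using b by linarith
  qed (simp add: eq)
qed

lemma int_dist_lipschitz: "\<bar>int_dist r - int_dist s\<bar> \<le> \<bar>r - s\<bar>"
proof -
  have "int_dist r \<le> \<bar>r - s\<bar> + int_dist s" for r s
    using int_dist_le [of r "\<lfloor>s + 1/2\<rfloor>"] by (simp add: int_dist_def frac_def)
  from this [of r s] this [of s r] show ?thesis by linarith
qed

lemma int_dist_bounds: "0 \<le> int_dist r" "int_dist r \<le> 1/2"
proof -
  have "0 \<le> frac (r + 1/2)" "frac (r + 1/2) < 1" by (simp_all add: frac_lt_1)
  then show "0 \<le> int_dist r" "int_dist r \<le> 1/2" unfolding int_dist_def by linarith+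
qed

lemma int_dist_measurable [measurable]: "int_dist \<in> borel_measurable borel"
  unfolding int_dist_def by measurable

text \<open>Twice the distance to the integers is the tent map, up to a translation of the circle.\<close>

lemma noise_tent: "distr noise noise (\<lambda>r. 2 * int_dist r) = noise"
proof -
  have tent: "distr noise noise (\<lambda>s. 2 * \<bar>s - 1/2\<bar>) = noise"
  proof (rule noise_preservedI)
    fix x :: real assume x: "0 \<le> x" "x < 1"
    let ?S = "{r\<in>{0..1}. x < 2 * \<bar>r - 1/2\<bar>}"
    have "emeasure lborel ?S = ennreal (((1 - x) / 2 - 0) + (1 - (1 + x) / 2))"
    proof (rule emeasure_two_intervals)
      show "?S - {0, (1 - x) / 2, (1 + x) / 2, 1} = {0<..<(1 - x) / 2} \<union> {(1 + x) / 2<..<1}"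
        using x by (auto simp: abs_if field_simps split: if_splits)
    qed (use x in \<open>auto simp: field_simps\<close>)
    also have "((1 - x) / 2 - 0) + (1 - (1 + x) / 2) = 1 - x" by (simp add: field_simps)
    finally show "emeasure lborel ?S = ennreal (1 - x)" .
  next
    show "0 \<le> 2 * \<bar>r - 1/2\<bar> \<and> 2 * \<bar>r - 1/2\<bar> \<le> (1 :: real)" if "0 \<le> r" "r \<le> 1" for r :: real
      using that by (auto simp: abs_if)
  qed measurable
  have "distr noise noise (\<lambda>r. 2 * int_dist r) = distr (distr noise noise (\<lambda>r. frac (r + 1/2))) noise (\<lambda>s. 2 * \<bar>s - 1/2\<bar>)"
    unfolding int_dist_def by (subst distr_distr) (auto simp: comp_def)
  then show ?thesis by (simp add: noise_frac_add tent)
qed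

definition box_noise :: "('n::finite \<Rightarrow> real) measure"
  where "box_noise = PiM UNIV (\<lambda>_. noise)"

lemma sets_box_noise [measurable_cong]: "sets box_noise = sets (PiM UNIV (\<lambda>_. borel))"
  unfolding box_noise_def by (rule sets_PiM_cong) simp_all

lemma space_box_noise [simp]: "space box_noise = UNIV"
  by (simp add: box_noise_def space_PiM)

lemma prob_space_box_noise: "prob_space box_noise"
  unfolding box_noise_def by (rule prob_space_PiM) (rule prob_space_noise)

lemma box_noise_map:
  assumes [measurable]: "\<And>i. \<phi> i \<in> borel_measurable borel" and \<phi>: "\<And>i. distr noise noise (\<phi> i) = noise"
  shows "distr box_noise box_noise (\<lambda>f i. \<phi> i (f i)) = (box_noise :: ('n::finite \<Rightarrow> real) measure)"
proof -
  interpret noise: prob_space noise by (rule prob_space_noise)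
  interpret product_sigma_finite "\<lambda>_ :: 'n. noise" ..
  have m [measurable]: "(\<lambda>f i. \<phi> i (f i)) \<in> (box_noise :: ('n \<Rightarrow> real) measure) \<rightarrow>\<^sub>M box_noise"
    unfolding box_noise_def by (rule measurable_PiM_single') (auto simp: space_PiM)
  have "distr box_noise box_noise (\<lambda>f i. \<phi> i (f i)) = PiM UNIV (\<lambda>_ :: 'n. noise)"
  proof (rule PiM_eqI)
    show "sets (distr box_noise box_noise (\<lambda>f i. \<phi> i (f i))) = sets (PiM UNIV (\<lambda>_ :: 'n. noise))"
      by (simp add: box_noise_def)
    fix A :: "'n \<Rightarrow> real set" assume A: "\<And>i. i \<in> UNIV \<Longrightarrow> A i \<in> sets noise"
    have vim: "\<phi> i -` A i \<in> sets noise" for i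
      using measurable_sets [of "\<phi> i" borel borel "A i"] A by simp
    have "emeasure (distr box_noise box_noise (\<lambda>f i. \<phi> i (f i))) (Pi\<^sub>E UNIV A) = emeasure box_noise (Pi\<^sub>E UNIV (\<lambda>i. \<phi> i -` A i))"
    proof (subst emeasure_distr [OF m])
      show "Pi\<^sub>E UNIV A \<in> sets box_noise" unfolding box_noise_def by (rule sets_PiM_I_finite) (use A in auto)
      show "emeasure box_noise ((\<lambda>f i. \<phi> i (f i)) -` Pi\<^sub>E UNIV A \<inter> space box_noise) = emeasure box_noise (Pi\<^sub>E UNIV (\<lambda>i. \<phi> i -` A i))"
        by (rule arg_cong [where f = "emeasure box_noise"]) (auto simp: PiE_def Pi_def)
    qed
    also have "\<dots> = (\<Prod>i\<in>UNIV. emeasure noise (\<phi> i -` A i))"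
      unfolding box_noise_def by (rule emeasure_PiM) (use vim in auto)
    also have "\<dots> = (\<Prod>i\<in>UNIV. emeasure (distr noise noise (\<phi> i)) (A i))"
      using A by (intro prod.cong refl) (simp add: emeasure_distr)
    finally show "emeasure (distr box_noise box_noise (\<lambda>f i. \<phi> i (f i))) (Pi\<^sub>E UNIV A) = (\<Prod>i\<in>UNIV. emeasure noise (A i))"
      by (simp add: \<phi>)
  qed simp
  then show ?thesis by (simp add: box_noise_def)
qed

lemma box_noise_eq_uniform:
  assumes S: "S \<in> sets borel" "S \<subseteq> {0..1}" "{0<..<1} \<subseteq> S"
  shows "box_noise = uniform_measure (PiM UNIV (\<lambda>_. lborel)) (Pi\<^sub>E UNIV (\<lambda>_ :: 'n::finite. S))"
proof -
  interpret noise: prob_space noise by (rule prob_space_noise)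
  interpret product_sigma_finite "\<lambda>_ :: 'n. noise" ..
  interpret l: product_sigma_finite "\<lambda>_ :: 'n. lborel :: real measure" ..
  let ?P = "PiM UNIV (\<lambda>_ :: 'n. lborel :: real measure)"
  have eS: "emeasure lborel (S \<inter> A) = emeasure noise A" if A: "A \<in> sets borel" for A
  proof -
    have "({0..1} \<inter> A) - {0, 1} \<subseteq> S \<inter> A" using S(3) by force
    then have "emeasure lborel (({0..1} \<inter> A) - {0, 1}) \<le> emeasure lborel (S \<inter> A)" using S A by (intro emeasure_mono) auto
    moreover have "emeasure lborel (({0..1} \<inter> A) - {0, 1}) = emeasure lborel ({0..1} \<inter> A)"
      using A by (intro emeasure_Diff_null_set finite_imp_null_set_lborel) auto
    moreover have "emeasure lborel (S \<inter> A) \<le> emeasure lborel ({0..1} \<inter> A)" using S A by (intro emeasure_mono) auto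
    ultimately show ?thesis using emeasure_noise [OF A] by simp
  qed
  have e1: "emeasure lborel S = 1" using eS [of UNIV] noise.emeasure_space_1 by simp
  have C: "Pi\<^sub>E UNIV (\<lambda>_ :: 'n. S) \<in> sets ?P" by (rule sets_PiM_I_finite) (use S in auto)
  have "uniform_measure ?P (Pi\<^sub>E UNIV (\<lambda>_. S)) = PiM UNIV (\<lambda>_ :: 'n. noise)"
  proof (rule PiM_eqI)
    show "sets (uniform_measure ?P (Pi\<^sub>E UNIV (\<lambda>_. S))) = sets (PiM UNIV (\<lambda>_ :: 'n. noise))"
      by (simp, rule sets_PiM_cong) simp_all
    fix A :: "'n \<Rightarrow> real set" assume A: "\<And>i. i \<in> UNIV \<Longrightarrow> A i \<in> sets noise"
    have Am: "Pi\<^sub>E UNIV A \<in> sets ?P" by (rule sets_PiM_I_finite) (use A in auto)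
    have "emeasure (uniform_measure ?P (Pi\<^sub>E UNIV (\<lambda>_. S))) (Pi\<^sub>E UNIV A)
        = emeasure ?P (Pi\<^sub>E UNIV (\<lambda>i. S \<inter> A i)) / emeasure ?P (Pi\<^sub>E UNIV (\<lambda>_. S))"
      by (simp add: emeasure_uniform_measure [OF C Am] PiE_Int)
    also have "emeasure ?P (Pi\<^sub>E UNIV (\<lambda>i. S \<inter> A i)) = (\<Prod>i\<in>UNIV. emeasure lborel (S \<inter> A i))"
      by (rule l.emeasure_PiM) (use S A in auto)
    also have "emeasure ?P (Pi\<^sub>E UNIV (\<lambda>_. S)) = (\<Prod>i\<in>(UNIV :: 'n set). emeasure lborel S)"
      by (rule l.emeasure_PiM) (use S in auto)
    finally show "emeasure (uniform_measure ?P (Pi\<^sub>E UNIV (\<lambda>_. S))) (Pi\<^sub>E UNIV A) = (\<Prod>i\<in>UNIV. emeasure noise (A i))"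
      using A by (simp add: e1 eS divide_ennreal_def)
  qed simp
  then show ?thesis by (simp add: box_noise_def)
qed

lemma vec_lambda_measurable [measurable]: "vec_lambda \<in> PiM UNIV (\<lambda>_ :: 'n::finite. borel :: real measure) \<rightarrow>\<^sub>M borel"
proof -
  have "(\<lambda>f. \<chi> i. f i) \<in> PiM UNIV (\<lambda>_ :: 'n::finite. borel :: real measure) \<rightarrow>\<^sub>M borel"
    by (rule measurable_vec_lambda) measurable
  then show ?thesis by simp
qed

lemma sets_PiM_lborel: "sets (PiM UNIV (\<lambda>_ :: 'n::finite. lborel :: real measure)) = sets (PiM UNIV (\<lambda>_ :: 'n. borel :: real measure))"
  by (rule sets_PiM_cong) simp_all

text \<open>
  The reduction to one coordinate: Lebesgue measure is the product of its coordinates.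
\<close>

lemma lborel_vec: "(lborel :: (real^'n) measure) = distr (PiM UNIV (\<lambda>_. lborel)) borel vec_lambda"
proof (rule lborel_eqI)
  interpret l: product_sigma_finite "\<lambda>_ :: 'n. lborel :: real measure" ..
  let ?P = "PiM UNIV (\<lambda>_ :: 'n. lborel :: real measure)"
  have m: "vec_lambda \<in> ?P \<rightarrow>\<^sub>M borel"
    unfolding measurable_cong_sets [OF sets_PiM_lborel refl] by (rule vec_lambda_measurable)
  fix l u :: "real^'n" assume lu: "\<And>b. b \<in> Basis \<Longrightarrow> l \<bullet> b \<le> u \<bullet> b"
  have lu': "l $ i \<le> u $ i" for i using lu [of "axis i 1"] by (simp add: inner_axis)
  have "emeasure (distr ?P borel vec_lambda) (box l u) = emeasure ?P (vec_lambda -` box l u \<inter> space ?P)"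
    by (rule emeasure_distr [OF m]) simp
  also have "vec_lambda -` box l u \<inter> space ?P = Pi\<^sub>E UNIV (\<lambda>i. {l $ i<..<u $ i})"
    by (auto simp: space_PiM mem_box_cart PiE_def Pi_def)
  also have "emeasure ?P \<dots> = (\<Prod>i\<in>UNIV. emeasure lborel {l $ i<..<u $ i})" by (rule l.emeasure_PiM) auto
  also have "\<dots> = ennreal (\<Prod>i\<in>UNIV. u $ i - l $ i)"
    using lu' by (simp add: prod_ennreal)
  also have "(\<Prod>i\<in>UNIV. u $ i - l $ i) = (\<Prod>b\<in>Basis. (u - l) \<bullet> b)"
  proof -
    have "(\<Prod>b\<in>Basis. (u - l) \<bullet> b) = (\<Prod>i\<in>UNIV. (u - l) \<bullet> axis i 1)"
      by (rule prod.reindex_cong [where l = "\<lambda>i. axis i 1"])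
        (auto simp: Basis_vec_def inj_on_def axis_eq_axis)
    then show ?thesis by (simp add: inner_axis)
  qed
  finally show "emeasure (distr ?P borel vec_lambda) (box l u) = (\<Prod>b\<in>Basis. (u - l) \<bullet> b)" .
qed simp

text \<open>The coordinates of a uniform point of the cube, with or without its upper faces, are independent and uniform.\<close>

lemma emeasure_box_noise:
  assumes S: "S \<in> sets borel" "S \<subseteq> {0..1}" "{0<..<1} \<subseteq> S" and A: "A \<in> sets (borel :: (real^'n) measure)"
  shows "emeasure box_noise (vec_lambda -` A) = emeasure lborel ({x. \<forall>i. x $ i \<in> S} \<inter> A)"
    and "emeasure (lborel :: (real^'n) measure) {x. \<forall>i. x $ i \<in> S} = 1"
proof -
  let ?P = "PiM UNIV (\<lambda>_ :: 'n. lborel :: real measure)" and ?C = "Pi\<^sub>E UNIV (\<lambda>_ :: 'n. S)"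
  have m: "vec_lambda \<in> ?P \<rightarrow>\<^sub>M borel"
    unfolding measurable_cong_sets [OF sets_PiM_lborel refl] by (rule vec_lambda_measurable)
  have C: "?C \<in> sets ?P" by (rule sets_PiM_I_finite) (use S in auto)
  have Q: "{x :: real^'n. \<forall>i. x $ i \<in> S} \<in> sets borel" using S(1) by measurable
  have e: "emeasure lborel ({x. \<forall>i. x $ i \<in> S} \<inter> B) = emeasure ?P (?C \<inter> vec_lambda -` B)" if B: "B \<in> sets (borel :: (real^'n) measure)" for B
  proof -
    have "emeasure lborel ({x. \<forall>i. x $ i \<in> S} \<inter> B) = emeasure (distr ?P borel vec_lambda) ({x. \<forall>i. x $ i \<in> S} \<inter> B)"
      by (simp only: lborel_vec)
    also have "\<dots> = emeasure ?P (vec_lambda -` ({x. \<forall>i. x $ i \<in> S} \<inter> B) \<inter> space ?P)"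
      by (rule emeasure_distr [OF m]) (use Q B in simp)
    also have "vec_lambda -` ({x. \<forall>i. x $ i \<in> S} \<inter> B) \<inter> space ?P = ?C \<inter> vec_lambda -` B"
      by (auto simp: space_PiM PiE_def Pi_def)
    finally show ?thesis .
  qed
  have one: "emeasure ?P ?C = 1"
  proof -
    have "emeasure lborel S = 1"
      using emeasure_noise [of UNIV] prob_space.emeasure_space_1 [OF prob_space_noise]
      by (metis (no_types) S antisym emeasure_mono emeasure_lborel_Icc emeasure_lborel_Ioo sets_lborel atLeastAtMost_borel greaterThanLessThan_borel diff_zero ennreal_1 zero_le_one)
    then show ?thesis using product_sigma_finite.emeasure_PiM [of "\<lambda>_ :: 'n. lborel :: real measure" UNIV "\<lambda>_. S"] S
      by (simp add: product_sigma_finite_def sigma_finite_lborel)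
  qed
  then show "emeasure (lborel :: (real^'n) measure) {x. \<forall>i. x $ i \<in> S} = 1" using e [of UNIV] by simp
  have vA: "vec_lambda -` A \<in> sets ?P" using measurable_sets [OF m A] by (simp add: space_PiM)
  show "emeasure box_noise (vec_lambda -` A) = emeasure lborel ({x. \<forall>i. x $ i \<in> S} \<inter> A)"
    unfolding e [OF A] box_noise_eq_uniform [OF S] emeasure_uniform_measure [OF C vA] one by (simp add: divide_ennreal_def)
qed

section \<open>The torus as a label space\<close>

lemma sets_mu_torus: "sets (mu (UNIV :: 'n::finite torus set)) = sets borel"
proof -
  have "sets (mu (UNIV :: 'n torus set)) = sets (restrict_space borel (UNIV :: 'n torus set))"
    unfolding mu_def by (rule sets_restrict_space_cong) (simp add: volume_torus_def)
  then show ?thesis by simp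
qed

lemma emeasure_mu_torus:
  assumes A: "A \<in> sets borel"
  shows "emeasure (mu (UNIV :: 'n::finite torus set)) A = emeasure box_noise {f. to_torus (vec_lambda f) \<in> A}"
proof -
  let ?Q = "{x::real^'n. \<forall>i. 0 \<le> x $ i \<and> x $ i < 1}"
  have Q: "?Q \<in> sets borel" by measurable
  have m: "to_torus \<in> restrict_space lborel ?Q \<rightarrow>\<^sub>M borel"
    using measurable_to_torus by (auto intro: measurable_restrict_space1)
  have s: "sets (volume :: 'n torus measure) = sets borel" by (simp add: volume_torus_def)
  have "emeasure (mu (UNIV :: 'n torus set)) A = emeasure (volume :: 'n torus measure) A"
  proof -
    have "UNIV \<in> sets (volume :: 'n torus measure)" "space (volume :: 'n torus measure) = UNIV" by (simp_all add: volume_torus_def)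
    then show ?thesis using A s
      by (simp add: mu_def emeasure_restrict_space emeasure_uniform_measure emeasure_volume_torus divide_ennreal_def)
  qed
  also have "\<dots> = emeasure (restrict_space lborel ?Q) (to_torus -` A \<inter> space (restrict_space lborel ?Q))"
    unfolding volume_torus_def by (rule emeasure_distr [OF m A])
  also have "\<dots> = emeasure lborel ({x. \<forall>i. x $ i \<in> {0..<1}} \<inter> to_torus -` A)"
    using Q by (subst emeasure_restrict_space) (auto simp: space_restrict_space Int_commute)
  also have "\<dots> = emeasure box_noise (vec_lambda -` (to_torus -` A))"
    using measurable_sets [OF measurable_to_torus A] by (intro emeasure_box_noise(1) [symmetric]) auto
  finally show ?thesis by (simp add: vimage_def)
qed

lemma to_torus_vec_measurable [measurable]: "(\<lambda>f. to_torus (vec_lambda f)) \<in> (box_noise :: ('n::finite \<Rightarrow> real) measure) \<rightarrow>\<^sub>M borel"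
  unfolding measurable_cong_sets [OF sets_box_noise refl] by measurable

lemma mu_torus: "mu (UNIV :: 'n::finite torus set) = distr box_noise (mu UNIV) (\<lambda>f. to_torus (vec_lambda f))"
proof (rule measure_eqI)
  fix A assume "A \<in> sets (mu (UNIV :: 'n torus set))"
  then have A: "A \<in> sets borel" by (simp add: sets_mu_torus)
  have m: "(\<lambda>f. to_torus (vec_lambda f)) \<in> (box_noise :: ('n \<Rightarrow> real) measure) \<rightarrow>\<^sub>M mu UNIV"
    by (simp add: measurable_cong_sets [OF refl sets_mu_torus])
  show "emeasure (mu UNIV) A = emeasure (distr box_noise (mu UNIV) (\<lambda>f. to_torus (vec_lambda f))) A"
    using A by (subst emeasure_distr [OF m]) (simp_all add: sets_mu_torus emeasure_mu_torus vimage_def)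
qed simp

definition unit_rep :: "'n::finite torus \<Rightarrow> real^'n"
  where "unit_rep p = (\<chi> i. frac (rep_torus p $ i))"

lemma to_torus_unit_rep [simp]: "to_torus (unit_rep p) = p"
proof -
  have "to_torus (unit_rep p) = to_torus (rep_torus p)"
    unfolding to_torus_eq_iff unit_rep_def by (simp add: frac_def)
  then show ?thesis by (metis Quotient3_abs_rep Quotient3_torus)
qed

lemma frac_cong_Ints: "r - s \<in> \<int> \<Longrightarrow> frac r = frac (s :: real)"
proof -
  assume "r - s \<in> \<int>"
  then obtain k where "r - s = of_int k" by (auto elim: Ints_cases)
  then have "r = s + of_int k" by simp
  then show ?thesis by (simp add: frac_def)
qed

lemma unit_rep_to_torus: "unit_rep (to_torus x) $ i = frac (x $ i)"
proof -
  have "to_torus (rep_torus (to_torus x)) = to_torus x" by (metis Quotient3_abs_rep Quotient3_torus)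
  then show ?thesis unfolding to_torus_eq_iff unit_rep_def by (simp add: frac_cong_Ints)
qed

lemma unit_rep_bounds: "0 \<le> unit_rep p $ i" "unit_rep p $ i < 1"
  by (simp_all add: unit_rep_def frac_lt_1)

text \<open>
  The section is discontinuous on the faces of the cell. But for \<open>a < 1\<close> the condition that the
  \<open>i\<close>-th coordinate is at most \<open>a\<close> describes the image of a compact subset of the closed cube,
  because points on the upper faces project to points whose representatives lie on lower faces.
\<close>

lemma unit_rep_measurable [measurable]: "unit_rep \<in> borel \<rightarrow>\<^sub>M (borel :: (real^'n::finite) measure)"
proof -
  have "(\<lambda>p :: 'n torus. \<chi> i. unit_rep p $ i) \<in> borel \<rightarrow>\<^sub>M borel"
  proof (rule measurable_vec_lambda, rule borel_measurable_iff_le [THEN iffD2], rule allI)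
    fix i :: 'n and a :: real
    consider "a < 0" | "0 \<le> a" "a < 1" | "1 \<le> a" by linarith
    then show "{p \<in> space borel. unit_rep p $ i \<le> a} \<in> sets borel"
    proof cases
      case 1
      then have "{p \<in> space borel. unit_rep p $ i \<le> a} = {}" using unit_rep_bounds(1) [of _ i] order_less_le_trans [OF 1] by (simp add: not_le)
      then show ?thesis by simp
    next
      case 2
      have "{p \<in> space borel. unit_rep p $ i \<le> a} = to_torus ` (cbox 0 1 \<inter> {x. x $ i \<le> a})" (is "?L = ?R")
      proof (rule set_eqI, rule iffI)
        fix p assume "p \<in> ?L"
        then have "unit_rep p \<in> cbox 0 1 \<inter> {x. x $ i \<le> a}"
          using unit_rep_bounds less_imp_le [OF unit_rep_bounds(2)] by (auto simp: mem_box_cart)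
        then show "p \<in> ?R" by (rule rev_image_eqI) simp
      next
        fix p assume "p \<in> ?R"
        then obtain x where x: "p = to_torus x" "x \<in> cbox 0 1" "x $ i \<le> a" by blast
        then have "0 \<le> x $ i" "x $ i < 1" using 2 by (auto simp: mem_box_cart)
        then have "frac (x $ i) = x $ i" by (simp add: frac_eq)
        then show "p \<in> ?L" using x by (simp add: unit_rep_to_torus)
      qed
      moreover have "compact (cbox 0 1 \<inter> {x :: real^'n. x $ i \<le> a})"
        by (intro compact_Int_closed compact_cbox closed_Collect_le continuous_intros)
      then have "compact (to_torus ` (cbox 0 1 \<inter> {x :: real^'n. x $ i \<le> a}))"
        by (rule compact_continuous_image [OF continuous_to_torus])
      ultimately show ?thesis by (simp add: borel_compact)
    next
      case 3
      then have "{p \<in> space borel. unit_rep p $ i \<le> a} = UNIV" using order_less_le_trans [OF unit_rep_bounds(2) [of _ i] 3] by (auto intro: less_imp_le)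
      then show ?thesis by simp
    qed
  qed
  then show ?thesis by simp
qed

lemma label_space_torus: "label_space (UNIV :: 'n::finite torus set)"
proof (rule label_space.intro)
  interpret m: prob_space "mu (UNIV :: 'n torus set)" by (rule prob_space_mu_torus)
  show "compact (UNIV :: 'n torus set)" by (rule compact_torus)
  show "sets (mu (UNIV :: 'n torus set)) = sets (restrict_space borel UNIV)" by (simp add: sets_mu_torus)
  show "prob_space (mu (UNIV :: 'n torus set))" by (rule prob_space_mu_torus)
  show "AE t in lebesgue. 0 < t \<and> t < T \<longrightarrow> has_metric_speed \<omega> (speed \<omega> t {0..T}) t"
    if "absolutely_continuous_path T \<omega>" for T and \<omega> :: "real \<Rightarrow> 'n torus"
    using that by (rule metric_speed_AE_torus)
  show "\<not> (AE p in mu UNIV. p = c)" for c :: "'n torus"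
  proof
    assume *: "AE p in mu UNIV. p = c"
    have c: "{c} \<in> sets borel" by simp
    have "emeasure (mu UNIV) {c} = 1"
      using * m.emeasure_eq_1_AE [of "{c}"] by (simp add: sets_mu_torus)
    moreover have "emeasure (mu UNIV) {c} = emeasure lborel ({x. \<forall>i. x $ i \<in> {0..<1}} \<inter> to_torus -` {c})"
      using measurable_sets [OF measurable_to_torus c]
      by (subst emeasure_mu_torus [OF c], subst emeasure_box_noise(1) [symmetric]) (auto simp: vimage_def)
    moreover have "{x. \<forall>i. x $ i \<in> {0..<1}} \<inter> to_torus -` {c} \<subseteq> {unit_rep c}"
    proof
      fix x :: "real^'n" assume x: "x \<in> {x. \<forall>i. x $ i \<in> {0..<1}} \<inter> to_torus -` {c}"
      then have "unit_rep c $ i = x $ i" for i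
        using unit_rep_to_torus [of x i] by (auto simp: frac_eq)
      then show "x \<in> {unit_rep c}" by (simp add: vec_eq_iff)
    qed
    then have "emeasure lborel ({x. \<forall>i. x $ i \<in> {0..<1}} \<inter> to_torus -` {c}) \<le> emeasure lborel {unit_rep c}"
      by (rule emeasure_mono) simp
    ultimately show False by simp
  qed
  let ?\<phi> = "\<lambda>p :: 'n torus. encode (\<lambda>i. unit_rep p $ i)"
  let ?v = "\<lambda>y :: real. (\<chi> i. decode y i) :: real^'n"
  have cn: "countable (UNIV :: 'n set)" by (simp add: countable_finite)
  show "\<exists>\<phi> \<psi>. \<phi> \<in> borel_measurable (mu (UNIV :: 'n torus set)) \<and> (\<forall>x\<in>UNIV. 0 \<le> \<phi> x \<and> \<phi> x \<le> (1::real)) \<and>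
      \<psi> \<in> borel \<rightarrow>\<^sub>M mu UNIV \<and> (\<forall>x\<in>UNIV. \<psi> (\<phi> x) = x)"
  proof (intro exI conjI ballI)
    have "?\<phi> \<in> borel_measurable borel" by (rule encode_measurable) measurable
    then show "?\<phi> \<in> borel_measurable (mu UNIV)" by (simp only: measurable_cong_sets [OF sets_mu_torus refl])
    show "0 \<le> ?\<phi> x" "?\<phi> x \<le> 1" for x using encode_bounds [of "\<lambda>i. unit_rep x $ i"] by auto
    have [measurable]: "?v \<in> borel_measurable borel" by (rule measurable_vec_lambda) measurable
    have "(\<lambda>y. to_torus (?v y)) \<in> borel_measurable borel" by measurable
    then show "(\<lambda>y. to_torus (?v y)) \<in> borel \<rightarrow>\<^sub>M mu UNIV" by (simp only: measurable_cong_sets [OF refl sets_mu_torus])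
    fix p :: "'n torus"
    have "decode (?\<phi> p) i = unit_rep p $ i" for i
      using unit_rep_bounds [of p i] by (intro decode_encode cn) auto
    then show "to_torus (?v (?\<phi> p)) = p" by simp
  qed
qed

text \<open>A translation of the torus acts as a rotation on each of the independent coordinates.\<close>

lemma mu_torus_translate: "distr (mu UNIV) (mu UNIV) (\<lambda>p. to_torus (unit_rep p + v)) = mu (UNIV :: 'n::finite torus set)"
proof -
  let ?B = "box_noise :: ('n \<Rightarrow> real) measure"
  have m [measurable]: "(\<lambda>f. to_torus (vec_lambda f)) \<in> ?B \<rightarrow>\<^sub>M mu UNIV"
    by (simp add: measurable_cong_sets [OF refl sets_mu_torus])
  have "(\<lambda>p. to_torus (unit_rep p + v)) \<in> borel \<rightarrow>\<^sub>M borel" by measurable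
  then have t: "(\<lambda>p. to_torus (unit_rep p + v)) \<in> mu UNIV \<rightarrow>\<^sub>M mu UNIV"
    by (simp only: measurable_cong_sets [OF sets_mu_torus sets_mu_torus])
  have s: "(\<lambda>f i. frac (f i + v $ i)) \<in> ?B \<rightarrow>\<^sub>M ?B"
    unfolding measurable_cong_sets [OF sets_box_noise sets_box_noise] by (rule measurable_PiM_single') (auto simp: space_PiM)
  have "distr (mu UNIV) (mu UNIV) (\<lambda>p. to_torus (unit_rep p + v)) = distr ?B (mu UNIV) (\<lambda>f. to_torus (unit_rep (to_torus (vec_lambda f)) + v))"
    by (subst (1) mu_torus, subst distr_distr [OF t m]) (simp add: comp_def)
  also have "\<dots> = distr ?B (mu UNIV) (\<lambda>f. to_torus (\<chi> i. frac (f i + v $ i)))"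
  proof (rule distr_cong [OF refl refl])
    fix f :: "'n \<Rightarrow> real"
    have "frac (f i) + v $ i - frac (f i + v $ i) \<in> \<int>" for i
      by (simp add: frac_def)
    then show "to_torus (unit_rep (to_torus (vec_lambda f)) + v) = to_torus (\<chi> i. frac (f i + v $ i))"
      unfolding to_torus_eq_iff by (simp add: unit_rep_to_torus)
  qed
  also have "\<dots> = distr (distr ?B ?B (\<lambda>f i. frac (f i + v $ i))) (mu UNIV) (\<lambda>f. to_torus (vec_lambda f))"
    by (subst distr_distr [OF m s]) (simp add: comp_def)
  also have "\<dots> = mu UNIV"
    using box_noise_map [of "\<lambda>i r. frac (r + v $ i)"] by (simp add: noise_frac_add mu_torus [symmetric])
  finally show ?thesis .
qed

section \<open>Diameter bounds for the torus and the cube\<close>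

context label_space begin

text \<open>
  A plan is realised by a random target \<open>q (a, u)\<close> of the label \<open>a\<close>. An independent uniform
  point \<open>w\<close> is added to the noise; it is also independent of the target.
\<close>

lemma plan_noise_representation:
  assumes \<eta>: "\<eta> \<in> uniform_plans D"
  obtains q where "q \<in> mu D \<Otimes>\<^sub>M noise \<rightarrow>\<^sub>M mu D"
    "distr (mu D \<Otimes>\<^sub>M (noise \<Otimes>\<^sub>M mu D)) (mu2 D) (\<lambda>z. (fst z, q (fst z, fst (snd z)))) = \<eta>"
    "distr (mu D \<Otimes>\<^sub>M (noise \<Otimes>\<^sub>M mu D)) (mu2 D) (\<lambda>z. (q (fst z, fst (snd z)), snd (snd z))) = mu2 D"
proof -
  note \<eta>D = uniform_plansD [OF \<eta>]
  note [measurable_cong] = \<eta>D(2)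
  interpret m: prob_space "mu D" by (rule prob_mu)
  interpret noise: prob_space noise by (rule prob_space_noise)
  interpret P: pair_prob_space noise "mu D" ..
  interpret MN: pair_prob_space "mu D" noise ..
  let ?M = "mu D \<Otimes>\<^sub>M (noise \<Otimes>\<^sub>M mu D)"
  have f: "fst \<in> \<eta> \<rightarrow>\<^sub>M mu D" and s: "snd \<in> \<eta> \<rightarrow>\<^sub>M mu D" by measurable
  obtain q where q [measurable]: "q \<in> mu D \<Otimes>\<^sub>M noise \<rightarrow>\<^sub>M mu D"
    and q_law: "distr \<eta> (mu2 D) (\<lambda>z. (fst z, snd z)) = distr (distr \<eta> (mu D) fst \<Otimes>\<^sub>M noise) (mu2 D) (\<lambda>(a, u). (a, q (a, u)))"
    by (rule noise_representation [OF \<eta>D(1) f s])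
  have \<eta>_eq: "\<eta> = distr (mu D \<Otimes>\<^sub>M noise) (mu2 D) (\<lambda>z. (fst z, q z))"
    using q_law distr_id2 [OF \<eta>D(2) [symmetric]] by (simp add: \<eta>D(3) case_prod_unfold)
  have q_mu: "distr (mu D \<Otimes>\<^sub>M noise) (mu D) q = mu D"
  proof -
    have "distr \<eta> (mu D) snd = distr (mu D \<Otimes>\<^sub>M noise) (mu D) q"
      by (subst \<eta>_eq, subst distr_distr) (auto simp: comp_def)
    then show ?thesis by (simp add: \<eta>D(4))
  qed
  have pr [measurable]: "(\<lambda>z. (fst z, fst (snd z))) \<in> ?M \<rightarrow>\<^sub>M mu D \<Otimes>\<^sub>M noise" by measurable
  have pr_law: "distr ?M (mu D \<Otimes>\<^sub>M noise) (\<lambda>z. (fst z, fst (snd z))) = mu D \<Otimes>\<^sub>M noise"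
  proof -
    have "distr (mu D) (mu D) (\<lambda>x. x) \<Otimes>\<^sub>M distr (noise \<Otimes>\<^sub>M mu D) noise fst = distr ?M (mu D \<Otimes>\<^sub>M noise) (\<lambda>(x, y). (x, fst y))"
      by (rule pair_measure_distr) (simp_all add: m.distr_pair_fst noise.sigma_finite_measure_axioms)
    then show ?thesis by (simp add: m.distr_pair_fst case_prod_unfold)
  qed
  show ?thesis
  proof (rule that [OF q])
    have "distr (distr ?M (mu D \<Otimes>\<^sub>M noise) (\<lambda>z. (fst z, fst (snd z)))) (mu2 D) (\<lambda>z. (fst z, q z)) = \<eta>"
      by (simp only: pr_law \<eta>_eq [symmetric])
    then show "distr ?M (mu2 D) (\<lambda>z. (fst z, q (fst z, fst (snd z)))) = \<eta>"
      by (subst (asm) distr_distr) (auto simp: comp_def)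
    let ?h = "\<lambda>z. (q (fst z, fst (snd z)), snd (snd z))"
    have h [measurable]: "?h \<in> ?M \<rightarrow>\<^sub>M mu2 D" by measurable
    show "distr ?M (mu2 D) ?h = mu2 D"
    proof (rule nn_integral_measure_eqI)
      fix g :: "'a \<times> 'a \<Rightarrow> ennreal" assume "g \<in> borel_measurable (distr ?M (mu2 D) ?h)"
      then have g [measurable]: "g \<in> borel_measurable (mu2 D)" by simp
      have "(\<integral>\<^sup>+z. g z \<partial>distr ?M (mu2 D) ?h) = (\<integral>\<^sup>+z. g (?h z) \<partial>?M)" by (rule nn_integral_distr) auto
      also have "\<dots> = (\<integral>\<^sup>+a. \<integral>\<^sup>+v. g (?h (a, v)) \<partial>(noise \<Otimes>\<^sub>M mu D) \<partial>mu D)"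
        by (rule P.nn_integral_fst [symmetric]) measurable
      also have "\<dots> = (\<integral>\<^sup>+a. \<integral>\<^sup>+u. \<integral>\<^sup>+w. g (q (a, u), w) \<partial>mu D \<partial>noise \<partial>mu D)"
        by (intro nn_integral_cong, subst m.nn_integral_fst [symmetric]) auto
      also have "\<dots> = (\<integral>\<^sup>+z. \<integral>\<^sup>+w. g (q z, w) \<partial>mu D \<partial>(mu D \<Otimes>\<^sub>M noise))"
        by (subst noise.nn_integral_fst [symmetric]) auto
      also have "\<dots> = (\<integral>\<^sup>+x. \<integral>\<^sup>+w. g (x, w) \<partial>mu D \<partial>distr (mu D \<Otimes>\<^sub>M noise) (mu D) q)"
        by (subst nn_integral_distr) auto
      also have "\<dots> = (\<integral>\<^sup>+z. g z \<partial>(mu2 D))"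
        unfolding q_mu by (rule m.nn_integral_fst) measurable
      finally show "(\<integral>\<^sup>+z. g z \<partial>distr ?M (mu2 D) ?h) = (\<integral>\<^sup>+z. g z \<partial>(mu2 D))" .
    qed simp
  qed
qed

end

text \<open>
  The representative of least norm: all coordinates lie between \<open>-1/2\<close> and \<open>1/2\<close>.
\<close>

definition centred_rep :: "'n::finite torus \<Rightarrow> real^'n"
  where "centred_rep p = (\<chi> i. frac (unit_rep p $ i + 1/2) - 1/2)"

lemma to_torus_centred_rep [simp]: "to_torus (centred_rep p) = p"
proof -
  have "to_torus (centred_rep p) = to_torus (unit_rep p)"
    unfolding to_torus_eq_iff centred_rep_def by (simp add: frac_def)
  then show ?thesis by simp
qed

lemma centred_rep_measurable [measurable]: "centred_rep \<in> borel \<rightarrow>\<^sub>M (borel :: (real^'n::finite) measure)"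
  unfolding centred_rep_def by (rule measurable_vec_lambda) measurable

lemma norm_centred_rep: "(norm (centred_rep p))\<^sup>2 = (\<Sum>i\<in>UNIV. (int_dist (unit_rep p $ i))\<^sup>2)"
  by (simp add: norm_vec_def L2_set_def sum_nonneg centred_rep_def int_dist_def)

lemma int_dist_antipode: "int_dist (frac (r + 1/2)) = 1/2 - int_dist r"
proof -
  define g where "g = frac (r + 1/2)"
  have g: "0 \<le> g" "g < 1" by (simp_all add: g_def frac_lt_1)
  show ?thesis
  proof (cases "g < 1/2")
    case True
    have "frac (g + 1/2) = g + 1/2" using g True by (intro frac_eq [THEN iffD2]) linarith
    then show ?thesis using g True by (simp add: int_dist_def g_def [symmetric])
  next
    case False
    have "frac (g + 1/2) = frac (g - 1/2)" by (rule frac_cong_Ints) simp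
    also have "\<dots> = g - 1/2" using g False by (intro frac_eq [THEN iffD2]) linarith
    finally show ?thesis using g False by (simp add: int_dist_def g_def [symmetric])
  qed
qed

text \<open>
  Pairing each point with its antipode bounds the mean square distance to the origin by \<open>n / 8\<close>:
  in each coordinate, the two distances to the integers add up to \<open>1 / 2\<close>.
\<close>

lemma mean_square_centred_rep:
  "(\<integral>\<^sup>+p. ennreal ((norm (centred_rep p))\<^sup>2) \<partial>mu (UNIV :: 'n::finite torus set)) \<le> ennreal (CARD('n) / 8)"
proof -
  let ?m = "mu (UNIV :: 'n torus set)" and ?S = "\<lambda>p :: 'n torus. (norm (centred_rep p))\<^sup>2"
  note [measurable_cong] = sets_mu_torus
  interpret m: prob_space ?m by (rule prob_space_mu_torus)
  define anti where "anti p = to_torus (unit_rep p + (\<chi> i. 1/2))" for p :: "'n torus"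
  have [measurable]: "anti \<in> borel \<rightarrow>\<^sub>M borel" unfolding anti_def by measurable
  have am: "anti \<in> ?m \<rightarrow>\<^sub>M ?m" by measurable
  have anti: "distr ?m ?m anti = ?m" unfolding anti_def by (rule mu_torus_translate)
  have pair: "?S p + ?S (anti p) \<le> CARD('n) / 4" for p
  proof -
    have "?S p + ?S (anti p) = (\<Sum>i\<in>UNIV. (int_dist (unit_rep p $ i))\<^sup>2 + (1/2 - int_dist (unit_rep p $ i))\<^sup>2)"
      unfolding norm_centred_rep sum.distrib [symmetric] by (simp add: anti_def unit_rep_to_torus int_dist_antipode)
    also have "\<dots> \<le> (\<Sum>i\<in>(UNIV :: 'n set). 1/4)"
    proof (rule sum_mono)
      fix i
      let ?c = "int_dist (unit_rep p $ i)"
      have "?c * ?c \<le> ?c * (1/2)" using int_dist_bounds by (intro mult_left_mono) auto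
      then show "?c\<^sup>2 + (1/2 - ?c)\<^sup>2 \<le> 1/4" by (simp add: power2_eq_square algebra_simps)
    qed
    finally show ?thesis by simp
  qed
  have "2 * (\<integral>\<^sup>+p. ennreal (?S p) \<partial>?m) = (\<integral>\<^sup>+p. ennreal (?S p) \<partial>?m) + (\<integral>\<^sup>+p. ennreal (?S p) \<partial>distr ?m ?m anti)"
    by (simp add: anti mult_2)
  also have "\<dots> = (\<integral>\<^sup>+p. ennreal (?S p) + ennreal (?S (anti p)) \<partial>?m)"
    by (subst nn_integral_distr [OF am]) (auto simp: nn_integral_add)
  also have "\<dots> \<le> (\<integral>\<^sup>+p. ennreal (CARD('n) / 4) \<partial>?m)"
    using pair by (intro nn_integral_mono) (simp add: ennreal_plus [symmetric] ennreal_leI del: ennreal_plus)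
  also have "\<dots> = ennreal (CARD('n) / 4)" by (simp add: m.emeasure_space_1)
  finally have "2 * (\<integral>\<^sup>+p. ennreal (?S p) \<partial>?m) \<le> ennreal (CARD('n) / 4)" .
  then show ?thesis
  proof (cases "\<integral>\<^sup>+p. ennreal (?S p) \<partial>?m")
    case (real r)
    then have "2 * ennreal r = ennreal (2 * r)" by (simp add: ennreal_mult)
    then show ?thesis using real \<open>2 * _ \<le> _\<close> by (simp add: ennreal_le_iff)
  qed (simp add: ennreal_mult_top top_unique)
qed

definition torus_line :: "'n::finite torus \<Rightarrow> 'n torus \<Rightarrow> real \<Rightarrow> 'n torus"
  where "torus_line x w s = to_torus (unit_rep x + s *\<^sub>R centred_rep (to_torus (unit_rep w + (- unit_rep x))))"

definition torus_gap :: "'n::finite torus \<Rightarrow> 'n torus \<Rightarrow> real"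
  where "torus_gap x w = norm (centred_rep (to_torus (unit_rep w + (- unit_rep x))))"

lemma torus_line_0 [simp]: "torus_line x w 0 = x"
  by (simp add: torus_line_def)

lemma torus_line_1 [simp]: "torus_line x w 1 = w"
proof -
  let ?v = "unit_rep w + (- unit_rep x)"
  have "to_torus (unit_rep x + centred_rep (to_torus ?v)) = to_torus (unit_rep x + ?v)"
    using to_torus_centred_rep [of "to_torus ?v"] unfolding to_torus_eq_iff by (simp add: algebra_simps)
  then show ?thesis by (simp add: torus_line_def)
qed

lemma dist_torus_line: "dist (torus_line x w s) (torus_line x w t) \<le> \<bar>s - t\<bar> * torus_gap x w"
proof -
  have "dist (torus_line x w s) (torus_line x w t) \<le> dist (s *\<^sub>R centred_rep (to_torus (unit_rep w + (- unit_rep x)))) (t *\<^sub>R centred_rep (to_torus (unit_rep w + (- unit_rep x))))"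
    unfolding torus_line_def using dist_to_torus_le [of "unit_rep x + _" "unit_rep x + _"] by (simp only: dist_add_cancel)
  then show ?thesis by (simp add: dist_norm torus_gap_def scaleR_left_diff_distrib [symmetric])
qed

lemma torus_line_continuous: "continuous_on S (torus_line x w)"
proof (rule lipschitz_on_continuous_on [of "torus_gap x w"], rule lipschitz_onI)
  show "dist (torus_line x w s) (torus_line x w t) \<le> torus_gap x w * dist s t" for s t
    using dist_torus_line [of x w s t] by (simp add: dist_real_def mult.commute)
qed (simp add: torus_gap_def)

lemma torus_line_measurable [measurable (raw)]:
  assumes [measurable]: "f \<in> borel_measurable M" "g \<in> borel_measurable M"
  shows "(\<lambda>z. torus_line (f z) (g z) s) \<in> borel_measurable M" "(\<lambda>z. torus_gap (f z) (g z)) \<in> borel_measurable M"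
  unfolding torus_line_def torus_gap_def by measurable

text \<open>
  For a uniform pair of end points, the displacement is independent of the starting point;
  hence all intermediate points are uniform.
\<close>

lemma nn_integral_displacement:
  assumes [measurable]: "(\<lambda>(x, c). h x c) \<in> borel_measurable (borel \<Otimes>\<^sub>M borel)"
  shows "(\<integral>\<^sup>+z. h (fst z) (centred_rep (to_torus (unit_rep (snd z) + (- unit_rep (fst z))))) \<partial>(mu UNIV \<Otimes>\<^sub>M mu UNIV))
    = (\<integral>\<^sup>+w. \<integral>\<^sup>+x. h x (centred_rep w) \<partial>mu UNIV \<partial>mu (UNIV :: 'n::finite torus set))"
proof -
  let ?m = "mu (UNIV :: 'n torus set)"
  note [measurable_cong] = sets_mu_torus
  interpret m: prob_space ?m by (rule prob_space_mu_torus)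
  interpret mm: pair_prob_space ?m ?m ..
  have hm [measurable]: "(\<lambda>z. h (f z) (g z)) \<in> borel_measurable M"
    if [measurable]: "f \<in> borel_measurable M" "g \<in> borel_measurable M" for f g and M :: "'z measure"
    using measurable_compose [OF _ assms, of "\<lambda>z. (f z, g z)" M] by simp
  have "(\<integral>\<^sup>+z. h (fst z) (centred_rep (to_torus (unit_rep (snd z) + (- unit_rep (fst z))))) \<partial>(?m \<Otimes>\<^sub>M ?m))
      = (\<integral>\<^sup>+x. \<integral>\<^sup>+w. h x (centred_rep (to_torus (unit_rep w + (- unit_rep x)))) \<partial>?m \<partial>?m)"
    by (subst m.nn_integral_fst [symmetric]) (auto intro!: hm)
  also have "\<dots> = (\<integral>\<^sup>+x. \<integral>\<^sup>+w. h x (centred_rep w) \<partial>?m \<partial>?m)"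
  proof (rule nn_integral_cong)
    fix x
    have "(\<integral>\<^sup>+w. h x (centred_rep w) \<partial>?m) = (\<integral>\<^sup>+w. h x (centred_rep w) \<partial>distr ?m ?m (\<lambda>p. to_torus (unit_rep p + (- unit_rep x))))"
      by (simp only: mu_torus_translate)
    also have "\<dots> = (\<integral>\<^sup>+w. h x (centred_rep (to_torus (unit_rep w + (- unit_rep x)))) \<partial>?m)"
      by (rule nn_integral_distr) (auto intro!: hm)
    finally show "(\<integral>\<^sup>+w. h x (centred_rep (to_torus (unit_rep w + (- unit_rep x)))) \<partial>?m) = (\<integral>\<^sup>+w. h x (centred_rep w) \<partial>?m)" by simp
  qed
  also have "\<dots> = (\<integral>\<^sup>+w. \<integral>\<^sup>+x. h x (centred_rep w) \<partial>?m \<partial>?m)"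
    by (rule mm.Fubini') (auto intro!: hm simp: case_prod_unfold)
  finally show ?thesis .
qed

lemma torus_line_law:
  "distr (mu UNIV \<Otimes>\<^sub>M mu UNIV) (mu UNIV) (\<lambda>z. torus_line (fst z) (snd z) s) = mu (UNIV :: 'n::finite torus set)"
proof (rule nn_integral_measure_eqI)
  let ?m = "mu (UNIV :: 'n torus set)"
  note [measurable_cong] = sets_mu_torus
  interpret m: prob_space ?m by (rule prob_space_mu_torus)
  have lm: "(\<lambda>z. torus_line (fst z) (snd z) s) \<in> ?m \<Otimes>\<^sub>M ?m \<rightarrow>\<^sub>M ?m" by measurable
  fix f :: "'n torus \<Rightarrow> ennreal" assume "f \<in> borel_measurable (distr (?m \<Otimes>\<^sub>M ?m) ?m (\<lambda>z. torus_line (fst z) (snd z) s))"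
  then have f [measurable]: "f \<in> borel_measurable borel" "f \<in> borel_measurable ?m" by (simp_all add: measurable_cong_sets [OF sets_mu_torus refl])
  have "(\<integral>\<^sup>+x. f x \<partial>distr (?m \<Otimes>\<^sub>M ?m) ?m (\<lambda>z. torus_line (fst z) (snd z) s)) = (\<integral>\<^sup>+z. f (torus_line (fst z) (snd z) s) \<partial>(?m \<Otimes>\<^sub>M ?m))"
    by (rule nn_integral_distr [OF lm]) measurable
  also have "\<dots> = (\<integral>\<^sup>+w. \<integral>\<^sup>+x. f (to_torus (unit_rep x + s *\<^sub>R centred_rep w)) \<partial>?m \<partial>?m)"
    unfolding torus_line_def by (rule nn_integral_displacement) measurable
  also have "\<dots> = (\<integral>\<^sup>+w. \<integral>\<^sup>+x. f x \<partial>distr ?m ?m (\<lambda>x. to_torus (unit_rep x + s *\<^sub>R centred_rep w)) \<partial>?m)"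
    by (intro nn_integral_cong, subst nn_integral_distr) auto
  also have "\<dots> = (\<integral>\<^sup>+x. f x \<partial>?m)" by (simp add: mu_torus_translate m.emeasure_space_1)
  finally show "(\<integral>\<^sup>+x. f x \<partial>distr (?m \<Otimes>\<^sub>M ?m) ?m (\<lambda>z. torus_line (fst z) (snd z) s)) = (\<integral>\<^sup>+x. f x \<partial>?m)" .
qed simp

lemma mean_square_torus_gap:
  "(\<integral>\<^sup>+z. ennreal ((torus_gap (fst z) (snd z))\<^sup>2) \<partial>(mu UNIV \<Otimes>\<^sub>M mu (UNIV :: 'n::finite torus set))) \<le> ennreal (CARD('n) / 8)"
proof -
  interpret m: prob_space "mu (UNIV :: 'n torus set)" by (rule prob_space_mu_torus)
  have "(\<integral>\<^sup>+z. ennreal ((torus_gap (fst z) (snd z))\<^sup>2) \<partial>(mu UNIV \<Otimes>\<^sub>M mu (UNIV :: 'n::finite torus set)))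
      = (\<integral>\<^sup>+w. \<integral>\<^sup>+x. ennreal ((norm (centred_rep w))\<^sup>2) \<partial>mu (UNIV :: 'n torus set) \<partial>mu (UNIV :: 'n torus set))"
    unfolding torus_gap_def by (rule nn_integral_displacement) measurable
  then show ?thesis using mean_square_centred_rep [where 'n = 'n] by (simp add: m.emeasure_space_1)
qed

text \<open>
  From level \<open>1\<close> on the midpoint is a grid point, so that every grid cell lies in one of the two
  halves, which are lines traversed in time \<open>T / 2\<close>.
\<close>

lemma dyadic_energy_via_midpoint:
  fixes \<omega> :: "real \<Rightarrow> 'n::finite torus"
  assumes T: "T > 0" and \<omega>: "\<And>t. t \<in> {0..T} \<Longrightarrow> \<omega> t = (if t \<le> T / 2 then torus_line x w (2 * t / T) else torus_line y w (2 * (T - t) / T))"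
  shows "dyadic_energy T \<omega> (Suc n) \<le> (torus_gap x w)\<^sup>2 + (torus_gap y w)\<^sup>2"
proof -
  interpret label_space "UNIV :: 'n torus set" by (rule label_space_torus)
  let ?t = "\<lambda>i. T * real i / 2 ^ Suc n"
  let ?d = "\<lambda>i. (dist (\<omega> (?t i)) (\<omega> (?t (Suc i))))\<^sup>2"
  have first: "\<omega> (?t i) = torus_line x w (real i / 2 ^ n)" if i: "i \<le> 2 ^ n" for i
  proof -
    have "i \<le> 2 ^ Suc n" using i by simp
    note tin = dyadic_point_in [OF T this]
    have "real i \<le> 2 ^ n" using i by (metis of_nat_le_iff of_nat_numeral of_nat_power)
    then have "?t i \<le> T / 2" using T by (simp add: field_simps)
    then show ?thesis using \<omega> [OF tin] T by simp
  qed
  have second: "\<omega> (?t i) = torus_line y w (2 - real i / 2 ^ n)" if i: "2 ^ n \<le> i" "i \<le> 2 ^ Suc n" for i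
  proof (cases "i = 2 ^ n")
    case True
    then show ?thesis using first [of i] by simp
  next
    case False
    note tin = dyadic_point_in [OF T i(2)]
    have "2 ^ n < i" using i False by simp
    then have "2 ^ n < real i" by (metis of_nat_less_iff of_nat_numeral of_nat_power)
    then have "\<not> ?t i \<le> T / 2" using T by (simp add: field_simps)
    moreover have "2 * (T - ?t i) / T = 2 - real i / 2 ^ n" using T by (simp add: field_simps)
    ultimately show ?thesis using \<omega> [OF tin] by simp
  qed
  have line: "(dist (torus_line z w a) (torus_line z w b))\<^sup>2 \<le> (torus_gap z w)\<^sup>2 / 4 ^ n" if "\<bar>a - b\<bar> = 1 / 2 ^ n" for z a b
  proof -
    have "(dist (torus_line z w a) (torus_line z w b))\<^sup>2 \<le> (1 / 2 ^ n * torus_gap z w)\<^sup>2"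
      using dist_torus_line [of z w a b] by (intro power_mono) (auto simp: that)
    also have "\<dots> = (torus_gap z w)\<^sup>2 / 4 ^ n"
      by (simp add: power_mult_distrib power_divide power_mult [symmetric] mult.commute [of n]) (simp add: power_mult)
    finally show ?thesis .
  qed
  have "real (Suc i) / 2 ^ n = real i / 2 ^ n + 1 / 2 ^ n" for i by (simp add: add_divide_distrib)
  then have step: "\<bar>real i / 2 ^ n - real (Suc i) / 2 ^ n\<bar> = 1 / 2 ^ n"
    "\<bar>(2 - real i / 2 ^ n) - (2 - real (Suc i) / 2 ^ n)\<bar> = 1 / 2 ^ n" for i by (simp_all only:) simp_all
  have "(\<Sum>i\<in>{0..<2 ^ n}. ?d i) \<le> of_nat (card {0..<2 ^ n :: nat}) * ((torus_gap x w)\<^sup>2 / 4 ^ n)"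
  proof (rule sum_bounded_above)
    fix i :: nat assume "i \<in> {0..<2 ^ n}"
    then have "i \<le> 2 ^ n" "Suc i \<le> 2 ^ n" by auto
    then show "?d i \<le> (torus_gap x w)\<^sup>2 / 4 ^ n" by (simp only: first) (rule line [OF step(1)])
  qed
  moreover have "(\<Sum>i\<in>{2 ^ n..<2 ^ Suc n}. ?d i) \<le> of_nat (card {2 ^ n..<2 ^ Suc n :: nat}) * ((torus_gap y w)\<^sup>2 / 4 ^ n)"
  proof (rule sum_bounded_above)
    fix i :: nat assume "i \<in> {2 ^ n..<2 ^ Suc n}"
    then have "2 ^ n \<le> i" "i \<le> 2 ^ Suc n" "2 ^ n \<le> Suc i" "Suc i \<le> 2 ^ Suc n" by auto
    then show "?d i \<le> (torus_gap y w)\<^sup>2 / 4 ^ n" by (simp only: second) (rule line [OF step(2)])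
  qed
  moreover have "(\<Sum>i<2 ^ Suc n. ?d i) = (\<Sum>i\<in>{0..<2 ^ n}. ?d i) + (\<Sum>i\<in>{2 ^ n..<2 ^ Suc n}. ?d i)"
    unfolding lessThan_atLeast0 by (rule sum.atLeastLessThan_concat [symmetric]) auto
  ultimately have "(\<Sum>i<2 ^ Suc n. ?d i) \<le> 2 ^ n * ((torus_gap x w)\<^sup>2 / 4 ^ n) + 2 ^ n * ((torus_gap y w)\<^sup>2 / 4 ^ n)"
    by simp
  also have "\<dots> = ((torus_gap x w)\<^sup>2 + (torus_gap y w)\<^sup>2) / 2 ^ n"
  proof -
    have "(4 :: real) ^ n = 2 ^ n * 2 ^ n" by (simp add: power_mult_distrib [symmetric])
    then show ?thesis by (simp add: field_simps)
  qed
  finally have "2 ^ Suc n / 2 * (\<Sum>i<2 ^ Suc n. ?d i) \<le> 2 ^ Suc n / 2 * (((torus_gap x w)\<^sup>2 + (torus_gap y w)\<^sup>2) / 2 ^ n)"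
    by (rule mult_left_mono) simp
  then show ?thesis unfolding dyadic_energy_def by simp
qed

text \<open>
  Every particle first moves along a shortest line to an independent uniform point, and from there
  to its target. All lines have random displacements that are independent of their starting (or
  final) points, so that the flow is incompressible.
\<close>

lemma delta_bar_torus_le:
  fixes \<eta> \<gamma> :: "('n::finite torus \<times> 'n torus) measure"
  assumes T: "T > 0" and plans: "\<eta> \<in> uniform_plans UNIV" "\<gamma> \<in> uniform_plans UNIV"
  shows "delta_bar T UNIV \<eta> \<gamma> \<le> ennreal (sqrt CARD('n) / 2)"
proof -
  interpret label_space "UNIV :: 'n torus set" by (rule label_space_torus)
  let ?m = "mu (UNIV :: 'n torus set)"
  note [measurable_cong] = sets_mu_torus
  interpret m: prob_space ?m by (rule prob_mu)
  interpret noise: prob_space noise by (rule prob_space_noise)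
  interpret P: pair_prob_space noise ?m ..
  let ?N = "noise \<Otimes>\<^sub>M ?m"
  let ?M = "?m \<Otimes>\<^sub>M ?N"
  obtain q where q [measurable]: "q \<in> ?m \<Otimes>\<^sub>M noise \<rightarrow>\<^sub>M ?m"
    and q_law: "distr ?M (?m \<Otimes>\<^sub>M ?m) (\<lambda>z. (fst z, q (fst z, fst (snd z)))) = \<eta>"
      "distr ?M (?m \<Otimes>\<^sub>M ?m) (\<lambda>z. (q (fst z, fst (snd z)), snd (snd z))) = ?m \<Otimes>\<^sub>M ?m"
    by (rule plan_noise_representation [OF plans(1)])
  obtain r where r [measurable]: "r \<in> ?m \<Otimes>\<^sub>M noise \<rightarrow>\<^sub>M ?m"
    and r_law: "distr ?M (?m \<Otimes>\<^sub>M ?m) (\<lambda>z. (fst z, r (fst z, fst (snd z)))) = \<gamma>"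
      "distr ?M (?m \<Otimes>\<^sub>M ?m) (\<lambda>z. (r (fst z, fst (snd z)), snd (snd z))) = ?m \<Otimes>\<^sub>M ?m"
    by (rule plan_noise_representation [OF plans(2)])
  define X where "X z = q (fst z, fst (snd z))" for z :: "'n torus \<times> real \<times> 'n torus"
  define Y where "Y z = r (fst z, fst (snd z))" for z :: "'n torus \<times> real \<times> 'n torus"
  define W where "W z = snd (snd z)" for z :: "'n torus \<times> real \<times> 'n torus"
  have [measurable]: "X \<in> ?M \<rightarrow>\<^sub>M ?m" "Y \<in> ?M \<rightarrow>\<^sub>M ?m" "W \<in> ?M \<rightarrow>\<^sub>M ?m"
    unfolding X_def Y_def W_def by measurable
  have XYb [measurable]: "X \<in> ?M \<rightarrow>\<^sub>M borel" "Y \<in> ?M \<rightarrow>\<^sub>M borel" "W \<in> ?M \<rightarrow>\<^sub>M borel"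
    by (auto intro!: mu_borel)
  have XW [measurable]: "(\<lambda>z. (X z, W z)) \<in> ?M \<rightarrow>\<^sub>M ?m \<Otimes>\<^sub>M ?m" and YW [measurable]: "(\<lambda>z. (Y z, W z)) \<in> ?M \<rightarrow>\<^sub>M ?m \<Otimes>\<^sub>M ?m" by measurable
  note laws = q_law [folded X_def W_def] r_law [folded Y_def W_def]
  define \<Phi> where "\<Phi> z = restrict (\<lambda>t. if t \<le> T / 2 then torus_line (X z) (W z) (2 * t / T) else torus_line (Y z) (W z) (2 * (T - t) / T)) {0..T}" for z
  have \<Phi>_val: "\<Phi> z t = (if t \<le> T / 2 then torus_line (X z) (W z) (2 * t / T) else torus_line (Y z) (W z) (2 * (T - t) / T))"
    if "t \<in> {0..T}" for z t using that by (simp add: \<Phi>_def)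
  have \<Phi>_space: "\<Phi> z \<in> space (Path T UNIV)" for z
  proof -
    have "continuous_on {0..T} (\<lambda>t. if t \<le> T / 2 then torus_line (X z) (W z) (2 * t / T) else torus_line (Y z) (W z) (2 * (T - t) / T))"
    proof (rule continuous_on_cases_le)
      show "continuous_on {t \<in> {0..T}. t \<le> T / 2} (\<lambda>t. torus_line (X z) (W z) (2 * t / T))"
        by (rule continuous_on_compose2 [OF torus_line_continuous [of UNIV]]) (use T in \<open>auto intro!: continuous_intros\<close>)
      show "continuous_on {t \<in> {0..T}. T / 2 \<le> t} (\<lambda>t. torus_line (Y z) (W z) (2 * (T - t) / T))"
        by (rule continuous_on_compose2 [OF torus_line_continuous [of UNIV]]) (use T in \<open>auto intro!: continuous_intros\<close>)
    qed (use T in \<open>auto intro!: continuous_intros simp: field_simps\<close>)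
    then have "continuous_on {0..T} (\<Phi> z)" by (rule continuous_on_eq) (simp add: \<Phi>_def)
    then show ?thesis by (auto simp: space_Path \<Phi>_def)
  qed
  have \<Phi>m: "\<Phi> \<in> ?M \<rightarrow>\<^sub>M Path T UNIV"
  proof (rule measurable_Path [OF T])
    fix t assume t: "t \<in> {0..T}"
    show "(\<lambda>z. \<Phi> z t) \<in> borel_measurable ?M" unfolding \<Phi>_val [OF t] by (cases "t \<le> T / 2") simp_all
  qed (use \<Phi>_space in auto)
  have line_law: "distr ?M ?m (\<lambda>z. torus_line (Z z) (W z) s) = ?m"
    if ZW: "(\<lambda>z. (Z z, W z)) \<in> ?M \<rightarrow>\<^sub>M ?m \<Otimes>\<^sub>M ?m" and law: "distr ?M (?m \<Otimes>\<^sub>M ?m) (\<lambda>z. (Z z, W z)) = ?m \<Otimes>\<^sub>M ?m" for Z s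
  proof -
    have l: "(\<lambda>z. torus_line (fst z) (snd z) s) \<in> ?m \<Otimes>\<^sub>M ?m \<rightarrow>\<^sub>M ?m" by measurable
    have "distr (distr ?M (?m \<Otimes>\<^sub>M ?m) (\<lambda>z. (Z z, W z))) ?m (\<lambda>z. torus_line (fst z) (snd z) s) = ?m"
      by (simp only: law torus_line_law)
    then show ?thesis unfolding distr_distr [OF l ZW] by (simp add: comp_def)
  qed
  have inc: "distr ?M ?m (\<lambda>z. \<Phi> z t) = ?m" if t: "t \<in> {0..T}" for t
    unfolding \<Phi>_val [OF t] by (cases "t \<le> T / 2") (simp_all add: line_law [OF XW laws(2)] line_law [OF YW laws(4)])
  have N: "prob_space ?N" by (rule P.prob_space_axioms)
  let ?F = "distr ?M (Path T UNIV \<Otimes>\<^sub>M ?m) (\<lambda>z. (\<Phi> z, fst z))"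
  have "(0::real) \<in> {0..T}" "T \<in> {0..T}" using T by auto
  then have ends: "\<Phi> z 0 = X z" "\<Phi> z T = Y z" for z using T by (simp_all add: \<Phi>_val)
  have F: "?F \<in> connecting_flows T UNIV \<eta> \<gamma>"
    using flow_of_noise(1) [OF T N \<Phi>m inc] by (simp only: ends laws)
  have gap: "(\<integral>\<^sup>+z. ennreal ((torus_gap (Z z) (W z))\<^sup>2) \<partial>?M) \<le> ennreal (CARD('n) / 8)"
    if ZW: "(\<lambda>z. (Z z, W z)) \<in> ?M \<rightarrow>\<^sub>M ?m \<Otimes>\<^sub>M ?m" and law: "distr ?M (?m \<Otimes>\<^sub>M ?m) (\<lambda>z. (Z z, W z)) = ?m \<Otimes>\<^sub>M ?m" for Z
  proof -
    have "(\<integral>\<^sup>+z. ennreal ((torus_gap (Z z) (W z))\<^sup>2) \<partial>?M) = (\<integral>\<^sup>+z. ennreal ((torus_gap (fst z) (snd z))\<^sup>2) \<partial>distr ?M (?m \<Otimes>\<^sub>M ?m) (\<lambda>z. (Z z, W z)))"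
      by (subst nn_integral_distr [OF ZW]) simp_all
    then show ?thesis using mean_square_torus_gap [where 'n = 'n] by (simp only: law)
  qed
  have "flow_action T ?F = (\<integral>\<^sup>+z. path_action T (\<Phi> z) \<partial>?M)" by (rule flow_of_noise(2) [OF T N \<Phi>m inc])
  also have "\<dots> \<le> (\<integral>\<^sup>+z. ennreal ((torus_gap (X z) (W z))\<^sup>2) + ennreal ((torus_gap (Y z) (W z))\<^sup>2) \<partial>?M)"
  proof (rule nn_integral_mono)
    fix z
    have "ennreal (dyadic_energy T (\<Phi> z) n) \<le> ennreal ((torus_gap (X z) (W z))\<^sup>2 + (torus_gap (Y z) (W z))\<^sup>2)" for n
    proof -
      have "dyadic_energy T (\<Phi> z) n \<le> dyadic_energy T (\<Phi> z) (Suc n)" by (rule dyadic_energy_mono) simp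
      also have "\<dots> \<le> (torus_gap (X z) (W z))\<^sup>2 + (torus_gap (Y z) (W z))\<^sup>2"
        by (rule dyadic_energy_via_midpoint [OF T \<Phi>_val])
      finally show ?thesis by (rule ennreal_leI)
    qed
    then have "path_action T (\<Phi> z) \<le> ennreal ((torus_gap (X z) (W z))\<^sup>2 + (torus_gap (Y z) (W z))\<^sup>2)"
      unfolding path_action_eq [OF T \<Phi>_space] by (rule SUP_least)
    then show "path_action T (\<Phi> z) \<le> ennreal ((torus_gap (X z) (W z))\<^sup>2) + ennreal ((torus_gap (Y z) (W z))\<^sup>2)" by simp
  qed
  also have "\<dots> = (\<integral>\<^sup>+z. ennreal ((torus_gap (X z) (W z))\<^sup>2) \<partial>?M) + (\<integral>\<^sup>+z. ennreal ((torus_gap (Y z) (W z))\<^sup>2) \<partial>?M)"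
    by (rule nn_integral_add) measurable
  also have "\<dots> \<le> ennreal (CARD('n) / 8) + ennreal (CARD('n) / 8)"
    by (intro add_mono gap XW YW laws)
  also have "\<dots> = ennreal (sqrt CARD('n) / 2) * ennreal (sqrt CARD('n) / 2)"
    by (simp add: ennreal_mult [symmetric] ennreal_plus [symmetric] del: ennreal_plus)
  finally have "delta_bar_sq T UNIV \<eta> \<gamma> \<le> ennreal (sqrt CARD('n) / 2) * ennreal (sqrt CARD('n) / 2)"
    unfolding delta_bar_sq_def by (rule INF_lower2 [OF F])
  then show ?thesis by (simp add: delta_bar_def ennreal_sqrt_le_iff)
qed

section \<open>Folding the torus onto the cube\<close>

lemma unit_cube_eq_cbox: "unit_cube = cbox (0 :: real^'n) 1"
  by (auto simp: unit_cube_def mem_box_cart)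

lemma unit_cube_compact_pos: "compact (unit_cube :: (real^'n) set)" "emeasure volume (unit_cube :: (real^'n) set) > 0"
proof -
  show "compact (unit_cube :: (real^'n) set)" by (simp add: unit_cube_eq_cbox)
  have "emeasure (lborel :: (real^'n) measure) unit_cube = 1"
    using emeasure_box_noise(2) [of "{0..1}" "{} :: (real^'n) set"] by (simp add: unit_cube_def greaterThanLessThan_subseteq_atLeastAtMost_iff)
  then show "emeasure volume (unit_cube :: (real^'n) set) > 0" by (simp add: volume_vec_def)
qed

text \<open>
  Each coordinate circle is folded to the unit interval by the tent map. Folding a circle of length
  \<open>1\<close> onto an interval of length \<open>1\<close> requires doubling lengths, hence the Lipschitz constant \<open>2\<close>.
\<close>

definition fold_torus :: "'n::finite torus \<Rightarrow> real^'n"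
  where "fold_torus p = (\<chi> i. 2 * int_dist (unit_rep p $ i))"

lemma fold_to_torus: "fold_torus (to_torus x) $ i = 2 * int_dist (x $ i)"
proof -
  have "frac (frac (x $ i) + 1/2) = frac (x $ i + 1/2)" by (rule frac_cong_Ints) (simp add: frac_def)
  then show ?thesis by (simp add: fold_torus_def unit_rep_to_torus int_dist_def)
qed

lemma fold_torus_lipschitz: "2-lipschitz_on UNIV (fold_torus :: 'n::finite torus \<Rightarrow> _)"
proof (rule lipschitz_onI)
  fix p q :: "'n torus"
  have "dist (fold_torus p) (fold_torus q) / 2 \<le> setdist {x. to_torus x = p} {y. to_torus y = q}"
  proof (rule le_setdistI)
    show "{x. to_torus x = p} \<noteq> {}" "{y. to_torus y = q} \<noteq> {}" using to_torus_surj by blast+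
    fix x y assume "x \<in> {x. to_torus x = p}" "y \<in> {y. to_torus y = q}"
    then have xy: "p = to_torus x" "q = to_torus y" by auto
    have "norm (fold_torus p - fold_torus q) \<le> norm (2 *\<^sub>R (x - y))"
    proof (rule norm_le_componentwise_cart)
      fix i
      have "\<bar>2 * int_dist (x $ i) - 2 * int_dist (y $ i)\<bar> = 2 * \<bar>int_dist (x $ i) - int_dist (y $ i)\<bar>" by (simp add: abs_if)
      then show "norm ((fold_torus p - fold_torus q) $ i) \<le> norm ((2 *\<^sub>R (x - y)) $ i)"
        using int_dist_lipschitz [of "x $ i" "y $ i"] by (simp add: xy fold_to_torus abs_mult)
    qed
    then show "dist (fold_torus p) (fold_torus q) / 2 \<le> dist x y" by (simp add: dist_norm)
  qed
  then show "dist (fold_torus p) (fold_torus q) \<le> 2 * dist p q" by (simp add: dist_torus_def)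
qed simp

lemma int_dist_twice: "0 \<le> 2 * int_dist r" "2 * int_dist r \<le> 1"
  using int_dist_bounds [of r] by simp_all

lemma fold_torus_in_cube: "fold_torus p \<in> unit_cube"
  using int_dist_twice by (simp add: fold_torus_def unit_cube_def)

lemma mu_cube: "distr box_noise (mu unit_cube) (\<lambda>f. \<chi> i. 2 * int_dist (f i)) = mu (unit_cube :: (real^'n) set)"
proof (rule measure_eqI)
  interpret label_space "unit_cube :: (real^'n) set" by (rule label_space_compact [OF unit_cube_compact_pos])
  let ?B = "box_noise :: ('n \<Rightarrow> real) measure" and ?t = "\<lambda>(f :: 'n \<Rightarrow> real) i. 2 * int_dist (f i)"
  have t: "?t \<in> ?B \<rightarrow>\<^sub>M ?B"
    unfolding measurable_cong_sets [OF sets_box_noise sets_box_noise] by (rule measurable_PiM_single') (auto simp: space_PiM)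
  have v: "vec_lambda \<in> ?B \<rightarrow>\<^sub>M borel" unfolding measurable_cong_sets [OF sets_box_noise refl] by (rule vec_lambda_measurable)
  have vtb: "(\<lambda>f. vec_lambda (?t f)) \<in> ?B \<rightarrow>\<^sub>M borel" by (rule measurable_compose [OF t v])
  have vt: "(\<lambda>f. vec_lambda (?t f)) \<in> ?B \<rightarrow>\<^sub>M mu unit_cube"
    unfolding measurable_to_mu_iff using vtb int_dist_twice by (auto simp: unit_cube_def)
  have one: "emeasure (lborel :: (real^'n) measure) unit_cube = 1"
    using emeasure_box_noise(2) [of "{0..1}" "{} :: (real^'n) set"] by (simp add: unit_cube_def greaterThanLessThan_subseteq_atLeastAtMost_iff)
  fix A assume "A \<in> sets (distr ?B (mu (unit_cube :: (real^'n) set)) (\<lambda>f. vec_lambda (?t f)))"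
  then have A: "A \<in> sets (mu unit_cube)" by simp
  then have Ab: "A \<in> sets borel" "A \<subseteq> unit_cube" using sets_mu_subset sets.sets_into_space [OF A] by (auto simp: space_mu_D)
  have vA: "vec_lambda -` A \<in> sets ?B" using measurable_sets [OF v Ab(1)] by simp
  have "emeasure (distr ?B (mu unit_cube) (\<lambda>f. vec_lambda (?t f))) A = emeasure ?B (?t -` (vec_lambda -` A) \<inter> space ?B)"
    by (subst emeasure_distr [OF vt A]) (simp add: vimage_def)
  also have "\<dots> = emeasure (distr ?B ?B ?t) (vec_lambda -` A)" by (rule emeasure_distr [OF t vA, symmetric])
  also have "\<dots> = emeasure ?B (vec_lambda -` A)"
    using box_noise_map [of "\<lambda>(i :: 'n) r. 2 * int_dist r"] by (simp add: noise_tent)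
  also have "\<dots> = emeasure lborel ({x. \<forall>i. x $ i \<in> {0..1}} \<inter> A)" using Ab by (intro emeasure_box_noise(1)) auto
  also have "\<dots> = emeasure lborel (unit_cube \<inter> A)" by (simp add: unit_cube_def)
  also have "\<dots> = emeasure (mu unit_cube) A"
    using D_borel Ab one by (simp add: mu_def volume_vec_def emeasure_restrict_space emeasure_uniform_measure divide_ennreal_def)
  finally show "emeasure (distr ?B (mu unit_cube) (\<lambda>f. vec_lambda (?t f))) A = emeasure (mu unit_cube) A" .
qed simp

lemma fold_torus_preserves: "distr (mu (UNIV :: 'n::finite torus set)) (mu unit_cube) fold_torus = mu (unit_cube :: (real^'n) set)"
  and fold_torus_measurable: "fold_torus \<in> mu (UNIV :: 'n::finite torus set) \<rightarrow>\<^sub>M mu (unit_cube :: (real^'n) set)"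
proof -
  interpret C: label_space "unit_cube :: (real^'n) set" by (rule label_space_compact [OF unit_cube_compact_pos])
  let ?m = "mu (UNIV :: 'n torus set)" and ?B = "box_noise :: ('n \<Rightarrow> real) measure"
  have "(fold_torus :: 'n torus \<Rightarrow> _) \<in> borel_measurable borel"
    by (rule borel_measurable_continuous_onI [OF lipschitz_on_continuous_on [OF fold_torus_lipschitz]])
  then show f: "fold_torus \<in> ?m \<rightarrow>\<^sub>M mu unit_cube"
    using fold_torus_in_cube by (auto simp: C.measurable_to_mu_iff measurable_cong_sets [OF sets_mu_torus refl])
  have m: "(\<lambda>f. to_torus (vec_lambda f)) \<in> ?B \<rightarrow>\<^sub>M ?m"
    by (simp add: measurable_cong_sets [OF refl sets_mu_torus])
  have "distr ?m (mu unit_cube) fold_torus = distr ?B (mu unit_cube) (\<lambda>f. fold_torus (to_torus (vec_lambda f)))"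
    by (subst (1) mu_torus, subst distr_distr [OF f m]) (simp add: comp_def)
  also have "\<dots> = distr ?B (mu unit_cube) (\<lambda>f. \<chi> i. 2 * int_dist (f i))"
    by (intro distr_cong refl) (simp add: vec_eq_iff fold_to_torus)
  finally show "distr ?m (mu unit_cube) fold_torus = mu unit_cube" by (simp add: mu_cube)
qed

lemma delta_bar_cube_le:
  assumes T: "T > 0" and plans: "\<eta> \<in> uniform_plans (unit_cube :: (real^'n) set)" "\<gamma> \<in> uniform_plans unit_cube"
  shows "delta_bar T unit_cube \<eta> \<gamma> \<le> ennreal (sqrt CARD('n))"
proof -
  have C: "label_space (unit_cube :: (real^'n) set)" by (rule label_space_compact [OF unit_cube_compact_pos])
  obtain \<eta>' \<gamma>' :: "('n torus \<times> 'n torus) measure" where \<eta>': "\<eta>' \<in> uniform_plans UNIV" "plan_image unit_cube fold_torus \<eta>' = \<eta>"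
    and \<gamma>': "\<gamma>' \<in> uniform_plans UNIV" "plan_image unit_cube fold_torus \<gamma>' = \<gamma>"
    using plan_image_surj [OF label_space_torus C fold_torus_measurable fold_torus_preserves] plans by meson
  have "delta_bar T unit_cube \<eta> \<gamma> \<le> ennreal 2 * delta_bar T UNIV \<eta>' \<gamma>'"
    using delta_bar_plan_image_le [OF T label_space_torus C _ fold_torus_lipschitz _ fold_torus_preserves, of \<eta>' \<gamma>'] fold_torus_in_cube
    by (auto simp: \<eta>'(2) \<gamma>'(2))
  also have "\<dots> \<le> ennreal 2 * ennreal (sqrt CARD('n) / 2)"
    by (intro mult_left_mono delta_bar_torus_le [OF T \<eta>'(1) \<gamma>'(1)]) simp
  also have "\<dots> = ennreal (sqrt CARD('n))" by (subst ennreal_mult [symmetric]) simp_all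
  finally show ?thesis .
qed

section \<open>Smooth curves of diffeomorphisms as flows\<close>

text \<open>
  The time derivative of a smooth extension is continuous in time and space, including the end times
  and the boundary of the domain.
\<close>

lemma smooth_curve_velocity:
  fixes D :: "(real^'n) set"
  assumes T: "T > 0" and g: "smooth_on ({0..T} \<times> D) (\<lambda>(t, x). g t x)"
  obtains V :: "real \<times> (real^'n) \<Rightarrow> real^'n" where "continuous_on ({0..T} \<times> D) V" "continuous_on ({0..T} \<times> D) (\<lambda>(t, x). g t x)"
    "\<And>t x. t \<in> {0..T} \<Longrightarrow> x \<in> D \<Longrightarrow> ((\<lambda>s. g s x) has_vector_derivative V (t, x)) (at t within {0..T})"
proof -
  obtain U G where U: "open U" "{0..T} \<times> D \<subseteq> U" and Ck: "\<And>k. Ck_on k U G"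
    and G: "\<And>z. z \<in> {0..T} \<times> D \<Longrightarrow> G z = (\<lambda>(t, x). g t x) z"
    using g unfolding smooth_on_def by blast
  have G0: "continuous_on U G" using Ck [of 0] by simp
  have G1: "\<And>z. z \<in> U \<Longrightarrow> G differentiable (at z)" "\<And>v. continuous_on U (\<lambda>z. frechet_derivative G (at z) v)"
    using Ck [of "Suc 0"] by auto
  show ?thesis
  proof (rule that [of "\<lambda>z. frechet_derivative G (at z) (1, 0)"])
    show "continuous_on ({0..T} \<times> D) (\<lambda>z. frechet_derivative G (at z) (1, 0))"
      by (rule continuous_on_subset [OF G1(2) U(2)])
    show "continuous_on ({0..T} \<times> D) (\<lambda>(t, x). g t x)"
      by (rule continuous_on_eq [OF continuous_on_subset [OF G0 U(2)] G])
    fix t x assume tx: "t \<in> {0..T}" "x \<in> D"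
    have "((\<lambda>s. (s, x)) has_vector_derivative (1, 0)) (at t within {0..T})"
      unfolding has_vector_derivative_def by (auto intro!: derivative_eq_intros)
    moreover have "(G has_derivative frechet_derivative G (at (t, x))) (at (t, x) within (\<lambda>s. (s, x)) ` {0..T})"
    proof (rule has_derivative_at_withinI)
      have "(t, x) \<in> U" using U(2) tx by blast
      then show "(G has_derivative frechet_derivative G (at (t, x))) (at (t, x))"
        using G1(1) by (simp only: frechet_derivative_works)
    qed
    ultimately have "((G \<circ> (\<lambda>s. (s, x))) has_vector_derivative frechet_derivative G (at (t, x)) (1, 0)) (at t within {0..T})"
      by (rule vector_derivative_diff_chain_within)
    then show "((\<lambda>s. g s x) has_vector_derivative frechet_derivative G (at (t, x)) (1, 0)) (at t within {0..T})"
      by (rule has_vector_derivative_transform [OF tx(1), rotated]) (use G tx(2) in \<open>simp add: comp_def\<close>)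
  qed
qed

lemma continuously_differentiable_path_action:
  fixes \<omega> :: "real \<Rightarrow> real^'n"
  assumes T: "T > 0" and V: "continuous_on {0..T} V" and \<omega>: "\<And>t. t \<in> {0..T} \<Longrightarrow> (\<omega> has_vector_derivative V t) (at t within {0..T})"
  shows "path_action T (restrict \<omega> {0..T}) = ennreal T * (\<integral>\<^sup>+t\<in>{0..T}. ennreal (1/2 * (norm (V t))\<^sup>2) \<partial>lborel)"
proof -
  let ?\<omega> = "restrict \<omega> {0..T}"
  obtain B where B: "B > 0" "\<And>t. t \<in> {0..T} \<Longrightarrow> norm (V t) \<le> B"
    using compact_imp_bounded [OF compact_continuous_image [OF V compact_Icc]] by (auto simp: bounded_pos)
  have "dist (\<omega> s) (\<omega> t) \<le> B * (t - s)" if st: "0 \<le> s" "s \<le> t" "t \<le> T" for s t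
  proof -
    have "norm (\<omega> s - \<omega> t) \<le> B * norm (s - t)"
    proof (rule differentiable_bound [OF convex_real_interval(5)])
      show "(\<omega> has_derivative (\<lambda>h. h *\<^sub>R V r)) (at r within {0..T})" if "r \<in> {0..T}" for r
        using \<omega> [OF that] by (simp add: has_vector_derivative_def)
      show "onorm (\<lambda>h. h *\<^sub>R V r) \<le> B" if "r \<in> {0..T}" for r
        by (rule onorm_le) (use mult_right_mono [OF B(2) [OF that] abs_ge_zero] in \<open>simp add: mult.commute\<close>)
    qed (use st in auto)
    then show ?thesis using st by (simp add: dist_norm)
  qed
  note lip = this
  have ac: "absolutely_continuous_path T ?\<omega>"
  proof (rule absolutely_continuous_path_dominated [OF _ _ B(1)])
    show "absolutely_continuous_path T (\<lambda>_. 0 :: real)"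
      unfolding absolutely_continuous_path_def by (auto intro: exI [of _ 1])
    show "dist (?\<omega> s) (?\<omega> t) \<le> B * (dist (0::real) 0 + (t - s))" if "0 \<le> s" "s \<le> t" "t \<le> T" for s t
      using lip [OF that] that by simp
  qed
  have speed: "speed ?\<omega> t {0..T} = norm (V t)" if t: "t \<in> {0..T}" for t
  proof -
    have "(?\<omega> has_vector_derivative V t) (at t within {0..T})"
      using \<omega> [OF t] by (rule has_vector_derivative_transform [OF t, rotated]) simp
    from vector_derivative_within_closed_interval [OF T t this] show ?thesis by (simp only: speed_vec_def)
  qed
  have "path_action T ?\<omega> = ennreal T * (\<integral>\<^sup>+t\<in>{0..T}. ennreal (1/2 * (norm (V t))\<^sup>2) \<partial>lebesgue)"
    unfolding path_action_def if_P [OF ac]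
  proof (rule arg_cong2 [where f = "(*)", OF refl], rule nn_integral_cong)
    fix t
    show "ennreal (1/2 * (speed ?\<omega> t {0..T})\<^sup>2) * indicator {0..T} t = ennreal (1/2 * (norm (V t))\<^sup>2) * indicator {0..T} t"
      by (cases "t \<in> {0..T}") (simp_all add: speed)
  qed
  then show ?thesis by (simp only: nn_integral_completion)
qed

text \<open>
  A smooth curve of measure-preserving diffeomorphisms is the flow that moves the particle with label
  \<open>a\<close> along \<open>t \<mapsto> g t a\<close>; the two actions agree by Tonelli's theorem.
\<close>

lemma delta_bar_le_arnold_dist:
  fixes D :: "(real^'n) set"
  assumes T: "T > 0" and D: "compact D" "emeasure volume D > 0"
  shows "delta_bar T D (map_plan D id) (map_plan D h) \<le> arnold_dist T D id h"
proof -
  interpret label_space D by (rule label_space_compact [OF D])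
  interpret m: prob_space "mu D" by (rule prob_mu)
  interpret noise: prob_space noise by (rule prob_space_noise)
  interpret mn: pair_sigma_finite lborel "mu D" ..
  let ?M = "mu D \<Otimes>\<^sub>M noise"
  have "delta_bar_sq T D (map_plan D id) (map_plan D h) \<le> curve_action T D g" if g: "g \<in> smooth_curves T D id h" for g
  proof -
    have sm: "smooth_on ({0..T} \<times> D) (\<lambda>(t, x). g t x)" and sd: "\<And>t. t \<in> {0..T} \<Longrightarrow> g t \<in> SDiff D"
      and ends: "\<And>x. x \<in> D \<Longrightarrow> g 0 x = x" "\<And>x. x \<in> D \<Longrightarrow> g T x = h x"
      using g by (auto simp: smooth_curves_def)
    obtain V where V: "continuous_on ({0..T} \<times> D) V" "continuous_on ({0..T} \<times> D) (\<lambda>(t, x). g t x)"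
      "\<And>t x. t \<in> {0..T} \<Longrightarrow> x \<in> D \<Longrightarrow> ((\<lambda>s. g s x) has_vector_derivative V (t, x)) (at t within {0..T})"
      by (rule smooth_curve_velocity [OF T sm]) (rule that)
    have gD: "g t x \<in> D" if "t \<in> {0..T}" "x \<in> D" for t x
      using sd [OF that(1)] that(2) unfolding SDiff_def bij_betw_def by blast
    have gt: "continuous_on {0..T} (\<lambda>t. g t x)" if "x \<in> D" for x
    proof -
      have "continuous_on {0..T} (\<lambda>t. (t, x))" by (intro continuous_intros)
      from continuous_on_compose2 [OF V(2) this] show ?thesis using that by (simp add: image_subset_iff)
    qed
    have Vt: "continuous_on {0..T} (\<lambda>t. V (t, x))" if "x \<in> D" for x
    proof -
      have "continuous_on {0..T} (\<lambda>t. (t, x))" by (intro continuous_intros)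
      from continuous_on_compose2 [OF V(1) this] show ?thesis using that by (simp add: image_subset_iff)
    qed
    have gx: "continuous_on D (g t)" if "t \<in> {0..T}" for t
    proof -
      have "continuous_on D (\<lambda>x. (t, x))" by (intro continuous_intros)
      from continuous_on_compose2 [OF V(2) this] show ?thesis using that by (simp add: image_subset_iff)
    qed
    have gm: "g t \<in> mu D \<rightarrow>\<^sub>M mu D" if "t \<in> {0..T}" for t
      using continuous_measurable_mu [OF gx [OF that]] gD [OF that] by (auto simp: measurable_to_mu_iff space_mu_D)
    define \<Phi> where "\<Phi> z = restrict (\<lambda>t. g t (fst z)) {0..T}" for z :: "(real^'n) \<times> real"
    have fstD: "fst z \<in> D" if "z \<in> space ?M" for z using that by (auto simp: space_pair_measure space_mu_D)
    have \<Phi>m: "\<Phi> \<in> ?M \<rightarrow>\<^sub>M Path T D"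
    proof (rule measurable_Path [OF T])
      show "\<Phi> \<in> space ?M \<rightarrow> space (Path T D)"
      proof
        fix z assume z: "z \<in> space ?M"
        have "continuous_on {0..T} (\<Phi> z)" by (rule continuous_on_eq [OF gt [OF fstD [OF z]]]) (simp add: \<Phi>_def)
        then show "\<Phi> z \<in> space (Path T D)" using gD fstD [OF z] by (auto simp: space_Path \<Phi>_def)
      qed
      fix t assume t: "t \<in> {0..T}"
      have "(\<lambda>z. g t (fst z)) \<in> ?M \<rightarrow>\<^sub>M mu D" by (rule measurable_compose [OF measurable_fst gm [OF t]])
      then show "(\<lambda>z. \<Phi> z t) \<in> borel_measurable ?M" using t by (simp add: \<Phi>_def mu_borel)
    qed
    have fst_law: "distr ?M (mu D) fst = mu D" by (rule noise.distr_pair_fst)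
    have inc: "distr ?M (mu D) (\<lambda>z. \<Phi> z t) = mu D" if t: "t \<in> {0..T}" for t
    proof -
      have "distr ?M (mu D) (\<lambda>z. \<Phi> z t) = distr (distr ?M (mu D) fst) (mu D) (g t)"
        using t by (subst distr_distr [OF gm [OF t] measurable_fst]) (simp add: comp_def \<Phi>_def)
      then show ?thesis using sd [OF t] by (simp add: fst_law SDiff_def)
    qed
    have plan: "distr ?M (mu2 D) (\<lambda>z. (fst z, \<Phi> z t)) = map_plan D k"
      if t: "t \<in> {0..T}" and k: "\<And>x. x \<in> D \<Longrightarrow> g t x = k x" for t k
    proof -
      have p: "(\<lambda>a. (a, g t a)) \<in> mu D \<rightarrow>\<^sub>M mu2 D" using gm [OF t] by simp
      have "distr ?M (mu2 D) (\<lambda>z. (fst z, \<Phi> z t)) = distr (distr ?M (mu D) fst) (mu2 D) (\<lambda>a. (a, g t a))"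
        using t by (subst distr_distr [OF p measurable_fst]) (simp add: comp_def \<Phi>_def)
      also have "\<dots> = map_plan D k"
        unfolding fst_law map_plan_def by (rule distr_cong) (simp_all add: k space_mu_D)
      finally show ?thesis .
    qed
    let ?F = "distr ?M (Path T D \<Otimes>\<^sub>M mu D) (\<lambda>z. (\<Phi> z, fst z))"
    have T0: "0 \<in> {0..T}" "T \<in> {0..T}" using T by auto
    have "map_plan D id = distr ?M (mu2 D) (\<lambda>z. (fst z, \<Phi> z 0))" "map_plan D h = distr ?M (mu2 D) (\<lambda>z. (fst z, \<Phi> z T))"
      using plan [OF T0(1), of id] plan [OF T0(2), of h] ends by simp_all
    then have F: "?F \<in> connecting_flows T D (map_plan D id) (map_plan D h)"
      using flow_of_noise(1) [OF T prob_space_noise \<Phi>m inc] by (simp only:)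
    define W where "W t x = ennreal (1/2 * (norm (V (t, x)))\<^sup>2) * indicator {0..T} t" for t x
    have Wm: "(\<lambda>(t, x). W t x) \<in> borel_measurable (lborel \<Otimes>\<^sub>M mu D)"
    proof -
      let ?K = "{0..T} \<times> D"
      have K: "?K \<in> sets borel" by (intro borel_compact compact_Times compact_Icc compact_D)
      have [measurable]: "(\<lambda>z. indicator ?K z *\<^sub>R V z) \<in> borel_measurable borel"
        by (rule borel_measurable_continuous_on_indicator [OF K V(1)])
      have "(\<lambda>z. (fst z, snd z)) \<in> borel_measurable (lborel \<Otimes>\<^sub>M mu D)"
        by (intro borel_measurable_Pair mu_borel) measurable
      then have [measurable]: "(\<lambda>z. z) \<in> lborel \<Otimes>\<^sub>M mu D \<rightarrow>\<^sub>M (borel :: (real \<times> (real^'n)) measure)" by simp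
      have "(\<lambda>z :: real \<times> (real^'n). ennreal (1/2 * (norm (indicator ?K z *\<^sub>R V z))\<^sup>2) * indicator {0..T} (fst z)) \<in> borel_measurable (lborel \<Otimes>\<^sub>M mu D)"
        by measurable
      then show ?thesis
        by (rule measurable_cong [THEN iffD1, rotated]) (auto simp: W_def space_pair_measure space_mu_D indicator_def)
    qed
    have "flow_action T ?F = (\<integral>\<^sup>+z. path_action T (\<Phi> z) \<partial>?M)" by (rule flow_of_noise(2) [OF T prob_space_noise \<Phi>m inc])
    also have "\<dots> = (\<integral>\<^sup>+z. ennreal T * (\<integral>\<^sup>+t. W t (fst z) \<partial>lborel) \<partial>?M)"
    proof (rule nn_integral_cong)
      fix z assume z: "z \<in> space ?M"
      show "path_action T (\<Phi> z) = ennreal T * (\<integral>\<^sup>+t. W t (fst z) \<partial>lborel)"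
        unfolding \<Phi>_def W_def using continuously_differentiable_path_action [OF T Vt [OF fstD [OF z]] V(3) [OF _ fstD [OF z]]] .
    qed
    also have "\<dots> = (\<integral>\<^sup>+x. ennreal T * (\<integral>\<^sup>+t. W t x \<partial>lborel) \<partial>distr ?M (mu D) fst)"
      by (rule nn_integral_distr [symmetric]) (use Wm in measurable)
    also have "\<dots> = ennreal T * (\<integral>\<^sup>+x. \<integral>\<^sup>+t. W t x \<partial>lborel \<partial>mu D)"
      unfolding fst_law by (rule nn_integral_cmult) (use Wm in measurable)
    also have "(\<integral>\<^sup>+x. \<integral>\<^sup>+t. W t x \<partial>lborel \<partial>mu D) = (\<integral>\<^sup>+t. \<integral>\<^sup>+x. W t x \<partial>mu D \<partial>lborel)"
      by (rule mn.Fubini') (rule Wm)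
    also have "ennreal T * \<dots> = curve_action T D g"
      unfolding curve_action_def
    proof (rule arg_cong2 [where f = "(*)", OF refl], rule nn_integral_cong)
      fix t :: real
      have "W t x = ennreal (1/2 * (norm (vector_derivative (\<lambda>s. g s x) (at t within {0..T})))\<^sup>2) * indicator {0..T} t"
        if "x \<in> D" for x
        using vector_derivative_within_closed_interval [OF T _ V(3) [OF _ that]] by (cases "t \<in> {0..T}") (simp_all add: W_def)
      then show "(\<integral>\<^sup>+x. W t x \<partial>mu D) = (\<integral>\<^sup>+x. ennreal (1/2 * (norm (vector_derivative (\<lambda>s. g s x) (at t within {0..T})))\<^sup>2) \<partial>mu D) * indicator {0..T} t"
        by (cases "t \<in> {0..T}") (auto intro!: nn_integral_cong simp: space_mu_D W_def)
    qed
    finally show ?thesis unfolding delta_bar_sq_def using INF_lower [OF F, of "flow_action T"] by simp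
  qed
  then have "delta_bar_sq T D (map_plan D id) (map_plan D h) \<le> arnold_dist_sq T D id h"
    unfolding arnold_dist_sq_def by (rule INF_greatest)
  then show ?thesis
    by (simp add: delta_bar_def arnold_dist_def ennreal_sqrt_le_iff ennreal_sqrt_square)
qed

theorem theorem3p3:
  fixes T :: real and D :: "(real^'n) set"
  assumes T: "T > 0" and D: "compact D" "emeasure volume D > 0"
  shows
    "(\<forall>\<eta>\<in>uniform_plans D. \<forall>\<gamma>\<in>uniform_plans D. connecting_flows T D \<eta> \<gamma> \<noteq> {} \<longrightarrow>
        (\<exists>F\<in>connecting_flows T D \<eta> \<gamma>. flow_action T F = delta_bar_sq T D \<eta> \<gamma>)) \<and>
     lower_semicontinuous_map (prod_topology (narrow_topology D) (narrow_topology D))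
        (\<lambda>(\<eta>, \<gamma>). delta_bar T D \<eta> \<gamma>) \<and>
     (\<forall>h\<in>SDiff D. delta_bar T D (map_plan D id) (map_plan D h) \<le> arnold_dist T D id h) \<and>
     (SUP \<eta>\<in>uniform_plans (unit_cube :: (real^'n) set). SUP \<gamma>\<in>uniform_plans unit_cube. delta_bar T unit_cube \<eta> \<gamma>)
        \<le> ennreal (sqrt CARD('n)) \<and>
     (SUP \<eta>\<in>uniform_plans (UNIV :: 'n torus set). SUP \<gamma>\<in>uniform_plans UNIV. delta_bar T UNIV \<eta> \<gamma>)
        \<le> ennreal (sqrt CARD('n)) \<and>
     (\<forall>(D' :: (real^'m) set) f. compact D' \<and> emeasure volume D' > 0 \<and>
        lipschitz_measure_preserving D' D f \<longrightarrow>
        (SUP \<gamma>\<in>uniform_plans D. delta_bar T D (map_plan D id) \<gamma>)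
          \<le> ennreal (Lip D' f) * (SUP \<gamma>'\<in>uniform_plans D'. delta_bar T D' (map_plan D' id) \<gamma>')) \<and>
     (\<forall>f. lipschitz_measure_preserving (UNIV :: 'm torus set) D f \<longrightarrow>
        (SUP \<gamma>\<in>uniform_plans D. delta_bar T D (map_plan D id) \<gamma>)
          \<le> ennreal (Lip UNIV f) *
             (SUP \<gamma>'\<in>uniform_plans (UNIV :: 'm torus set). delta_bar T UNIV (map_plan UNIV id) \<gamma>')) \<and>
     (\<forall>(D' :: (real^'m) set) f. compact D' \<and> emeasure volume D' > 0 \<and>
        lipschitz_measure_preserving D' (UNIV :: 'n torus set) f \<longrightarrow>
        (SUP \<gamma>\<in>uniform_plans (UNIV :: 'n torus set). delta_bar T UNIV (map_plan UNIV id) \<gamma>)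
          \<le> ennreal (Lip D' f) * (SUP \<gamma>'\<in>uniform_plans D'. delta_bar T D' (map_plan D' id) \<gamma>')) \<and>
     (\<forall>f. lipschitz_measure_preserving (UNIV :: 'm torus set) (UNIV :: 'n torus set) f \<longrightarrow>
        (SUP \<gamma>\<in>uniform_plans (UNIV :: 'n torus set). delta_bar T UNIV (map_plan UNIV id) \<gamma>)
          \<le> ennreal (Lip UNIV f) *
             (SUP \<gamma>'\<in>uniform_plans (UNIV :: 'm torus set). delta_bar T UNIV (map_plan UNIV id) \<gamma>'))"
proof (intro conjI ballI allI impI)
  note LD = label_space_compact [OF D]
  show "\<exists>F\<in>connecting_flows T D \<eta> \<gamma>. flow_action T F = delta_bar_sq T D \<eta> \<gamma>"
    if "\<eta> \<in> uniform_plans D" "\<gamma> \<in> uniform_plans D" "connecting_flows T D \<eta> \<gamma> \<noteq> {}" for \<eta> \<gamma>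
    by (rule minimising_flow_exists [OF T D that])
  show "lower_semicontinuous_map (prod_topology (narrow_topology D) (narrow_topology D)) (\<lambda>(\<eta>, \<gamma>). delta_bar T D \<eta> \<gamma>)"
    by (rule delta_bar_lower_semicontinuous [OF T D])
  show "delta_bar T D (map_plan D id) (map_plan D h) \<le> arnold_dist T D id h" for h
    by (rule delta_bar_le_arnold_dist [OF T D])
  show "(SUP \<eta>\<in>uniform_plans (unit_cube :: (real^'n) set). SUP \<gamma>\<in>uniform_plans unit_cube. delta_bar T unit_cube \<eta> \<gamma>)
      \<le> ennreal (sqrt CARD('n))"
    by (intro SUP_least delta_bar_cube_le [OF T])
  show "(SUP \<eta>\<in>uniform_plans (UNIV :: 'n torus set). SUP \<gamma>\<in>uniform_plans UNIV. delta_bar T UNIV \<eta> \<gamma>)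
      \<le> ennreal (sqrt CARD('n))"
  proof (intro SUP_least)
    fix \<eta> \<gamma> :: "('n torus \<times> 'n torus) measure" assume plans: "\<eta> \<in> uniform_plans UNIV" "\<gamma> \<in> uniform_plans UNIV"
    have "delta_bar T UNIV \<eta> \<gamma> \<le> ennreal (sqrt CARD('n) / 2)" by (rule delta_bar_torus_le [OF T plans])
    also have "\<dots> \<le> ennreal (sqrt CARD('n))" by (intro ennreal_leI) simp
    finally show "delta_bar T UNIV \<eta> \<gamma> \<le> ennreal (sqrt CARD('n))" .
  qed
  show "(SUP \<gamma>\<in>uniform_plans D. delta_bar T D (map_plan D id) \<gamma>)
      \<le> ennreal (Lip D' f) * (SUP \<gamma>'\<in>uniform_plans D'. delta_bar T D' (map_plan D' id) \<gamma>')"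
    if "compact D' \<and> emeasure volume D' > 0 \<and> lipschitz_measure_preserving D' D f" for D' :: "(real^'m) set" and f
    using that by (intro sup_delta_bar_lipschitz [OF T _ LD] label_space_compact) auto
  show "(SUP \<gamma>\<in>uniform_plans D. delta_bar T D (map_plan D id) \<gamma>)
      \<le> ennreal (Lip UNIV f) * (SUP \<gamma>'\<in>uniform_plans (UNIV :: 'm torus set). delta_bar T UNIV (map_plan UNIV id) \<gamma>')"
    if "lipschitz_measure_preserving (UNIV :: 'm torus set) D f" for f
    by (rule sup_delta_bar_lipschitz [OF T label_space_torus LD that])
  show "(SUP \<gamma>\<in>uniform_plans (UNIV :: 'n torus set). delta_bar T UNIV (map_plan UNIV id) \<gamma>)
      \<le> ennreal (Lip D' f) * (SUP \<gamma>'\<in>uniform_plans D'. delta_bar T D' (map_plan D' id) \<gamma>')"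
    if "compact D' \<and> emeasure volume D' > 0 \<and> lipschitz_measure_preserving D' (UNIV :: 'n torus set) f" for D' :: "(real^'m) set" and f
    using that by (intro sup_delta_bar_lipschitz [OF T _ label_space_torus] label_space_compact) auto
  show "(SUP \<gamma>\<in>uniform_plans (UNIV :: 'n torus set). delta_bar T UNIV (map_plan UNIV id) \<gamma>)
      \<le> ennreal (Lip UNIV f) * (SUP \<gamma>'\<in>uniform_plans (UNIV :: 'm torus set). delta_bar T UNIV (map_plan UNIV id) \<gamma>')"
    if "lipschitz_measure_preserving (UNIV :: 'm torus set) (UNIV :: 'n torus set) f" for f
    by (rule sup_delta_bar_lipschitz [OF T label_space_torus label_space_torus that])
qed

end
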